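(* Work over an algebraically closed field. For $n\ge 3$ the scheme $U_n\simeq\widetilde{\mathcal{U}}^{sns}_{1,n}$ is Gorenstein and regular in codimension $1$, hence normal.
   Context: $\widetilde{\mathcal{U}}^{sns}_{1,n}$ is the moduli space of data $(C,p_1,\dots,p_n,\omega)$, where $C\to S$ is a flat proper finitely presented family with reduced connected geometric fibers of arithmetic genus $1$, $p_1,\dots,p_n$ are sections that are distinct and smooth in each geometric fiber, such that in each geometric fiber $h^0(\mathcal{O}_C(p_i))=1$ for all $i$ and $\mathcal{O}_C(p_1+\dots+p_n)$ is ample, and $\omega$ is a generator of $H^0(C,\omega_C)$. For $n\ge3$ it is isomorphic to the affine scheme $U_n$, where $U_3=\mathbb{A}^4$, and for $n\ge4$, $U_n$ has coordinate ring generated by $a,c,\bar c,(c_i,\bar c_i)_{4\le i\le n},(c_{ij})_{4\le i<j\le n}$ with defining relations $(c_j-c_i)c_{ij}=(a+\bar c_i+c_j+\bar c_j)c_j-c$, $(\bar c_i-\bar c_j)c_{ij}=(a+c_i+\bar c_i+c_j)\bar c_i-\bar c$ for $i<j$, and $c_{ij}c_{jk}+c_{ji}c_{ik}-c_{ik}c_{jk}+(a+c_k+\bar c_k)c_k=c$ for $i<j<k$, where $c_{ji}:=a+c_i+\bar c_i+c_j+\bar c_j-c_{ij}$. *)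

theory Defs
  imports
    "HOL-Algebra.Algebra"
    "HOL-Algebra.Algebraic_Closure_Type"
    "HOL-Library.Poly_Mapping"
    "HOL-Library.Extended_Nat"
begin

section \<open>Localization of commutative rings\<close>

text \<open>
  The fraction \<open>a / s\<close> is the class of \<open>(a, s)\<close> for the relation
  \<open>u (t a - s b) = 0\<close> for some \<open>u\<close> in \<open>S\<close>; zero divisors in \<open>S\<close> are allowed.
\<close>

definition loc_frac :: "('a, 'b) ring_scheme \<Rightarrow> 'a set \<Rightarrow> 'a \<Rightarrow> 'a \<Rightarrow> ('a \<times> 'a) set" where
  "loc_frac R S a s =
     {(b, t). b \<in> carrier R \<and> t \<in> S \<and>
        (\<exists>u\<in>S. u \<otimes>\<^bsub>R\<^esub> (t \<otimes>\<^bsub>R\<^esub> a) = u \<otimes>\<^bsub>R\<^esub> (s \<otimes>\<^bsub>R\<^esub> b))}"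

text \<open>
  The operations are unions over all representatives, as for the product of cosets in the
  quotient ring; all members of such a union coincide.
\<close>

definition localization :: "('a, 'b) ring_scheme \<Rightarrow> 'a set \<Rightarrow> ('a \<times> 'a) set ring" where
  "localization R S =
     \<lparr> carrier = {loc_frac R S a s | a s. a \<in> carrier R \<and> s \<in> S},
       monoid.mult = (\<lambda>x y. \<Union>(a, s)\<in>x. \<Union>(b, t)\<in>y.
                        loc_frac R S (a \<otimes>\<^bsub>R\<^esub> b) (s \<otimes>\<^bsub>R\<^esub> t)),
       one = loc_frac R S \<one>\<^bsub>R\<^esub> \<one>\<^bsub>R\<^esub>,
       ring.zero = loc_frac R S \<zero>\<^bsub>R\<^esub> \<one>\<^bsub>R\<^esub>,
       add = (\<lambda>x y. \<Union>(a, s)\<in>x. \<Union>(b, t)\<in>y.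
                loc_frac R S ((t \<otimes>\<^bsub>R\<^esub> a) \<oplus>\<^bsub>R\<^esub> (s \<otimes>\<^bsub>R\<^esub> b)) (s \<otimes>\<^bsub>R\<^esub> t)) \<rparr>"

definition local_at :: "('a, 'b) ring_scheme \<Rightarrow> 'a set \<Rightarrow> ('a \<times> 'a) set ring" where
  "local_at R P = localization R (carrier R - P)"


section \<open>Local rings, dimension, regularity\<close>

definition noetherian_local_ring :: "('a, 'b) ring_scheme \<Rightarrow> bool" where
  "noetherian_local_ring R \<longleftrightarrow> cring R \<and> noetherian_ring R \<and> (\<exists>!M. maximalideal M R)"

text \<open>The supremum of the lengths of strict chains of primes; \<open>0\<close> for the zero ring.\<close>

definition krull_dim :: "('a, 'b) ring_scheme \<Rightarrow> enat" where
  "krull_dim R =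
     (SUP n \<in> {n. \<exists>P :: nat \<Rightarrow> 'a set. (\<forall>i\<le>n. primeideal (P i) R) \<and> (\<forall>i<n. P i \<subset> P (Suc i))}.
        enat n)"

definition regular_local_ring :: "('a, 'b) ring_scheme \<Rightarrow> bool" where
  "regular_local_ring R \<longleftrightarrow>
     noetherian_local_ring R \<and>
     (\<exists>M A. maximalideal M R \<and> A \<subseteq> carrier R \<and> finite A \<and> enat (card A) = krull_dim R \<and>
            M = genideal R A)"


section \<open>Injective dimension and Gorenstein local rings\<close>

definition module_hom ::
    "('a, 'b) ring_scheme \<Rightarrow> ('a, 'm, 'c) module_scheme \<Rightarrow> ('a, 'n, 'd) module_scheme \<Rightarrow> ('m \<Rightarrow> 'n) set"
  where
  "module_hom R M N =
     {f \<in> hom (add_monoid M) (add_monoid N).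
        \<forall>r\<in>carrier R. \<forall>x\<in>carrier M. f (r \<odot>\<^bsub>M\<^esub> x) = r \<odot>\<^bsub>N\<^esub> f x}"

definition regular_module :: "('a, 'b) ring_scheme \<Rightarrow> ('a, 'a) module" where
  "regular_module R =
     \<lparr> carrier = carrier R, monoid.mult = monoid.mult R, one = one R,
       ring.zero = ring.zero R, add = add R, module.smult = monoid.mult R \<rparr>"

text \<open>
  Maps from submodules extend. The test modules \<open>A\<close>, \<open>B\<close> have their elements in the same type
  \<open>'m\<close> as the module \<open>I\<close>. As soon as \<open>'m\<close> has room for a copy of \<open>R\<close> this is injectivity in the
  class of all \<open>R\<close>-modules, since by Baer's criterion it suffices to test on the inclusions of
  ideals into \<open>R\<close>.
\<close>

definition injective_module :: "('a, 'b) ring_scheme \<Rightarrow> ('a, 'm) module \<Rightarrow> bool" where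
  "injective_module R I \<longleftrightarrow>
     module R I \<and>
     (\<forall>(A :: ('a, 'm) module) (B :: ('a, 'm) module) f g.
        module R A \<and> module R B \<and> f \<in> module_hom R A B \<and> inj_on f (carrier A) \<and>
        g \<in> module_hom R A I \<longrightarrow>
        (\<exists>h \<in> module_hom R B I. \<forall>x\<in>carrier A. h (f x) = g x))"

text \<open>
  \<open>R\<close> has a finite resolution \<open>0 \<rightarrow> R \<rightarrow> I 0 \<rightarrow> I 1 \<rightarrow> \<dots> \<rightarrow> I n \<rightarrow> 0\<close> by injective modules.
  Every module has to be carried by some type; functions \<open>'a \<Rightarrow> 'a\<close> leave enough room and lose no
  generality. If \<open>R\<close> is Noetherian and infinite, then the injective hull of a module with at most
  as many elements as \<open>R\<close> again has at most as many elements as \<open>R\<close>, so the minimal injective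
  resolution of \<open>R\<close> fits into this type. If \<open>R\<close> is local and finite and has finite injective
  dimension, then \<open>R\<close> is itself injective.
\<close>

definition finite_injective_dimension :: "('a, 'b) ring_scheme \<Rightarrow> bool" where
  "finite_injective_dimension R \<longleftrightarrow>
     (\<exists>(n :: nat) (I :: nat \<Rightarrow> ('a, 'a \<Rightarrow> 'a) module) e d.
        (\<forall>i. injective_module R (I i)) \<and>
        (\<forall>i>n. carrier (I i) = {\<zero>\<^bsub>I i\<^esub>}) \<and>
        e \<in> module_hom R (regular_module R) (I 0) \<and>
        (\<forall>i. d i \<in> module_hom R (I i) (I (Suc i))) \<and>
        inj_on e (carrier R) \<and>
        e ` carrier R = a_kernel (I 0) (I 1) (d 0) \<and>
        (\<forall>i. d i ` carrier (I i) = a_kernel (I (Suc i)) (I (Suc (Suc i))) (d (Suc i))))"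

definition gorenstein_local_ring :: "('a, 'b) ring_scheme \<Rightarrow> bool" where
  "gorenstein_local_ring R \<longleftrightarrow> noetherian_local_ring R \<and> finite_injective_dimension R"


section \<open>Normal domains\<close>

definition integrally_closed_domain :: "('a, 'b) ring_scheme \<Rightarrow> bool" where
  "integrally_closed_domain R \<longleftrightarrow>
     Ring.domain R \<and>
     (let S = carrier R - {\<zero>\<^bsub>R\<^esub>};
          K = localization R S;
          \<iota> = (\<lambda>r. loc_frac R S r \<one>\<^bsub>R\<^esub>)
      in \<forall>x\<in>carrier K.
           (\<exists>(n :: nat) c. (\<forall>i<n. c i \<in> carrier R) \<and>
              (x [^]\<^bsub>K\<^esub> n) \<oplus>\<^bsub>K\<^esub> (\<Oplus>\<^bsub>K\<^esub>i\<in>{..<n}. \<iota> (c i) \<otimes>\<^bsub>K\<^esub> (x [^]\<^bsub>K\<^esub> i)) = \<zero>\<^bsub>K\<^esub>)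
           \<longrightarrow> x \<in> \<iota> ` carrier R)"


section \<open>Properties of the affine scheme \<open>Spec R\<close>\<close>

text \<open>
  The points of \<open>Spec R\<close> are the prime ideals of \<open>R\<close>, and the local ring of the structure sheaf
  at \<open>P\<close> is \<open>local_at R P\<close>. All three properties are conditions on these local rings.
  The codimension of (the closure of) a point \<open>P\<close> is the dimension of its local ring.
\<close>

definition Spec_gorenstein :: "('a, 'b) ring_scheme \<Rightarrow> bool" where
  "Spec_gorenstein R \<longleftrightarrow>
     cring R \<and> noetherian_ring R \<and> (\<forall>P. primeideal P R \<longrightarrow> gorenstein_local_ring (local_at R P))"

definition Spec_regular_in_codim_1 :: "('a, 'b) ring_scheme \<Rightarrow> bool" where
  "Spec_regular_in_codim_1 R \<longleftrightarrow>
     cring R \<and> noetherian_ring R \<and>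
     (\<forall>P. primeideal P R \<and> krull_dim (local_at R P) \<le> 1 \<longrightarrow> regular_local_ring (local_at R P))"

definition Spec_normal :: "('a, 'b) ring_scheme \<Rightarrow> bool" where
  "Spec_normal R \<longleftrightarrow>
     cring R \<and> (\<forall>P. primeideal P R \<longrightarrow> integrally_closed_domain (local_at R P))"


section \<open>The coordinate ring of \<open>U\<^sub>n\<close>\<close>

text \<open>Polynomials in a set \<open>V\<close> of variables, as finitely supported functions on monomials.\<close>

type_synonym ('v, 'k) mpoly = "('v \<Rightarrow>\<^sub>0 nat) \<Rightarrow>\<^sub>0 'k"

definition mpoly_ring :: "'v set \<Rightarrow> ('v, 'k::comm_ring_1) mpoly ring" where
  "mpoly_ring V =
     ring_of_type_algebra \<lparr>carrier := {p. \<forall>m \<in> Poly_Mapping.keys p. Poly_Mapping.keys m \<subseteq> V}\<rparr>"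

definition mvar :: "'v \<Rightarrow> ('v, 'k::comm_ring_1) mpoly" where
  "mvar v = Poly_Mapping.single (Poly_Mapping.single v 1) 1"

text \<open>
  \<open>Vcbar\<close> and \<open>Vcbari i\<close> are the barred variables. The variables other than \<open>Aff i\<close> are used for
  \<open>n \<ge> 4\<close>; the \<open>Aff i\<close> are the coordinates on the affine space \<open>U\<^sub>3\<close> of dimension 4.
\<close>

datatype uvar = Va | Vc | Vcbar | Vci nat | Vcbari nat | Vcij nat nat | Aff nat

definition U_vars :: "nat \<Rightarrow> uvar set" where
  "U_vars n =
     (if n = 3 then Aff ` {..<4}
      else {Va, Vc, Vcbar} \<union> Vci ` {4..n} \<union> Vcbari ` {4..n} \<union>
           {Vcij i j | i j. 4 \<le> i \<and> i < j \<and> j \<le> n})"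

text \<open>For \<open>i > j\<close>, \<open>c\<^sub>i\<^sub>j\<close> is not a variable but an abbreviation.\<close>

definition cc :: "nat \<Rightarrow> nat \<Rightarrow> (uvar, 'k::comm_ring_1) mpoly" where
  "cc i j =
     (if i < j then mvar (Vcij i j)
      else mvar Va + mvar (Vci j) + mvar (Vcbari j) + mvar (Vci i) + mvar (Vcbari i) - mvar (Vcij j i))"

text \<open>A relation \<open>lhs = rhs\<close> is represented by the polynomial \<open>lhs - rhs\<close>.\<close>

definition rel1 :: "nat \<Rightarrow> nat \<Rightarrow> (uvar, 'k::comm_ring_1) mpoly" where
  "rel1 i j =
     (mvar (Vci j) - mvar (Vci i)) * cc i j
     - ((mvar Va + mvar (Vcbari i) + mvar (Vci j) + mvar (Vcbari j)) * mvar (Vci j) - mvar Vc)"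

definition rel2 :: "nat \<Rightarrow> nat \<Rightarrow> (uvar, 'k::comm_ring_1) mpoly" where
  "rel2 i j =
     (mvar (Vcbari i) - mvar (Vcbari j)) * cc i j
     - ((mvar Va + mvar (Vci i) + mvar (Vcbari i) + mvar (Vci j)) * mvar (Vcbari i) - mvar Vcbar)"

definition rel3 :: "nat \<Rightarrow> nat \<Rightarrow> nat \<Rightarrow> (uvar, 'k::comm_ring_1) mpoly" where
  "rel3 i j k =
     (cc i j * cc j k + cc j i * cc i k - cc i k * cc j k
        + (mvar Va + mvar (Vci k) + mvar (Vcbari k)) * mvar (Vci k))
     - mvar Vc"

text \<open>Both sets are empty for \<open>n = 3\<close> and \<open>n = 4\<close>.\<close>

definition U_rels :: "nat \<Rightarrow> (uvar, 'k::comm_ring_1) mpoly set" where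
  "U_rels n =
     {r. \<exists>i j. 4 \<le> i \<and> i < j \<and> j \<le> n \<and> (r = rel1 i j \<or> r = rel2 i j)} \<union>
     {r. \<exists>i j k. 4 \<le> i \<and> i < j \<and> j < k \<and> k \<le> n \<and> r = rel3 i j k}"

definition U_ring :: "nat \<Rightarrow> (uvar, 'k::comm_ring_1) mpoly set ring" where
  "U_ring n = mpoly_ring (U_vars n) Quot (genideal (mpoly_ring (U_vars n)) (U_rels n))"

end

theory Submission
  imports Defs "HOL-Computational_Algebra.Computational_Algebra" "HOL-Library.Function_Algebras"
begin

text \<open>
  For \<open>n \<ge> 4\<close> the points \<open>(c\<^sub>i, cb\<^sub>i)\<close> (with \<open>cb\<close> for the barred \<open>c\<close>) lie on the plane cubic
  \<open>x\<^sup>2y + xy\<^sup>2 + axy = cb x + cy + e\<close>, and passing from \<open>n\<close> to \<open>n + 1\<close> adds a generic point of it: with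
  \<open>A\<close> the ring for \<open>n\<close>, the ring \<open>B\<close> for \<open>n + 1\<close> is the affine ring of a curve over \<open>A\<close> with \<open>n\<close>
  points at infinity. All rings are realized inside one large algebraically closed field. Comparing leading
  coefficients at the points at infinity shows that the given relations are complete and that \<open>B\<close> is free over a polynomial
  ring \<open>A[tau]\<close>, with an explicit functional \<open>Lam\<close> inducing a perfect pairing on \<open>B\<close>.

  Gorenstein: by induction the ring \<open>A\<close> is a Frobenius extension of a polynomial ring
  \<open>k[t\<^sub>1, \<dots>, t\<^sub>m]\<close>. A Koszul-type complex built from \<open>Hom\<^sub>k(A, k[t])\<close> is then an
  injective resolution of \<open>Hom\<^bsub>k[t]\<^esub>(A, k[t]) \<cong> A\<close> of length \<open>m\<close>, and it localizes.

  Normal: the generic fibre of \<open>B\<close> over \<open>A\<close> is an open part of the smooth cubic, hence integrally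
  closed, and all fibres over primes of \<open>A\<close> are reduced; together with the normality of \<open>A\<close> this makes
  \<open>B\<close> integrally closed. Regularity in codimension 1 follows.
\<close>

section \<open>Subrings of a field\<close>

text \<open>At each stage of the induction three statements are carried together: the relations
  generate the kernel of an evaluation map, its image is normal, and the image is a Frobenius
  extension of a polynomial ring. One algebraically closed field containing all images avoids a new
  type at every stage; being larger than the base field, it always has generic elements left. The
  constant \<open>e\<close> of the cubic is not a variable: it is the value of the cubic form at
  each of the points. For \<open>n = 4\<close> there are no relations, the five variables are
  independent and \<open>e\<close> is defined by them; smoothness of the cubic comes from
  genericity. For \<open>n = 3\<close> there is no point yet, and the free polynomial ring is
  treated directly. Finite injective dimension asks for modules with elements of a prescribed type.
  The functions on \<open>A\<close> that make up \<open>Hom k A S\<close>, with \<open>S\<close> the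
  polynomial ring, can be encoded there explicitly, and their injectivity is linear algebra over
  \<open>k\<close>. All characteristics are allowed, so no square is completed: the smooth cubic is
  handled by trace and norm and by both partial derivatives.\<close>

definition is_subring :: "'a::comm_ring_1 set => bool" where
 "is_subring A \<longleftrightarrow> 1 : A & (ALL x:A. ALL y:A. x - y : A & x*y : A)"

lemma is_subring_one: "is_subring A ==> 1 : A"
 and is_subring_diff: "is_subring A ==> x : A ==> y : A ==> x - y : A"
 and is_subring_mult: "is_subring A ==> x : A ==> y : A ==> x*y : A" by (auto simp: is_subring_def)

lemma is_subring_zero: "is_subring A ==> 0 : A" using is_subring_diff[of A 1 1] is_subring_one[of A] by simp

lemma is_subring_uminus: "is_subring A ==> x : A ==> - x : A"
 using is_subring_diff[of A 0 x] is_subring_zero[of A] by simp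

lemma is_subring_add: "is_subring A ==> x : A ==> y : A ==> x+y : A"
 using is_subring_diff[of A x "- y"] is_subring_uminus[of A y] by simp

lemma is_subring_power: "is_subring A ==> x : A ==> x^n : A"
 by (induction n) (auto intro: is_subring_one is_subring_mult)

lemma is_subring_sum: "is_subring A ==> (!!i. i : I ==> f i : A) ==> sum f I : A"
 by (induction I rule: infinite_finite_induct) (auto intro: is_subring_zero is_subring_add)

lemma is_subring_prod: "is_subring A ==> (!!i. i : I ==> f i : A) ==> prod f I : A"
 by (induction I rule: infinite_finite_induct) (auto intro: is_subring_one is_subring_mult)

lemma is_subring_of_nat: "is_subring A ==> of_nat n : A"
 by (induction n) (auto intro: is_subring_zero is_subring_one is_subring_add)

lemma is_subring_numeral: "is_subring A ==> numeral n : A" using is_subring_of_nat[of A "numeral n"] by simp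

lemmas is_subring_closed = is_subring_one is_subring_zero is_subring_diff is_subring_add
 is_subring_mult is_subring_uminus is_subring_power is_subring_sum is_subring_prod
 is_subring_numeral

text \<open>Division by zero yields \<open>0\<close>, so a vanishing denominator contributes only
  \<open>0\<close>, and for a subring \<open>A\<close> the set is its fraction field.\<close>

definition fracs :: "'a::field set => 'a set" where
 "fracs A = {a / b | a b. a : A & b : A}"

lemma fracs_incl: "is_subring A ==> x : A ==> x : fracs A"
 unfolding fracs_def using is_subring_one[of A] by (metis (mono_tags, lifting) div_by_1 mem_Collect_eq)

lemma fracsE: assumes "is_subring A" "x : fracs A"
 obtains a b where "a : A" "b : A" "b ~= 0" "x = a / b"
proof -
 obtain a b where ab: "a : A" "b : A" "x = a / b" using assms(2) by (auto simp: fracs_def)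
 show ?thesis
 proof (cases "b = 0")
  case True
  thus ?thesis using that[of 0 1] ab assms(1) is_subring_zero is_subring_one by auto
 next
  case False
  thus ?thesis using that ab by blast
 qed
qed

lemma fracsI: "a : A ==> b : A ==> a / b : fracs A" by (auto simp: fracs_def)

lemma is_subring_fracs: assumes A: "is_subring A" shows "is_subring (fracs A)" unfolding is_subring_def
proof (intro conjI ballI)
 show "1 : fracs A" by (intro fracs_incl A is_subring_one)
 fix x y assume "x : fracs A" "y : fracs A"
 then obtain a b c d where x: "a : A" "b : A" "b ~= 0" "x = a / b"
  and y: "c : A" "d : A" "d ~= 0" "y = c / d" using A by (metis fracsE)
 have "x - y = (a*d - c*b) / (b*d)" using x y by (simp add: field_simps)
 thus "x - y : fracs A" using x y A by (auto intro!: fracsI is_subring_closed)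
 have "x*y = (a * c) / (b*d)" using x y by simp
 thus "x*y : fracs A" using x y A by (auto intro!: fracsI is_subring_closed)
qed

lemma fracs_inverse: "x : fracs A ==> inverse x : fracs A"
proof -
 assume "x : fracs A"
 then obtain a b where "a : A" "b : A" "inverse x = b / a" by (auto simp: fracs_def)
 thus ?thesis using fracsI by metis
qed

lemma fracs_divide:
 "is_subring A ==> x : fracs A ==> y : fracs A ==> x / y : fracs A"
 using is_subring_mult[OF is_subring_fracs, of A x "inverse y"] fracs_inverse[of y A] by (simp add: divide_inverse)

lemma fracs_mono: "A <= B ==> fracs A <= fracs B" by (auto simp: fracs_def)

lemma fracs_least: assumes "is_subring A" "is_subring L" "!!x. x : L ==> inverse x : L" "A <= L" shows "fracs A <= L"
 using assms unfolding fracs_def by (auto simp: divide_inverse intro!: is_subring_mult)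

section \<open>Polynomials with coefficients in a subring\<close>

definition polys_over :: "'a::comm_ring_1 set => 'a poly set" where
 "polys_over A = {p. ALL i. coeff p i : A}"

lemma polys_overD: "p : polys_over A ==> coeff p i : A" by (simp add: polys_over_def)

lemma is_subring_polys_over: "is_subring A ==> is_subring (polys_over A)" unfolding is_subring_def[of "polys_over A"]
 by (auto simp: polys_over_def coeff_mult coeff_1 intro!: is_subring_closed)

lemma polys_over_const: "is_subring A ==> a : A ==> [:a:] : polys_over A"
 by (auto simp: polys_over_def coeff_pCons split: nat.splits intro: is_subring_zero)

lemma polys_over_pCons: "a : A ==> p : polys_over A ==> pCons a p : polys_over A"
 by (auto simp: polys_over_def coeff_pCons split: nat.splits)

lemma polys_over_pConsD: "pCons a p : polys_over A ==> a : A & p : polys_over A"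
 using polys_overD[of "pCons a p" A 0] polys_overD[of "pCons a p" A "Suc i" for i] by (auto simp: polys_over_def)

lemma polys_over_monom: "is_subring A ==> a : A ==> monom a n : polys_over A"
 by (auto simp: polys_over_def intro: is_subring_zero)

lemma polys_over_smult: "is_subring A ==> a : A ==> p : polys_over A ==> smult a p : polys_over A"
 by (auto simp: polys_over_def intro: is_subring_mult)

lemma polys_over_X: "is_subring A ==> [:0, 1:] : polys_over A"
 by (auto simp: polys_over_def coeff_pCons split: nat.splits intro: is_subring_zero is_subring_one)

lemma polys_over_zero: "is_subring A ==> 0 : polys_over A" by (auto simp: polys_over_def intro: is_subring_zero)

lemma polys_over_mono: "A <= B ==> polys_over A <= polys_over B" by (auto simp: polys_over_def)

lemmas polys_over_closed = is_subring_polys_over[THEN is_subring_add]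
 is_subring_polys_over[THEN is_subring_diff] is_subring_polys_over[THEN is_subring_mult]
 is_subring_polys_over[THEN is_subring_power] is_subring_polys_over[THEN is_subring_uminus]
 polys_over_const polys_over_pCons polys_over_monom polys_over_smult polys_over_X polys_over_zero

lemma poly_polys_over: assumes "is_subring A" "p : polys_over A" "x : A" shows "poly p x : A"
 using assms unfolding poly_altdef polys_over_def by (auto intro!: is_subring_sum is_subring_mult is_subring_power)

definition adjoin :: "'a::comm_ring_1 set => 'a => 'a set" where
 "adjoin A x = (%p. poly p x) ` polys_over A"

lemma is_subring_adjoin: assumes "is_subring A" shows "is_subring (adjoin A x)" unfolding is_subring_def adjoin_def
proof (intro conjI ballI)
 have P: "is_subring (polys_over A)" using assms by (rule is_subring_polys_over)
 show "1 : (%p. poly p x) ` polys_over A" by (rule image_eqI[of _ _ 1]) (auto intro: is_subring_one[OF P])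
 fix u v assume "u : (%p. poly p x) ` polys_over A" "v : (%p. poly p x) ` polys_over A"
 then obtain p q where p: "p : polys_over A" "u = poly p x" and q: "q : polys_over A" "v = poly q x" by auto
 show "u - v : (%p. poly p x) ` polys_over A"
  by (rule image_eqI[of _ _ "p - q"]) (auto simp: p q intro: is_subring_diff[OF P])
 show "u*v : (%p. poly p x) ` polys_over A"
  by (rule image_eqI[of _ _ "p*q"]) (auto simp: p q intro: is_subring_mult[OF P])
qed

lemma adjoin_base: "is_subring A ==> a : A ==> a : adjoin A x"
 unfolding adjoin_def by (rule image_eqI[of _ _ "[:a:]"]) (auto intro: polys_over_const)

lemma adjoin_self: "is_subring A ==> x : adjoin A x"
 unfolding adjoin_def by (rule image_eqI[of _ _ "[:0,1:]"]) (auto intro: polys_over_X)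

lemma adjoinI: "p : polys_over A ==> poly p x : adjoin A x" by (auto simp: adjoin_def)

lemma adjoin_least: assumes "is_subring B" "A <= B" "x : B" shows "adjoin A x <= B"
 using assms polys_over_mono[of A B] by (auto simp: adjoin_def intro!: poly_polys_over)

definition transcendental :: "'a::comm_ring_1 set => 'a => bool" where
 "transcendental A x \<longleftrightarrow> (ALL p : polys_over A. poly p x = 0 --> p = 0)"

lemma common_denominator: assumes A: "is_subring A" and "finite I" "!!i. i : I ==> f i : fracs A"
 shows "EX d:A. d ~= 0 & (ALL i:I. d*f i : A)" using assms(2,3)
proof (induction I rule: finite_induct)
 case empty
 thus ?case using is_subring_one[OF A] by (intro bexI[of _ 1]) auto
next
 case (insert i I)
 then obtain d where d: "d : A" "d ~= 0" "ALL i:I. d*f i : A" by auto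
 obtain a b where ab: "a : A" "b : A" "b ~= 0" "f i = a / b" using insert.prems[of i] A by (auto elim: fracsE)
 show ?case
 proof (intro bexI[of _ "b*d"] conjI ballI)
  fix j assume "j : insert i I"
  thus "b*d*f j : A"
  proof
   assume "j = i"
   hence eq: "b*d*f j = a*d" using ab by simp
   show ?thesis unfolding eq by (rule is_subring_mult[OF A ab(1) d(1)])
  next
   assume "j : I"
   thus ?thesis using d ab A is_subring_mult[OF A, of b "d*f j"] by (simp add: mult.assoc)
  qed
 qed (use ab d A in \<open>auto intro: is_subring_mult\<close>)
qed

lemma polys_over_fracs_clear: assumes A: "is_subring A" and p: "p : polys_over (fracs A)"
 shows "EX d:A. d ~= 0 & smult d p : polys_over A"
proof -
 obtain d where d: "d : A" "d ~= 0" "ALL i:{..degree p}. d * coeff p i : A"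
  using common_denominator[OF A, of "{..degree p}" "coeff p"] p by (auto simp: polys_over_def)
 have "smult d p : polys_over A" unfolding polys_over_def
 proof safe
  fix i show "coeff (smult d p) i : A" using d is_subring_zero[OF A] by (cases "i <= degree p") (auto simp: coeff_eq_0)
 qed
 thus ?thesis using d by blast
qed

lemma transcendental_fracs: assumes A: "is_subring A" and x: "transcendental A x"
 shows "transcendental (fracs A) (x::'a::field)" unfolding transcendental_def
proof safe
 fix p assume p: "p : polys_over (fracs A)" "poly p x = 0"
 obtain d where "d : A" "d ~= 0" "smult d p : polys_over A" using polys_over_fracs_clear[OF A p(1)] by auto
 thus "p = 0" using x p(2) by (auto simp: transcendental_def)
qed

lemma transcendental_mono: "A <= B ==> transcendental B x ==> transcendental A x"
 using polys_over_mono[of A B] by (auto simp: transcendental_def)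

section \<open>Ideals and the Noetherian property\<close>

definition is_ideal :: "'a::comm_ring_1 set => 'a set => bool" where
 "is_ideal A I \<longleftrightarrow> I <= A & 0 : I & (ALL x:I. ALL y:I. x+y : I) & (ALL a:A. ALL x:I. a*x : I)"

lemma is_idealD: assumes "is_ideal A I"
 shows "I <= A" "0 : I" "!!x y. x : I ==> y : I ==> x+y : I" "!!a x. a : A ==> x : I ==> a*x : I"
 using assms by (auto simp: is_ideal_def)

lemma is_ideal_uminus: assumes "is_subring A" "is_ideal A I" "x : I" shows "- x : I"
 using is_idealD(4)[OF assms(2), of "- 1" x] is_subring_uminus[OF assms(1) is_subring_one[OF assms(1)]] assms(3) by simp

lemma is_ideal_diff: assumes "is_subring A" "is_ideal A I" "x : I" "y : I" shows "x - y : I"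
 using is_idealD(3)[OF assms(2), of x "- y"] is_ideal_uminus[OF assms(1,2), of y] assms by simp

lemma is_ideal_sum:
 "is_ideal A I ==> (!!i. i : J ==> f i : I) ==> sum f J : I"
 by (induction J rule: infinite_finite_induct) (auto simp: is_ideal_def)

definition is_prime_ideal :: "'a::comm_ring_1 set => 'a set => bool" where
 "is_prime_ideal A P \<longleftrightarrow> is_ideal A P & 1 ~: P & (ALL x:A. ALL y:A. x*y : P --> x : P \<or> y : P)"

lemma is_prime_ideal_power: assumes "is_subring A" "is_prime_ideal A P" "x : A" "x^n : P" shows "x : P" using assms(4)
proof (induction n)
 case 0 thus ?case using assms(2) by (simp add: is_prime_ideal_def)
next
 case (Suc n)
 thus ?case using assms is_subring_power[OF assms(1,3), of n] by (auto simp: is_prime_ideal_def)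
qed

text \<open>Finite generation is expressed by minimality of \<open>I\<close> among the ideals
  containing \<open>F\<close>, which avoids a separate notion of generated ideal.\<close>

definition noetherian :: "'a::comm_ring_1 set => bool" where
 "noetherian A \<longleftrightarrow> (ALL I. is_ideal A I -->
  (EX F. finite F & F <= I & (ALL I'. is_ideal A I' & F <= I' --> I <= I')))"

lemma noetherianE: assumes "noetherian A" "is_ideal A I"
 obtains F where "finite F" "F <= I" "!!I'. is_ideal A I' ==> F <= I' ==> I <= I'"
 using assms unfolding noetherian_def by metis

lemma is_ideal_Union_chain: assumes "C ~= {}" "subset.chain (Collect (is_ideal A)) C" shows "is_ideal A (\<Union>C)"
 unfolding is_ideal_def
proof (intro conjI ballI)
 have I: "is_ideal A c" if "c : C" for c using assms(2) that by (auto simp: subset.chain_def)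
 show "\<Union>C <= A" "0 : \<Union>C" using I assms(1) is_idealD(1,2) by blast+
 show "a*x : \<Union>C" if "a : A" "x : \<Union>C" for a x using that I is_idealD(4) by blast
 fix x y assume "x : \<Union>C" "y : \<Union>C"
 then obtain c where "c : C" "{x, y} <= c" using finite_subset_Union_chain[of "{x, y}" C] assms by auto
 thus "x+y : \<Union>C" using I is_idealD(3) by blast
qed

text \<open>The union of a chain is generated by finitely many elements, and these lie in one
  member. So every chain contains its union, and Zorn's lemma applies.\<close>

lemma noetherian_maximal: assumes A: "noetherian A" and F: "F ~= {}" "!!I. I : F ==> is_ideal A I"
 shows "EX M:F. ALL Y:F. M <= Y --> Y = M"
proof (rule subset_Zorn_nonempty)
 show "F ~= {}" by fact
 fix C assume C: "C ~= {}" "subset.chain F C"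
 have C': "subset.chain (Collect (is_ideal A)) C" using C(2) F(2) by (auto simp: subset.chain_def)
 have "is_ideal A (\<Union>C)" by (rule is_ideal_Union_chain[OF C(1) C'])
 then obtain G where G: "finite G" "G <= \<Union>C" "!!I'. is_ideal A I' ==> G <= I' ==> \<Union>C <= I'"
  using A by (metis noetherianE)
 obtain c where c: "c : C" "G <= c" using finite_subset_Union_chain[OF G(1,2) C(1) C'] by auto
 have "is_ideal A c" using c C F by (auto simp: subset.chain_def)
 hence "\<Union>C <= c" using G(3) c by blast
 hence "\<Union>C = c" using c by auto
 thus "\<Union>C : F" using c C by (auto simp: subset.chain_def)
qed

text \<open>Hilbert's basis theorem, by the ideals of leading coefficients.\<close>

lemma noetherian_adjoin: assumes A: "is_subring A" and N: "noetherian A" shows "noetherian (adjoin A x)"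
 unfolding noetherian_def
proof (intro allI impI)
 fix I assume I: "is_ideal (adjoin A x) I"
 note PA = is_subring_polys_over[OF A]
 \<comment> \<open>As \<open>x\<close> may be algebraic over \<open>A\<close>, degrees and leading
   coefficients are those of representing polynomials, not of elements.\<close>
 define lc where "lc J d = {a. EX p:polys_over A. degree p <= d & coeff p d = a & poly p x : J}" for J d
 have lc_ideal: "is_ideal A (lc J d)" if J: "is_ideal (adjoin A x) J" for J d unfolding is_ideal_def
 proof (intro conjI ballI)
  show "lc J d <= A" by (auto simp: lc_def polys_over_def)
  show "0 : lc J d" unfolding lc_def using is_idealD(2)[OF J] polys_over_zero[OF A] by (auto intro!: bexI[of _ 0])
  show "a+b : lc J d" if ab: "a : lc J d" "b : lc J d" for a b
  proof -
   obtain p where p: "p : polys_over A" "degree p <= d" "coeff p d = a" "poly p x : J" using ab by (auto simp: lc_def)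
   obtain q where q: "q : polys_over A" "degree q <= d" "coeff q d = b" "poly q x : J" using ab by (auto simp: lc_def)
   show ?thesis unfolding lc_def using p q is_subring_add[OF PA p(1) q(1)] is_idealD(3)[OF J p(4) q(4)]
    by (auto intro!: bexI[of _ "p+q"] degree_add_le)
  qed
  show "a*b : lc J d" if ab: "a : A" "b : lc J d" for a b
  proof -
   obtain p where p: "p : polys_over A" "degree p <= d" "coeff p d = b" "poly p x : J" using ab by (auto simp: lc_def)
   have "degree (smult a p) <= d" using degree_smult_le[of a p] p(2) by (rule le_trans)
   moreover have "poly (smult a p) x : J" using is_idealD(4)[OF J adjoin_base[OF A ab(1)] p(4)] by simp
   ultimately show ?thesis unfolding lc_def mem_Collect_eq
    using p(3) polys_over_smult[OF A ab(1) p(1)] by (intro bexI[of _ "smult a p"]) auto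
  qed
 qed
 have lc_mono: "lc J d <= lc J (Suc d)" if J: "is_ideal (adjoin A x) J" for J d
 proof
  fix a assume "a : lc J d"
  then obtain p where p: "p : polys_over A" "degree p <= d" "coeff p d = a" "poly p x : J" by (auto simp: lc_def)
  show "a : lc J (Suc d)" unfolding lc_def
   using p polys_over_pCons[OF is_subring_zero[OF A] p(1)] is_idealD(4)[OF J adjoin_self[OF A] p(4)]
   by (auto intro!: bexI[of _ "pCons 0 p"] simp: degree_pCons_eq_if)
 qed
 have lc_mono': "d <= e ==> lc J d <= lc J e" if J: "is_ideal (adjoin A x) J" for J d e
  using lift_Suc_mono_le[of "lc J" d e] lc_mono[OF J] by auto
 have chain: "subset.chain (Collect (is_ideal A)) (range (lc I))" unfolding subset_chain_def
 proof (intro conjI ballI)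
  show "range (lc I) <= Collect (is_ideal A)" using lc_ideal[OF I] by auto
  fix u v assume "u : range (lc I)" "v : range (lc I)"
  then obtain d e where "u = lc I d" "v = lc I e" by auto
  thus "u <= v \<or> v <= u" using lc_mono'[OF I, of d e] lc_mono'[OF I, of e d] by (cases "d <= e") auto
 qed
 have "is_ideal A (\<Union>(range (lc I)))" by (rule is_ideal_Union_chain[OF _ chain]) auto
 then obtain G where G: "finite G" "G <= \<Union>(range (lc I))"
   "!!I'. is_ideal A I' ==> G <= I' ==> \<Union>(range (lc I)) <= I'" using N by (metis noetherianE)
 obtain D where D: "G <= lc I D" using finite_subset_Union_chain[OF G(1,2) _ chain] by auto
 have lcD: "lc I d <= lc I D" for d using G(3)[OF lc_ideal[OF I] D] by blast
 have "ALL d. EX F. finite F & F <= lc I d & (ALL I'. is_ideal A I' & F <= I' --> lc I d <= I')"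
  using N lc_ideal[OF I] unfolding noetherian_def by blast
 then obtain F where F: "!!d. finite (F d)" "!!d. F d <= lc I d"
   "!!d I'. is_ideal A I' ==> F d <= I' ==> lc I d <= I'" by metis
 have "ALL d. ALL a:F d. EX p. p:polys_over A & degree p <= d & coeff p d = a & poly p x : I"
  using F(2) by (fastforce simp: lc_def)
 then obtain P where P: "!!d a. a : F d ==> P d a : polys_over A & degree (P d a) <= d &
   coeff (P d a) d = a & poly (P d a) x : I" by metis
 define S where "S = (\<Union>d\<le>D. (%a. poly (P d a) x) ` F d)"
 show "EX F. finite F & F <= I & (ALL I'. is_ideal (adjoin A x) I' & F <= I' --> I <= I')"
 proof (intro exI[of _ S] conjI allI impI)
  show "finite S" using F(1) by (auto simp: S_def)
  show "S <= I" using P by (auto simp: S_def)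
  fix I' assume "is_ideal (adjoin A x) I' & S <= I'"
  hence I': "is_ideal (adjoin A x) I'" and S: "S <= I'" by auto
  \<comment> \<open>Comparison with \<open>I Int I'\<close> instead of \<open>I'\<close> lets the
    polynomials \<open>r\<close> below be chosen with values in both ideals, so that
    \<open>p - r\<close> stays in \<open>I\<close> during the reduction.\<close>
  have IJ: "is_ideal (adjoin A x) (I Int I')" using I I' by (auto simp: is_ideal_def)
  have lcI': "lc I d <= lc (I Int I') d" if "d <= D" for d
  proof (rule F(3)[OF lc_ideal[OF IJ]], rule)
   fix a assume a: "a : F d"
   have "poly (P d a) x : I Int I'" using S a that P by (auto simp: S_def)
   thus "a : lc (I Int I') d" using P[OF a] unfolding lc_def by blast
  qed
  have lcI2: "lc I d <= lc (I Int I') d" for d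
  proof (cases "d <= D")
   case False
   have "lc I d <= lc (I Int I') D" using lcD[of d] lcI'[of D] by auto
   also have "\<dots> <= lc (I Int I') d" using lc_mono'[OF IJ, of D d] False by auto
   finally show ?thesis .
  qed (rule lcI')
  have red: "poly p x : I ==> p : polys_over A ==> (ALL i>=d. coeff p i = 0) ==> poly p x : I'" for p d
  proof (induction d arbitrary: p)
   case 0
   hence "p = 0" by (simp add: poly_eq_iff)
   thus ?case using is_idealD(2)[OF I'] by simp
  next
   case (Suc d)
   have "coeff p d : lc I d" using Suc.prems unfolding lc_def by (auto intro!: bexI[of _ p] degree_le)
   obtain r where r: "r : polys_over A" "degree r <= d" "coeff r d = coeff p d" "poly r x : I Int I'"
    using \<open>coeff p d : lc I d\<close> lcI2[of d] unfolding lc_def by blast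
   have "poly (p - r) x : I'"
   proof (rule Suc.IH)
    show "poly (p - r) x : I"
     using is_ideal_diff[OF is_subring_adjoin[OF A] I, of "poly p x" "poly r x"] r Suc.prems by simp
    show "p - r : polys_over A" by (intro is_subring_diff[OF PA] r Suc.prems)
    show "ALL i>=d. coeff (p - r) i = 0"
    proof safe
     fix i assume "d <= i"
     thus "coeff (p - r) i = 0" using Suc.prems(3) r(2,3) by (cases "i = d") (auto simp: coeff_eq_0)
    qed
   qed
   thus ?case using is_idealD(3)[OF I', of "poly (p - r) x" "poly r x"] r by simp
  qed
  show "I <= I'"
  proof
   fix y assume y: "y : I"
   then obtain p where p: "p : polys_over A" "y = poly p x" using is_idealD(1)[OF I] by (auto simp: adjoin_def)
   show "y : I'" using red[of p "Suc (degree p)"] y p by (auto simp: coeff_eq_0)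
  qed
 qed
qed

section \<open>Integral elements and normality\<close>

definition integral_over :: "'a::comm_ring_1 set => 'a => bool" where
 "integral_over A w \<longleftrightarrow> (EX n c. (ALL i<n. c i : A) & w^n+(\<Sum>i<n. c i*w^i) = 0)"

definition normal_subring :: "'a::field set => bool" where
 "normal_subring A \<longleftrightarrow> (ALL w:fracs A. integral_over A w --> w : A)"

lemma integral_over_mono: "A <= B ==> integral_over A w ==> integral_over B w" unfolding integral_over_def by blast

lemma integral_over_mult: assumes A: "is_subring A" and "integral_over A w" "d : A" shows "integral_over A (d*w)"
proof -
 obtain n c where c: "!!i. i < n ==> c i : A" "w^n+(\<Sum>i<n. c i*w^i) = 0"
  using assms(2) by (auto simp: integral_over_def)
 have "(d*w)^n+(\<Sum>i<n. d^(n - i) * c i*(d*w)^i) = d^n*(w^n+(\<Sum>i<n. c i*w^i))"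
  unfolding distrib_left sum_distrib_left
 proof (intro arg_cong2[of _ _ _ _ "(+)"] sum.cong refl)
  fix i assume "i : {..<n}"
  hence "d^n = d^(n - i)*d^i" by (simp flip: power_add)
  thus "d^(n - i) * c i*(d*w)^i = d^n*(c i*w^i)" by (simp add: power_mult_distrib)
 qed (simp add: power_mult_distrib)
 hence "(d*w)^n+(\<Sum>i<n. d^(n - i) * c i*(d*w)^i) = 0" using c by simp
 thus ?thesis unfolding integral_over_def using c(1) assms(3) A by (intro exI[of _ n] exI[of _ "%i. d^(n - i) * c i"])
   (auto intro!: is_subring_closed)
qed

text \<open>The equation replaces high powers of \<open>w\<close> by lower ones, and
  \<open>d^n\<close> clears the powers up to the degree \<open>n\<close>. Integrality enters the
  closedness proofs below in this almost integral form.\<close>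

lemma integral_over_powers: assumes A: "is_subring A" and w: "integral_over A w" and d: "d : A" "d*w : A"
 shows "EX N. ALL m. d^N*w^m : A"
proof -
 obtain n c where c: "!!i. i < n ==> c i : A" "w^n+(\<Sum>i<n. c i*w^i) = 0" using w by (auto simp: integral_over_def)
 have "d^n*w^m : A" for m
 proof (induction m rule: less_induct)
  case (less m)
  show ?case
  proof (cases "m <= n")
   case True
   hence "d^n = d^(n - m)*d^m" by (simp flip: power_add)
   hence "d^n*w^m = d^(n - m)*(d*w)^m" by (simp add: power_mult_distrib)
   thus ?thesis using d A by (auto intro!: is_subring_closed)
  next
   case False
   have "w^m = w^(m - n)*w^n" using False by (simp flip: power_add)
   also have "w^n = - (\<Sum>i<n. c i*w^i)" using c(2) by (simp add: eq_neg_iff_add_eq_0)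
   finally have "d^n*w^m = - (\<Sum>i<n. c i*(d^n*w^(m - n+i)))" by (simp add: sum_distrib_left power_add mult_ac)
   moreover have "d^n*w^(m - n+i) : A" if "i < n" for i using less that False by auto
   ultimately show ?thesis using c(1)
    by (auto intro!: is_subring_uminus[OF A] is_subring_sum[OF A] intro: is_subring_mult[OF A])
  qed
 qed
 thus ?thesis by blast
qed

text \<open>Converse of \<open>integral_over_powers\<close>: \<open>h * A[w]\<close> is an ideal of
  \<open>A\<close>, and its finitely many generators are expressions in \<open>w\<close> of bounded
  degree. So \<open>h * w^n\<close> is one of degree below \<open>n\<close> for some
  \<open>n\<close>, and cancelling \<open>h\<close> gives the equation.\<close>

lemma noetherian_integral:
 fixes w :: "'a::field" assumes A: "is_subring A" and N: "noetherian A" and h: "h ~= 0" and hw: "!!m. h*w^m : A"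
 shows "integral_over A w"
proof -
 note PA = is_subring_polys_over[OF A]
 \<comment> \<open>The predicate is later either always true or a bound on the degree; both give
   ideals by the same argument.\<close>
 define I where "I P = (%p. h*poly p w) ` (polys_over A Int {p. P p})" for P
 have hp: "h*poly p w : A" if "p : polys_over A" for p
 proof -
  have "h*poly p w = (\<Sum>i\<le>degree p. coeff p i*(h*w^i))" by (simp add: poly_altdef sum_distrib_left mult_ac)
  thus ?thesis using that hw by (auto intro!: is_subring_sum[OF A] intro: is_subring_mult[OF A] simp: polys_over_def)
 qed
 have id: "is_ideal A (I P)" if P: "P 0" "!!p q. P p ==> P q ==> P (p+q)" "!!a p. P p ==> P (smult a p)" for P
  unfolding is_ideal_def
 proof (intro conjI ballI)
  show "I P <= A" using hp by (auto simp: I_def)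
  show "0 : I P" unfolding I_def by (rule image_eqI[of _ _ 0]) (auto intro: P is_subring_zero[OF PA])
  fix u v assume "u : I P" "v : I P"
  then obtain p q where pq: "p : polys_over A" "P p" "u = h*poly p w" "q : polys_over A" "P q" "v = h*poly q w"
   by (auto simp: I_def)
  thus "u+v : I P" unfolding I_def
   by (intro image_eqI[of _ _ "p+q"]) (auto intro: P is_subring_add[OF PA] simp: algebra_simps)
 next
  fix a u assume "a : A" "u : I P"
  then obtain p where "p : polys_over A" "P p" "u = h*poly p w" by (auto simp: I_def)
  thus "a*u : I P" unfolding I_def using \<open>a : A\<close>
   by (intro image_eqI[of _ _ "smult a p"]) (auto intro: P polys_over_smult[OF A])
 qed
 have "is_ideal A (I (%_. True))" by (rule id) auto
 then obtain F where F: "finite F" "F <= I (%_. True)"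
   "!!I'. is_ideal A I' ==> F <= I' ==> I (%_. True) <= I'" using N by (metis noetherianE)
 hence "ALL f:F. EX p. p : polys_over A & f = h*poly p w" by (auto simp: I_def)
 then obtain p where p: "!!f. f : F ==> p f : polys_over A & f = h*poly (p f) w" by metis
 define n where "n = Suc (\<Sum>f\<in>F. degree (p f))"
 have deg: "degree (p f) < n" if "f : F" for f
  unfolding n_def using member_le_sum[of f F "%f. degree (p f)"] F(1) that by simp
 let ?P = "%p. degree p < n"
 have "is_ideal A (I ?P)" by (rule id) (auto simp: n_def intro: degree_add_less le_less_trans[OF degree_smult_le])
 moreover have "F <= I ?P" using p deg by (force simp: I_def)
 ultimately have "I (%_. True) <= I ?P" by (rule F(3))
 moreover have "h*w^n : I (%_. True)" unfolding I_def by (rule image_eqI[of _ _ "monom 1 n"])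
   (auto simp: poly_monom intro: polys_over_monom[OF A] is_subring_one[OF A])
 ultimately obtain q where q: "q : polys_over A" "degree q < n" "w^n = poly q w" using h by (auto simp: I_def)
 have "poly q w = (\<Sum>i<n. coeff q i*w^i)"
  unfolding poly_altdef by (rule sum.mono_neutral_left) (use q in \<open>auto simp: coeff_eq_0\<close>)
 hence "w^n+(\<Sum>i<n. - coeff q i*w^i) = 0" using q by (simp add: sum_negf)
 thus ?thesis unfolding integral_over_def
  using q(1) by (intro exI[of _ n] exI[of _ "%i. - coeff q i"]) (auto simp: polys_over_def intro: is_subring_uminus[OF A])
qed

text \<open>
  The fractional ideal \<open>x P\<close> with \<open>x = b / s\<close> is an ideal of \<open>A\<close>; it cannot be contained in \<open>P\<close>,
  as then \<open>x\<close> would be integral.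
\<close>

lemma normal_colon_ideal: assumes A: "is_subring A" "noetherian A" "normal_subring A"
  and s: "s : A" "s ~= 0" and b: "b : A" "!!y. y : A ==> b ~= s*y"
  and P: "P = {a:A. EX y:A. a*b = s*y}" shows "EX pp:P. EX v:A. v ~: P & pp*b = s*v"
proof (rule ccontr)
 assume neg: "~ ?thesis"
 define x where "x = b / s"
 have xP: "x*a : P" if a: "a : P" for a
 proof -
  obtain y where y: "y : A" "a*b = s*y" using a P by auto
  hence "y : P" using neg a by auto
  moreover have "x*a = y" using y s by (simp add: x_def field_simps)
  ultimately show ?thesis by simp
 qed
 have "s : P" using s b by (auto simp: P)
 hence "s*x^m : P" for m
 proof (induction m)
  case (Suc m)
  thus ?case using xP[of "s*x^m"] by (simp add: mult_ac)
 qed simp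
 hence "integral_over A x" using noetherian_integral[OF A(1,2) s(2)] P by auto
 moreover have "x : fracs A" using s b by (auto simp: x_def fracs_def)
 ultimately have "x : A" using A(3) by (auto simp: normal_subring_def)
 thus False using b(2)[of x] s by (simp add: x_def)
qed

text \<open>
  Normality of an extension \<open>B\<close> with \<open>A\<close>-linear coordinates \<open>kp\<close>, all of whose fibres are reduced
  and whose generic fibre is normal: an element \<open>f = b / s\<close> integral over \<open>B\<close> is moved to one with
  \<open>(s : b)\<close> prime in \<open>A\<close>. Then \<open>pp b = s bt\<close> where \<open>bt\<close> is nonzero in the fibre over this prime,
  but the integral equation of \<open>bt / pp\<close> shows that \<open>bt\<close> is nilpotent there.
\<close>

lemma normal_extension:
 fixes A B :: "'a::field set" and kp :: "'i => 'a => 'a"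
 assumes A: "is_subring A" "noetherian A" "normal_subring A" and B: "is_subring B" "A <= B"
  and k1: "!!i f. f : B ==> kp i f : A"
  and k2: "!!i f g. f : B ==> g : B ==> kp i (f+g) = kp i f+kp i g"
  and k3: "!!i f a. f : B ==> a : A ==> kp i (a*f) = a*kp i f"
  and k4: "!!f. f : B ==> finite {i. kp i f ~= 0}"
  and k5: "!!f s. f : B ==> s : A ==> s ~= 0 ==> (!!i. EX y:A. kp i f = s*y) ==> EX g:B. f = s*g"
  and k6: "!!P f b. is_prime_ideal A P ==> f : B ==> (!!i. kp i f : P) ==> b : B ==> kp i (b*f) : P"
  and red: "!!P f n i. is_prime_ideal A P ==> f : B ==> (!!i. kp i (f^n) : P) ==> kp i f : P"
  and gen: "!!f. f : fracs B ==> integral_over B f ==> EX s:A. s ~= 0 & s*f : B" shows "normal_subring B"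
 unfolding normal_subring_def
proof (intro ballI impI, rule ccontr)
 fix f assume f: "f : fracs B" "integral_over B f" and nf: "f ~: B"
 obtain s where s: "s : A" "s ~= 0" "s*f : B" using gen f by blast
 \<comment> \<open>As with associated primes: among the denominator ideals of the multiples of
   \<open>f\<close> outside \<open>B\<close>, a maximal one is prime.\<close>
 define C where "C r = {a:A. a*r*f : B}" for r
 have C_ideal: "is_ideal A (C r)" for r using A(1) B is_subring_zero[OF B(1)] is_subring_zero[OF A(1)]
  by (auto simp: is_ideal_def C_def mult.assoc distrib_right distrib_left intro!: is_subring_add is_subring_mult)
 define FF where "FF = C ` {r:A. r*f ~: B}"
 have "FF ~= {}" unfolding FF_def using nf is_subring_one[OF A(1)] by (auto intro!: exI[of _ 1])
 hence "EX P:FF. ALL Y:FF. P <= Y --> Y = P"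
  by (rule noetherian_maximal[OF A(2)]) (use C_ideal in \<open>auto simp: FF_def\<close>)
 then obtain P where P: "P : FF" "!!Y. Y : FF ==> P <= Y ==> Y = P" by blast
 then obtain r where r: "r : A" "r*f ~: B" "P = C r" by (auto simp: FF_def)
 have prime: "is_prime_ideal A P" unfolding is_prime_ideal_def
 proof (intro conjI ballI impI)
  show "is_ideal A P" using C_ideal r by simp
  show "1 ~: P" using r by (auto simp: C_def)
  fix x y assume xy: "x : A" "y : A" "x*y : P"
  show "x : P \<or> y : P"
  proof (rule ccontr)
   assume c: "~ (x : P \<or> y : P)"
   hence "y*r*f ~: B" using xy r by (auto simp: C_def)
   hence "C (y*r) : FF" using xy r A(1) by (auto simp: FF_def intro: is_subring_mult)
   moreover have "P <= C (y*r)"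
   proof
    fix a assume "a : P"
    hence "a : A" "a*r*f : B" using r by (auto simp: C_def)
    hence "y*(a*r*f) : B" using xy B by (auto intro: is_subring_mult)
    thus "a : C (y*r)" using \<open>a : A\<close> by (simp add: C_def mult_ac)
   qed
   ultimately have "C (y*r) = P" using P(2) by blast
   moreover have "x : C (y*r)" using xy r by (auto simp: C_def mult_ac)
   ultimately show False using c by simp
  qed
 qed
 define b where "b = s*(r*f)"
 have bB: "b : B" using is_subring_mult[OF B(1), of r "s*f"] s r B(2) by (auto simp: b_def mult_ac)
 have PC: "a : P \<longleftrightarrow> (EX g:B. a*b = s*g)" if "a : A" for a
  using that s(2) by (auto simp: r(3) C_def b_def mult.assoc mult.left_commute[of a s])
 have kzero: "kp i 0 = 0" for i using k3[of 0 0 i] is_subring_zero[OF B(1)] is_subring_zero[OF A(1)] by simp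
 define D where "D i = {a:A. EX y:A. a*kp i b = s*y}" for i
 have PD: "P <= D i" for i
 proof
  fix a assume a: "a : P"
  hence aA: "a : A" using r by (auto simp: C_def)
  obtain g where g: "g : B" "a*b = s*g" using PC aA a by blast
  hence "a*kp i b = s*kp i g" using k3 s aA bB by metis
  thus "a : D i" using k1 g aA by (auto simp: D_def)
 qed
 define Z where "Z = {i. kp i b ~= 0}"
 have Z: "finite Z" using k4 bB by (simp add: Z_def)
 \<comment> \<open>An element lies in \<open>P\<close> iff it makes every coordinate of
   \<open>b\<close> divisible by \<open>s\<close>, so \<open>P\<close> is the intersection of the
   \<open>D i\<close>. All but finitely many of these are \<open>A\<close>, and a prime containing a
   finite intersection contains one of its members.\<close>
 have "EX i. D i <= P"
 proof (rule ccontr)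
  assume "~ (EX i. D i <= P)"
  hence "ALL i. EX a. a : D i & a ~: P" by blast
  then obtain a where a: "!!i. a i : D i" "!!i. a i ~: P" by metis
  define m where "m = (\<Prod>i\<in>Z. a i)"
  have aA: "a i : A" for i using a by (auto simp: D_def)
  have mA: "m : A" unfolding m_def using aA A(1) by (auto intro: is_subring_prod)
  have "m ~: P" unfolding m_def using Z
  proof (induction Z rule: finite_induct)
   case empty thus ?case using prime by (simp add: is_prime_ideal_def)
  next
   case (insert i Z)
   have "prod a Z : A" by (rule is_subring_prod[OF A(1)]) (rule aA)
   hence "a i*prod a Z ~: P" using prime a(2) aA insert unfolding is_prime_ideal_def by blast
   thus ?case using insert by simp
  qed
  moreover have "EX y:A. kp i (m*b) = s*y" for i
  proof (cases "i : Z")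
   case True
   hence m: "m = a i*(\<Prod>i\<in>Z - {i}. a i)" using Z by (simp add: m_def prod.remove)
   obtain y where "y : A" "a i*kp i b = s*y" using a(1)[of i] by (auto simp: D_def)
   thus ?thesis using k3[OF bB mA] m is_subring_prod[OF A(1), of "Z - {i}" a] aA
    by (auto intro!: bexI[of _ "(\<Prod>i\<in>Z - {i}. a i)*y"] is_subring_mult[OF A(1)])
  next
   case False
   thus ?thesis using k3[OF bB mA] is_subring_zero[OF A(1)] by (auto simp: Z_def intro!: bexI[of _ 0])
  qed
  hence "EX g:B. m*b = s*g" using k5[of "m*b" s] s mA bB B by (auto intro: is_subring_mult)
  hence "m : P" using PC mA by simp
  ultimately show False by simp
 qed
 then obtain i where DP: "D i = P" using PD by blast
 have nb: "kp i b ~= s*y" if "y : A" for y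
 proof
  assume "kp i b = s*y"
  hence "1 : D i" using that is_subring_one[OF A(1)] by (auto simp: D_def)
  thus False using DP prime by (simp add: is_prime_ideal_def)
 qed
 obtain pp v where pp: "pp : P" "v : A" "v ~: P" "pp*kp i b = s*v"
  using normal_colon_ideal[OF A s(1,2) k1[OF bB] nb, of P] DP by (auto simp: D_def)
 have ppA: "pp : A" using pp r by (auto simp: C_def)
 obtain bt where bt: "bt : B" "pp*b = s*bt" using PC ppA pp by blast
 have "s*kp i bt = s*v" using k3[OF bt(1) s(1)] k3[OF bB ppA] bt(2) pp(4) by metis
 hence kv: "kp i bt = v" using s by simp
 have ppf: "bt = pp*(r*f)" using bt(2) s by (simp add: b_def)
 have "integral_over B (r*f)" using integral_over_mult[OF B(1) f(2)] r B(2) by auto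
 then obtain n c where c: "!!i. i < n ==> c i : B" "(r*f)^n+(\<Sum>i<n. c i*(r*f)^i) = 0"
  by (auto simp: integral_over_def)
 have eq: "bt^n = (\<Sum>i<n. pp*(- c i*pp^(n - i - 1)*bt^i))"
 proof -
  have "bt^n = - (pp^n*(\<Sum>i<n. c i*(r*f)^i))"
   using c(2) by (simp add: ppf power_mult_distrib eq_neg_iff_add_eq_0 flip: distrib_left)
  also have "\<dots> = (\<Sum>i<n. - (pp^n*(c i*(r*f)^i)))" by (simp add: sum_distrib_left sum_negf)
  also have "\<dots> = (\<Sum>i<n. pp*(- c i*pp^(n - i - 1)*bt^i))"
  proof (rule sum.cong)
   fix i assume "i : {..<n}"
   hence "Suc (n - i - 1+i) = n" by auto
   hence "pp^n = pp*pp^(n - i - 1)*pp^i" by (metis power_add power_Suc mult.assoc)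
   thus "- (pp^n*(c i*(r*f)^i)) = pp*(- c i*pp^(n - i - 1)*bt^i)" by (simp add: ppf power_mult_distrib)
  qed simp
  finally show ?thesis .
 qed
 have Pid: "is_ideal A P" using prime by (simp add: is_prime_ideal_def)
 have "kp j (bt^n) : P" for j
 proof -
  define g where "g = (%i. - c i*pp^(n - i - 1)*bt^i)"
  have gB: "g i : B" if "i < n" for i unfolding g_def using c(1)[OF that] ppA bt B by (auto intro!: is_subring_closed)
  define G where "G = (\<Sum>i<n. g i)"
  have "G : B" unfolding G_def using gB B by (auto intro!: is_subring_sum)
  moreover have "bt^n = pp*G" unfolding G_def eq g_def by (simp add: sum_distrib_left)
  ultimately have "kp j (bt^n) = kp j G*pp" "kp j G : A" using k3 ppA k1 by (auto simp: mult.commute)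
  thus ?thesis using is_idealD(4)[OF Pid] pp(1) by auto
 qed
 hence "kp i bt : P" using red prime bt(1) by blast
 thus False using kv pp by simp
qed

section \<open>Rings embedded in a field\<close>

text \<open>Transport of structure: a record ring is replaced by its image in a field type, where
  the operations are those of the type classes and fractions are at hand.\<close>

locale embedded_cring = cring R for R (structure) +
 fixes j :: "'a => 'f::field" assumes j_inj: "inj_on j (carrier R)"
  and j_mult: "[|x : carrier R; y : carrier R|] ==> j (x \<otimes> y) = j x*j y"
  and j_add: "[|x : carrier R; y : carrier R|] ==> j (x \<oplus> y) = j x+j y"
  and j_one: "j \<one> = 1"
begin

lemma j_zero: "j \<zero> = 0"
proof -
 have "j \<zero> + j \<zero> = j \<zero> + 0"
  using j_add[OF zero_closed zero_closed] by (simp only: l_zero[OF zero_closed] add_0_right)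
 thus ?thesis by (rule add_left_imp_eq)
qed

lemma j_a_inv: "x : carrier R ==> j (\<ominus> x) = - j x"
 using j_add[of x "\<ominus> x"] by (simp add: r_neg j_zero eq_neg_iff_add_eq_0 add.commute)

lemma j_minus: "x : carrier R ==> y : carrier R ==> j (x \<ominus> y) = j x - j y"
 by (simp add: a_minus_def j_add j_a_inv)

lemma j_pow: "x : carrier R ==> j (x [^] (n::nat)) = j x^n" by (induction n) (auto simp: j_one j_mult mult.commute)

lemma j_finsum: assumes "finite I" "!!i. i : I ==> f i : carrier R"
 shows "j (\<Oplus>i\<in>I. f i) = (\<Sum>i\<in>I. j (f i))" using assms
proof (induction I rule: finite_induct)
 case empty
 thus ?case by (simp add: j_zero)
next
 case (insert i I)
 hence "f : I \<rightarrow> carrier R" "f i : carrier R" by auto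
 thus ?case using insert by (simp add: finsum_insert j_add finsum_closed)
qed

lemma j_eq_iff: "x : carrier R ==> y : carrier R ==> j x = j y \<longleftrightarrow> x = y"
 using j_inj by (auto simp: inj_on_def)

lemma j_image_iff: "I <= carrier R ==> x : carrier R ==> j x : j ` I \<longleftrightarrow> x : I"
 using j_inj by (auto simp: inj_on_def)

lemma is_subring_image: "is_subring (j ` carrier R)" unfolding is_subring_def
 by (auto simp: j_minus[symmetric] j_mult[symmetric] j_one[symmetric])

lemma is_ideal_image: assumes I: "I <= carrier R"
 shows "is_ideal (j ` carrier R) (j ` I) \<longleftrightarrow> ideal I R"
proof
 assume id: "ideal I R"
 interpret ideal I R by fact
 show "is_ideal (j ` carrier R) (j ` I)" unfolding is_ideal_def
 proof (intro conjI)
  show "0 : j ` I" using j_zero additive_subgroup.zero_closed[OF is_additive_subgroup] by force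
  show "j ` I <= j ` carrier R" using I by auto
  show "ALL x:j ` I. ALL y:j ` I. x+y : j ` I"
   using I by (auto simp: j_add[symmetric] subset_iff intro!: imageI a_closed)
  show "ALL a:j ` carrier R. ALL x:j ` I. a*x : j ` I"
   using I by (auto simp: j_mult[symmetric] subset_iff intro!: imageI I_l_closed)
 qed
next
 assume id: "is_ideal (j ` carrier R) (j ` I)"
 note sub = is_subring_image
 have mem: "x : I" if "x : carrier R" "j x : j ` I" for x using that j_image_iff[OF I] by auto
 have mult: "x \<otimes> a : I" if "a : I" "x : carrier R" for a x
  using that I is_idealD(4)[OF id, of "j x" "j a"] by (intro mem) (auto simp: j_mult subset_iff)
 show "ideal I R"
 proof (rule idealI)
  show "ring R" by (rule ring_axioms)
  show "subgroup I (add_monoid R)"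
  proof (rule add.subgroupI)
   show "I <= carrier R" by fact
   show "I ~= {}" using is_idealD(2)[OF id] by auto
   show "\<ominus> a : I" if "a : I" for a
    using that I is_ideal_uminus[OF sub id, of "j a"] by (intro mem) (auto simp: j_a_inv subset_iff)
   show "a \<oplus> b : I" if "a : I" "b : I" for a b
    using that I is_idealD(3)[OF id, of "j a" "j b"] by (intro mem) (auto simp: j_add subset_iff)
  qed
  show "x \<otimes> a : I" if "a : I" "x : carrier R" for a x by (rule mult[OF that])
  show "a \<otimes> x : I" if "a : I" "x : carrier R" for a x
   using mult[OF that] that I by (auto simp: m_comm subset_iff)
 qed
qed

lemma ideal_vimage: assumes "is_ideal (j ` carrier R) I"
 shows "ideal {x : carrier R. j x : I} R" "j ` {x : carrier R. j x : I} = I"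
proof -
 show *: "j ` {x : carrier R. j x : I} = I" using is_idealD(1)[OF assms] by auto
 show "ideal {x : carrier R. j x : I} R" using is_ideal_image[of "{x : carrier R. j x : I}"] assms*by auto
qed

lemma genideal_image: assumes F: "F <= carrier R" and I: "ideal I R" "F <= I"
  and least: "!!I'. is_ideal (j ` carrier R) I' ==> j ` F <= I' ==> j ` I <= I'" shows "I = genideal R F"
proof
 have IC: "I <= carrier R" using I(1) by (rule ideal.Icarr[THEN subsetI])
 show "genideal R F <= I" by (rule genideal_minimal[OF I])
 show "I <= genideal R F"
 proof
  fix x assume x: "x : I"
  have g: "ideal (genideal R F) R" by (rule genideal_ideal[OF F])
  hence gc: "genideal R F <= carrier R" by (rule ideal.Icarr[THEN subsetI])
  have "j ` I <= j ` genideal R F" using is_ideal_image[OF gc] g genideal_self[OF F] by (intro least) auto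
  thus "x : genideal R F" using x IC j_image_iff[OF gc, of x] by auto
 qed
qed

lemma noetherian_ring_image: assumes "noetherian (j ` carrier R)" shows "noetherian_ring R"
proof (unfold_locales, goal_cases)
 case (1 I)
 hence IC: "I <= carrier R" by (rule ideal.Icarr[THEN subsetI])
 then obtain F where F: "finite F" "F <= j ` I"
   "!!I'. is_ideal (j ` carrier R) I' ==> F <= I' ==> j ` I <= I'"
  using assms is_ideal_image[OF IC] 1 by (metis noetherianE)
 then obtain G where G: "finite G" "G <= I" "F = j ` G" by (metis finite_subset_image)
 hence "I = genideal R G" using 1 IC F by (intro genideal_image) auto
 thus ?case using G IC by (intro exI[of _ G]) auto
qed

lemma prime_ideal_image: assumes P: "primeideal P R" shows "is_prime_ideal (j ` carrier R) (j ` P)"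
proof -
 interpret primeideal P R by fact
 have PC: "P <= carrier R" by (rule subsetI) (rule Icarr)
 have "\<one> ~: P" using I_notcarr one_imp_carrier by auto
 hence "1 ~: j ` P" using j_image_iff[OF PC, of \<one>] j_one by simp
 moreover have "is_ideal (j ` carrier R) (j ` P)" using is_ideal_image[OF PC] is_ideal by simp
 moreover have "x : j ` P \<or> y : j ` P" if "x : j ` carrier R" "y : j ` carrier R" "x*y : j ` P" for x y
 proof -
  obtain a b where ab: "a : carrier R" "b : carrier R" "x = j a" "y = j b" using \<open>x : _\<close> \<open>y : _\<close> by auto
  hence "a \<otimes> b : P" using \<open>x*y : _\<close> j_image_iff[OF PC, of "a \<otimes> b"] by (simp add: j_mult)
  thus ?thesis using I_prime ab by auto
 qed
 ultimately show ?thesis unfolding is_prime_ideal_def by blast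
qed

lemma prime_ideal_vimage: assumes P: "is_prime_ideal (j ` carrier R) P" shows "primeideal {x : carrier R. j x : P} R"
proof (rule primeidealI)
 have id: "is_ideal (j ` carrier R) P" using P by (simp add: is_prime_ideal_def)
 show "ideal {x : carrier R. j x : P} R" by (rule ideal_vimage(1)[OF id])
 show "cring R" by (rule is_cring)
 have "\<one> ~: {x : carrier R. j x : P}" using P j_one by (auto simp: is_prime_ideal_def)
 thus "carrier R ~= {x : carrier R. j x : P}" using one_closed by blast
 show "a : {x : carrier R. j x : P} \<or> b : {x : carrier R. j x : P}"
  if "a : carrier R" "b : carrier R" "a \<otimes> b : {x : carrier R. j x : P}" for a b
  using that P by (auto simp: is_prime_ideal_def j_mult)
qed

lemma embedded_domain: "Ring.domain R"
proof (unfold_locales)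
 show "\<one> ~= \<zero>" using j_one j_zero by auto
 fix a b assume "a \<otimes> b = \<zero>" "a : carrier R" "b : carrier R"
 thus "a = \<zero> \<or> b = \<zero>" using j_mult[of a b] j_zero j_eq_iff[of _ \<zero>] by auto
qed

end

lemma embedded_cringI:
 fixes R (structure) and j :: "'a => 'f::field" assumes inj: "inj_on j (carrier R)"
  and m: "!!x y. [|x : carrier R; y : carrier R|] ==> x \<otimes> y : carrier R & j (x \<otimes> y) = j x*j y"
  and a: "!!x y. [|x : carrier R; y : carrier R|] ==> x \<oplus> y : carrier R & j (x \<oplus> y) = j x+j y"
  and o: "\<one> : carrier R" "j \<one> = 1" and z: "\<zero> : carrier R" "j \<zero> = 0"
  and n: "!!x. x : carrier R ==> EX y:carrier R. j y = - j x" shows "embedded_cring R j"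
proof -
 have eq: "x = y" if "j x = j y" "x : carrier R" "y : carrier R" for x y using inj that by (auto simp: inj_on_def)
 have "abelian_group R"
 proof (rule abelian_groupI)
  fix x assume x: "x : carrier R"
  then obtain y where "y : carrier R" "j y = - j x" using n by blast
  thus "EX y:carrier R. y \<oplus> x = \<zero>" using x a z by (intro bexI[of _ y] eq) auto
 qed (use a z in \<open>auto intro!: eq\<close>)
 moreover have "comm_monoid R" by (rule comm_monoidI) (use m o in \<open>auto intro!: eq\<close>)
 ultimately have "cring R" by (rule cringI) (use m a in \<open>auto intro!: eq simp: distrib_right\<close>)
 thus ?thesis unfolding embedded_cring_def embedded_cring_axioms_def using inj m a o by auto
qed

section \<open>Localizations of embedded rings\<close>

locale embedded_localization = embedded_cring R j for R (structure) and j :: "'a => 'f::field" +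
 fixes S :: "'a set" assumes S_sub: "S <= carrier R" and S_one: "\<one> : S" and S_zero: "\<zero> ~: S"
  and S_mult: "[|s : S; t : S|] ==> s \<otimes> t : S"
begin

definition loc_emb :: "('a \<times> 'a) set => 'f" where
 "loc_emb x = (let p = (SOME p. p : x) in j (fst p) / j (snd p))"

lemma S_carr: "s : S ==> s : carrier R" using S_sub by auto

lemma S_nz: "s : S ==> j s ~= 0" using j_eq_iff[of s \<zero>] S_sub S_zero by (auto simp: j_zero)

lemma loc_frac_eq: assumes "a : carrier R" "s : S"
 shows "loc_frac R S a s = {(b, t). b : carrier R & t : S & j b / j t = j a / j s}"
proof -
 have "(EX u:S. u \<otimes> (t \<otimes> a) = u \<otimes> (s \<otimes> b)) \<longleftrightarrow> j b / j t = j a / j s"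
  if b: "b : carrier R" "t : S" for b t
 proof -
  have "u \<otimes> (t \<otimes> a) = u \<otimes> (s \<otimes> b) \<longleftrightarrow> j b / j t = j a / j s" if "u : S" for u
  proof -
   have "u \<otimes> (t \<otimes> a) = u \<otimes> (s \<otimes> b) \<longleftrightarrow> j (u \<otimes> (t \<otimes> a)) = j (u \<otimes> (s \<otimes> b))"
    using that b assms S_sub by (subst j_eq_iff) auto
   also have "\<dots> \<longleftrightarrow> j u*(j t*j a) = j u*(j s*j b)"
    using that b assms S_sub by (simp add: j_mult subset_iff)
   also have "\<dots> \<longleftrightarrow> j b / j t = j a / j s"
    using S_nz[OF that] S_nz[OF assms(2)] S_nz[OF b(2)] by (auto simp: field_simps)
   finally show ?thesis .
  qed
  thus ?thesis using S_one by blast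
 qed
 thus ?thesis by (auto simp: loc_frac_def)
qed

lemma loc_frac_self: "a : carrier R ==> s : S ==> (a, s) : loc_frac R S a s" by (simp add: loc_frac_eq)

lemma loc_emb_frac: assumes "a : carrier R" "s : S" shows "loc_emb (loc_frac R S a s) = j a / j s"
proof -
 have "(SOME p. p : loc_frac R S a s) : loc_frac R S a s" using loc_frac_self[OF assms] by (rule someI)
 thus ?thesis using assms by (auto simp: loc_emb_def Let_def loc_frac_eq split: prod.splits)
qed

lemma loc_frac_cong: assumes "a : carrier R" "s : S" "b : carrier R" "t : S" "j a / j s = j b / j t"
 shows "loc_frac R S a s = loc_frac R S b t" using assms by (simp add: loc_frac_eq)

lemma loc_Union: assumes "a : carrier R" "s : S" "b : carrier R" "t : S"
  and "!!a' s' b' t'. [|a' : carrier R; s' : S; b' : carrier R; t' : S; j a' / j s' = j a / j s;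
    j b' / j t' = j b / j t|] ==> f a' s' b' t' = f a s b t"
 shows "(\<Union>(a, s)\<in>loc_frac R S a s. \<Union>(b, t)\<in>loc_frac R S b t. f a s b t) = f a s b t"
proof
 show "f a s b t <= (\<Union>(a, s)\<in>loc_frac R S a s. \<Union>(b, t)\<in>loc_frac R S b t. f a s b t)"
  by (rule subsetI, rule UN_I[of "(a, s)"], rule loc_frac_self[OF assms(1,2)], simp,
    rule bexI[of _ "(b, t)"]) (use loc_frac_self[OF assms(3,4)] in auto)
 show "(\<Union>(a, s)\<in>loc_frac R S a s. \<Union>(b, t)\<in>loc_frac R S b t. f a s b t) <= f a s b t"
 proof (clarify)
  fix x a' s' b' t'
  assume "x : f a' s' b' t'" "(a', s') : loc_frac R S a s" "(b', t') : loc_frac R S b t"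
  thus "x : f a s b t" using assms(5)[of a' s' b' t'] assms(1-4) by (auto simp: loc_frac_eq)
 qed
qed

lemma loc_mult: assumes "a : carrier R" "s : S" "b : carrier R" "t : S"
 shows "loc_frac R S a s \<otimes>\<^bsub>localization R S\<^esub> loc_frac R S b t = loc_frac R S (a \<otimes> b) (s \<otimes> t)"
proof -
 have "loc_frac R S (a' \<otimes> b') (s' \<otimes> t') = loc_frac R S (a \<otimes> b) (s \<otimes> t)"
  if h: "a' : carrier R" "s' : S" "b' : carrier R" "t' : S" "j a' / j s' = j a / j s" "j b' / j t' = j b / j t"
  for a' s' b' t'
 proof (rule loc_frac_cong)
  have "j a'*j b' / (j s'*j t') = (j a' / j s')*(j b' / j t')" by simp
  also have "\<dots> = j a*j b / (j s*j t)" unfolding h by simp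
  finally show "j (a' \<otimes> b') / j (s' \<otimes> t') = j (a \<otimes> b) / j (s \<otimes> t)"
   using h assms S_sub by (simp add: j_mult subset_iff)
 qed (use h assms S_mult in auto)
 thus ?thesis
  unfolding localization_def using loc_Union[OF assms, of "%a s b t. loc_frac R S (a \<otimes> b) (s \<otimes> t)"]
  by simp
qed

lemma loc_add: assumes "a : carrier R" "s : S" "b : carrier R" "t : S"
 shows "loc_frac R S a s \<oplus>\<^bsub>localization R S\<^esub> loc_frac R S b t
  = loc_frac R S ((t \<otimes> a) \<oplus> (s \<otimes> b)) (s \<otimes> t)"
proof -
 have "loc_frac R S ((t' \<otimes> a') \<oplus> (s' \<otimes> b')) (s' \<otimes> t') = loc_frac R S ((t \<otimes> a) \<oplus> (s \<otimes> b)) (s \<otimes> t)"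
  if h: "a' : carrier R" "s' : S" "b' : carrier R" "t' : S" "j a' / j s' = j a / j s" "j b' / j t' = j b / j t"
  for a' s' b' t'
 proof (rule loc_frac_cong)
  have *: "j (t \<otimes> a \<oplus> s \<otimes> b) / j (s \<otimes> t) = j a / j s+j b / j t"
   if "a : carrier R" "s : S" "b : carrier R" "t : S" for a s b t
   using that S_nz[of s] S_nz[of t] S_sub by (simp add: j_mult j_add subset_iff field_simps)
  show "j (t' \<otimes> a' \<oplus> s' \<otimes> b') / j (s' \<otimes> t') = j (t \<otimes> a \<oplus> s \<otimes> b) / j (s \<otimes> t)"
   using h assms by (simp add: *)
 qed (use h assms S_mult S_carr in auto)
 thus ?thesis unfolding localization_def
  using loc_Union[OF assms, of "%a s b t. loc_frac R S ((t \<otimes> a) \<oplus> (s \<otimes> b)) (s \<otimes> t)"]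
  by simp
qed

lemma loc_carrier: "carrier (localization R S) = {loc_frac R S a s | a s. a : carrier R & s : S}"
 and loc_one: "\<one>\<^bsub>localization R S\<^esub> = loc_frac R S \<one> \<one>"
 and loc_zero: "\<zero>\<^bsub>localization R S\<^esub> = loc_frac R S \<zero> \<one>"
 by (simp_all add: localization_def)

lemma loc_embedded: "embedded_cring (localization R S) loc_emb"
proof (rule embedded_cringI)
 show "inj_on loc_emb (carrier (localization R S))"
 proof (rule inj_onI)
  fix x y assume "x : carrier (localization R S)" "y : carrier (localization R S)"
   and eq: "loc_emb x = loc_emb y"
  then obtain a s b t where h: "a : carrier R" "s : S" "b : carrier R" "t : S"
    "x = loc_frac R S a s" "y = loc_frac R S b t" by (auto simp: loc_carrier)
  thus "x = y" using eq loc_frac_cong[OF h(1-4)] by (simp add: loc_emb_frac)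
 qed
 show "x \<otimes>\<^bsub>localization R S\<^esub> y : carrier (localization R S) &
   loc_emb (x \<otimes>\<^bsub>localization R S\<^esub> y) = loc_emb x*loc_emb y"
  if xy: "x : carrier (localization R S)" "y : carrier (localization R S)" for x y
 proof -
  obtain a s b t where h: "a : carrier R" "s : S" "b : carrier R" "t : S"
    "x = loc_frac R S a s" "y = loc_frac R S b t" using xy by (auto simp: loc_carrier)
  have st: "s \<otimes> t : S" "s : carrier R" "t : carrier R" using h S_mult S_sub by auto
  show ?thesis using h st by (auto simp: loc_mult loc_emb_frac j_mult loc_carrier)
 qed
 show "x \<oplus>\<^bsub>localization R S\<^esub> y : carrier (localization R S) &
   loc_emb (x \<oplus>\<^bsub>localization R S\<^esub> y) = loc_emb x+loc_emb y"
  if xy: "x : carrier (localization R S)" "y : carrier (localization R S)" for x y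
 proof -
  obtain a s b t where h: "a : carrier R" "s : S" "b : carrier R" "t : S"
    "x = loc_frac R S a s" "y = loc_frac R S b t" using xy by (auto simp: loc_carrier)
  have st: "s \<otimes> t : S" "s : carrier R" "t : carrier R" "t \<otimes> a \<oplus> s \<otimes> b : carrier R"
   using h S_mult S_carr by auto
  have "loc_emb (x \<oplus>\<^bsub>localization R S\<^esub> y) = loc_emb x+loc_emb y"
   using h st S_nz[of s] S_nz[of t] by (simp add: loc_add loc_emb_frac j_mult j_add field_simps)
  thus ?thesis using h st by (auto simp: loc_add loc_carrier)
 qed
 show "\<one>\<^bsub>localization R S\<^esub> : carrier (localization R S)" "\<zero>\<^bsub>localization R S\<^esub> : carrier (localization R S)"
  using S_one by (auto simp: loc_carrier loc_one loc_zero)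
 show "loc_emb \<one>\<^bsub>localization R S\<^esub> = 1" "loc_emb \<zero>\<^bsub>localization R S\<^esub> = 0"
  using S_one by (auto simp: loc_one loc_zero loc_emb_frac j_one j_zero)
 show "EX y:carrier (localization R S). loc_emb y = - loc_emb x" if x: "x : carrier (localization R S)" for x
 proof -
  obtain a s where h: "a : carrier R" "s : S" "x = loc_frac R S a s" using x by (auto simp: loc_carrier)
  thus ?thesis by (intro bexI[of _ "loc_frac R S (\<ominus> a) s"]) (auto simp: loc_emb_frac j_a_inv loc_carrier)
 qed
qed

lemma loc_image: "loc_emb ` carrier (localization R S) = {j a / j s | a s. a : carrier R & s : S}"
proof -
 have "loc_emb ` carrier (localization R S) = {loc_emb (loc_frac R S a s) | a s. a : carrier R & s : S}"
  by (auto simp: loc_carrier)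
 also have "\<dots> = {j a / j s | a s. a : carrier R & s : S}" using loc_emb_frac by (intro Collect_cong) metis
 finally show ?thesis .
qed

end

lemma (in embedded_cring) integrally_closed_image: assumes "normal_subring (j ` carrier R)"
 shows "integrally_closed_domain R"
proof -
 define S where "S = carrier R - {\<zero>}"
 interpret d: Ring.domain R by (rule embedded_domain)
 interpret L: embedded_localization R j S by unfold_locales (auto simp: S_def d.integral_iff)
 interpret K: embedded_cring "localization R S" L.loc_emb by (rule L.loc_embedded)
 define i where "i = (%r. loc_frac R S r \<one>)"
 have iK: "i r : carrier (localization R S)" "L.loc_emb (i r) = j r" if "r : carrier R" for r
  using that L.S_one by (auto simp: i_def L.loc_carrier L.loc_emb_frac j_one)
 have main: "x : i ` carrier R" if x: "x : carrier (localization R S)" and c: "!!k. k < n ==> c k : carrier R"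
   and eq: "(x [^]\<^bsub>localization R S\<^esub> n) \<oplus>\<^bsub>localization R S\<^esub>
    (\<Oplus>\<^bsub>localization R S\<^esub>k\<in>{..<n}. i (c k) \<otimes>\<^bsub>localization R S\<^esub> (x [^]\<^bsub>localization R S\<^esub> k))
    = \<zero>\<^bsub>localization R S\<^esub>" for x and n :: nat and c
 proof -
  let ?w = "L.loc_emb x"
  have *: "(%k. i (c k) \<otimes>\<^bsub>localization R S\<^esub> (x [^]\<^bsub>localization R S\<^esub> k)) : {..<n} \<rightarrow> carrier (localization R S)"
   using c x iK by auto
  have "0 = L.loc_emb (x [^]\<^bsub>localization R S\<^esub> n)+L.loc_emb
    (\<Oplus>\<^bsub>localization R S\<^esub>k\<in>{..<n}. i (c k) \<otimes>\<^bsub>localization R S\<^esub> (x [^]\<^bsub>localization R S\<^esub> k))"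
   using K.j_add[OF K.nat_pow_closed[OF x] K.finsum_closed[OF *], of n, unfolded eq K.j_zero] .
  also have "\<dots> = ?w^n+(\<Sum>k<n. L.loc_emb (i (c k) \<otimes>\<^bsub>localization R S\<^esub> (x [^]\<^bsub>localization R S\<^esub> k)))"
   using*by (subst K.j_finsum) (auto simp: K.j_pow[OF x])
  also have "(\<Sum>k<n. L.loc_emb (i (c k) \<otimes>\<^bsub>localization R S\<^esub> (x [^]\<^bsub>localization R S\<^esub> k)))
    = (\<Sum>k<n. j (c k) * ?w^k)" using x c iK by (intro sum.cong refl) (simp add: K.j_pow K.j_mult)
  finally have "integral_over (j ` carrier R) ?w"
   unfolding integral_over_def using c by (intro exI[of _ n] exI[of _ "%k. j (c k)"]) auto
  moreover have "?w : fracs (j ` carrier R)"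
   using imageI[OF x, of L.loc_emb] L.S_carr unfolding L.loc_image by (auto intro!: fracsI)
  ultimately have "?w : j ` carrier R" using assms by (auto simp: normal_subring_def)
  then obtain r where r: "r : carrier R" "?w = j r" by auto
  hence "x = i r" using K.j_eq_iff[OF x iK(1)] iK(2) by auto
  thus ?thesis using r by auto
 qed
 show ?thesis unfolding integrally_closed_domain_def Let_def S_def[symmetric]
  by (intro conjI ballI impI d.domain_axioms, elim exE conjE)
   (rule main[unfolded i_def], auto)
qed

section \<open>Localizations of subrings of a field at a prime\<close>

definition local_subring :: "'a::field set => 'a set => 'a set" where
 "local_subring A P = {a / s | a s. a : A & s : A & s ~: P}"

locale local_subring_at =
 fixes A P :: "'a::field set" assumes A: "is_subring A" and P: "is_prime_ideal A P"
begin

abbreviation "AP \<equiv> local_subring A P"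

lemma P_ideal: "is_ideal A P" and P_one: "1 ~: P" using P by (auto simp: is_prime_ideal_def)

lemma P_zero: "0 : P" by (rule is_idealD(2)[OF P_ideal])

lemma P_mult: "s : A ==> t : A ==> s ~: P ==> t ~: P ==> s*t ~: P" using P by (auto simp: is_prime_ideal_def)

lemma P_nz: "s ~: P ==> s ~= 0" using P_zero by auto

lemma local_subringE: assumes "x : AP"
 obtains a s where "a : A" "s : A" "s ~: P" "s ~= 0" "x = a / s" using assms P_nz by (auto simp: local_subring_def)

lemma local_subringI: "a : A ==> s : A ==> s ~: P ==> a / s : AP" by (auto simp: local_subring_def)

lemma local_subring_incl: "a : A ==> a : AP" using local_subringI[of a 1] is_subring_one[OF A] P_one by simp

lemma is_subring_local: "is_subring AP" unfolding is_subring_def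
proof (intro conjI ballI)
 show "1 : AP" by (intro local_subring_incl is_subring_one A)
 fix x y assume "x : AP" "y : AP"
 then obtain a s b t where h: "a : A" "s : A" "s ~: P" "s ~= 0" "x = a / s"
  "b : A" "t : A" "t ~: P" "t ~= 0" "y = b / t" by (metis local_subringE)
 have "x - y = (a*t - b*s) / (s*t)" using h by (simp add: field_simps)
 thus "x - y : AP" using h P_mult A by (auto intro!: local_subringI is_subring_diff is_subring_mult)
 have "x*y = (a*b) / (s*t)" using h by simp
 thus "x*y : AP" using h P_mult A by (auto intro!: local_subringI is_subring_mult)
qed

lemma fracs_local: "fracs AP = fracs A"
proof
 show "fracs A <= fracs AP" by (rule fracs_mono) (auto intro: local_subring_incl)
 have "AP <= fracs A" by (auto simp: local_subring_def intro: fracsI)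
 thus "fracs AP <= fracs A" by (intro fracs_least is_subring_local is_subring_fracs A fracs_inverse)
qed

lemma noetherian_local: assumes N: "noetherian A" shows "noetherian AP" unfolding noetherian_def
proof (intro allI impI)
 fix I assume I: "is_ideal AP I"
 have cont: "is_ideal A (J Int A)" if "is_ideal AP J" for J
  using is_idealD[OF that] is_subring_zero[OF A] is_subring_add[OF A] is_subring_mult[OF A] local_subring_incl
  by (auto simp: is_ideal_def)
 obtain F where F: "finite F" "F <= I Int A" "!!I'. is_ideal A I' ==> F <= I' ==> I Int A <= I'"
  using N cont[OF I] by (metis noetherianE)
 show "EX F. finite F & F <= I & (ALL I'. is_ideal AP I' & F <= I' --> I <= I')"
 proof (intro exI[of _ F] conjI allI impI)
  show "finite F" "F <= I" using F by auto
  fix I' assume "is_ideal AP I' & F <= I'"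
  hence I': "is_ideal AP I'" "F <= I' Int A" using F by auto
  have sub: "I Int A <= I' Int A" by (rule F(3)[OF cont[OF I'(1)] I'(2)])
  show "I <= I'"
  proof
   fix x assume x: "x : I"
   then obtain a s where h: "a : A" "s : A" "s ~: P" "s ~= 0" "x = a / s"
    using is_idealD(1)[OF I] by (metis local_subringE subsetD)
   have "s*x : I" using is_idealD(4)[OF I] h x local_subring_incl by blast
   hence "a : I Int A" using h by simp
   hence "a : I'" using sub by blast
   hence "(1 / s)*a : I'" using is_idealD(4)[OF I'(1)] local_subringI[OF is_subring_one[OF A] h(2,3)] by blast
   thus "x : I'" using h by simp
  qed
 qed
qed

lemma common_local_denominator: assumes "finite I" "!!i. i : I ==> f i : AP"
 shows "EX d:A. d ~: P & (ALL i:I. d*f i : A)" using assms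
proof (induction I rule: finite_induct)
 case empty
 thus ?case using is_subring_one[OF A] P_one by (intro bexI[of _ 1]) auto
next
 case (insert i I)
 then obtain d where d: "d : A" "d ~: P" "ALL i:I. d*f i : A" by auto
 obtain a b where ab: "a : A" "b : A" "b ~: P" "b ~= 0" "f i = a / b"
  using insert.prems[of i] by (metis insertI1 local_subringE)
 show ?case
 proof (intro bexI[of _ "b*d"] conjI ballI)
  fix k assume "k : insert i I"
  thus "b*d*f k : A"
  proof
   assume "k = i"
   hence eq: "b*d*f k = a*d" using ab by simp
   show ?thesis unfolding eq by (rule is_subring_mult[OF A ab(1) d(1)])
  next
   assume "k : I"
   thus ?thesis using d ab is_subring_mult[OF A, of b "d*f k"] by (simp add: mult.assoc)
  qed
 qed (use ab d P_mult in \<open>auto intro: is_subring_mult[OF A]\<close>)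
qed

text \<open>The coefficients of an integral equation have a common denominator outside
  \<open>P\<close>; multiplied by it, \<open>w\<close> becomes integral over
  \<open>A\<close>.\<close>

lemma normal_local: assumes N: "normal_subring A" shows "normal_subring AP" unfolding normal_subring_def
proof (intro ballI impI)
 fix w assume w: "w : fracs AP" "integral_over AP w"
 then obtain n c where c: "!!i. i < n ==> c i : AP" "w^n+(\<Sum>i<n. c i*w^i) = 0" by (auto simp: integral_over_def)
 obtain d where d: "d : A" "d ~: P" "ALL i:{..<n}. d * c i : A"
  using common_local_denominator[of "{..<n}" c] c(1) by auto
 have "(d*w)^n+(\<Sum>i<n. d^(n - i - 1)*(d * c i)*(d*w)^i) = d^n*(w^n+(\<Sum>i<n. c i*w^i))"
  unfolding distrib_left sum_distrib_left
 proof (intro arg_cong2[of _ _ _ _ "(+)"] sum.cong refl)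
  fix i assume "i : {..<n}"
  hence "Suc (n - i - 1+i) = n" by auto
  hence "d^n = d^(n - i - 1)*d*d^i" by (metis power_add power_Suc mult.assoc mult.commute)
  thus "d^(n - i - 1)*(d * c i)*(d*w)^i = d^n*(c i*w^i)" by (simp add: power_mult_distrib)
 qed (simp add: power_mult_distrib)
 hence "(d*w)^n+(\<Sum>i<n. d^(n - i - 1)*(d * c i)*(d*w)^i) = 0" using c by simp
 hence "integral_over A (d*w)" unfolding integral_over_def using d
  by (intro exI[of _ n] exI[of _ "%i. d^(n - i - 1)*(d * c i)"])
   (auto intro: is_subring_mult[OF A] is_subring_power[OF A])
 moreover have "d*w : fracs A"
  using w(1) is_subring_mult[OF is_subring_fracs[OF A] fracs_incl[OF A d(1)]] unfolding fracs_local by blast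
 ultimately have "d*w : A" using N by (auto simp: normal_subring_def)
 hence "(d*w) / d : AP" using d by (intro local_subringI)
 thus "w : AP" using P_nz[OF d(2)] by simp
qed

definition "MP = {a / s | a s. a : P & s : A & s ~: P}"

lemma MP_nonunits: "MP = {x : AP. x = 0 \<or> inverse x ~: AP}"
proof (intro equalityI subsetI)
 fix x assume "x : MP"
 then obtain a s where h: "a : P" "s : A" "s ~: P" "x = a / s" by (auto simp: MP_def)
 have aA: "a : A" using h is_idealD(1)[OF P_ideal] by auto
 have "inverse x ~: AP" if "x ~= 0"
 proof
  assume "inverse x : AP"
  then obtain b t where t: "b : A" "t : A" "t ~: P" "t ~= 0" "inverse x = b / t" by (metis local_subringE)
  have "s / a = b / t" using t(5) h(4) by simp
  hence "s*t = b*a" using that h t P_nz by (auto simp: frac_eq_eq)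
  hence "s*t : P" using is_idealD(4)[OF P_ideal t(1) h(1)] by simp
  thus False using P_mult h t by blast
 qed
 thus "x : {x : AP. x = 0 \<or> inverse x ~: AP}" using h aA local_subringI by auto
next
 fix x assume x: "x : {x : AP. x = 0 \<or> inverse x ~: AP}"
 hence xA: "x : AP" by simp
 obtain a s where h: "a : A" "s : A" "s ~: P" "s ~= 0" "x = a / s" by (rule local_subringE[OF xA])
 have "a : P"
 proof (rule ccontr)
  assume "a ~: P"
  hence "s / a : AP" using h by (intro local_subringI)
  thus False using x h P_nz[OF \<open>a ~: P\<close>] by simp
 qed
 thus "x : MP" using h by (auto simp: MP_def)
qed

lemma MP_ideal: "is_ideal AP MP" unfolding is_ideal_def
proof (intro conjI ballI)
 show "MP <= AP" using is_idealD(1)[OF P_ideal] by (auto simp: MP_def local_subring_def)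
 show "0 : MP" using P_zero is_subring_one[OF A] P_one unfolding MP_def by (intro CollectI exI[of _ 0] exI[of _ 1]) auto
 fix x y assume "x : MP" "y : MP"
 then obtain a s b t where h: "a : P" "s : A" "s ~: P" "x = a / s" "b : P" "t : A" "t ~: P" "y = b / t"
  by (auto simp: MP_def)
 have "x+y = (t*a+s*b) / (s*t)" using h P_nz by (auto simp: field_simps)
 moreover have "t*a+s*b : P" using h is_idealD(3,4)[OF P_ideal] by blast
 ultimately show "x+y : MP" using h P_mult is_subring_mult[OF A] unfolding MP_def by blast
next
 fix x y assume "x : AP" "y : MP"
 then obtain a s b t where h: "a : A" "s : A" "s ~: P" "x = a / s" "b : P" "t : A" "t ~: P" "y = b / t"
  by (auto simp: MP_def local_subring_def)
 have "x*y = (a*b) / (s*t)" using h by simp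
 moreover have "a*b : P" using h is_idealD(4)[OF P_ideal] by blast
 ultimately show "x*y : MP" using h P_mult is_subring_mult[OF A] unfolding MP_def by blast
qed

end

section \<open>Local rings of dimension at most one\<close>

text \<open>Since \<open>inverse 0 = 0\<close> lies in \<open>A\<close>, zero has to be listed
  separately.\<close>

definition nonunits :: "'a::field set => 'a set" where
 "nonunits A = {x : A. x = 0 \<or> inverse x ~: A}"

lemma proper_ideal_nonunits: assumes A: "is_subring A" and I: "is_ideal A I" "1 ~: I" shows "I <= nonunits A"
proof
 fix x assume x: "x : I"
 have "inverse x ~: A" if "x ~= 0"
 proof
  assume "inverse x : A"
  hence "inverse x*x : I" using x is_idealD(4)[OF I(1)] by blast
  thus False using that I(2) by simp
 qed
 thus "x : nonunits A" using x is_idealD(1)[OF I(1)] by (auto simp: nonunits_def)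
qed

lemma nonunits_prime: assumes A: "is_subring A" and M: "is_ideal A (nonunits A)" shows "is_prime_ideal A (nonunits A)"
 unfolding is_prime_ideal_def
proof (intro conjI ballI impI)
 show "is_ideal A (nonunits A)" "1 ~: nonunits A" using M is_subring_one[OF A] by (auto simp: nonunits_def)
 fix x y assume xy: "x : A" "y : A" "x*y : nonunits A"
 show "x : nonunits A \<or> y : nonunits A"
 proof (rule ccontr)
  assume "~ (x : nonunits A \<or> y : nonunits A)"
  hence "x ~= 0" "y ~= 0" "inverse x : A" "inverse y : A" using xy by (auto simp: nonunits_def)
  hence "x*y ~= 0" "inverse (x*y) : A" using is_subring_mult[OF A, of "inverse x" "inverse y"] by auto
  thus False using xy by (auto simp: nonunits_def)
 qed
qed

lemma zero_prime: "is_subring (A::'a::field set) ==> is_prime_ideal A {0}"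
 by (auto simp: is_prime_ideal_def is_ideal_def intro: is_subring_zero)

text \<open>A maximal proper colon ideal \<open>(s : b)\<close> is prime, hence equal to the maximal
  ideal by the hypothesis on primes. Then \<open>normal_colon_ideal\<close> gives
  \<open>pp * b = s * v\<close> with \<open>v\<close> a unit, so \<open>pp\<close> is
  \<open>s / b\<close> up to a unit, and every element of \<open>(s : b)\<close> is a multiple of
  it.\<close>

lemma nonunits_principal:
 fixes A :: "'a::field set" assumes A: "is_subring A" "noetherian A" "normal_subring A" and M: "is_ideal A (nonunits A)"
  and nz: "nonunits A ~= {0}"
  and dim: "!!Q. is_prime_ideal A Q ==> Q ~= {0} ==> Q = nonunits A"
 shows "EX pp:nonunits A. ALL a:nonunits A. EX y:A. a = y*pp"
proof -
 obtain s where s: "s : nonunits A" "s ~= 0" using nz is_idealD(2)[OF M] by blast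
 have sA: "s : A" using s by (simp add: nonunits_def)
 define C where "C b = {a:A. EX y:A. a*b = s*y}" for b
 have Ceq: "C b = {a:A. a*b / s : A}" for b using s(2) by (force simp: C_def field_simps)
 define FF where "FF = C ` {b:A. 1 ~: C b}"
 have Cid: "is_ideal A (C b)" for b unfolding Ceq is_ideal_def
  using A(1) by (auto simp: is_subring_zero distrib_right add_divide_distrib mult.assoc
    intro!: is_subring_add is_subring_mult simp flip: times_divide_eq_right)
 have "1 ~: C 1" using s by (auto simp: Ceq nonunits_def divide_inverse)
 hence "FF ~= {}" using is_subring_one[OF A(1)] by (auto simp: FF_def)
 hence "EX Q:FF. ALL Y:FF. Q <= Y --> Y = Q"
  by (rule noetherian_maximal[OF A(2)]) (use Cid in \<open>auto simp: FF_def\<close>)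
 then obtain Q where Q: "Q : FF" "!!Y. Y : FF ==> Q <= Y ==> Y = Q" by blast
 then obtain b where b: "b : A" "1 ~: C b" "Q = C b" by (auto simp: FF_def)
 have "is_prime_ideal A Q" unfolding is_prime_ideal_def
 proof (intro conjI ballI impI)
  show "is_ideal A Q" "1 ~: Q" using Cid b by auto
  fix x y assume xy: "x : A" "y : A" "x*y : Q"
  show "x : Q \<or> y : Q"
  proof (rule ccontr)
   assume c: "~ (x : Q \<or> y : Q)"
   hence "1 ~: C (y*b)" using xy b by (auto simp: Ceq)
   hence "C (y*b) : FF" using xy b A(1) by (auto simp: FF_def intro: is_subring_mult)
   moreover have "Q <= C (y*b)"
   proof
    fix a assume "a : Q"
    hence "a : A" "a*b / s : A" using b by (auto simp: Ceq)
    hence "y*(a*b / s) : A" using is_subring_mult[OF A(1) xy(2)] by blast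
    thus "a : C (y*b)" using \<open>a : A\<close> by (simp add: Ceq mult_ac)
   qed
   ultimately have "C (y*b) = Q" using Q(2) by blast
   moreover have "x : C (y*b)" using xy b by (auto simp: Ceq mult_ac)
   ultimately show False using c by simp
  qed
 qed
 moreover have "s : Q" using sA s(2) b by (simp add: Ceq)
 ultimately have QM: "Q = nonunits A" using dim s by blast
 have "b ~= s*y" if "y : A" for y using b that is_subring_one[OF A(1)] by (auto simp: C_def)
 then obtain pp v where pp: "pp : Q" "v : A" "v ~: Q" "pp*b = s*v"
  using normal_colon_ideal[OF A sA s(2) b(1), of Q] b(3) by (auto simp: C_def)
 have v: "v ~= 0" "inverse v : A" using pp(2,3) QM by (auto simp: nonunits_def)
 have "EX y:A. a = y*pp" if a: "a : nonunits A" for a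
 proof -
  obtain y where y: "y : A" "a*b = s*y" using a QM b by (auto simp: C_def)
  have "b ~= 0" using b(2) is_subring_one[OF A(1)] is_subring_zero[OF A(1)] by (auto simp: Ceq)
  have "a*(s*v) = pp*(s*y)" using y(2) pp(4) by (metis mult.left_commute)
  hence "a = (inverse v*y)*pp" using v s(2) by (simp add: field_simps)
  thus ?thesis using v(2) y(1) is_subring_mult[OF A(1)] by blast
 qed
 thus ?thesis using pp(1) QM by blast
qed

lemma singleton_psubsetI: "z : N ==> r : N ==> r ~= z ==> {z} \<subset> N" by auto

lemma regular_local_ringI:
 "noetherian_local_ring R ==> maximalideal M R ==> A <= carrier R ==> finite A ==>
  enat (card A) = krull_dim R ==> M = genideal R A ==> regular_local_ring R" unfolding regular_local_ring_def by blast

context embedded_cring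
begin

lemma vimage_image: "N <= j ` carrier R ==> j ` {x : carrier R. j x : N} = N" by auto

lemma noetherian_local_ring_image:
 assumes N: "noetherian (j ` carrier R)" and M: "is_ideal (j ` carrier R) (nonunits (j ` carrier R))"
 shows "noetherian_local_ring R" "maximalideal {x : carrier R. j x : nonunits (j ` carrier R)} R"
proof -
 let ?M = "{x : carrier R. j x : nonunits (j ` carrier R)}"
 have sub: "I <= ?M" if "ideal I R" "\<one> ~: I" for I
 proof -
  have IC: "I <= carrier R" using that(1) by (rule ideal.Icarr[THEN subsetI])
  have "1 ~: j ` I" using that(2) j_image_iff[OF IC, of \<one>] j_one by auto
  hence "j ` I <= nonunits (j ` carrier R)"
   using is_ideal_image[OF IC] that(1) by (intro proper_ideal_nonunits is_subring_image) auto
  thus ?thesis using IC by auto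
 qed
 have one: "\<one> ~: ?M" using is_subring_one[OF is_subring_image] by (auto simp: nonunits_def j_one)
 show max: "maximalideal ?M R"
 proof (rule maximalidealI)
  show "ideal ?M R" by (rule ideal_vimage(1)[OF M])
  show "carrier R ~= ?M" using one one_closed by blast
  fix J assume J: "ideal J R" "?M <= J" "J <= carrier R"
  show "J = ?M \<or> J = carrier R"
  proof (cases "\<one> : J")
   case True
   thus ?thesis using ideal.one_imp_carrier[OF J(1)] by simp
  next
   case False
   thus ?thesis using sub[OF J(1)] J(2) by blast
  qed
 qed
 have "M' = ?M" if M': "maximalideal M' R" for M'
 proof -
  interpret M': maximalideal M' R by fact
  have "\<one> ~: M'" using M'.I_notcarr M'.one_imp_carrier by auto
  hence "M' <= ?M" using sub[OF M'.is_ideal] by simp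
  hence "?M = M' \<or> ?M = carrier R" using M'.I_maximal[OF ideal_vimage(1)[OF M]] by blast
  thus ?thesis using one one_closed by blast
 qed
 hence "EX! M. maximalideal M R" using max by blast
 thus "noetherian_local_ring R" unfolding noetherian_local_ring_def using is_cring noetherian_ring_image[OF N] by blast
qed

text \<open>If the maximal ideal vanishes, the dimension is \<open>0\<close> and the empty set
  generates it. Otherwise another nonzero prime would give a chain of length 2; so
  \<open>nonunits_principal\<close> applies, and its single generator matches the dimension
  1.\<close>

lemma regular_dim_le_one: assumes N: "noetherian (j ` carrier R)" "normal_subring (j ` carrier R)"
  and M: "is_ideal (j ` carrier R) (nonunits (j ` carrier R))" and dim: "krull_dim R <= 1" shows "regular_local_ring R"
proof -
 let ?A = "j ` carrier R"
 let ?M = "{x : carrier R. j x : nonunits ?A}"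
 note A = is_subring_image
 note loc = noetherian_local_ring_image[OF N(1) M]
 have MP: "is_prime_ideal ?A (nonunits ?A)" by (rule nonunits_prime[OF A M])
 have Mprime: "primeideal ?M R" by (rule prime_ideal_vimage[OF MP])
 have "{x : carrier R. j x : {0}} = {\<zero>}" using j_zero j_eq_iff[of _ \<zero>] by auto
 hence zprime: "primeideal {\<zero>} R" using prime_ideal_vimage[OF zero_prime[OF A]] by simp
 have Mid: "ideal ?M R" by (rule ideal_vimage(1)[OF M])
 have zM: "\<zero> : ?M" using is_idealD(2)[OF M] by (simp add: j_zero)
 have chain: "enat n <= krull_dim R" if "ALL i<=n. primeideal (p i) R" "ALL i<n. p i \<subset> p (Suc i)" for n and p
  unfolding krull_dim_def using that by (intro SUP_upper) auto
 show ?thesis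
 proof (cases "nonunits ?A = {0}")
  case True
  hence M0: "?M = {\<zero>}" using j_zero j_eq_iff[of _ \<zero>] by auto
  have "krull_dim R = 0"
  proof -
   have "n = 0" if p: "ALL i<=n. primeideal (p i) R" "ALL i<n. p i \<subset> p (Suc i)" for n :: nat and p
   proof (rule ccontr)
    assume "n ~= 0"
    hence pr: "primeideal (p 1) R" "p 0 \<subset> p 1" "primeideal (p 0) R" using p by auto
    have id: "ideal (p 1) R" "p 1 ~= carrier R" "\<zero> : p 0" "p 0 \<subset> p 1"
     using pr(2) primeideal.I_notcarr[OF pr(1)] primeideal.axioms(1)[OF pr(1)]
      additive_subgroup.zero_closed[OF ideal.axioms(1)[OF primeideal.axioms(1)[OF pr(3)]]] by auto
    have pC: "p 1 <= carrier R" using id(1) by (rule ideal.Icarr[THEN subsetI])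
    have "\<one> ~: p 1" using id ideal.one_imp_carrier by blast
    hence "1 ~: j ` p 1" using j_image_iff[OF pC, of \<one>] j_one by auto
    hence "j ` p 1 <= nonunits ?A" using is_ideal_image[OF pC] id(1) by (intro proper_ideal_nonunits A) auto
    hence "p 1 <= ?M" using pC by auto
    thus False using M0 id by auto
   qed
   hence "krull_dim R <= 0" unfolding krull_dim_def by (intro SUP_least) (auto simp: zero_enat_def)
   thus ?thesis by simp
  qed
  moreover have "?M = genideal R {}"
  proof -
   have "\<zero> : genideal R {}" by (rule additive_subgroup.zero_closed[OF ideal.axioms(1)[OF genideal_ideal]]) simp
   thus ?thesis using M0 genideal_minimal[OF zeroideal, of "{}"] by auto
  qed
  ultimately show ?thesis by (intro regular_local_ringI[OF loc, of "{}"]) (simp_all add: zero_enat_def)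
 next
  case False
  obtain m where m: "m : nonunits ?A" "m ~= 0" using False is_idealD(2)[OF M] by blast
  then obtain r where "r : ?M" "j r ~= 0" using is_idealD(1)[OF M] by auto
  hence M0: "{\<zero>} \<subset> ?M" using zM j_zero by (intro singleton_psubsetI[of _ _ r]) auto
  have "Q = nonunits ?A" if Q: "is_prime_ideal ?A Q" "Q ~= {0}" for Q
  proof (rule ccontr)
   assume ne: "Q ~= nonunits ?A"
   have Qid: "is_ideal ?A Q" "1 ~: Q" using Q by (auto simp: is_prime_ideal_def)
   let ?Q = "{x : carrier R. j x : Q}"
   have "Q <= nonunits ?A" by (rule proper_ideal_nonunits[OF A Qid])
   hence "?Q <= ?M" by auto
   moreover have "?Q ~= ?M"
    using ne vimage_image[OF is_idealD(1)[OF Qid(1)]] vimage_image[OF is_idealD(1)[OF M]] by metis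
   ultimately have QM: "?Q \<subset> ?M" by (rule psubsetI)
   obtain m where m: "m : Q" "m ~= 0" using Q(2) is_idealD(2)[OF Qid(1)] by blast
   then obtain r where "r : ?Q" "j r ~= 0" using is_idealD(1)[OF Qid(1)] by auto
   moreover have "\<zero> : ?Q" using is_idealD(2)[OF Qid(1)] j_zero by simp
   ultimately have "{\<zero>} \<subset> ?Q" using j_zero by (intro singleton_psubsetI[of _ _ r]) auto
   hence "enat 2 <= krull_dim R" using QM zprime Mprime prime_ideal_vimage[OF Q(1)]
    by (intro chain[of 2 "%i. if i = 0 then {\<zero>} else if i = 1 then ?Q else ?M"])
     (simp_all add: less_2_cases_iff)
   hence "enat 2 <= 1" using dim by (rule order.trans)
   thus False by (simp add: one_enat_def)
  qed
  then obtain pp where pp: "pp : nonunits ?A" "!!a. a : nonunits ?A ==> EX y:?A. a = y*pp"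
   using nonunits_principal[OF A N M False] by blast
  then obtain p where p: "p : ?M" "j p = pp" using is_idealD(1)[OF M] by auto
  have pC: "p : carrier R" using p by simp
  have "?M = genideal R {p}"
  proof (rule genideal_image)
   show "{p} <= carrier R" "{p} <= ?M" using p by auto
   show "ideal ?M R" by (rule Mid)
   fix I' assume I': "is_ideal ?A I'" "j ` {p} <= I'"
   show "j ` ?M <= I'" using pp(2) is_idealD(4)[OF I'(1)] I'(2) p by fastforce
  qed
  moreover have "enat 1 <= krull_dim R" using zprime Mprime M0
   by (intro chain[of 1 "%i. if i = 0 then {\<zero>} else ?M"]) simp_all
  hence "krull_dim R = 1" using dim by (simp add: one_enat_def)
  ultimately show ?thesis using pC by (intro regular_local_ringI[OF loc, of "{p}"]) (simp_all add: one_enat_def)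
 qed
qed

lemma prime_localization: assumes P: "primeideal P R" shows "embedded_localization R j (carrier R - P)"
proof -
 interpret primeideal P R by fact
 show ?thesis
 proof unfold_locales
  show "\<one> : carrier R - P" using I_notcarr one_imp_carrier by auto
  show "\<zero> ~: carrier R - P" using additive_subgroup.zero_closed[OF is_additive_subgroup] by simp
  show "s \<otimes> t : carrier R - P" if "s : carrier R - P" "t : carrier R - P" for s t using that I_prime by auto
 qed auto
qed

lemma local_at_image: assumes P: "primeideal P R"
 shows "embedded_localization.loc_emb j ` carrier (local_at R P) = local_subring (j ` carrier R) (j ` P)"
proof -
 have PC: "P <= carrier R" using P by (auto simp: primeideal_def intro: ideal.Icarr)
 interpret L: embedded_localization R j "carrier R - P" by (rule prime_localization[OF P])
 show ?thesis unfolding local_at_def L.loc_image local_subring_def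
  using j_image_iff[OF PC] by (intro Collect_cong) blast
qed

theorem normal_spec: assumes N: "noetherian (j ` carrier R)" "normal_subring (j ` carrier R)"
 shows "Spec_normal R" "Spec_regular_in_codim_1 R"
proof -
 have *: "integrally_closed_domain (local_at R P) &
   (krull_dim (local_at R P) <= 1 --> regular_local_ring (local_at R P))" if P: "primeideal P R" for P
 proof -
  interpret L: embedded_localization R j "carrier R - P" by (rule prime_localization[OF P])
  interpret E: embedded_cring "local_at R P" L.loc_emb unfolding local_at_def by (rule L.loc_embedded)
  interpret F: local_subring_at "j ` carrier R" "j ` P"
   by unfold_locales (auto intro: is_subring_image prime_ideal_image P)
  have M: "is_ideal F.AP (nonunits F.AP)" using F.MP_ideal unfolding F.MP_nonunits nonunits_def .
  have I: "L.loc_emb ` carrier (local_at R P) = F.AP" by (rule local_at_image[OF P])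
  show ?thesis using E.integrally_closed_image[unfolded I, OF F.normal_local[OF N(2)]]
    E.regular_dim_le_one[unfolded I, OF F.noetherian_local[OF N(1)] F.normal_local[OF N(2)] M] by simp
 qed
 thus "Spec_normal R" "Spec_regular_in_codim_1 R"
  unfolding Spec_normal_def Spec_regular_in_codim_1_def using is_cring noetherian_ring_image[OF N(1)] by blast+
qed

end

section \<open>Baer's criterion\<close>

definition baer_module :: "('a, 'b) ring_scheme => ('a, 'm) module => bool" where
 "baer_module R I \<longleftrightarrow> module R I &
  (ALL J f. ideal J R & (ALL x:J. f x : carrier I) &
    (ALL x:J. ALL y:J. f (x \<oplus>\<^bsub>R\<^esub> y) = f x \<oplus>\<^bsub>I\<^esub> f y) &
    (ALL r:carrier R. ALL x:J. f (r \<otimes>\<^bsub>R\<^esub> x) = r \<odot>\<^bsub>I\<^esub> f x) -->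
    (EX m:carrier I. ALL x:J. f x = x \<odot>\<^bsub>I\<^esub> m))"

lemma module_homD: assumes "f : module_hom R M N" shows "x : carrier M ==> f x : carrier N"
  and "x : carrier M ==> y : carrier M ==> f (x \<oplus>\<^bsub>M\<^esub> y) = f x \<oplus>\<^bsub>N\<^esub> f y"
  and "r : carrier R ==> x : carrier M ==> f (r \<odot>\<^bsub>M\<^esub> x) = r \<odot>\<^bsub>N\<^esub> f x"
 using assms by (auto simp: module_hom_def hom_def)

lemma module_homI: assumes "!!x. x : carrier M ==> f x : carrier N"
  and "!!x y. x : carrier M ==> y : carrier M ==> f (x \<oplus>\<^bsub>M\<^esub> y) = f x \<oplus>\<^bsub>N\<^esub> f y"
  and "!!r x. r : carrier R ==> x : carrier M ==> f (r \<odot>\<^bsub>M\<^esub> x) = r \<odot>\<^bsub>N\<^esub> f x"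
 shows "f : module_hom R M N" using assms by (auto simp: module_hom_def hom_def)

text \<open>Partial extensions of a homomorphism are represented by their graphs.\<close>

locale baer_extension =
 fixes R :: "('a, 'r) ring_scheme" (structure) and A B :: "('a, 'm) module" and I :: "('a, 'n) module"
  and f :: "'m => 'm" and g :: "'m => 'n" assumes baer: "baer_module R I" and modA: "module R A" and modB: "module R B"
  and f: "f : module_hom R A B" "inj_on f (carrier A)" and g: "g : module_hom R A I"
begin

sublocale A: module R A by (rule modA)
sublocale B: module R B by (rule modB)
sublocale I: module R I using baer by (simp add: baer_module_def)

definition graph :: "('m \<times> 'n) set => bool" where
 "graph G \<longleftrightarrow> G <= carrier B \<times> carrier I & (ALL a:carrier A. (f a, g a) : G) &
  (ALL y z y' z'. (y, z) : G --> (y', z') : G --> (y \<oplus>\<^bsub>B\<^esub> y', z \<oplus>\<^bsub>I\<^esub> z') : G) &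
  (ALL r:carrier R. ALL y z. (y, z) : G --> (r \<odot>\<^bsub>B\<^esub> y, r \<odot>\<^bsub>I\<^esub> z) : G) &
  (ALL y z z'. (y, z) : G --> (y, z') : G --> z = z')"

lemma graphD: assumes "graph G" shows "(y, z) : G ==> y : carrier B" "(y, z) : G ==> z : carrier I"
  "a : carrier A ==> (f a, g a) : G"
  "(y, z) : G ==> (y', z') : G ==> (y \<oplus>\<^bsub>B\<^esub> y', z \<oplus>\<^bsub>I\<^esub> z') : G"
  "r : carrier R ==> (y, z) : G ==> (r \<odot>\<^bsub>B\<^esub> y, r \<odot>\<^bsub>I\<^esub> z) : G"
  "(y, z) : G ==> (y, z') : G ==> z = z'" using assms unfolding graph_def by blast+

lemma graph_minimal: "graph ((%a. (f a, g a)) ` carrier A)" unfolding graph_def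
proof (intro conjI allI impI ballI)
 show "(%a. (f a, g a)) ` carrier A <= carrier B \<times> carrier I"
  using module_homD(1)[OF f(1)] module_homD(1)[OF g] by auto
 show "(f a, g a) : (%a. (f a, g a)) ` carrier A" if "a : carrier A" for a using that by auto
 show "(y \<oplus>\<^bsub>B\<^esub> y', z \<oplus>\<^bsub>I\<^esub> z') : (%a. (f a, g a)) ` carrier A"
  if h: "(y, z) : (%a. (f a, g a)) ` carrier A" "(y', z') : (%a. (f a, g a)) ` carrier A" for y z y' z'
 proof -
  obtain a a' where "a : carrier A" "a' : carrier A" "y = f a" "z = g a" "y' = f a'" "z' = g a'" using h by auto
  thus ?thesis using module_homD(2)[OF f(1)] module_homD(2)[OF g]
   by (intro image_eqI[of _ _ "a \<oplus>\<^bsub>A\<^esub> a'"]) auto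
 qed
 show "(r \<odot>\<^bsub>B\<^esub> y, r \<odot>\<^bsub>I\<^esub> z) : (%a. (f a, g a)) ` carrier A"
  if h: "r : carrier R" "(y, z) : (%a. (f a, g a)) ` carrier A" for r y z
 proof -
  obtain a where "a : carrier A" "y = f a" "z = g a" using h by auto
  thus ?thesis using module_homD(3)[OF f(1)] module_homD(3)[OF g] h
   by (intro image_eqI[of _ _ "r \<odot>\<^bsub>A\<^esub> a"]) auto
 qed
 show "z = z'" if "(y, z) : (%a. (f a, g a)) ` carrier A" "(y, z') : (%a. (f a, g a)) ` carrier A" for y z z'
  using that f(2) by (auto simp: inj_on_def)
qed

lemma graph_Union: assumes "C ~= {}" "subset.chain (Collect graph) C" shows "graph (\<Union>C)"
proof -
 have gr: "graph c" if "c : C" for c using assms that by (auto simp: subset_chain_def)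
 have two: "EX c:C. p : c & q : c" if "p : \<Union>C" "q : \<Union>C" for p q
  using finite_subset_Union_chain[of "{p, q}" C] that assms by auto
 show ?thesis unfolding graph_def
 proof (intro conjI allI impI ballI)
  show "\<Union>C <= carrier B \<times> carrier I" by (rule Union_least) (use gr in \<open>simp add: graph_def\<close>)
  show "(f a, g a) : \<Union>C" if "a : carrier A" for a using that gr assms(1) graphD(3) by blast
  show "(y \<oplus>\<^bsub>B\<^esub> y', z \<oplus>\<^bsub>I\<^esub> z') : \<Union>C" if "(y, z) : \<Union>C" "(y', z') : \<Union>C" for y z y' z'
   using two[OF that] gr graphD(4) by blast
  show "(r \<odot>\<^bsub>B\<^esub> y, r \<odot>\<^bsub>I\<^esub> z) : \<Union>C" if "r : carrier R" "(y, z) : \<Union>C" for r y z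
   using that gr graphD(5) by blast
  show "z = z'" if "(y, z) : \<Union>C" "(y, z') : \<Union>C" for y z z' using two[OF that] gr graphD(6) by blast
 qed
qed

lemma minus_one_smult:
 "y : carrier B ==> (\<ominus> \<one>) \<odot>\<^bsub>B\<^esub> y = \<ominus>\<^bsub>B\<^esub> y" "z : carrier I ==> (\<ominus> \<one>) \<odot>\<^bsub>I\<^esub> z = \<ominus>\<^bsub>I\<^esub> z"
 by (simp_all add: B.smult_l_minus I.smult_l_minus)

lemma graph_minus: assumes "graph G" "(y, z) : G" "(y', z') : G"
 shows "(y \<ominus>\<^bsub>B\<^esub> y', z \<ominus>\<^bsub>I\<^esub> z') : G"
proof -
 have "((\<ominus> \<one>) \<odot>\<^bsub>B\<^esub> y', (\<ominus> \<one>) \<odot>\<^bsub>I\<^esub> z') : G" using graphD(5)[OF assms(1) _ assms(3)] by simp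
 hence "(\<ominus>\<^bsub>B\<^esub> y', \<ominus>\<^bsub>I\<^esub> z') : G" using graphD(1,2)[OF assms(1,3)] by (simp add: minus_one_smult)
 thus ?thesis using graphD(4)[OF assms(1,2)] by (simp add: a_minus_def)
qed

lemma graph_zero: assumes "graph G" shows "(\<zero>\<^bsub>B\<^esub>, \<zero>\<^bsub>I\<^esub>) : G"
proof -
 have "(f \<zero>\<^bsub>A\<^esub>, g \<zero>\<^bsub>A\<^esub>) : G" by (rule graphD(3)[OF assms]) simp
 from graphD(5)[OF assms _ this, of \<zero>] graphD(1,2)[OF assms this] show ?thesis by simp
qed

lemma graph_extend: assumes G: "graph G" and b: "b : carrier B" shows "EX G'. graph G' & G <= G' & (EX m. (b, m) : G')"
proof -
 \<comment> \<open>\<open>G\<close> determines a homomorphism from the ideal \<open>J\<close> to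
   \<open>I\<close>; Baer's condition for it provides a possible value \<open>m\<close> at
   \<open>b\<close>.\<close>
 define J where "J = {r : carrier R. EX z. (r \<odot>\<^bsub>B\<^esub> b, z) : G}"
 define h where "h r = (SOME z. (r \<odot>\<^bsub>B\<^esub> b, z) : G)" for r
 have h: "(r \<odot>\<^bsub>B\<^esub> b, h r) : G" if "r : J" for r
  using that someI_ex[of "%z. (r \<odot>\<^bsub>B\<^esub> b, z) : G"] by (auto simp: J_def h_def)
 have hI: "r : J & h r = z" if "r : carrier R" "(r \<odot>\<^bsub>B\<^esub> b, z) : G" for r z
 proof -
  have "r : J" using that by (auto simp: J_def)
  thus ?thesis using h that graphD(6)[OF G] by blast
 qed
 have Jadd: "r \<oplus> s : J & h (r \<oplus> s) = h r \<oplus>\<^bsub>I\<^esub> h s" if "r : J" "s : J" for r s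
  using that graphD(4)[OF G h[OF that(1)] h[OF that(2)]] b by (intro hI) (auto simp: J_def B.smult_l_distr)
 have Jmult: "r \<otimes> s : J & h (r \<otimes> s) = r \<odot>\<^bsub>I\<^esub> h s" if "r : carrier R" "s : J" for r s
  using that graphD(5)[OF G that(1) h[OF that(2)]] b by (intro hI) (auto simp: J_def B.smult_assoc1)
 have Jid: "ideal J R"
 proof (rule idealI)
  show "ring R" by (rule A.R.ring_axioms)
  show "subgroup J (add_monoid R)"
  proof (rule A.R.add.subgroupI)
   show "J <= carrier R" by (auto simp: J_def)
   have "(\<zero> \<odot>\<^bsub>B\<^esub> b, \<zero>\<^bsub>I\<^esub>) : G" using graph_zero[OF G] b by simp
   hence "\<zero> : J" by (auto simp: J_def)
   thus "J ~= {}" by auto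
   show "\<ominus> r : J" if "r : J" for r using Jmult[of "\<ominus> \<one>" r] that by (simp add: A.R.l_minus J_def)
   show "r \<oplus> s : J" if "r : J" "s : J" for r s using Jadd that by blast
  qed
  show "s \<otimes> r : J" if "r : J" "s : carrier R" for r s using Jmult that by blast
  thus "r \<otimes> s : J" if "r : J" "s : carrier R" for r s using that by (simp add: A.R.m_comm J_def)
 qed
 have "EX m:carrier I. ALL x:J. h x = x \<odot>\<^bsub>I\<^esub> m"
  using baer Jid Jadd Jmult h graphD(2)[OF G] unfolding baer_module_def by blast
 then obtain m where m: "m : carrier I" "!!x. x : J ==> h x = x \<odot>\<^bsub>I\<^esub> m" by blast
 define G' where "G' = {(y \<oplus>\<^bsub>B\<^esub> r \<odot>\<^bsub>B\<^esub> b, z \<oplus>\<^bsub>I\<^esub> r \<odot>\<^bsub>I\<^esub> m) | y z r. (y, z) : G & r : carrier R}"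
 have G'I: "(y \<oplus>\<^bsub>B\<^esub> r \<odot>\<^bsub>B\<^esub> b, z \<oplus>\<^bsub>I\<^esub> r \<odot>\<^bsub>I\<^esub> m) : G'" if "(y, z) : G" "r : carrier R" for y z r
  using that by (auto simp: G'_def)
 have sub: "G <= G'"
 proof (rule subrelI)
  fix y z assume yz: "(y, z) : G"
  hence "y : carrier B" "z : carrier I" using graphD[OF G] by auto
  thus "(y, z) : G'" using G'I[OF yz A.R.zero_closed] b m by simp
 qed
 have "graph G'" unfolding graph_def
 proof (intro conjI allI impI ballI)
  show "G' <= carrier B \<times> carrier I" using graphD(1,2)[OF G] b m by (auto simp: G'_def)
  show "(f a, g a) : G'" if "a : carrier A" for a using that graphD(3)[OF G] sub by blast
 next
  fix y z y' z' assume "(y, z) : G'" "(y', z') : G'"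
  then obtain v w r v' w' r' where
   1: "(v, w) : G" "r : carrier R" "y = v \<oplus>\<^bsub>B\<^esub> r \<odot>\<^bsub>B\<^esub> b" "z = w \<oplus>\<^bsub>I\<^esub> r \<odot>\<^bsub>I\<^esub> m" and
   2: "(v', w') : G" "r' : carrier R" "y' = v' \<oplus>\<^bsub>B\<^esub> r' \<odot>\<^bsub>B\<^esub> b" "z' = w' \<oplus>\<^bsub>I\<^esub> r' \<odot>\<^bsub>I\<^esub> m"
   by (auto simp: G'_def)
  note c = graphD(1,2)[OF G 1(1)] graphD(1,2)[OF G 2(1)] 1(2) 2(2) b m(1)
  have "y \<oplus>\<^bsub>B\<^esub> y' = (v \<oplus>\<^bsub>B\<^esub> v') \<oplus>\<^bsub>B\<^esub> (r \<oplus> r') \<odot>\<^bsub>B\<^esub> b"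
   using c by (simp add: 1 2 B.smult_l_distr B.a_ac)
  moreover have "z \<oplus>\<^bsub>I\<^esub> z' = (w \<oplus>\<^bsub>I\<^esub> w') \<oplus>\<^bsub>I\<^esub> (r \<oplus> r') \<odot>\<^bsub>I\<^esub> m"
   using c by (simp add: 1 2 I.smult_l_distr I.a_ac)
  ultimately show "(y \<oplus>\<^bsub>B\<^esub> y', z \<oplus>\<^bsub>I\<^esub> z') : G'" using G'I[OF graphD(4)[OF G 1(1) 2(1)], of "r \<oplus> r'"] c by simp
 next
  fix s y z assume s: "s : carrier R" and "(y, z) : G'"
  then obtain v w r where 1: "(v, w) : G" "r : carrier R" "y = v \<oplus>\<^bsub>B\<^esub> r \<odot>\<^bsub>B\<^esub> b" "z = w \<oplus>\<^bsub>I\<^esub> r \<odot>\<^bsub>I\<^esub> m"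
   by (auto simp: G'_def)
  note c = graphD(1,2)[OF G 1(1)] 1(2) b m(1) s
  have "s \<odot>\<^bsub>B\<^esub> y = s \<odot>\<^bsub>B\<^esub> v \<oplus>\<^bsub>B\<^esub> (s \<otimes> r) \<odot>\<^bsub>B\<^esub> b" using c by (simp add: 1 B.smult_r_distr B.smult_assoc1)
  moreover have "s \<odot>\<^bsub>I\<^esub> z = s \<odot>\<^bsub>I\<^esub> w \<oplus>\<^bsub>I\<^esub> (s \<otimes> r) \<odot>\<^bsub>I\<^esub> m" using c by (simp add: 1 I.smult_r_distr I.smult_assoc1)
  ultimately show "(s \<odot>\<^bsub>B\<^esub> y, s \<odot>\<^bsub>I\<^esub> z) : G'" using G'I[OF graphD(5)[OF G s 1(1)], of "s \<otimes> r"] c by simp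
 next
  \<comment> \<open>Equal first components put \<open>r - r'\<close> into \<open>J\<close>, where
    \<open>h\<close> is multiplication by \<open>m\<close>; this forces the second components to
    agree.\<close>
  fix y z z' assume "(y, z) : G'" "(y, z') : G'"
  then obtain v w r v' w' r' where
   1: "(v, w) : G" "r : carrier R" "y = v \<oplus>\<^bsub>B\<^esub> r \<odot>\<^bsub>B\<^esub> b" "z = w \<oplus>\<^bsub>I\<^esub> r \<odot>\<^bsub>I\<^esub> m" and
   2: "(v', w') : G" "r' : carrier R" "y = v' \<oplus>\<^bsub>B\<^esub> r' \<odot>\<^bsub>B\<^esub> b" "z' = w' \<oplus>\<^bsub>I\<^esub> r' \<odot>\<^bsub>I\<^esub> m"
   by (auto simp: G'_def)
  note c = graphD(1,2)[OF G 1(1)] graphD(1,2)[OF G 2(1)] 1(2) 2(2) b m(1)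
  have "(r \<ominus> r') \<odot>\<^bsub>B\<^esub> b = v' \<ominus>\<^bsub>B\<^esub> v"
  proof -
   have "v \<oplus>\<^bsub>B\<^esub> r \<odot>\<^bsub>B\<^esub> b = v' \<oplus>\<^bsub>B\<^esub> r' \<odot>\<^bsub>B\<^esub> b" using 1 2 by simp
   hence "(\<ominus>\<^bsub>B\<^esub> v \<oplus>\<^bsub>B\<^esub> (v \<oplus>\<^bsub>B\<^esub> r \<odot>\<^bsub>B\<^esub> b)) \<oplus>\<^bsub>B\<^esub> \<ominus>\<^bsub>B\<^esub> (r' \<odot>\<^bsub>B\<^esub> b)
     = (\<ominus>\<^bsub>B\<^esub> v \<oplus>\<^bsub>B\<^esub> (v' \<oplus>\<^bsub>B\<^esub> r' \<odot>\<^bsub>B\<^esub> b)) \<oplus>\<^bsub>B\<^esub> \<ominus>\<^bsub>B\<^esub> (r' \<odot>\<^bsub>B\<^esub> b)" by simp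
   moreover have "(\<ominus>\<^bsub>B\<^esub> v \<oplus>\<^bsub>B\<^esub> (v \<oplus>\<^bsub>B\<^esub> r \<odot>\<^bsub>B\<^esub> b)) \<oplus>\<^bsub>B\<^esub> \<ominus>\<^bsub>B\<^esub> (r' \<odot>\<^bsub>B\<^esub> b) = (r \<ominus> r') \<odot>\<^bsub>B\<^esub> b"
    using c by (simp add: a_minus_def B.smult_l_distr B.smult_l_minus B.M.r_neg1)
   moreover have "(\<ominus>\<^bsub>B\<^esub> v \<oplus>\<^bsub>B\<^esub> (v' \<oplus>\<^bsub>B\<^esub> r' \<odot>\<^bsub>B\<^esub> b)) \<oplus>\<^bsub>B\<^esub> \<ominus>\<^bsub>B\<^esub> (r' \<odot>\<^bsub>B\<^esub> b) = v' \<ominus>\<^bsub>B\<^esub> v"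
    using c B.M.a_comm[of "\<ominus>\<^bsub>B\<^esub> v" v'] by (simp add: a_minus_def B.a_assoc B.M.r_neg)
   ultimately show ?thesis by simp
  qed
  hence "((r \<ominus> r') \<odot>\<^bsub>B\<^esub> b, w' \<ominus>\<^bsub>I\<^esub> w) : G" using graph_minus[OF G 2(1) 1(1)] by simp
  hence "w' \<ominus>\<^bsub>I\<^esub> w = (r \<ominus> r') \<odot>\<^bsub>I\<^esub> m" using hI[of "r \<ominus> r'" "w' \<ominus>\<^bsub>I\<^esub> w"] m(2)[of "r \<ominus> r'"] c by simp
  hence "w \<oplus>\<^bsub>I\<^esub> ((r \<ominus> r') \<odot>\<^bsub>I\<^esub> m \<oplus>\<^bsub>I\<^esub> r' \<odot>\<^bsub>I\<^esub> m) = w \<oplus>\<^bsub>I\<^esub> ((w' \<ominus>\<^bsub>I\<^esub> w) \<oplus>\<^bsub>I\<^esub> r' \<odot>\<^bsub>I\<^esub> m)" by simp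
  moreover have "w \<oplus>\<^bsub>I\<^esub> ((r \<ominus> r') \<odot>\<^bsub>I\<^esub> m \<oplus>\<^bsub>I\<^esub> r' \<odot>\<^bsub>I\<^esub> m) = z"
  proof -
   have "(r \<ominus> r') \<oplus> r' = r" using c by (simp add: a_minus_def A.R.a_assoc A.R.l_neg)
   thus ?thesis using c by (simp add: 1 flip: I.smult_l_distr)
  qed
  moreover have "w \<oplus>\<^bsub>I\<^esub> ((w' \<ominus>\<^bsub>I\<^esub> w) \<oplus>\<^bsub>I\<^esub> r' \<odot>\<^bsub>I\<^esub> m) = z'"
  proof -
   have "w \<oplus>\<^bsub>I\<^esub> (w' \<ominus>\<^bsub>I\<^esub> w) = w'" using c
    by (simp add: a_minus_def I.M.a_lcomm[of w w'] I.M.r_neg)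
   thus ?thesis using c by (simp add: 2 flip: I.a_assoc)
  qed
  ultimately show "z = z'" by simp
 qed
 moreover have "(b, m) : G'" using G'I[OF graph_zero[OF G] A.R.one_closed] b m by simp
 ultimately show ?thesis using sub by blast
qed

lemma extension: "EX h:module_hom R B I. ALL x:carrier A. h (f x) = g x"
proof -
 have "EX G:Collect graph. ALL Y:Collect graph. G <= Y --> Y = G"
  by (rule subset_Zorn_nonempty) (use graph_minimal graph_Union in auto)
 then obtain G where G: "graph G" and max: "!!G'. graph G' ==> G <= G' ==> G' = G" by auto
 have "ALL b:carrier B. EX m. (b, m) : G" using graph_extend[OF G] max by blast
 then obtain h where h: "!!b. b : carrier B ==> (b, h b) : G" by metis
 have u: "h b = m" if "(b, m) : G" for b m using h graphD(6)[OF G] graphD(1)[OF G] that by blast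
 have "h : module_hom R B I"
 proof (rule module_homI)
  show "h x : carrier I" if "x : carrier B" for x using h graphD(2)[OF G] that by blast
  show "h (x \<oplus>\<^bsub>B\<^esub> y) = h x \<oplus>\<^bsub>I\<^esub> h y" if "x : carrier B" "y : carrier B" for x y
   using u graphD(4)[OF G h[OF that(1)] h[OF that(2)]] by simp
  show "h (r \<odot>\<^bsub>B\<^esub> x) = r \<odot>\<^bsub>I\<^esub> h x" if "r : carrier R" "x : carrier B" for r x
   using u graphD(5)[OF G that(1) h[OF that(2)]] by simp
 qed
 thus ?thesis using u graphD(3)[OF G] by blast
qed

end

theorem baer_injective:
 fixes I :: "('a, 'm) module" assumes "baer_module R I" shows "injective_module R I" unfolding injective_module_def
proof (intro conjI allI impI)
 show "module R I" using assms by (simp add: baer_module_def)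
 fix A B :: "('a, 'm) module" and f g
 assume "module R A & module R B & f : module_hom R A B & inj_on f (carrier A) & g : module_hom R A I"
 then interpret baer_extension R A B I f g using assms by (intro baer_extension.intro) auto
 show "EX h:module_hom R B I. ALL x:carrier A. h (f x) = g x" by (rule extension)
qed

section \<open>Modules over subrings of a field, and their localizations\<close>

definition is_module :: "'f::field set => ('f => 'n::ab_group_add => 'n) => 'n set => bool" where
 "is_module A act M \<longleftrightarrow> 0 : M & (ALL u:M. ALL v:M. u - v : M) & (ALL a:A. ALL u:M. act a u : M) &
  (ALL a:A. ALL u:M. ALL v:M. act a (u+v) = act a u+act a v) &
  (ALL a:A. ALL b:A. ALL u:M. act (a+b) u = act a u+act b u & act (a*b) u = act a (act b u)) &
  (ALL u:M. act 1 u = u)"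

definition is_linear_on :: "'f::field set => ('f => 'm::ab_group_add => 'm) => ('f => 'n::ab_group_add => 'n)
  => 'm set => ('m => 'n) => bool" where
 "is_linear_on A act act' M f \<longleftrightarrow> (ALL x:M. ALL y:M. f (x+y) = f x+f y) &
  (ALL a:A. ALL x:M. f (act a x) = act' a (f x))"

definition is_baer :: "'f::field set => ('f => 'n::ab_group_add => 'n) => 'n set => bool" where
 "is_baer A act M \<longleftrightarrow> (ALL J f. is_ideal A J & f ` J <= M & is_linear_on A (*) act J f -->
  (EX m:M. ALL x:J. f x = act x m))"

lemma is_moduleD: assumes "is_module A act M"
 shows "0 : M" "u : M ==> v : M ==> u - v : M" "a : A ==> u : M ==> act a u : M"
  "a : A ==> u : M ==> v : M ==> act a (u+v) = act a u+act a v"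
  "a : A ==> b : A ==> u : M ==> act (a+b) u = act a u+act b u"
  "a : A ==> b : A ==> u : M ==> act (a*b) u = act a (act b u)"
  "u : M ==> act 1 u = u" using assms unfolding is_module_def by blast+

lemma is_module_uminus: "is_module A act M ==> u : M ==> - u : M"
 using is_moduleD(1)[of A act M] is_moduleD(2)[of A act M 0 u] by simp

lemma is_module_add: "is_module A act M ==> u : M ==> v : M ==> u+v : M"
 using is_moduleD(2)[of A act M u "- v"] is_module_uminus[of A act M v] by simp

lemma is_module_act_zero: "is_module A act M ==> a : A ==> act a 0 = 0"
 using is_moduleD(1)[of A act M] is_moduleD(4)[of A act M a 0 0] by simp

lemma is_module_act_uminus: "is_module A act M ==> a : A ==> u : M ==> act a (- u) = - act a u"
 using is_moduleD(4)[of A act M a u "- u"] is_module_uminus[of A act M u] is_module_act_zero[of A act M a]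
 by (simp add: eq_neg_iff_add_eq_0 add.commute)

lemma is_module_zero_act: assumes "is_module A act M" "is_subring A" "u : M" shows "act 0 u = 0"
 using is_moduleD(5)[OF assms(1) is_subring_zero[OF assms(2)] is_subring_zero[OF assms(2)] assms(3)] by simp

text \<open>The fractions \<open>fr m s\<close> are kept abstract: only their equality is
  prescribed. Their type stays open because the injective modules must be carried by the type fixed
  in \<open>finite_injective_dimension\<close>. All terms of a resolution lie in the one ambient
  module \<open>N\<close>, so a single \<open>fr\<close> serves for all of them.\<close>

locale module_localization = embedded_cring R j for R (structure) and j :: "'a => 'f::field" +
 fixes P and A S :: "'f set" and act :: "'f => 'n::ab_group_add => 'n" and N :: "'n set"
  and fr :: "'n => 'f => 't" assumes P: "primeideal P R"
  and A_eq: "A = j ` carrier R" and S_eq: "S = A - j ` P"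
  and modN: "is_module A act N"
  and fr_eq: "[|m : N; n : N; s : S; t : S|] ==>
   fr m s = fr n t \<longleftrightarrow> (EX u:S. act (u*t) m = act (u*s) n)"
begin

sublocale L: embedded_localization R j "carrier R - P" by (rule prime_localization[OF P])

abbreviation "RP \<equiv> local_at R P"
abbreviation "J \<equiv> L.loc_emb"

sublocale E: embedded_cring RP J unfolding local_at_def by (rule L.loc_embedded)
sublocale F: local_subring_at A "j ` P"
 unfolding A_eq by unfold_locales (auto intro: is_subring_image prime_ideal_image P)

lemma J_image: "J ` carrier RP = {a / s | a s. a : A & s : S}"
 unfolding S_eq A_eq local_at_image[OF P] local_subring_def by auto

lemma S_A: "s : S ==> s : A" by (simp add: S_eq)
lemma S_mult: "s : S ==> t : S ==> s*t : S" using F.P_mult is_subring_mult[OF F.A] unfolding S_eq by blast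
lemma S_one: "1 : S" using F.P_one is_subring_one[OF F.A] unfolding S_eq by blast
lemma S_nz: "s : S ==> s ~= 0" using F.P_nz unfolding S_eq by blast

lemmas A_closed = is_subring_mult[OF F.A] is_subring_add[OF F.A] S_A
lemmas N_closed = is_module_add[OF modN] is_moduleD(1,3)[OF modN] is_module_uminus[OF modN]

lemma act_add: "a : A ==> m : N ==> n : N ==> act a (m+n) = act a m+act a n" by (rule is_moduleD(4)[OF modN])
lemma act_act: "a : A ==> b : A ==> m : N ==> act a (act b m) = act (a*b) m" using is_moduleD(6)[OF modN] by simp
lemma add_act: "a : A ==> b : A ==> m : N ==> act (a+b) m = act a m+act b m" by (rule is_moduleD(5)[OF modN])

lemma frE: assumes "fr m s = fr n t" "m : N" "n : N" "s : S" "t : S"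
 obtains u where "u : S" "act (u*t) m = act (u*s) n" using fr_eq assms by blast

lemma frI: assumes "u : S" "act (u*t) m = act (u*s) n" "m : N" "n : N" "s : S" "t : S" shows "fr m s = fr n t"
 using fr_eq assms by blast

lemma fr_same: "m : N ==> s : S ==> t : S ==> fr (act t m) (t*s) = fr m s"
 by (rule frI[OF S_one]) (auto simp: act_act A_closed mult.commute intro: N_closed S_mult)

lemma fr_zero_iff: assumes "m : N" "s : S" shows "fr m s = fr 0 1 \<longleftrightarrow> (EX u:S. act u m = 0)"
proof -
 have "act (u*s) 0 = 0" if "u : S" for u
  using is_module_act_zero[OF modN, of "u*s"] that assms(2) by (auto intro: A_closed)
 thus ?thesis using fr_eq[OF assms(1) N_closed(2) assms(2) S_one] by auto
qed

lemma fr_zero: "s : S ==> fr 0 s = fr 0 1"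
 using fr_zero_iff[OF N_closed(2)] is_moduleD(7)[OF modN N_closed(2)] S_one by blast

definition rep :: "'t => 'n \<times> 'f" where
 "rep x = (SOME p. fst p : N & snd p : S & x = fr (fst p) (snd p))"

lemma rep_fr: assumes "m : N" "s : S"
 shows "fst (rep (fr m s)) : N" "snd (rep (fr m s)) : S" "fr (fst (rep (fr m s))) (snd (rep (fr m s))) = fr m s"
proof -
 have "fst (rep (fr m s)) : N & snd (rep (fr m s)) : S & fr m s = fr (fst (rep (fr m s))) (snd (rep (fr m s)))"
  unfolding rep_def by (rule someI[of _ "(m, s)"]) (use assms in auto)
 thus "fst (rep (fr m s)) : N" "snd (rep (fr m s)) : S" "fr (fst (rep (fr m s))) (snd (rep (fr m s))) = fr m s" by auto
qed

definition rrep :: "('a \<times> 'a) set => 'f \<times> 'f" where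
 "rrep l = (SOME p. fst p : A & snd p : S & J l = fst p / snd p)"

lemma rrep: assumes "l : carrier RP" shows "fst (rrep l) : A" "snd (rrep l) : S" "J l = fst (rrep l) / snd (rrep l)"
proof -
 have "J l : J ` carrier RP" using assms by (rule imageI)
 then obtain a s where as: "a : A" "s : S" "J l = a / s" unfolding J_image by blast
 have "fst (rrep l) : A & snd (rrep l) : S & J l = fst (rrep l) / snd (rrep l)"
  unfolding rrep_def by (rule someI[of _ "(a, s)"]) (use as in auto)
 thus "fst (rrep l) : A" "snd (rrep l) : S" "J l = fst (rrep l) / snd (rrep l)" by auto
qed

definition fadd :: "'t => 't => 't" where
 "fadd x y = fr (act (snd (rep y)) (fst (rep x))+act (snd (rep x)) (fst (rep y))) (snd (rep x)*snd (rep y))"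

definition fsmult :: "('a \<times> 'a) set => 't => 't" where
 "fsmult l x = fr (act (fst (rrep l)) (fst (rep x))) (snd (rrep l)*snd (rep x))"

lemma fadd_fr: assumes "m : N" "n : N" "s : S" "t : S" shows "fadd (fr m s) (fr n t) = fr (act t m+act s n) (s*t)"
proof -
 obtain m' s' where p: "m' = fst (rep (fr m s))" "s' = snd (rep (fr m s))" by simp
 obtain n' t' where q: "n' = fst (rep (fr n t))" "t' = snd (rep (fr n t))" by simp
 have h: "m' : N" "s' : S" "fr m' s' = fr m s" "n' : N" "t' : S" "fr n' t' = fr n t"
  using rep_fr assms by (auto simp: p q)
 obtain u where u: "u : S" "act (u*s) m' = act (u*s') m" using frE[OF h(3)] h assms by blast
 obtain v where v: "v : S" "act (v*t) n' = act (v*t') n" using frE[OF h(6)] h assms by blast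
 have "fr (act t' m'+act s' n') (s'*t') = fr (act t m+act s n) (s*t)"
 proof (rule frI[of "u*v"])
  note mem = h(1,2,4,5) u(1) v(1) assms
  have "act (u*v*(s*t)*t') m' = act (v*t*t') (act (u*s) m')" using mem by (simp add: act_act A_closed mult_ac)
  also have "\<dots> = act (v*t*t') (act (u*s') m)" by (simp only: u)
  finally have e1: "act (u*v*(s*t)*t') m' = act (v*t*t'*(u*s')) m" using mem by (simp add: act_act A_closed)
  have "act (u*v*(s*t)*s') n' = act (u*s*s') (act (v*t) n')" using mem by (simp add: act_act A_closed mult_ac)
  also have "\<dots> = act (u*s*s') (act (v*t') n)" by (simp only: v)
  finally have e2: "act (u*v*(s*t)*s') n' = act (u*s*s'*(v*t')) n" using mem by (simp add: act_act A_closed)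
  have "act (u*v*(s*t)) (act t' m'+act s' n') = act (u*v*(s*t)*t') m'+act (u*v*(s*t)*s') n'"
   using mem by (simp add: act_add act_act A_closed N_closed)
  also have "\<dots> = act (v*t*t'*(u*s')) m+act (u*s*s'*(v*t')) n" by (simp only: e1 e2)
  also have "\<dots> = act (u*v*(s'*t')) (act t m+act s n)"
   using mem by (simp add: act_add act_act A_closed N_closed mult_ac)
  finally show "act (u*v*(s*t)) (act t' m'+act s' n') = act (u*v*(s'*t')) (act t m+act s n)" .
 qed (use h u v assms in \<open>auto intro!: S_mult N_closed intro: S_A\<close>)
 thus ?thesis by (simp add: fadd_def p q)
qed

lemma fsmult_fr: assumes l: "l : carrier RP" "J l = a / b" "a : A" "b : S" and m: "m : N" "s : S"
 shows "fsmult l (fr m s) = fr (act a m) (b*s)"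
proof -
 obtain m' s' where p: "m' = fst (rep (fr m s))" "s' = snd (rep (fr m s))" by simp
 obtain a' b' where q: "a' = fst (rrep l)" "b' = snd (rrep l)" by simp
 have h: "m' : N" "s' : S" "fr m' s' = fr m s" "a' : A" "b' : S" "J l = a' / b'"
  using rep_fr rrep assms by (auto simp: p q)
 have ab: "a'*b = a*b'" using h(5,6) l(2,4) S_nz by (metis frac_eq_eq)
 obtain u where u: "u : S" "act (u*s) m' = act (u*s') m" using frE[OF h(3)] h assms by blast
 have "fr (act a' m') (b'*s') = fr (act a m) (b*s)"
 proof (rule frI[of u])
  note mem = h(1,2,4,5) u(1) l(3,4) m
  have "act (u*(b*s)) (act a' m') = act (a'*b) (act (u*s) m')" using mem by (simp add: act_act A_closed mult_ac)
  also have "\<dots> = act (a*b') (act (u*s') m)" by (simp only: ab u)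
  also have "\<dots> = act (u*(b'*s')) (act a m)" using mem by (simp add: act_act A_closed mult_ac)
  finally show "act (u*(b*s)) (act a' m') = act (u*(b'*s')) (act a m)" .
 qed (use h u assms in \<open>auto intro!: S_mult N_closed intro: S_A\<close>)
 thus ?thesis by (simp add: fsmult_def p q)
qed

definition lmod :: "'n set => (('a \<times> 'a) set, 't) module" where
 "lmod M = \<lparr>carrier = {fr m s | m s. m : M & s : S}, monoid.mult = (%x y. x), one = fr 0 1,
  ring.zero = fr 0 1, add = fadd, module.smult = fsmult\<rparr>"

lemma lmod_simps: "carrier (lmod M) = {fr m s | m s. m : M & s : S}" "\<zero>\<^bsub>lmod M\<^esub> = fr 0 1"
 "add (lmod M) = fadd" "module.smult (lmod M) = fsmult" by (simp_all add: lmod_def)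

lemma lmod_module: assumes M: "is_module A act M" "M <= N" shows "module RP (lmod M)"
proof (rule moduleI)
 show "cring RP" by (rule E.is_cring)
 have sub: "m : M ==> m : N" for m using M(2) by auto
 note MC = is_module_add[OF M(1)] is_moduleD(1,3)[OF M(1)] is_module_uminus[OF M(1)]
 show "abelian_group (lmod M)"
 proof (rule abelian_groupI)
  fix x y assume "x : carrier (lmod M)" "y : carrier (lmod M)"
  then obtain m s n t where h: "m : M" "s : S" "x = fr m s" "n : M" "t : S" "y = fr n t" unfolding lmod_simps by blast
  have "act t m+act s n : M" using h S_A by (intro MC) auto
  thus "x \<oplus>\<^bsub>lmod M\<^esub> y : carrier (lmod M)"
   using h S_mult[of s t] unfolding lmod_simps by (simp add: fadd_fr sub) blast
  show "x \<oplus>\<^bsub>lmod M\<^esub> y = y \<oplus>\<^bsub>lmod M\<^esub> x"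
   using h by (simp add: lmod_simps fadd_fr sub add.commute mult.commute)
  fix z assume "z : carrier (lmod M)"
  then obtain p v where h': "p : M" "v : S" "z = fr p v" unfolding lmod_simps by blast
  have N: "act t m+act s n : N" "act v n+act t p : N" "s*t : S" "t*v : S"
   using h h' sub by (auto intro!: N_closed S_mult intro: S_A)
  show "(x \<oplus>\<^bsub>lmod M\<^esub> y) \<oplus>\<^bsub>lmod M\<^esub> z = x \<oplus>\<^bsub>lmod M\<^esub> (y \<oplus>\<^bsub>lmod M\<^esub> z)"
   using h h' N by (simp add: lmod_simps fadd_fr sub act_add act_act A_closed N_closed ac_simps)
 next
  show "\<zero>\<^bsub>lmod M\<^esub> : carrier (lmod M)" using MC(2) S_one unfolding lmod_simps by blast
  fix x assume "x : carrier (lmod M)"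
  then obtain m s where h: "m : M" "s : S" "x = fr m s" unfolding lmod_simps by blast
  thus "\<zero>\<^bsub>lmod M\<^esub> \<oplus>\<^bsub>lmod M\<^esub> x = x"
   using S_one N_closed(2) by (simp add: lmod_simps fadd_fr sub S_A is_module_act_zero[OF modN] is_moduleD(7)[OF modN])
  have N: "- m : M" "- m : N" "m : N" using h MC sub N_closed by auto
  have "fadd (fr (- m) s) (fr m s) = fr 0 (s*s)" using h N by (simp add: fadd_fr S_A is_module_act_uminus[OF modN])
  also have "\<dots> = fr 0 1" by (rule fr_zero[OF S_mult[OF h(2) h(2)]])
  finally show "EX y:carrier (lmod M). y \<oplus>\<^bsub>lmod M\<^esub> x = \<zero>\<^bsub>lmod M\<^esub>"
   using h N unfolding lmod_simps by (intro bexI[of _ "fr (- m) s"]) auto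
 qed
 fix l x assume l: "l : carrier RP" and "x : carrier (lmod M)"
 then obtain m s where h: "m : M" "s : S" "x = fr m s" unfolding lmod_simps by blast
 obtain a b where ab: "a : A" "b : S" "J l = a / b" using rrep[OF l] by blast
 note sm = fsmult_fr[OF l ab(3,1,2)]
 show "l \<odot>\<^bsub>lmod M\<^esub> x : carrier (lmod M)"
  using h ab MC(3) S_mult[of b s] unfolding lmod_simps by (simp add: sm sub) blast
 fix y assume "y : carrier (lmod M)"
 then obtain n t where h2: "n : M" "t : S" "y = fr n t" unfolding lmod_simps by blast
 have N: "act t m+act s n : N" "act a m : N" "act a n : N" "b*s : S" "b*t : S" "s*t : S" "b*(s*t) : S"
  using h h2 sub ab by (auto intro!: N_closed S_mult intro: S_A)
 show "l \<odot>\<^bsub>lmod M\<^esub> (x \<oplus>\<^bsub>lmod M\<^esub> y) = l \<odot>\<^bsub>lmod M\<^esub> x \<oplus>\<^bsub>lmod M\<^esub> l \<odot>\<^bsub>lmod M\<^esub> y"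
 proof -
  have "fr (act a (act t m+act s n)) (b*(s*t)) = fr (act (b*t) (act a m)+act (b*s) (act a n)) (b*s*(b*t))"
  proof -
   have e1: "act (b*t) (act a m)+act (b*s) (act a n) = act b (act a (act t m+act s n))"
    using h h2 ab sub by (simp add: act_act act_add A_closed N_closed mult_ac)
   have e2: "b*s*(b*t) = b*(b*(s*t))" by (simp add: mult_ac)
   show ?thesis unfolding e1 e2 by (rule fr_same[symmetric]) (use N ab N_closed in auto)
  qed
  thus ?thesis using h h2 N by (simp add: lmod_simps fadd_fr sm sub)
 qed
next
 have sub: "m : M ==> m : N" for m using M(2) by auto
 fix l l' x assume l: "l : carrier RP" and l': "l' : carrier RP" and "x : carrier (lmod M)"
 then obtain m s where h: "m : N" "s : S" "x = fr m s" using sub unfolding lmod_simps by blast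
 obtain a b where ab: "a : A" "b : S" "J l = a / b" using rrep[OF l] by blast
 obtain a' b' where ab': "a' : A" "b' : S" "J l' = a' / b'" using rrep[OF l'] by blast
 have bb: "b*b' : S" "b*s : S" "b'*s : S" "b ~= 0" "b' ~= 0" "act a m : N" "act a' m : N"
  using ab ab' h S_mult S_nz N_closed by auto
 have "J (l \<oplus>\<^bsub>RP\<^esub> l') = (a*b'+a'*b) / (b*b')" using E.j_add[OF l l'] ab ab' bb by (simp add: field_simps)
 hence s1: "fsmult (l \<oplus>\<^bsub>RP\<^esub> l') x = fr (act (a*b'+a'*b) m) (b*b'*s)"
  using h ab ab' bb l l' by (auto intro!: fsmult_fr intro: A_closed)
 have "fr (act (a*b'+a'*b) m) (b*b'*s) = fr (act (b'*s) (act a m)+act (b*s) (act a' m)) (b*s*(b'*s))"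
 proof -
  have e1: "act (b'*s) (act a m)+act (b*s) (act a' m) = act s (act (a*b'+a'*b) m)"
   using h ab ab' by (simp add: act_act act_add add_act A_closed N_closed mult_ac)
  have e2: "b*s*(b'*s) = s*(b*b'*s)" by (simp add: mult_ac)
  show ?thesis unfolding e1 e2
   by (rule fr_same[symmetric]) (use h ab ab' bb in \<open>auto intro!: N_closed S_mult intro: A_closed\<close>)
 qed
 thus "(l \<oplus>\<^bsub>RP\<^esub> l') \<odot>\<^bsub>lmod M\<^esub> x = l \<odot>\<^bsub>lmod M\<^esub> x \<oplus>\<^bsub>lmod M\<^esub> l' \<odot>\<^bsub>lmod M\<^esub> x"
  using h bb s1 fsmult_fr[OF l ab(3,1,2)] fsmult_fr[OF l' ab'(3,1,2)] by (simp add: lmod_simps fadd_fr)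
 have "J (l \<otimes>\<^bsub>RP\<^esub> l') = (a*a') / (b*b')" using E.j_mult[OF l l'] ab ab' by simp
 hence "fsmult (l \<otimes>\<^bsub>RP\<^esub> l') x = fr (act (a*a') m) (b*b'*s)"
  using h ab ab' bb l l' by (auto intro!: fsmult_fr intro: A_closed)
 thus "(l \<otimes>\<^bsub>RP\<^esub> l') \<odot>\<^bsub>lmod M\<^esub> x = l \<odot>\<^bsub>lmod M\<^esub> (l' \<odot>\<^bsub>lmod M\<^esub> x)"
  using h bb ab ab' fsmult_fr[OF l ab(3,1,2)] fsmult_fr[OF l' ab'(3,1,2)] by (simp add: lmod_simps act_act mult.assoc)
next
 have sub: "m : M ==> m : N" for m using M(2) by auto
 fix x assume "x : carrier (lmod M)"
 then obtain m s where h: "m : N" "s : S" "x = fr m s" using sub unfolding lmod_simps by blast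
 have "J \<one>\<^bsub>RP\<^esub> = 1 / 1" using E.j_one by simp
 thus "\<one>\<^bsub>RP\<^esub> \<odot>\<^bsub>lmod M\<^esub> x = x"
  using h S_one S_A[OF S_one] fsmult_fr[OF E.one_closed, of 1 1 m s] is_moduleD(7)[OF modN] by (simp add: lmod_simps)
qed

end

section \<open>Localization of maps, exactness and injectivity\<close>

lemma is_baerD:
 "is_baer A act M ==> is_ideal A J ==> f ` J <= M ==> is_linear_on A (*) act J f ==>
  EX m:M. ALL x:J. f x = act x m" unfolding is_baer_def by simp

context module_localization
begin

lemma frac_in_image: "a : A ==> s : S ==> EX l:carrier RP. J l = a / s"
proof -
 assume "a : A" "s : S"
 hence "a / s : J ` carrier RP" unfolding J_image by blast
 thus ?thesis by force
qed

text \<open>The representative is chosen with numerator in \<open>M\<close>, since \<open>d\<close>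
  is only known to be linear there, while the same fraction also has representatives elsewhere in
  \<open>N\<close>.\<close>

definition lmap :: "'n set => ('n => 'n) => 't => 't" where
 "lmap M d x = (let p = (SOME p. fst p : M & snd p : S & x = fr (fst p) (snd p)) in fr (d (fst p)) (snd p))"

lemma lmap_fr: assumes M: "is_module A act M" "M <= N" and d: "is_linear_on A act act M d" "d ` M <= N"
  and m: "m : M" "s : S" shows "lmap M d (fr m s) = fr (d m) s"
proof -
 define p where "p = (SOME p. fst p : M & snd p : S & fr m s = fr (fst p) (snd p))"
 have p: "fst p : M & snd p : S & fr m s = fr (fst p) (snd p)"
  unfolding p_def by (rule someI[of _ "(m, s)"]) (use m in auto)
 then obtain u where u: "u : S" "act (u*snd p) m = act (u*s) (fst p)" using frE[of m s "fst p" "snd p"] m M by blast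
 have ue: "u*snd p : A" "u*s : A" using u p m A_closed by auto
 have "d (act (u*snd p) m) = act (u*snd p) (d m)" "d (act (u*s) (fst p)) = act (u*s) (d (fst p))"
  using d(1) m p ue unfolding is_linear_on_def by blast+
 hence "act (u*snd p) (d m) = act (u*s) (d (fst p))" using u(2) by simp
 hence "fr (d (fst p)) (snd p) = fr (d m) s" using u p m d(2) by (intro frI[OF u(1)]) auto
 thus ?thesis by (simp add: lmap_def p_def Let_def)
qed

lemma lmap_hom: assumes M: "is_module A act M" "M <= N" and M': "is_module A act M'" "M' <= N"
  and d: "is_linear_on A act act M d" "d ` M <= M'" shows "lmap M d : module_hom RP (lmod M) (lmod M')"
proof (rule module_homI)
 have dN: "d ` M <= N" using d(2) M'(2) by auto
 note lf = lmap_fr[OF M d(1) dN]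
 have sub: "m : M ==> m : N" "m : M ==> d m : N" "m : M ==> d m : M'" for m using M(2) dN d(2) by auto
 note MC = is_module_add[OF M(1)] is_moduleD(1,3)[OF M(1)]
 fix x assume "x : carrier (lmod M)"
 then obtain m s where h: "m : M" "s : S" "x = fr m s" unfolding lmod_simps by blast
 have "lmap M d x = fr (d m) s" using h lf by simp
 thus "lmap M d x : carrier (lmod M')" using h sub unfolding lmod_simps by blast
 show "lmap M d (r \<odot>\<^bsub>lmod M\<^esub> x) = r \<odot>\<^bsub>lmod M'\<^esub> lmap M d x" if r: "r : carrier RP" for r
 proof -
  obtain a b where ab: "a : A" "b : S" "J r = a / b" using rrep[OF r] by blast
  note sm = fsmult_fr[OF r ab(3,1,2)]
  have "d (act a m) = act a (d m)" using d(1) h ab by (auto simp: is_linear_on_def)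
  thus ?thesis using h ab sub MC S_mult by (simp add: lmod_simps sm lf)
 qed
 fix y assume "y : carrier (lmod M)"
 then obtain n t where h2: "n : M" "t : S" "y = fr n t" unfolding lmod_simps by blast
 have "d (act t m+act s n) = act t (d m)+act s (d n)" using d(1) h h2 S_A MC by (simp add: is_linear_on_def)
 thus "lmap M d (x \<oplus>\<^bsub>lmod M\<^esub> y) = lmap M d x \<oplus>\<^bsub>lmod M'\<^esub> lmap M d y"
  using h h2 sub MC S_mult[OF h(2) h2(2)] S_A by (simp add: lmod_simps lf fadd_fr)
qed

lemma lmap_exact:
 assumes M: "is_module A act M" "M <= N" and M': "is_module A act M'" "M' <= N" and M'': "is_module A act M''" "M'' <= N"
  and d: "is_linear_on A act act M d" "d ` M <= M'" and d': "is_linear_on A act act M' d'" "d' ` M' <= M''"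
  and ex: "d ` M = {u:M'. d' u = 0}" shows "lmap M d ` carrier (lmod M) = a_kernel (lmod M') (lmod M'') (lmap M' d')"
proof -
 have dN: "d ` M <= N" "d' ` M' <= N" using d(2) M'(2) d'(2) M''(2) by auto
 note lf = lmap_fr[OF M d(1) dN(1)] and lf' = lmap_fr[OF M' d'(1) dN(2)]
 show ?thesis unfolding a_kernel_def'
 proof (intro equalityI subsetI)
  fix y assume "y : lmap M d ` carrier (lmod M)"
  then obtain m s where h: "m : M" "s : S" "y = lmap M d (fr m s)" unfolding lmod_simps by blast
  have dm: "d m : M'" "d' (d m) = 0" using ex h by auto
  hence "lmap M' d' y = fr 0 s" "y = fr (d m) s" using h by (auto simp: lf lf')
  moreover have "fr 0 s = fr 0 1" by (rule fr_zero[OF h(2)])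
  ultimately show "y : {r : carrier (lmod M'). lmap M' d' r = \<zero>\<^bsub>lmod M''\<^esub>}"
   using dm h unfolding lmod_simps by auto
 next
  fix y assume y: "y : {r : carrier (lmod M'). lmap M' d' r = \<zero>\<^bsub>lmod M''\<^esub>}"
  then obtain m s where h: "m : M'" "s : S" "y = fr m s" unfolding lmod_simps by blast
  hence "fr (d' m) s = fr 0 1" using y by (simp add: lf' lmod_simps)
  moreover have "d' m : N" using h dN by auto
  ultimately obtain u where u: "u : S" "act u (d' m) = 0" using fr_zero_iff h by blast
  have "d' (act u m) = 0" using d'(1) u h S_A by (simp add: is_linear_on_def)
  moreover have um: "act u m : M'" using is_moduleD(3)[OF M'(1)] u h S_A by blast
  ultimately obtain n where n: "n : M" "act u m = d n" using ex by auto
  have "fr (d n) (u*s) = y" using n(2) h u M'(2) by (metis fr_same subsetD)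
  hence "lmap M d (fr n (u*s)) = y" using lf n S_mult u h by simp
  thus "y : lmap M d ` carrier (lmod M)" using n u h S_mult unfolding lmod_simps by blast
 qed
qed

definition rr :: "'f => ('a \<times> 'a) set" where "rr a = inv_into (carrier RP) J a"

lemma rr: assumes "a : A" shows "rr a : carrier RP" "J (rr a) = a"
proof -
 have "a : J ` carrier RP" using frac_in_image[OF assms S_one] by auto
 thus "rr a : carrier RP" "J (rr a) = a" unfolding rr_def by (auto intro: inv_into_into f_inv_into_f)
qed

lemma rr_eqI: "l : carrier RP ==> a : A ==> J l = a ==> l = rr a" using rr[of a] E.j_eq_iff[of l "rr a"] by simp

lemma rr_add: "a : A ==> b : A ==> rr (a+b) = rr a \<oplus>\<^bsub>RP\<^esub> rr b"
 using rr[of a] rr[of b] by (intro rr_eqI[symmetric]) (auto simp: E.j_add intro: A_closed)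

lemma rr_mult: "a : A ==> b : A ==> rr (a*b) = rr a \<otimes>\<^bsub>RP\<^esub> rr b"
 using rr[of a] rr[of b] by (intro rr_eqI[symmetric]) (auto simp: E.j_mult intro: A_closed)

lemma rr_zero: "rr 0 = \<zero>\<^bsub>RP\<^esub>"
 by (rule rr_eqI[symmetric]) (auto simp: E.j_zero intro: is_subring_zero[OF F.A])

lemma rr_smult: "a : A ==> m : N ==> s : S ==> fsmult (rr a) (fr m s) = fr (act a m) s"
 using fsmult_fr[OF rr(1), of a a 1 m s] rr(2) S_one by simp

lemma common_annihilator: assumes "finite G" "!!q. q : G ==> q : A & (EX u:S. act (u*q) m = 0)" "m : N"
 shows "EX u:S. ALL q:G. act (u*q) m = 0" using assms(1,2)
proof (induction G rule: finite_induct)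
 case empty
 thus ?case using S_one by blast
next
 case (insert q G)
 obtain u where "u : S" "ALL q:G. act (u*q) m = 0" using insert by auto
 moreover obtain v where "v : S" "act (v*q) m = 0" using insert.prems[of q] by auto
 ultimately have uv: "u : S" "v : S" "ALL q:G. act (u*q) m = 0" "act (v*q) m = 0" by auto
 have *: "act (w*x*r) m = 0" if "w : S" "x : S" "r : A" "act (x*r) m = 0" for w x r
 proof -
  have "act w (act (x*r) m) = act (w*(x*r)) m"
   by (rule act_act) (use that assms(3) in \<open>auto intro: A_closed\<close>)
  hence "act (w*x*r) m = act w (act (x*r) m)" by (simp add: mult.assoc)
  thus ?thesis using that is_module_act_zero[OF modN] S_A by simp
 qed
 have "act (u*v*r) m = 0" if "r : insert q G" for r
 proof (cases "r = q")
  case True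
  thus ?thesis using*uv insert.prems by auto
 next
  case False
  hence "act (v*u*r) m = 0" using*uv insert.prems that by auto
  thus ?thesis by (simp add: mult.commute)
 qed
 thus ?case using S_mult uv by blast
qed

text \<open>Over a Noetherian ring localization preserves injectivity. A homomorphism on an ideal of
  the local ring is made to agree with multiplication by some \<open>x\<close> on one after the
  other of finitely many generators of the contracted ideal; each correction of \<open>x\<close>
  comes from a homomorphism into \<open>M\<close>, to which Baer's condition over \<open>A\<close>
  applies.\<close>

lemma lmod_baer: assumes M: "is_module A act M" "M <= N" and B: "is_baer A act M" and noeth: "noetherian A"
 shows "baer_module RP (lmod M)" unfolding baer_module_def
proof (intro conjI allI impI)
 show mod: "module RP (lmod M)" by (rule lmod_module[OF M])
 interpret Q: module RP "lmod M" by (rule mod)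
 fix K f assume "ideal K RP & (ALL x:K. f x : carrier (lmod M)) &
  (ALL x:K. ALL y:K. f (x \<oplus>\<^bsub>RP\<^esub> y) = f x \<oplus>\<^bsub>lmod M\<^esub> f y) &
  (ALL r:carrier RP. ALL x:K. f (r \<otimes>\<^bsub>RP\<^esub> x) = r \<odot>\<^bsub>lmod M\<^esub> f x)"
 hence K: "ideal K RP" and fC: "ALL x:K. f x : carrier (lmod M)"
  and fadd: "ALL x:K. ALL y:K. f (x \<oplus>\<^bsub>RP\<^esub> y) = f x \<oplus>\<^bsub>lmod M\<^esub> f y"
  and fsm: "ALL r:carrier RP. ALL x:K. f (r \<otimes>\<^bsub>RP\<^esub> x) = r \<odot>\<^bsub>lmod M\<^esub> f x" by simp_all
 interpret K: ideal K RP by fact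
 define I0 where "I0 = {a:A. rr a : K}"
 define f0 where "f0 a = f (rr a)" for a
 have sub: "m : M ==> m : N" for m using M(2) by auto
 have I0A: "a : I0 ==> a : A" for a by (simp add: I0_def)
 have f0C: "f0 a : carrier (lmod M)" if "a : I0" for a using fC that by (simp add: I0_def f0_def)
 have I0: "is_ideal A I0" unfolding is_ideal_def
 proof (intro conjI ballI)
  show "I0 <= A" by (auto simp: I0_def)
  show "0 : I0" using is_subring_zero[OF F.A] additive_subgroup.zero_closed[OF K.is_additive_subgroup]
   by (simp add: I0_def rr_zero)
  show "x+y : I0" if "x : I0" "y : I0" for x y using that by (auto simp: I0_def rr_add A_closed)
  show "a*x : I0" if "a : A" "x : I0" for a x
   using that rr(1)[of a] by (auto simp: I0_def rr_mult A_closed K.I_l_closed)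
 qed
 have f0_add: "f0 (a+b) = f0 a \<oplus>\<^bsub>lmod M\<^esub> f0 b" if "a : I0" "b : I0" for a b
  using that fadd by (auto simp: f0_def I0_def rr_add)
 have f0_mult: "f0 (a*b) = rr a \<odot>\<^bsub>lmod M\<^esub> f0 b" if "a : A" "b : I0" for a b
  using that fsm rr(1)[of a] by (auto simp: f0_def I0_def rr_mult)
 define good where "good x = {a:I0. f0 a = rr a \<odot>\<^bsub>lmod M\<^esub> x}" for x
 have good_ideal: "is_ideal A (good x)" if x: "x : carrier (lmod M)" for x unfolding is_ideal_def
 proof (intro conjI ballI)
  show "good x <= A" by (auto simp: good_def I0_def)
  have "f0 (0*0) = rr 0 \<odot>\<^bsub>lmod M\<^esub> f0 0"
   by (rule f0_mult) (use is_subring_zero[OF F.A] is_idealD(2)[OF I0] in auto)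
  thus "0 : good x" using is_idealD(2)[OF I0] x f0C by (simp add: good_def rr_zero)
  show "a+b : good x" if "a : good x" "b : good x" for a b
   using that x is_idealD(3)[OF I0] rr(1)[OF I0A] by (simp add: good_def f0_add rr_add[OF I0A I0A] Q.smult_l_distr)
  show "a*b : good x" if "a : A" "b : good x" for a b using that x is_idealD(4)[OF I0] rr(1)[OF I0A] rr(1)[OF that(1)]
   by (simp add: good_def f0_mult rr_mult[OF that(1) I0A] Q.smult_assoc1)
 qed
 have step: "EX x':carrier (lmod M). insert a0 (good x) <= good x'"
  if x: "x : carrier (lmod M)" and a0: "a0 : I0" for x a0
 proof -
  have a0A: "a0 : A" using a0 I0A by simp
  \<comment> \<open>The error of \<open>x\<close> at \<open>a0\<close>, to be removed without
    disturbing the agreement on \<open>good x\<close>.\<close>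
  define y where "y = f0 a0 \<ominus>\<^bsub>lmod M\<^esub> rr a0 \<odot>\<^bsub>lmod M\<^esub> x"
  have rx: "rr a0 \<odot>\<^bsub>lmod M\<^esub> x : carrier (lmod M)" using rr(1)[OF a0A] x by simp
  have "y : carrier (lmod M)" using f0C[OF a0] rx by (simp add: y_def)
  then obtain m s where ms: "m : M" "s : S" "y = fr m s" unfolding lmod_simps by blast
  note gi = good_ideal[OF x]
  define Q where "Q = {q:A. q*a0 : good x}"
  have Qi: "is_ideal A Q" using is_idealD[OF gi] is_subring_zero[OF F.A] A_closed(1,2)
   by (auto simp: is_ideal_def Q_def distrib_right mult.assoc)
  have ann: "EX u:S. act (u*q) m = 0" if q: "q : Q" for q
  proof -
   have qA: "q : A" using q by (simp add: Q_def)
   have "rr q \<odot>\<^bsub>lmod M\<^esub> f0 a0 = rr q \<odot>\<^bsub>lmod M\<^esub> (rr a0 \<odot>\<^bsub>lmod M\<^esub> x)"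
    using q f0_mult[OF qA a0] x rr(1)[OF qA] rr(1)[OF a0A]
    by (simp add: Q_def good_def rr_mult[OF qA a0A] Q.smult_assoc1)
   hence "rr q \<odot>\<^bsub>lmod M\<^esub> y = \<zero>\<^bsub>lmod M\<^esub>" using f0C[OF a0] rx rr(1)[OF qA]
    by (simp add: y_def a_minus_def Q.smult_r_distr Q.smult_r_minus Q.M.r_neg)
   hence "fr (act q m) s = fr 0 1" using ms qA sub by (simp add: lmod_simps rr_smult)
   then obtain u where "u : S" "act u (act q m) = 0"
    using fr_zero_iff[OF _ ms(2)] N_closed(3)[OF qA sub[OF ms(1)]] by blast
   thus ?thesis using qA ms sub S_A by (auto simp: act_act)
  qed
  obtain G where G: "finite G" "G <= Q" "!!I'. is_ideal A I' ==> G <= I' ==> Q <= I'"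
   using noeth Qi by (metis noetherianE)
  have "EX u:S. ALL q:G. act (u*q) m = 0"
   by (rule common_annihilator[OF G(1)]) (use G(2) ann is_idealD(1)[OF Qi] ms sub in blast)+
  then obtain u where u: "u : S" "ALL q:G. act (u*q) m = 0" by blast
  note uA = S_A[OF u(1)] and mN = sub[OF ms(1)]
  define Z where "Z = {q:A. act (u*q) m = 0}"
  have Zi: "is_ideal A Z" unfolding is_ideal_def
  proof (intro conjI ballI)
   show "Z <= A" by (auto simp: Z_def)
   show "0 : Z" using is_module_zero_act[OF modN F.A mN] is_subring_zero[OF F.A] by (simp add: Z_def)
   show "a+b : Z" if "a : Z" "b : Z" for a b using that uA mN by (simp add: Z_def distrib_left add_act A_closed)
   show "a*b : Z" if "a : A" "b : Z" for a b
   proof -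
    have "act a (act (u*b) m) = act (a*(u*b)) m"
     by (rule act_act) (use that uA mN in \<open>auto simp: Z_def intro: A_closed\<close>)
    moreover have "a*(u*b) = u*(a*b)" by (simp add: mult_ac)
    ultimately have "act (u*(a*b)) m = act a (act (u*b) m)" by simp
    thus ?thesis using that is_module_act_zero[OF modN] by (simp add: Z_def A_closed)
   qed
  qed
  have "Q <= Z" by (rule G(3)[OF Zi]) (use u G(2) is_idealD(1)[OF Qi] in \<open>auto simp: Z_def\<close>)
  hence uQ: "act (u*q) m = 0" if "q : Q" for q using that by (auto simp: Z_def)
  \<comment> \<open>\<open>K2\<close> is \<open>good x + A a0\<close>, and \<open>h\<close> sends
    \<open>g + q a0\<close> to \<open>u q m\<close>. This is well defined because \<open>u\<close>
    kills \<open>q m\<close> whenever \<open>q a0\<close> lies in \<open>good x\<close>. The map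
    vanishes on \<open>good x\<close>, and divided by \<open>u s\<close> it has the value
    \<open>y\<close> at \<open>a0\<close>.\<close>
  define K2 where "K2 = {z:A. EX q:A. z - q*a0 : good x}"
  define h where "h z = act (u*(SOME q. q : A & z - q*a0 : good x)) m" for z
  have h_eq: "h z = act (u*q) m" if q: "q : A" "z - q*a0 : good x" for z q
  proof -
   define q' where "q' = (SOME q. q : A & z - q*a0 : good x)"
   have q': "q' : A & z - q'*a0 : good x" unfolding q'_def by (rule someI[of _ q]) (use q in auto)
   have "(q' - q)*a0 : good x" using is_ideal_diff[OF F.A gi q(2), of "z - q'*a0"] q' by (simp add: algebra_simps)
   hence "q' - q : Q" using q q' is_subring_diff[OF F.A] by (simp add: Q_def)
   hence "act (u*(q' - q)) m = 0" by (rule uQ)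
   moreover have "act (u*q') m = act (u*(q' - q)) m+act (u*q) m" using q q' uA mN is_subring_diff[OF F.A, of q' q]
    by (simp add: A_closed flip: add_act distrib_left)
   ultimately show ?thesis by (simp add: h_def q'_def)
  qed
  have K2i: "is_ideal A K2" unfolding is_ideal_def
  proof (intro conjI ballI)
   show "K2 <= A" by (auto simp: K2_def)
   show "0 : K2" unfolding K2_def using is_subring_zero[OF F.A] is_idealD(2)[OF gi] by force
   show "z+z' : K2" if zz: "z : K2" "z' : K2" for z z'
   proof -
    obtain q q' where q: "q : A" "z - q*a0 : good x" "q' : A" "z' - q'*a0 : good x" using zz by (auto simp: K2_def)
    have "z+z' - (q+q')*a0 : good x" using is_idealD(3)[OF gi q(2,4)] by (simp add: algebra_simps)
    thus ?thesis using q zz by (auto simp: K2_def A_closed)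
   qed
   show "a*z : K2" if az: "a : A" "z : K2" for a z
   proof -
    obtain q where q: "q : A" "z - q*a0 : good x" using az by (auto simp: K2_def)
    have "a*z - (a*q)*a0 : good x" using is_idealD(4)[OF gi az(1) q(2)] by (simp add: algebra_simps)
    thus ?thesis using q az by (auto simp: K2_def A_closed)
   qed
  qed
  have h_lin: "is_linear_on A (*) act K2 h" unfolding is_linear_on_def
  proof (intro conjI ballI)
   show "h (z+z') = h z+h z'" if zz: "z : K2" "z' : K2" for z z'
   proof -
    obtain q q' where q: "q : A" "z - q*a0 : good x" "q' : A" "z' - q'*a0 : good x" using zz by (auto simp: K2_def)
    have "z+z' - (q+q')*a0 : good x" using is_idealD(3)[OF gi q(2,4)] by (simp add: algebra_simps)
    hence "h (z+z') = act (u*(q+q')) m" using q by (intro h_eq) (auto intro: A_closed)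
    thus ?thesis using h_eq[OF q(1,2)] h_eq[OF q(3,4)] q uA mN by (simp add: distrib_left add_act A_closed)
   qed
   show "h (a*z) = act a (h z)" if az: "a : A" "z : K2" for a z
   proof -
    obtain q where q: "q : A" "z - q*a0 : good x" using az by (auto simp: K2_def)
    have "a*z - (a*q)*a0 : good x" using is_idealD(4)[OF gi az(1) q(2)] by (simp add: algebra_simps)
    hence "h (a*z) = act (u*(a*q)) m" using q az by (intro h_eq) (auto intro: A_closed)
    thus ?thesis using h_eq[OF q] q az uA mN by (simp add: act_act A_closed mult_ac)
   qed
  qed
  have "h ` K2 <= M" using h_eq ms uA is_moduleD(3)[OF M(1)] A_closed by (auto simp: K2_def)
  then obtain m' where m': "m' : M" "!!z. z : K2 ==> h z = act z m'" using is_baerD[OF B K2i _ h_lin] by blast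
  have us: "u*s : S" using u ms S_mult by simp
  define x' where "x' = x \<oplus>\<^bsub>lmod M\<^esub> fr m' (u*s)"
  have frC: "fr m' (u*s) : carrier (lmod M)" using m' us unfolding lmod_simps by blast
  have "x' : carrier (lmod M)" unfolding x'_def using x frC by simp
  moreover have "insert a0 (good x) <= good x'"
  proof
   fix b assume "b : insert a0 (good x)"
   then consider "b : good x" | "b = a0" by auto
   thus "b : good x'"
   proof cases
    case 1
    hence b: "b : I0" "b : A" "f0 b = rr b \<odot>\<^bsub>lmod M\<^esub> x" by (auto simp: good_def I0_def)
    have bg: "b - 0*a0 : good x" using 1 by simp
    have "b : K2" unfolding K2_def using b bg is_subring_zero[OF F.A] by blast
    hence "act b m' = act (u*0) m" using m'(2) h_eq[OF is_subring_zero[OF F.A] bg] by simp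
    hence "act b m' = 0" using is_module_zero_act[OF modN F.A mN] by simp
    hence "rr b \<odot>\<^bsub>lmod M\<^esub> fr m' (u*s) = fr 0 (u*s)"
     using b m' us sub by (simp add: lmod_simps rr_smult)
    also have "\<dots> = \<zero>\<^bsub>lmod M\<^esub>" by (simp add: lmod_simps fr_zero[OF us])
    finally show ?thesis using b x frC rr(1)[OF b(2)] by (simp add: good_def x'_def Q.smult_r_distr)
   next
    case 2
    have ag: "a0 - 1*a0 : good x" using is_idealD(2)[OF gi] by simp
    have "a0 : K2" unfolding K2_def using a0A ag is_subring_one[OF F.A] by blast
    hence "act a0 m' = act (u*1) m" using m'(2) h_eq[OF is_subring_one[OF F.A] ag] by simp
    hence "rr a0 \<odot>\<^bsub>lmod M\<^esub> fr m' (u*s) = fr (act u m) (u*s)"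
     using a0A m' us sub by (simp add: lmod_simps rr_smult)
    also have "\<dots> = y" using fr_same[OF mN ms(2) u(1)] ms by simp
    finally have "rr a0 \<odot>\<^bsub>lmod M\<^esub> x' = rr a0 \<odot>\<^bsub>lmod M\<^esub> x \<oplus>\<^bsub>lmod M\<^esub> y"
     using x frC rr(1)[OF a0A] by (simp add: x'_def Q.smult_r_distr)
    also have "\<dots> = f0 a0"
     using f0C[OF a0] rx by (simp add: y_def a_minus_def Q.M.a_lcomm[of "rr a0 \<odot>\<^bsub>lmod M\<^esub> x" "f0 a0"] Q.M.r_neg)
    finally show ?thesis using 2 a0 by (simp add: good_def)
   qed
  qed
  ultimately show ?thesis by blast
 qed
 obtain G where G: "finite G" "G <= I0" "!!I'. is_ideal A I' ==> G <= I' ==> I0 <= I'"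
  using noeth I0 by (metis noetherianE)
 have "EX x:carrier (lmod M). G <= good x" using G(1,2)
 proof (induction G rule: finite_induct)
  case empty
  thus ?case using Q.M.zero_closed by blast
 next
  case (insert a0 G)
  then obtain x where x: "x : carrier (lmod M)" "G <= good x" by auto
  have "a0 : I0" using insert.prems by simp
  then obtain x' where "x' : carrier (lmod M)" "insert a0 (good x) <= good x'" using step[OF x(1)] by blast
  thus ?case using x by blast
 qed
 then obtain x where x: "x : carrier (lmod M)" "G <= good x" by blast
 have all: "I0 <= good x" by (rule G(3)[OF good_ideal[OF x(1)] x(2)])
 have "f l = l \<odot>\<^bsub>lmod M\<^esub> x" if l: "l : K" for l
 proof -
  have lC: "l : carrier RP" using l by (rule K.Icarr)
  obtain a b where ab: "a : A" "b : S" "J l = a / b" using rrep[OF lC] by blast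
  note bA = S_A[OF ab(2)] and bn = S_nz[OF ab(2)]
  obtain c where c: "c : carrier RP" "J c = 1 / b" using frac_in_image[OF is_subring_one[OF F.A] ab(2)] by blast
  have e: "rr b \<otimes>\<^bsub>RP\<^esub> l = rr a" using rr[OF bA] lC ab bn by (intro rr_eqI) (auto simp: E.j_mult)
  have e2: "c \<otimes>\<^bsub>RP\<^esub> rr b = \<one>\<^bsub>RP\<^esub>"
   using c rr[OF bA] bn E.j_eq_iff[of "c \<otimes>\<^bsub>RP\<^esub> rr b" "\<one>\<^bsub>RP\<^esub>"] by (simp add: E.j_mult E.j_one)
  have "rr a : K" using K.I_l_closed[OF l rr(1)[OF bA]] e by simp
  hence "a : good x" using all ab by (auto simp: I0_def)
  hence "f (rr a) = rr a \<odot>\<^bsub>lmod M\<^esub> x" by (simp add: good_def f0_def)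
  hence "rr b \<odot>\<^bsub>lmod M\<^esub> f l = rr b \<odot>\<^bsub>lmod M\<^esub> (l \<odot>\<^bsub>lmod M\<^esub> x)"
   using fsm l rr(1)[OF bA] x lC by (simp add: Q.smult_assoc1 flip: e)
  hence "(c \<otimes>\<^bsub>RP\<^esub> rr b) \<odot>\<^bsub>lmod M\<^esub> f l = (c \<otimes>\<^bsub>RP\<^esub> rr b) \<odot>\<^bsub>lmod M\<^esub> (l \<odot>\<^bsub>lmod M\<^esub> x)"
   using c rr(1)[OF bA] fC l x lC by (simp add: Q.smult_assoc1)
  thus ?thesis using e2 fC l x lC by simp
 qed
 thus "EX m:carrier (lmod M). ALL x:K. f x = x \<odot>\<^bsub>lmod M\<^esub> m" using x by blast
qed

end

theorem (in module_localization) localized_resolution: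
 fixes I :: "nat => 'n set" and d :: "nat => 'n => 'n" and e :: "'f => 'n" assumes noeth: "noetherian A"
  and I: "!!p. is_module A act (I p)" "!!p. I p <= N" "!!p. is_baer A act (I p)" "!!p. p > k ==> I p = {0}"
  and d: "!!p. is_linear_on A act act (I p) (d p)" "!!p. d p ` I p <= I (Suc p)"
  and ex: "!!p. d p ` I p = {u:I (Suc p). d (Suc p) u = 0}"
  and e: "is_linear_on A (*) act A e" "inj_on e A" "e ` A = {u:I 0. d 0 u = 0}"
 shows "EX (I' :: nat => (('a \<times> 'a) set, 't) module) e' d'.
  (ALL i. baer_module RP (I' i)) & (ALL i>k. carrier (I' i) = {\<zero>\<^bsub>I' i\<^esub>}) &
  e' : module_hom RP (regular_module RP) (I' 0) &
  (ALL i. d' i : module_hom RP (I' i) (I' (Suc i))) & inj_on e' (carrier RP) &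
  e' ` carrier RP = a_kernel (I' 0) (I' 1) (d' 0) &
  (ALL i. d' i ` carrier (I' i) = a_kernel (I' (Suc i)) (I' (Suc (Suc i))) (d' (Suc i)))"
proof -
 define e' where "e' = (%l. l \<odot>\<^bsub>lmod (I 0)\<^esub> fr (e 1) 1)"
 interpret Q: module RP "lmod (I 0)" by (rule lmod_module[OF I(1,2)])
 have one: "1 : A" by (rule is_subring_one[OF F.A])
 have e1: "e 1 : I 0" "e 1 : N" "e a : I 0" if "a : A" for a using e(3) one that I(2)[of 0] by auto
 have eA: "e a = act a (e 1)" if "a : A" for a using e(1) that one by (metis is_linear_on_def mult.right_neutral)
 have fC: "fr (e 1) 1 : carrier (lmod (I 0))" using e1[OF one] S_one unfolding lmod_simps by blast
 have e'_eq: "e' l = fr (e a) b" if "l : carrier RP" "J l = a / b" "a : A" "b : S" for l a b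
  using fsmult_fr[OF that e1(2)[OF one] S_one] eA that by (simp add: e'_def lmod_simps)
 show ?thesis
 proof (intro exI[of _ "%p. lmod (I p)"] exI[of _ e'] exI[of _ "%p. lmap (I p) (d p)"] conjI allI impI)
  show "baer_module RP (lmod (I i))" for i by (rule lmod_baer[OF I(1,2,3) noeth])
  show "carrier (lmod (I i)) = {\<zero>\<^bsub>lmod (I i)\<^esub>}" if "k < i" for i
  proof -
   have "{fr m s | m s. m : {0} & s : S} = {fr 0 1}" using S_one fr_zero by blast
   thus ?thesis using I(4)[OF that] unfolding lmod_simps by simp
  qed
  show "e' : module_hom RP (regular_module RP) (lmod (I 0))"
   by (rule module_homI) (use fC in \<open>auto simp: regular_module_def e'_def Q.smult_l_distr Q.smult_assoc1\<close>)
  show "lmap (I i) (d i) : module_hom RP (lmod (I i)) (lmod (I (Suc i)))" for i by (rule lmap_hom[OF I(1,2) I(1,2) d])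
  show "inj_on e' (carrier RP)"
  proof (rule inj_onI)
   fix l l' assume l: "l : carrier RP" "l' : carrier RP" "e' l = e' l'"
   obtain a b where ab: "a : A" "b : S" "J l = a / b" using rrep[OF l(1)] by blast
   obtain a' b' where ab': "a' : A" "b' : S" "J l' = a' / b'" using rrep[OF l(2)] by blast
   have "fr (e a) b = fr (e a') b'" using l e'_eq ab ab' by metis
   then obtain u where u: "u : S" "act (u*b') (e a) = act (u*b) (e a')" using frE e1 I(2) ab ab' by (metis subsetD)
   have "e (u*b'*a) = e (u*b*a')" using u ab ab' e(1) A_closed by (simp add: is_linear_on_def)
   hence "u*b'*a = u*b*a'" using e(2) u ab ab' A_closed by (simp add: inj_on_eq_iff)
   hence "a*b' = a'*b" using S_nz[OF u(1)] by (simp add: mult_ac)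
   hence "a / b = a' / b'" using S_nz[OF ab(2)] S_nz[OF ab'(2)] by (simp add: frac_eq_eq)
   hence "J l = J l'" using ab(3) ab'(3) by simp
   thus "l = l'" using E.j_eq_iff l by simp
  qed
  have lf: "lmap (I 0) (d 0) (fr m s) = fr (d 0 m) s" if "m : I 0" "s : S" for m s
   by (rule lmap_fr[OF I(1,2) d(1) _ that]) (use d(2)[of 0] I(2)[of "Suc 0"] in auto)
  show "e' ` carrier RP = a_kernel (lmod (I 0)) (lmod (I 1)) (lmap (I 0) (d 0))" unfolding a_kernel_def'
  proof (intro equalityI subsetI)
   fix y assume "y : e' ` carrier RP"
   then obtain l where l: "l : carrier RP" "y = e' l" by auto
   obtain a b where ab: "a : A" "b : S" "J l = a / b" using rrep[OF l(1)] by blast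
   have y: "y = fr (e a) b" using l e'_eq ab by simp
   have ea: "e a : I 0" "d 0 (e a) = 0" using e(3) ab by auto
   hence "lmap (I 0) (d 0) y = fr 0 b" using y lf ab by simp
   also have "\<dots> = fr 0 1" by (rule fr_zero[OF ab(2)])
   finally show "y : {r : carrier (lmod (I 0)). lmap (I 0) (d 0) r = \<zero>\<^bsub>lmod (I 1)\<^esub>}"
    using y ea ab unfolding lmod_simps by auto
  next
   fix y assume y: "y : {r : carrier (lmod (I 0)). lmap (I 0) (d 0) r = \<zero>\<^bsub>lmod (I 1)\<^esub>}"
   then obtain m s where ms: "m : I 0" "s : S" "y = fr m s" unfolding lmod_simps by blast
   have dm: "d 0 m : N" using d(2)[of 0] I(2)[of "Suc 0"] ms by auto
   have "fr (d 0 m) s = fr 0 1" using y ms lf by (simp add: lmod_simps)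
   then obtain u where u: "u : S" "act u (d 0 m) = 0" using fr_zero_iff[OF dm ms(2)] by blast
   have "d 0 (act u m) = 0" using d(1)[of 0] u ms S_A by (simp add: is_linear_on_def)
   moreover have "act u m : I 0" using is_moduleD(3)[OF I(1)] u ms S_A by blast
   ultimately obtain a where a: "a : A" "act u m = e a" using e(3) by auto
   have us: "u*s : S" using S_mult u ms by simp
   obtain l where l: "l : carrier RP" "J l = a / (u*s)" using frac_in_image[OF a(1) us] by blast
   have "e' l = fr (act u m) (u*s)" using e'_eq[OF l a(1) us] a by simp
   also have "\<dots> = y" using fr_same[of m s u] ms u I(2) by auto
   finally show "y : e' ` carrier RP" using l by blast
  qed
  show "lmap (I i) (d i) ` carrier (lmod (I i)) = a_kernel (lmod (I (Suc i))) (lmod (I (Suc (Suc i)))) (lmap (I (Suc i)) (d (Suc i)))" for i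
   by (rule lmap_exact[OF I(1,2) I(1,2) I(1,2) d d ex])
 qed
qed

section \<open>A resolution over a free extension of a polynomial ring\<close>

lemma double_eq_zero: "(x::'a::ab_group_add) = x+x ==> x = 0" by simp

text \<open>Serves in \<open>Hm_baer\<close> to extend \<open>k\<close>-linear functions from an
  ideal to the whole ring.\<close>

lemma linear_projection:
 fixes scale :: "'k::field => 'v::ab_group_add => 'v"
 assumes "vector_space scale" and J: "0 : J" "!!x y. x : J ==> y : J ==> x+y : J" "!!c x. x : J ==> scale c x : J"
 shows "EX p. (ALL x y. p (x+y) = p x+p y) & (ALL c x. p (scale c x) = scale c (p x)) & range p <= J & (ALL x:J. p x = x)"
proof -
 interpret vector_space_pair scale scale using assms(1) by (simp add: vector_space_pair_def)
 have sub: "vs1.subspace J" using J by (simp add: vs1.subspace_def)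
 obtain B where B: "B <= J" "vs1.independent B" "J <= vs1.span B" using vs1.maximal_independent_subset[of J] by metis
 have span: "vs1.span B = J" using B vs1.span_minimal[OF B(1) sub] by blast
 define p where "p = construct B id"
 have lin: "Vector_Spaces.linear scale scale p" unfolding p_def by (rule linear_construct[OF B(2)])
 hence add: "p (x+y) = p x+p y" and sc: "p (scale c x) = scale c (p x)" for c x y
  by (auto simp: Vector_Spaces.linear_iff)
 have "p 0 = 0" using sc[of 0 0] by simp
 hence "vs1.subspace {x. p x = x}" using add sc by (simp add: vs1.subspace_def)
 moreover have "B <= {x. p x = x}" using construct_basis[OF B(2)] by (auto simp: p_def)
 ultimately have "J <= {x. p x = x}" using vs1.span_minimal span by blast
 moreover have "range p <= J" using construct_in_span[OF B(2), of id] span by (auto simp: p_def)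
 ultimately show ?thesis using add sc by blast
qed

text \<open>
  \<open>S\<close> is generated over \<open>k\<close> by \<open>t 0, \<dots>, t (m - 1)\<close>, the operators \<open>q l\<close> divide by \<open>t l\<close> after dropping
  the terms without \<open>t l\<close>, and \<open>lam\<close> is a generator of \<open>Hom S A S\<close>, with dual bases \<open>b\<close> and \<open>b'\<close>.
  The module \<open>Hom k A S\<close> is injective over \<open>A\<close>. On it \<open>t l\<close> acts in two ways, and the submodule
  where the two actions agree for all \<open>l\<close> is \<open>Hom S A S = A\<close>. Since each difference \<open>theta l\<close> is
  surjective on the kernel of the previous ones, the Koszul complex of these differences is a
  resolution of \<open>A\<close>.
\<close>

locale frobenius_extension =
 fixes io :: "'k::field => 'f::field" and A S :: "'f set" and m :: nat and t :: "nat => 'f"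
  and q :: "nat => 'f => 'f" and lam :: "'f => 'f" and r :: nat and b b' :: "nat => 'f"
 assumes io_add: "io (c + c') = io c+io c'" and io_mult: "io (c * c') = io c*io c'" and io_one: "io 1 = 1"
  and A: "is_subring A" and S: "is_subring S" and SA: "S <= A" and io_S: "io c : S"
  and t_S: "l < m ==> t l : S"
  and S_gen: "[|!!c. io c : Z; !!x y. x : Z ==> y : Z ==> x+y : Z; !!l x. l < m ==> x : Z ==> t l*x : Z|] ==> S <= Z"
  and q_A: "l < m ==> x : A ==> q l x : A"
  and q_add: "l < m ==> x : A ==> y : A ==> q l (x+y) = q l x+q l y"
  and q_scale: "l < m ==> x : A ==> q l (io c*x) = io c*q l x"
  and q_self: "l < m ==> x : A ==> q l (t l*x) = x"
  and q_comm: "l < m ==> i < l ==> x : A ==> q l (t i*x) = t i*q l x"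
  and q_nil: "l < m ==> x : A ==> EX n. (q l ^^ n) x = 0"
  and lam_S: "x : A ==> lam x : S"
  and lam_add: "x : A ==> y : A ==> lam (x+y) = lam x+lam y"
  and lam_scale: "x : A ==> s : S ==> lam (s*x) = s*lam x"
  and b_A: "i < r ==> b i : A" and b'_A: "i < r ==> b' i : A"
  and dual: "x : A ==> x = (\<Sum>i<r. lam (x*b' i)*b i)"
begin

lemma S_A: "s : S ==> s : A" using SA by auto
lemma io_A: "io c : A" using io_S SA by auto
lemma t_A: "l < m ==> t l : A" using t_S SA by auto

lemmas AC = is_subring_add[OF A] is_subring_mult[OF A] is_subring_zero[OF A] is_subring_one[OF A] is_subring_diff[OF A] is_subring_uminus[OF A]
lemmas SC = is_subring_add[OF S] is_subring_mult[OF S] is_subring_zero[OF S] is_subring_one[OF S] is_subring_diff[OF S] is_subring_uminus[OF S]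

lemma vs: "vector_space (%c x. io c*x)" by unfold_locales (auto simp: io_add io_mult io_one algebra_simps)

lemma q_zero: "l < m ==> q l 0 = 0" by (rule double_eq_zero) (use q_add[of l 0 0] AC(3) in simp)

text \<open>The functions vanish outside \<open>A\<close>, so that equal homomorphisms are equal
  functions and the group structure is the pointwise one.\<close>

definition Hm :: "('f => 'f) set" where
 "Hm = {phi. (ALL x. x ~: A --> phi x = 0) & (ALL x:A. phi x : S) & (ALL x:A. ALL y:A. phi (x+y) = phi x+phi y) &
  (ALL c. ALL x:A. phi (io c*x) = io c*phi x)}"

definition act :: "'f => ('f => 'f) => 'f => 'f" where
 "act a phi = (%x. if x : A then phi (a*x) else 0)"

definition theta :: "nat => ('f => 'f) => 'f => 'f" where
 "theta l phi = (%x. if x : A then t l*phi x - phi (t l*x) else 0)"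

lemma HmD: assumes "phi : Hm"
 shows "x ~: A ==> phi x = 0" "x : A ==> phi x : S" "x : A ==> y : A ==> phi (x+y) = phi x+phi y"
  "x : A ==> phi (io c*x) = io c*phi x" using assms by (auto simp: Hm_def)

lemma Hm_module: "is_module A act Hm" unfolding is_module_def
proof (intro conjI ballI)
 show "0 : Hm" by (auto simp: Hm_def SC)
 show "u - v : Hm" if "u : Hm" "v : Hm" for u v using that by (auto simp: Hm_def SC algebra_simps)
 show "act a u : Hm" if a: "a : A" "u : Hm" for a u
 proof -
  have "u (a*(io c*x)) = io c*u (a*x)" if "x : A" for c x
   using HmD(4)[OF a(2), of "a*x" c] a that by (simp add: AC mult.left_commute)
  thus ?thesis using HmD(2,3)[OF a(2)] a by (auto simp: Hm_def act_def AC io_A distrib_left)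
 qed
 show "act a (u+v) = act a u+act a v" for a u v by (auto simp: act_def)
 show "act (a + c) u = act a u+act c u" if "a : A" "c : A" "u : Hm" for a c u
  using that HmD(3)[OF that(3)] by (auto simp: act_def AC distrib_right)
 show "act (a * c) u = act a (act c u)" if "a : A" "c : A" "u : Hm" for a c u
  using that by (auto simp: act_def AC mult_ac)
 show "act 1 u = u" if "u : Hm" for u using that by (auto simp: act_def Hm_def)
qed

text \<open>Adjunction: an \<open>A\<close>-linear map \<open>f\<close> from \<open>J\<close> to
  functions on \<open>A\<close> amounts to the \<open>k\<close>-linear function sending
  \<open>x\<close> to \<open>f x 1\<close> on \<open>J\<close>. Composed with a linear projection
  onto \<open>J\<close>, the latter extends to \<open>A\<close>.\<close>

lemma Hm_baer: "is_baer A act Hm" unfolding is_baer_def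
proof (intro allI impI, elim conjE)
 fix J f assume J: "is_ideal A J" and f: "f ` J <= Hm" and lin: "is_linear_on A (*) act J f"
 note Jc = is_idealD[OF J]
 have "EX p. (ALL x y. p (x+y) = p x+p y) & (ALL c x. p (io c*x) = io c*p x) & range p <= J & (ALL x:J. p x = x)"
  by (rule linear_projection[OF vs Jc(2)]) (use Jc(3) Jc(4)[OF io_A] in auto)
 then obtain p where "(ALL x y. p (x+y) = p x+p y) & (ALL c x. p (io c*x) = io c*p x) & range p <= J & (ALL x:J. p x = x)"
  by (rule exE)
 hence p: "!!x y. p (x+y) = p x+p y" "!!c x. p (io c*x) = io c*p x" "range p <= J" "!!x. x : J ==> p x = x" by simp_all
 have fJ: "f x : Hm" if "x : J" for x using f that by auto
 have f1: "f (x+y) 1 = f x 1+f y 1" "f (a*x) = act a (f x)" if "x : J" "y : J" "a : A" for x y a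
  using lin that by (auto simp: is_linear_on_def)
 define h where "h = (%x. if x : A then f (p x) 1 else 0)"
 have pJ: "p x : J" for x using p(3) by auto
 have "h : Hm" unfolding Hm_def
 proof (intro CollectI conjI allI ballI impI)
  show "h x : S" if "x : A" for x using HmD(2)[OF fJ[OF pJ]] AC that by (simp add: h_def)
  show "h (x+y) = h x+h y" if "x : A" "y : A" for x y using that f1(1)[OF pJ pJ AC(3)] by (simp add: h_def AC p(1))
  show "h (io c*x) = io c*h x" if "x : A" for c x
  proof -
   have "f (io c*p x) 1 = f (p x) (io c)" using f1(2)[OF pJ pJ io_A] by (simp add: act_def AC)
   also have "\<dots> = io c*f (p x) 1" using HmD(4)[OF fJ[OF pJ] AC(4), of x c] by simp
   finally show ?thesis using that by (simp add: h_def p(2) AC io_A)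
  qed
 qed (simp add: h_def)
 moreover have "f x = act x h" if x: "x : J" for x
 proof
  fix y show "f x y = act x h y"
  proof (cases "y : A")
   case True
   hence yx: "y*x : J" "y*x : A" using Jc(1,4) x by auto
   hence "act x h y = f (y*x) 1" using True p(4) by (simp add: act_def h_def mult.commute)
   also have "\<dots> = f x y" using f1(2)[OF x x True] True by (simp add: act_def AC)
   finally show ?thesis by simp
  next
   case False
   thus ?thesis using HmD(1)[OF fJ[OF x]] by (simp add: act_def)
  qed
 qed
 ultimately show "EX m:Hm. ALL x:J. f x = act x m" by blast
qed

lemma theta_Hm: "l < m ==> phi : Hm ==> theta l phi : Hm"
proof -
 assume l: "l < m" and f: "phi : Hm"
 have "phi (t l*(io c*x)) = io c*phi (t l*x)" if "x : A" for c x
  using HmD(4)[OF f, of "t l*x" c] l that t_A by (simp add: AC mult.left_commute)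
 thus ?thesis using HmD(2-4)[OF f] t_A[OF l] t_S[OF l] by (auto simp: Hm_def theta_def AC SC io_A algebra_simps)
qed

lemma theta_add: "theta l (phi+psi) = theta l phi+theta l psi"
 and theta_diff: "theta l (phi - psi) = theta l phi - theta l psi"
 and theta_zero: "theta l 0 = 0" by (auto simp: theta_def algebra_simps)

lemma theta_act: "l < m ==> a : A ==> theta l (act a phi) = act a (theta l phi)"
 using t_A by (auto simp: theta_def act_def AC mult_ac)

lemma theta_comm: "l < m ==> k < m ==> theta l (theta k phi) = theta k (theta l phi)"
 using t_A by (auto simp: theta_def AC algebra_simps)

definition Hk :: "nat => ('f => 'f) set" where
 "Hk i = {phi:Hm. ALL l<i. theta l phi = 0}"

text \<open>The preimage of \<open>psi\<close> is \<open>x \<mapsto> - (psi (q x) + t psi (q (q x)) + t\<^sup>2 psi (q (q (q x))) + \<dots>)\<close>.\<close>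

lemma theta_surj: assumes i: "i < m" and psi: "psi : Hk i" shows "EX phi:Hk i. theta i phi = psi"
proof -
 have psiH: "psi : Hm" and psit: "!!l. l < i ==> theta l psi = 0" using psi by (auto simp: Hk_def)
 note P = HmD[OF psiH]
 have psic: "psi (t l*x) = t l*psi x" if "l < i" "x : A" for l x
  using fun_cong[OF psit[OF that(1)], of x] that(2) by (simp add: theta_def)
 have qA: "(q i ^^ n) x : A" if "x : A" for n x using that q_A[OF i] by (induction n) auto
 have q0: "(q i ^^ n) 0 = 0" for n using q_zero[OF i] by (induction n) auto
 have qadd: "(q i ^^ n) (x+y) = (q i ^^ n) x+(q i ^^ n) y" if "x : A" "y : A" for n x y
  using that qA q_add[OF i] by (induction n) auto
 have qsc: "(q i ^^ n) (io c*x) = io c*(q i ^^ n) x" if "x : A" for n c x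
  using that qA q_scale[OF i] by (induction n) auto
 have qco: "(q i ^^ n) (t l*x) = t l*(q i ^^ n) x" if "x : A" "l < i" for n l x
  using that qA q_comm[OF i] by (induction n) auto
 have psi0: "psi 0 = 0" by (rule double_eq_zero) (use P(3)[of 0 0] AC in simp)
 define F where "F N x = - (\<Sum>n<N. t i^n*psi ((q i ^^ Suc n) x))" for N x
 define nz where "nz x = (LEAST n. (q i ^^ n) x = 0)" for x
 have nz: "(q i ^^ n) x = 0" if x: "x : A" and n: "nz x <= n" for x n
 proof -
  have "(q i ^^ nz x) x = 0" unfolding nz_def using q_nil[OF i x] by (rule LeastI_ex)
  hence "(q i ^^ (n - nz x+nz x)) x = 0" by (simp only: funpow_add comp_apply q0)
  thus ?thesis using n by simp
 qed
 have FN: "F N x = F (nz x) x" if x: "x : A" and N: "nz x <= N" for x N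
 proof -
  have "(\<Sum>n<N. t i^n*psi ((q i ^^ Suc n) x)) = (\<Sum>n<nz x. t i^n*psi ((q i ^^ Suc n) x))"
  proof (rule sum.mono_neutral_right)
   show "ALL n:{..<N} - {..<nz x}. t i^n*psi ((q i ^^ Suc n) x) = 0"
   proof
    fix n assume "n : {..<N} - {..<nz x}"
    hence "(q i ^^ Suc n) x = 0" by (intro nz[OF x]) auto
    thus "t i^n*psi ((q i ^^ Suc n) x) = 0" by (simp only: psi0 mult_zero_right)
   qed
  qed (use N in auto)
  thus ?thesis by (simp add: F_def)
 qed
 define phi where "phi = (%x. if x : A then F (nz x) x else 0)"
 have phiF: "phi x = F N x" if "x : A" "nz x <= N" for x N unfolding phi_def using FN[OF that] that(1) by (simp only: if_True)
 have phiS: "phi x : S" if "x : A" for x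
 proof -
  have "t i^n*psi ((q i ^^ Suc n) x) : S" for n
   by (rule SC(2)[OF is_subring_power[OF S t_S[OF i]] P(2)[OF qA[OF that]]])
  hence "F (nz x) x : S" unfolding F_def by (intro SC(6) is_subring_sum[OF S])
  thus ?thesis using that by (simp add: phi_def)
 qed
 have phiH: "phi : Hm" unfolding Hm_def
 proof (intro CollectI conjI allI ballI impI)
  show "phi x = 0" if "x ~: A" for x using that by (simp add: phi_def)
  show "phi x : S" if "x : A" for x by (rule phiS[OF that])
  show "phi (x+y) = phi x+phi y" if "x : A" "y : A" for x y
  proof -
   define N where "N = nz x+nz y+nz (x+y)"
   have "F N (x+y) = F N x+F N y" unfolding F_def using that qA
    by (simp add: qadd P(3) distrib_left sum.distrib del: funpow.simps)
   thus ?thesis using that phiF[of x N] phiF[of y N] phiF[of "x+y" N] by (simp add: N_def AC)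
  qed
  show "phi (io c*x) = io c*phi x" if "x : A" for c x
  proof -
   define N where "N = nz x+nz (io c*x)"
   have "F N (io c*x) = io c*F N x" unfolding F_def using that qA
    by (simp add: qsc P(4) sum_distrib_left mult.left_commute del: funpow.simps)
   thus ?thesis using that phiF[of x N] phiF[of "io c*x" N] by (simp add: N_def AC io_A)
  qed
 qed
 have "phi (t l*x) = t l*phi x" if "x : A" "l < i" for x l
 proof -
  have tl: "t l : A" using t_A that i by simp
  define N where "N = nz x+nz (t l*x)"
  have "F N (t l*x) = t l*F N x" unfolding F_def using that qA
   by (simp add: qco psic sum_distrib_left mult.left_commute del: funpow.simps)
  thus ?thesis using that tl phiF[of x N] phiF[of "t l*x" N] by (simp add: N_def AC)
 qed
 hence "theta l phi = 0" if "l < i" for l using that by (auto simp: theta_def)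
 hence "phi : Hk i" using phiH by (simp add: Hk_def)
 moreover have "theta i phi = psi"
 proof
  fix x show "theta i phi x = psi x"
  proof (cases "x : A")
   case True
   define N where "N = nz x+nz (t i*x)"
   have tx: "t i*x : A" using True t_A[OF i] AC by simp
   have "(q i ^^ Suc n) (t i*x) = (q i ^^ n) x" for n by (simp only: funpow_Suc_right comp_apply q_self[OF i True])
   hence "F (Suc N) (t i*x) = - (\<Sum>n<Suc N. t i^n*psi ((q i ^^ n) x))" by (simp only: F_def)
   also have "\<dots> = - (psi x+(\<Sum>n<N. t i^Suc n*psi ((q i ^^ Suc n) x)))" by (subst sum.lessThan_Suc_shift) simp
   also have "\<dots> = - psi x+t i*F N x" by (simp add: F_def sum_distrib_left mult.assoc)
   finally have "phi (t i*x) = - psi x+t i*phi x" using phiF[OF tx, of "Suc N"] phiF[OF True, of N] by (simp add: N_def)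
   thus ?thesis using True by (simp add: theta_def)
  next
   case False
   thus ?thesis using P(1) by (simp add: theta_def)
  qed
 qed
 ultimately show ?thesis by blast
qed

definition eA :: "'f => 'f => 'f" where
 "eA a = (%x. if x : A then lam (a*x) else 0)"

text \<open>Vanishing of all \<open>theta l\<close> means compatibility with the generators of
  \<open>S\<close>, hence \<open>S\<close>-linearity. An \<open>S\<close>-linear function is
  determined by its values on the basis \<open>b\<close>, and the dual basis turns these values into
  the element \<open>a\<close> representing it through \<open>lam\<close>.\<close>

lemma eA_Hk: "eA ` A = Hk m"
proof (intro equalityI subsetI)
 fix phi assume "phi : eA ` A"
 then obtain a where a: "a : A" "phi = eA a" by auto
 have sc: "lam (a*(s*x)) = s*lam (a*x)" if "s : S" "x : A" for s x
  using lam_scale[of "a*x" s] that a by (simp add: AC mult.left_commute)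
 have "phi : Hm" using a sc[OF io_S] by (auto simp: Hm_def eA_def AC io_A lam_S lam_add distrib_left)
 moreover have "theta l phi = 0" if "l < m" for l
  using sc[OF t_S[OF that]] t_A[OF that] a by (auto simp: theta_def eA_def AC)
 ultimately show "phi : Hk m" by (simp add: Hk_def)
next
 fix phi assume p: "phi : Hk m"
 hence H: "phi : Hm" by (simp add: Hk_def)
 have tc: "phi (t l*x) = t l*phi x" if "l < m" "x : A" for l x
 proof -
  have "theta l phi x = 0" using p that by (simp add: Hk_def)
  thus ?thesis using that by (simp add: theta_def)
 qed
 have "S <= {s:A. ALL x:A. phi (s*x) = s*phi x}"
  by (rule S_gen) (use HmD(3,4)[OF H] tc t_A in \<open>auto simp: AC io_A distrib_right mult.assoc\<close>)
 hence lin: "phi (s*x) = s*phi x" if "s : S" "x : A" for s x using that by auto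
 have phi0: "phi 0 = 0" by (rule double_eq_zero) (use HmD(3)[OF H, of 0 0] AC in simp)
 have sum: "phi (sum f I) = (\<Sum>i\<in>I. phi (f i))" if "finite I" "!!i. i : I ==> f i : A" for f and I :: "nat set"
  using that
 proof (induction I rule: finite_induct)
  case (insert i I)
  thus ?case using HmD(3)[OF H] is_subring_sum[OF A, of I f] by simp
 qed (simp add: phi0)
 have lam_sum: "lam (sum f I) = (\<Sum>i\<in>I. lam (f i))" if "finite I" "!!i. i : I ==> f i : A" for f and I :: "nat set"
  using that
 proof (induction I rule: finite_induct)
  case empty
  have "lam 0 = 0" by (rule double_eq_zero) (use lam_add[of 0 0] AC in simp)
  thus ?case by simp
 next
  case (insert i I)
  thus ?case using lam_add is_subring_sum[OF A, of I f] by simp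
 qed
 define a where "a = (\<Sum>i<r. phi (b i)*b' i)"
 have aA: "a : A" unfolding a_def using HmD(2)[OF H] b_A b'_A S_A by (auto intro!: is_subring_sum[OF A] AC(2))
 have "phi x = eA a x" for x
 proof (cases "x : A")
  case True
  have lA: "lam y : A" if "y : A" for y using lam_S S_A that by blast
  have "phi x = phi (\<Sum>i<r. lam (x*b' i)*b i)" using dual[OF True] by simp
  also have "\<dots> = (\<Sum>i<r. phi (lam (x*b' i)*b i))" by (rule sum) (use True b_A b'_A lA AC(2) in auto)
  also have "\<dots> = (\<Sum>i<r. lam (x*b' i)*phi (b i))" using True b_A b'_A lam_S lin AC by (intro sum.cong) auto
  also have "\<dots> = (\<Sum>i<r. lam (phi (b i)*b' i*x))"
  proof (rule sum.cong)
   fix i assume "i : {..<r}"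
   thus "lam (x*b' i)*phi (b i) = lam (phi (b i)*b' i*x)"
    using lam_scale[of "x*b' i" "phi (b i)"] True b_A b'_A HmD(2)[OF H] AC by (simp add: mult_ac)
  qed simp
  also have "\<dots> = lam (a*x)" unfolding a_def sum_distrib_right using True b_A b'_A HmD(2)[OF H] S_A AC
   by (intro lam_sum[symmetric]) auto
  finally show ?thesis using True by (simp add: eA_def)
 next
  case False
  thus ?thesis using HmD(1)[OF H] by (simp add: eA_def)
 qed
 thus "phi : eA ` A" using aA by blast
qed

lemma eA_inj: "inj_on eA A"
proof (rule inj_onI)
 fix x y assume xy: "x : A" "y : A" "eA x = eA y"
 have "lam (x*b' i) = lam (y*b' i)" if "i < r" for i
  using fun_cong[OF xy(3), of "b' i"] b'_A[OF that] by (simp add: eA_def)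
 thus "x = y" using dual[OF xy(1)] dual[OF xy(2)] by simp
qed

lemma eA_linear: "is_linear_on A (*) act A eA"
 by (auto simp: is_linear_on_def eA_def act_def AC lam_add distrib_right mult.assoc mult.left_commute fun_eq_iff)

section \<open>The Koszul complex\<close>

text \<open>
  The modules of the complex are powers of \<open>Hm\<close>, realized as sequences supported on a set of
  indices. The complex for \<open>i + 1\<close> differences is the mapping cone of \<open>theta i\<close> on the complex for \<open>i\<close>,
  whose two parts are put in the even and the odd positions.
\<close>

primrec ix :: "nat => nat => nat set" where
 "ix 0 p = (if p = 0 then {0} else {})"
| "ix (Suc i) p = {n. if even n then n div 2 : ix i p else p > 0 & n div 2 : ix i (p - 1)}"

definition ev :: "(nat => 'f => 'f) => nat => 'f => 'f" where "ev f = (%n. f (2*n))"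
definition od :: "(nat => 'f => 'f) => nat => 'f => 'f" where "od f = (%n. f (Suc (2*n)))"
definition jn :: "(nat => 'f => 'f) => (nat => 'f => 'f) => nat => 'f => 'f" where
 "jn u v = (%n. if even n then u (n div 2) else v (n div 2))"
definition th :: "nat => (nat => 'f => 'f) => nat => 'f => 'f" where "th l f = (%n. theta l (f n))"
definition actn :: "'f => (nat => 'f => 'f) => nat => 'f => 'f" where "actn a f = (%n. act a (f n))"

definition pw :: "nat set => (nat => 'f => 'f) set" where
 "pw D = {f. (ALL n:D. f n : Hm) & (ALL n. n ~: D --> f n = 0)}"

abbreviation "cx i p \<equiv> pw (ix i p)"

text \<open>Cone differential: \<open>(u, v)\<close> goes to \<open>(d u, theta u - d v)\<close>. As
  \<open>theta\<close> commutes with \<open>d\<close>, the minus sign makes the square vanish. In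
  degree \<open>0\<close> the second component is absent.\<close>

primrec dd :: "nat => nat => (nat => 'f => 'f) => nat => 'f => 'f" where
 "dd 0 p f = 0"
| "dd (Suc i) p f = jn (dd i p (ev f)) (th i (ev f) - (if p = 0 then 0 else dd i (p - 1) (od f)))"

definition e0 :: "('f => 'f) => nat => 'f => 'f" where "e0 phi = (%n. if n = 0 then phi else 0)"

lemma fun_zero_eq [simp]: "(%n x. 0) = (0 :: nat => 'f => 'f)" by (simp add: fun_eq_iff)

lemma jn_ev_od: "jn (ev f) (od f) = f"
proof
 fix n show "jn (ev f) (od f) n = f n" by (cases "even n") (auto simp: jn_def ev_def od_def)
qed

lemma ev_jn [simp]: "ev (jn u v) = u" and od_jn [simp]: "od (jn u v) = v" by (auto simp: jn_def ev_def od_def)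

lemma jn_eq_iff: "jn u v = jn u' v' \<longleftrightarrow> u = u' & v = v'" using ev_jn od_jn by metis

lemma jn_zero: "jn 0 0 = 0" by (auto simp: jn_def)
lemma jn_add: "jn u v+jn u' v' = jn (u+u') (v+v')" by (auto simp: jn_def)
lemma ev_add: "ev (f+g) = ev f+ev g" and od_add: "od (f+g) = od f + od g" by (auto simp: ev_def od_def fun_eq_iff)
lemma jn_act: "actn a (jn u v) = jn (actn a u) (actn a v)" and ev_act: "ev (actn a f) = actn a (ev f)"
 and od_act: "od (actn a f) = actn a (od f)" by (auto simp: jn_def ev_def od_def actn_def)
lemma jn_th: "th l (jn u v) = jn (th l u) (th l v)" and ev_th: "ev (th l f) = th l (ev f)"
 and od_th: "od (th l f) = th l (od f)" by (auto simp: jn_def ev_def od_def th_def)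
lemma th_add: "th l (f+g) = th l f+th l g" and th_diff: "th l (f - g) = th l f - th l g" and th_zero: "th l 0 = 0"
 by (auto simp: th_def theta_add theta_diff theta_zero)
lemma th_act: "l < m ==> a : A ==> th l (actn a f) = actn a (th l f)" by (auto simp: th_def actn_def theta_act)
lemma th_comm: "l < m ==> k < m ==> th l (th k f) = th k (th l f)" by (auto simp: th_def theta_comm)
lemma actn_diff: "actn a (f - g) = actn a f - actn a g" and actn_zero: "actn a 0 = 0"
 and actn_add: "actn a (f+g) = actn a f+actn a g" by (auto simp: actn_def act_def fun_eq_iff)

lemma pw_module: "is_module A actn (pw D)"
proof -
 note H = is_moduleD[OF Hm_module]
 have a0: "act a 0 = 0" for a by (auto simp: act_def)
 have 0: "act (a + c) (u n) = act a (u n)+act c (u n)" "act (a * c) (u n) = act a (act c (u n))" "act 1 (u n) = u n"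
  if "a : A" "c : A" "u : pw D" for a c u n using that H a0 by (cases "n : D"; auto simp: pw_def)+
 show ?thesis unfolding is_module_def
 proof (intro conjI ballI)
  show "0 : pw D" using H(1) by (simp add: pw_def)
  show "u - v : pw D" if "u : pw D" "v : pw D" for u v using that H(2) by (simp add: pw_def)
  show "actn a u : pw D" if "a : A" "u : pw D" for a u using that H(3) a0 by (simp add: pw_def actn_def)
  show "actn a (u+v) = actn a u+actn a v" for a u v by (rule actn_add)
  show "actn (a + c) u = actn a u+actn c u" if "a : A" "c : A" "u : pw D" for a c u
   by (rule ext) (simp add: actn_def 0(1)[OF that])
  show "actn (a * c) u = actn a (actn c u)" if "a : A" "c : A" "u : pw D" for a c u
   by (rule ext) (simp add: actn_def 0(2)[OF that])
  show "actn 1 u = u" if "u : pw D" for u by (rule ext) (simp add: actn_def 0(3)[OF AC(4) AC(4) that])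
 qed
qed

lemma pw_baer: "is_baer A actn (pw D)" unfolding is_baer_def
proof (intro allI impI, elim conjE)
 fix J f assume J: "is_ideal A J" and f: "f ` J <= pw D" and lin: "is_linear_on A (*) actn J f"
 have "EX u. (n : D --> u : Hm) & (n ~: D --> u = 0) & (ALL x:J. f x n = act x u)" for n
 proof (cases "n : D")
  case True
  have "(%x. f x n) ` J <= Hm" using f True by (auto simp: pw_def)
  moreover have "is_linear_on A (*) act J (%x. f x n)" using lin by (auto simp: is_linear_on_def actn_def)
  ultimately show ?thesis using is_baerD[OF Hm_baer J] True by blast
 next
  case False
  have "act x 0 = 0" for x by (auto simp: act_def)
  thus ?thesis using False f by (auto simp: pw_def)
 qed
 then obtain u where "!!n. n : D ==> u n : Hm" "!!n. n ~: D ==> u n = 0" "!!n x. x : J ==> f x n = act x (u n)" by metis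
 thus "EX m:pw D. ALL x:J. f x = actn x m" by (intro bexI[of _ u]) (auto simp: pw_def actn_def)
qed

lemma cx_Suc: "f : cx (Suc i) p \<longleftrightarrow> ev f : cx i p & (if p = 0 then od f = 0 else od f : cx i (p - 1))"
proof -
 have all: "(ALL n. P n) \<longleftrightarrow> (ALL n. P (2*n)) & (ALL n. P (Suc (2*n)))" for P :: "nat => bool"
  by (metis evenE oddE Suc_eq_plus1)
 have "f : cx (Suc i) p \<longleftrightarrow> (ALL n. if n : ix (Suc i) p then f n : Hm else f n = 0)"
  by (auto simp: pw_def)
 also have "\<dots> \<longleftrightarrow> (ALL n. if n : ix i p then ev f n : Hm else ev f n = 0) &
   (ALL n. if p > 0 & n : ix i (p - 1) then od f n : Hm else od f n = 0)" by (subst all) (simp add: ev_def od_def)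
 also have "\<dots> \<longleftrightarrow> ev f : cx i p & (if p = 0 then od f = 0 else od f : cx i (p - 1))"
  by (auto simp: pw_def fun_eq_iff[where 'a = nat])
 finally show ?thesis .
qed

declare ix.simps(2) [simp del]

lemma th_pw: "l < m ==> f : pw D ==> th l f : pw D" by (auto simp: pw_def th_def theta_Hm theta_zero)

lemma pw_diff: "f : pw D ==> g : pw D ==> f - g : pw D" by (rule is_moduleD(2)[OF pw_module])
lemma pw_zero: "0 : pw D" by (rule is_moduleD(1)[OF pw_module])

lemma dd_add: "dd i p (f+g) = dd i p f+dd i p g"
 by (induction i arbitrary: p f g) (auto simp: ev_add od_add th_add jn_add add_diff_add)

lemma dd_zero: "dd i p 0 = 0" using dd_add[of i p 0 0] by simp

lemma dd_diff: "dd i p (f - g) = dd i p f - dd i p g" using dd_add[of i p "f - g" g] by (simp add: algebra_simps)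

lemma dd_act: "i <= m ==> a : A ==> dd i p (actn a f) = actn a (dd i p f)"
 by (induction i arbitrary: p f) (auto simp: ev_act od_act th_act jn_act actn_diff actn_zero)

lemma dd_th: "i <= m ==> l < m ==> dd i p (th l f) = th l (dd i p f)"
 by (induction i arbitrary: p f) (auto simp: ev_th od_th th_comm jn_th th_diff th_zero)

lemma dd_cx: "i <= m ==> f : cx i p ==> dd i p f : cx i (Suc p)"
proof (induction i arbitrary: p f)
 case 0 thus ?case by (simp add: pw_zero)
next
 case (Suc i)
 hence f: "ev f : cx i p" "p ~= 0 ==> od f : cx i (p - 1)" using cx_Suc by (auto split: if_splits)
 have "dd i (p - 1) (od f) : cx i p" if "p ~= 0" using Suc.IH[of "od f" "p - 1"] Suc.prems f(2) that by simp
 moreover have "dd i p (ev f) : cx i (Suc p)" "th i (ev f) : cx i p" using Suc f th_pw by auto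
 ultimately show ?case unfolding cx_Suc by (cases "p = 0") (auto intro: pw_diff)
qed

lemma cx_vanish: "p > i ==> cx i p = {0}"
proof -
 have "p > i ==> ix i p = {}"
 proof (induction i arbitrary: p)
  case (Suc i)
  hence "ix i p = {}" "ix i (p - 1) = {}" by auto
  thus ?case by (auto simp: ix.simps(2))
 qed simp
 moreover have "pw {} = {0}" by (auto simp: pw_def)
 ultimately show "p > i ==> cx i p = {0}" by simp
qed

lemma e0_cx: "phi : Hm ==> e0 phi : cx i 0"
proof (induction i)
 case (Suc i)
 have "ev (e0 phi) = e0 phi" "od (e0 phi) = 0" by (auto simp: ev_def od_def e0_def)
 thus ?case using Suc cx_Suc[of "e0 phi" i 0] by simp
qed (auto simp: pw_def e0_def)

lemma e0_th: "th l (e0 phi) = e0 (theta l phi)" by (auto simp: th_def e0_def theta_zero)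

lemma cx_kernel: "i <= m ==> {u : cx i 0. dd i 0 u = 0} = e0 ` Hk i"
proof (induction i)
 case 0
 have "u : e0 ` Hk 0" if "u : cx 0 0" for u
 proof (rule image_eqI[of _ _ "u 0"])
  show "u = e0 (u 0)" using that by (auto simp: pw_def e0_def)
  show "u 0 : Hk 0" using that by (auto simp: pw_def Hk_def)
 qed
 moreover have "e0 ` Hk 0 <= cx 0 0" using e0_cx[of _ 0] by (auto simp: Hk_def)
 ultimately show ?case by auto
next
 case (Suc i)
 note ex = ev_jn od_jn
 have ev0: "ev (e0 phi) = e0 phi" "od (e0 phi) = 0" for phi by (auto simp: ev_def od_def e0_def)
 show ?case
 proof (intro equalityI subsetI)
  fix u assume u: "u : {u : cx (Suc i) 0. dd (Suc i) 0 u = 0}"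
  hence h: "ev u : cx i 0" "od u = 0" using cx_Suc[of u i 0] by auto
  have "jn (dd i 0 (ev u)) (th i (ev u)) = jn 0 0" using u by (simp add: jn_zero)
  hence d: "dd i 0 (ev u) = 0" "th i (ev u) = 0" by (auto simp: jn_eq_iff)
  have "ev u : e0 ` Hk i" using Suc h d by auto
  then obtain phi where p: "phi : Hk i" "ev u = e0 phi" by auto
  have "theta i phi = 0" using fun_cong[OF d(2), of 0] by (simp add: p e0_def th_def)
  hence "phi : Hk (Suc i)" using p by (auto simp: Hk_def less_Suc_eq)
  moreover have "u = e0 phi" using jn_ev_od[of u] jn_ev_od[of "e0 phi"] h p ev0 by simp
  ultimately show "u : e0 ` Hk (Suc i)" by auto
 next
  fix u assume "u : e0 ` Hk (Suc i)"
  then obtain phi where p: "phi : Hk (Suc i)" "u = e0 phi" by auto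
  hence k: "phi : Hk i" "theta i phi = 0" "phi : Hm" by (auto simp: Hk_def)
  have "e0 phi : {u : cx i 0. dd i 0 u = 0}" using Suc k by auto
  moreover have "e0 0 = 0" by (auto simp: e0_def)
  ultimately show "u : {u : cx (Suc i) 0. dd (Suc i) 0 u = 0}"
   using p k ev0 e0_cx[of phi "Suc i"] by (simp add: e0_th jn_zero)
 qed
qed

text \<open>In a cocycle of the cone the even part is a boundary by induction. After matching it,
  the discrepancy \<open>z\<close> of the odd part is a cocycle of the smaller complex. In positive
  degree \<open>z\<close> is a boundary; in degree \<open>0\<close> it comes from
  \<open>Hk i\<close>, and surjectivity of \<open>theta i\<close> removes it by a change of
  \<open>u'\<close>.\<close>

lemma cx_exact: "i <= m ==> dd i p ` cx i p = {u : cx i (Suc p). dd i (Suc p) u = 0}"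
proof (induction i arbitrary: p)
 case 0
 have "cx 0 (Suc p) = {0}" by (rule cx_vanish) simp
 moreover have "cx 0 p ~= {}" using pw_zero by blast
 moreover have "dd 0 p ` cx 0 p = (%_. 0) ` cx 0 p" by (rule image_cong) simp_all
 ultimately show ?case by (auto simp: image_constant_conv)
next
 case (Suc i)
 have im: "i <= m" "i < m" using Suc by auto
 have d2: "dd i (Suc p) (dd i p u) = 0" if "u : cx i p" for u p using Suc.IH[of p] im that by blast
 show ?case
 proof (intro equalityI subsetI)
  fix u assume "u : dd (Suc i) p ` cx (Suc i) p"
  then obtain w where w: "w : cx (Suc i) p" "u = dd (Suc i) p w" by auto
  hence h: "ev w : cx i p" "p ~= 0 ==> od w : cx i (p - 1)" using cx_Suc by (auto split: if_splits)
  have "dd i p (dd i (p - 1) (od w)) = 0" if "p ~= 0" using d2[OF h(2)[OF that]] that by simp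
  hence "dd (Suc i) (Suc p) u = 0" using w h d2[OF h(1)] im by (auto simp: dd_diff dd_th dd_zero th_zero jn_zero)
  thus "u : {u : cx (Suc i) (Suc p). dd (Suc i) (Suc p) u = 0}" using dd_cx[OF Suc.prems w(1)] w by simp
 next
  fix u assume u: "u : {u : cx (Suc i) (Suc p). dd (Suc i) (Suc p) u = 0}"
  hence h: "ev u : cx i (Suc p)" "od u : cx i p" using cx_Suc[of u i "Suc p"] by auto
  have "jn (dd i (Suc p) (ev u)) (th i (ev u) - dd i p (od u)) = jn 0 0" using u by (simp add: jn_zero)
  hence d: "dd i (Suc p) (ev u) = 0" "th i (ev u) = dd i p (od u)" by (auto simp: jn_eq_iff)
  obtain u' where u': "u' : cx i p" "ev u = dd i p u'" using Suc.IH[of p] im h d by blast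
  define z where "z = th i u' - od u"
  have z: "z : cx i p" "dd i p z = 0" using u' h d im by (auto simp: z_def pw_diff th_pw dd_diff dd_th)
  show "u : dd (Suc i) p ` cx (Suc i) p"
  proof (cases "p = 0")
   case True
   hence "z : e0 ` Hk i" using z cx_kernel[OF im(1)] by auto
   then obtain phi where p: "phi : Hk i" "z = e0 phi" by auto
   obtain psi where s: "psi : Hk i" "theta i psi = phi" using theta_surj[OF im(2) p(1)] by auto
   have ps: "e0 psi : cx i 0" "dd i 0 (e0 psi) = 0" using cx_kernel[OF im(1)] s by auto
   define w where "w = jn (u' - e0 psi) 0"
   have "w : cx (Suc i) p" using True u' ps pw_diff by (simp add: w_def cx_Suc)
   moreover have "dd (Suc i) p w = u"
   proof -
    have "dd (Suc i) p w = jn (dd i p u') (th i u' - z)" using True ps p s by (simp add: w_def dd_diff th_diff e0_th)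
    thus ?thesis using u' jn_ev_od[of u] by (simp add: z_def)
   qed
   ultimately show ?thesis by blast
  next
   case False
   then obtain p' where p': "p = Suc p'" by (cases p) auto
   obtain z' where z': "z' : cx i p'" "z = dd i p' z'" using Suc.IH[of p'] im z p' by blast
   define w where "w = jn u' z'"
   have "w : cx (Suc i) p" using u' z' p' by (simp add: w_def cx_Suc)
   moreover have "dd (Suc i) p w = u" using p' z' u' jn_ev_od[of u] by (simp add: w_def z_def algebra_simps)
   ultimately show ?thesis by blast
  qed
 qed
qed

end

section \<open>Encoding the localized resolution in the prescribed type\<close>

lemma inj_nat_triples: assumes "infinite C"
 shows "EX f :: nat \<times> 'a \<times> 'a => 'a. inj_on f (UNIV \<times> C \<times> C)"
proof -
 have CC: "(card_of C, card_of C) : ordLeq" by (rule card_of_refl[THEN ordIso_imp_ordLeq])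
 have "(card_of (UNIV :: nat set), card_of C) : ordLeq" using assms infinite_iff_card_of_nat by blast
 moreover have "(card_of (C \<times> C), card_of C) : ordLeq" by (rule card_of_Times_ordLeq_infinite[OF assms CC CC])
 ultimately have "(card_of ((UNIV :: nat set) \<times> C \<times> C), card_of C) : ordLeq"
  by (rule card_of_Times_ordLeq_infinite[OF assms])
 thus ?thesis unfolding card_of_ordLeq[symmetric] by blast
qed

text \<open>Elements of the local rings have type \<open>('a \<times> 'a) set\<close>, so those of
  the injective modules must be functions from this type to itself. A sequence of functions together
  with a denominator is coded by one subset of \<open>'a \<times> 'a\<close>; a fraction is a set of
  such pairs, and the set of their codes is given by an indicator function.\<close>

theorem spec_gorenstein:
 fixes R :: "('a, 'r) ring_scheme" and j :: "'a => 'f::field" and io :: "'k::field => 'f"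
 assumes emb: "embedded_cring R j" and inf: "infinite (carrier R)"
  and frob: "frobenius_extension io (j ` carrier R) T m t q lam r b b'"
  and noeth: "noetherian (j ` carrier R)" shows "Spec_gorenstein R"
proof -
 interpret embedded_cring R j by fact
 define A where "A = j ` carrier R"
 interpret X: frobenius_extension io A T m t q lam r b b' using frob by (simp add: A_def)
 have "gorenstein_local_ring (local_at R P)" if P: "primeideal P R" for P
 proof -
  define S where "S = A - j ` P"
  define N where "N = X.pw UNIV"
  have modN: "is_module A X.actn N" unfolding N_def by (rule X.pw_module)
  have prime: "is_prime_ideal A (j ` P)" unfolding A_def by (rule prime_ideal_image[OF P])
  have S: "1 : S" "!!s t. s : S ==> t : S ==> s*t : S" "!!s. s : S ==> s : A"
   using prime is_subring_one[OF X.A] is_subring_mult[OF X.A] by (auto simp: S_def is_prime_ideal_def)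
  obtain f :: "nat \<times> 'a \<times> 'a => 'a" where f: "inj_on f (UNIV \<times> carrier R \<times> carrier R)"
   using inj_nat_triples[OF inf] by blast
  define iv where "iv = inv_into (carrier R) j"
  have iv: "iv x : carrier R" "j (iv x) = x" if "x : A" for x
   using that unfolding iv_def A_def by (auto intro: inv_into_into f_inv_into_f)
  have iv_eq: "x = y" if "iv x = iv y" "x : A" "y : A" for x y using iv(2) that by metis
  \<comment> \<open>The graph of \<open>g\<close>, pulled back to \<open>R\<close>, is packed into
    the first components by the injection \<open>f\<close>; the second components all repeat the
    denominator.\<close>
  define code :: "(nat => 'f => 'f) \<times> 'f => ('a \<times> 'a) set" where
   "code = (%(g, s). (%(n, x). (f (n, iv x, iv (g n x)), iv s)) ` (UNIV \<times> A))"
  have gA: "g n x : A" if "g : N" "x : A" for g n x using that X.HmD(2) X.S_A unfolding N_def X.pw_def by blast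
  have code_sub: "(ALL n. ALL x:A. g n x = g' n x) & s = s'"
   if c: "code (g, s) <= code (g', s')" and h: "g : N" "g' : N" "s : A" "s' : A" for g s g' s'
  proof -
   have *: "g n x = g' n x & s = s'" if x: "x : A" for n x
   proof -
    have "(f (n, iv x, iv (g n x)), iv s) : code (g, s)" using x by (auto simp: code_def)
    then obtain n' x' where y: "x' : A" "f (n, iv x, iv (g n x)) = f (n', iv x', iv (g' n' x'))" "iv s = iv s'"
     using c by (auto simp: code_def)
    have "(n, iv x, iv (g n x)) = (n', iv x', iv (g' n' x'))" by (rule inj_onD[OF f y(2)]) (use iv gA x y h in auto)
    thus ?thesis using iv_eq y x h gA by (metis prod.inject)
   qed
   thus ?thesis using is_subring_one[OF X.A] by blast
  qed
  have code_inj: "inj_on code (N \<times> A)"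
  proof (rule inj_onI)
   fix p p' assume "p : N \<times> A" "p' : N \<times> A" and eq: "code p = code p'"
   then obtain g s g' s' where h: "p = (g, s)" "p' = (g', s')" "g : N" "g' : N" "s : A" "s' : A" by auto
   have c: "(ALL n. ALL x:A. g n x = g' n x) & s = s'" using code_sub[of g s g' s'] eq h by simp
   have out: "g n x = 0" "g' n x = 0" if "x ~: A" for n x using that h X.HmD(1) unfolding N_def X.pw_def by blast+
   have "g = g'"
   proof (intro ext)
    fix n x show "g n x = g' n x" using c out by (cases "x : A") auto
   qed
   thus "p = p'" using c h by simp
  qed
  define enc :: "((nat => 'f => 'f) \<times> 'f) set => ('a \<times> 'a) set => ('a \<times> 'a) set" where
   "enc W = (%z. if z : code ` W then UNIV else {})" for W
  have enc_inj: "W = W'" if "enc W = enc W'" "W <= N \<times> A" "W' <= N \<times> A" for W W'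
  proof -
   have "code ` W = code ` W'"
   proof (intro equalityI subsetI)
    show "z : code ` W'" if "z : code ` W" for z
     using fun_cong[OF \<open>enc W = enc W'\<close>, of z] that by (simp add: enc_def split: if_splits)
    show "z : code ` W" if "z : code ` W'" for z
     using fun_cong[OF \<open>enc W = enc W'\<close>, of z] that by (simp add: enc_def split: if_splits)
   qed
   thus ?thesis using inj_on_image_eq_iff[OF code_inj] that by blast
  qed
  define cls where "cls g s = {(g', s'). g' : N & s' : S & (EX u:S. X.actn (u*s') g = X.actn (u*s) g')}" for g s
  define fr where "fr g s = enc (cls g s)" for g s
  have aa: "X.actn x (X.actn y g) = X.actn (x*y) g" if "x : A" "y : A" "g : N" for x y g
   using is_moduleD(6)[OF modN] that by simp
  have trans: "EX x:S. X.actn (x*v) h = X.actn (x*t) p"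
   if "w : S" "X.actn (w*t) g = X.actn (w*s) h" "u : S" "X.actn (u*v) g = X.actn (u*s) p"
    "g : N" "h : N" "p : N" "s : S" "t : S" "v : S" for g h p s t u v w
  proof (rule bexI[of _ "u*w*s"])
   have SA: "u : A" "v : A" "w : A" "s : A" "t : A" using that S(3) by blast+
   note mem = that(5-7) SA is_subring_mult[OF X.A]
   have "X.actn (u*w*s*v) h = X.actn (u*v) (X.actn (w*s) h)" using mem by (simp add: aa mult_ac)
   also have "\<dots> = X.actn (u*v) (X.actn (w*t) g)" by (simp only: that(2))
   also have "\<dots> = X.actn (w*t) (X.actn (u*v) g)" using mem by (simp add: aa mult_ac)
   also have "\<dots> = X.actn (w*t) (X.actn (u*s) p)" by (simp only: that(4))
   also have "\<dots> = X.actn (u*w*s*t) p" using mem by (simp add: aa mult_ac)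
   finally show "X.actn (u*w*s*v) h = X.actn (u*w*s*t) p" .
   show "u*w*s : S" by (intro S(2) that)
  qed
  have fr_eq: "fr g s = fr h t \<longleftrightarrow> (EX u:S. X.actn (u*t) g = X.actn (u*s) h)"
   if "g : N" "h : N" "s : S" "t : S" for g h s t
  proof
   assume "fr g s = fr h t"
   hence "cls g s = cls h t" unfolding fr_def by (rule enc_inj) (use S(3) in \<open>auto simp: cls_def\<close>)
   moreover have "(h, t) : cls h t" using that S(1) by (auto simp: cls_def)
   ultimately have "(h, t) : cls g s" by (simp only:)
   thus "EX u:S. X.actn (u*t) g = X.actn (u*s) h" by (simp add: cls_def)
  next
   assume "EX u:S. X.actn (u*t) g = X.actn (u*s) h"
   then obtain w where w: "w : S" "X.actn (w*t) g = X.actn (w*s) h" by auto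
   have "cls g s <= cls h t"
   proof (rule subrelI)
    fix p v assume "(p, v) : cls g s"
    then obtain u where u: "p : N" "v : S" "u : S" "X.actn (u*v) g = X.actn (u*s) p" by (auto simp: cls_def)
    show "(p, v) : cls h t" using trans[OF w u(3,4) that(1,2) u(1) that(3,4) u(2)] u by (simp add: cls_def)
   qed
   moreover have "cls h t <= cls g s"
   proof (rule subrelI)
    fix p v assume "(p, v) : cls h t"
    then obtain u where u: "p : N" "v : S" "u : S" "X.actn (u*v) h = X.actn (u*t) p" by (auto simp: cls_def)
    show "(p, v) : cls g s"
     using trans[OF w(1) w(2)[symmetric] u(3,4) that(2,1) u(1) that(4,3) u(2)] u by (simp add: cls_def)
   qed
   ultimately show "fr g s = fr h t" by (simp add: fr_def)
  qed
  have "module_localization R j P A S X.actn N fr"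
   by (rule module_localization.intro[OF emb], rule module_localization_axioms.intro,
     rule P, rule A_def, rule S_def, rule modN, rule fr_eq)
  then interpret Lo: module_localization R j P A S X.actn N fr .
  have noethA: "noetherian A" using noeth by (simp add: A_def)
  have M: "is_ideal Lo.F.AP (nonunits Lo.F.AP)" using Lo.F.MP_ideal unfolding Lo.F.MP_nonunits nonunits_def .
  have im: "Lo.J ` carrier Lo.RP = Lo.F.AP" unfolding A_def by (rule local_at_image[OF P])
  have loc: "noetherian_local_ring Lo.RP"
   using Lo.E.noetherian_local_ring_image(1)[unfolded im, OF Lo.F.noetherian_local[OF noethA] M] .
  have lin_d: "is_linear_on A X.actn X.actn (X.cx m p) (X.dd m p)" for p
   by (auto simp: is_linear_on_def X.dd_add X.dd_act)
  have e0_add: "X.e0 (phi+psi) = X.e0 phi+X.e0 psi" for phi psi by (rule ext) (simp add: X.e0_def)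
  have e0_act: "X.e0 (X.act a phi) = X.actn a (X.e0 phi)" for a phi
   by (rule ext) (simp add: X.e0_def X.actn_def X.act_def fun_eq_iff)
  have e0_at: "X.e0 phi 0 = phi" for phi by (simp add: X.e0_def)
  have e0_inj: "X.e0 phi = X.e0 psi ==> phi = psi" for phi psi using e0_at by metis
  have lin_e: "is_linear_on A (*) X.actn A (%a. X.e0 (X.eA a))"
   using X.eA_linear by (simp add: is_linear_on_def e0_add e0_act)
  have inj_e: "inj_on (%a. X.e0 (X.eA a)) A" using X.eA_inj e0_inj by (auto simp: inj_on_def)
  have im_e: "(%a. X.e0 (X.eA a)) ` A = {u : X.cx m 0. X.dd m 0 u = 0}"
   unfolding X.cx_kernel[OF order_refl] X.eA_Hk[symmetric] by auto
  have dcx: "X.dd m p ` X.cx m p <= X.cx m (Suc p)" for p using X.dd_cx by auto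
  have sub: "X.cx m p <= N" for p using is_moduleD(1)[OF X.Hm_module] unfolding N_def X.pw_def by auto
  note res = Lo.localized_resolution[OF noethA X.pw_module sub X.pw_baer _ lin_d dcx
    X.cx_exact[OF order_refl] lin_e inj_e im_e, of m, OF X.cx_vanish]
  have "finite_injective_dimension Lo.RP" unfolding finite_injective_dimension_def
   apply (rule exI[of _ m])
   apply (insert res, drule meta_mp, assumption)
   apply (elim exE)
   apply (rule exI, rule exI, rule exI)
   apply (erule conjE)
   apply (rule conjI)
   prefer 2
   apply assumption
   apply (intro allI baer_injective)
   apply (erule spec)
   done
  thus ?thesis using loc by (simp add: gorenstein_local_ring_def)
 qed
 thus ?thesis unfolding Spec_gorenstein_def using is_cring noetherian_ring_image[OF noeth] by blast
qed

section \<open>Free extensions of a polynomial extension\<close>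

locale free_basis =
 fixes A B :: "'f::field set" and tau :: 'f and s :: nat and w :: "nat => 'f"
 assumes subA: "is_subring A" and subB: "is_subring B" and AB: "A <= B" and tauB: "tau : B"
  and wB: "j < s ==> w j : B"
  and span: "f : B ==> EX p. (ALL j. p j : polys_over A) & f = (\<Sum>j<s. poly (p j) tau*w j)"
  and indep: "(!!j. j < s ==> p j : polys_over A) ==> (\<Sum>j<s. poly (p j) tau*w j) = 0 ==> j < s ==> p j = 0"
begin

definition comb :: "(nat => 'f poly) => 'f" where "comb p = (\<Sum>j<s. poly (p j) tau*w j)"

definition coord :: "'f => nat => 'f poly" where
 "coord f = (SOME p. (ALL j. p j : polys_over A) & (ALL j>=s. p j = 0) & f = comb p)"

lemma coord: assumes "f : B" shows "coord f j : polys_over A" "j >= s ==> coord f j = 0" "comb (coord f) = f"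
proof -
 obtain p where p: "ALL j. p j : polys_over A" "f = comb p" using span[OF assms] by (auto simp: comb_def)
 define p' where "p' = (%j. if j < s then p j else 0)"
 have "(ALL j. p' j : polys_over A) & (ALL j>=s. p' j = 0) & f = comb p'"
  using p polys_over_zero[OF subA] by (auto simp: p'_def comb_def)
 hence "(ALL j. coord f j : polys_over A) & (ALL j>=s. coord f j = 0) & f = comb (coord f)" unfolding coord_def
  by (rule someI[where P = "%p. (ALL j. p j : polys_over A) & (ALL j>=s. p j = 0) & f = comb p"])
 thus "coord f j : polys_over A" "j >= s ==> coord f j = 0" "comb (coord f) = f" by auto
qed

lemma comb_B: "(!!j. j < s ==> p j : polys_over A) ==> comb p : B" unfolding comb_def
 by (intro is_subring_sum[OF subB] is_subring_mult[OF subB] poly_polys_over[OF subB _ tauB] wB)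
  (use polys_over_mono[OF AB] in auto)

lemma comb_add: "comb (%j. p j+p' j) = comb p + comb p'"
 and comb_diff: "comb (%j. p j - p' j) = comb p - comb p'"
 and comb_smult: "comb (%j. smult a (p j)) = a * comb p"
 and comb_pCons: "comb (%j. pCons 0 (p j)) = tau * comb p"
 by (simp_all add: comb_def algebra_simps sum.distrib sum_subtractf sum_distrib_left)

lemma coord_comb: assumes "!!j. j < s ==> p j : polys_over A" "j < s" shows "coord (comb p) j = p j"
proof -
 have f: "comb p : B" by (rule comb_B[OF assms(1)])
 have "(\<Sum>j<s. poly (coord (comb p) j - p j) tau*w j) = 0"
  using coord(3)[OF f] comb_diff[of "coord (comb p)" p] by (simp add: comb_def)
 hence "coord (comb p) j - p j = 0"
  by (rule indep[rotated]) (use assms coord(1)[OF f] is_subring_diff[OF is_subring_polys_over[OF subA]] in auto)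
 thus ?thesis by simp
qed

lemma coord_eqI: assumes "f : B" "!!j. j < s ==> p j : polys_over A" "f = comb p" "!!j. j >= s ==> p j = 0"
 shows "coord f = p"
proof
 fix j show "coord f j = p j" using assms coord_comb[of p j] coord(2)[OF assms(1), of j] by (cases "j < s") auto
qed

lemma coord_add: "f : B ==> g : B ==> coord (f+g) = (%j. coord f j + coord g j)" by (rule coord_eqI)
  (auto simp: comb_add coord(2,3) intro: is_subring_add[OF subB] is_subring_add[OF is_subring_polys_over[OF subA]] coord(1))

lemma coord_smult: "f : B ==> a : A ==> coord (a*f) = (%j. smult a (coord f j))" by (rule coord_eqI)
  (use AB in \<open>auto simp: comb_smult coord(2,3) intro: is_subring_mult[OF subB] polys_over_smult[OF subA] coord(1)\<close>)

lemma coord_tau: "f : B ==> coord (tau*f) = (%j. pCons 0 (coord f j))" by (rule coord_eqI)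
  (auto simp: comb_pCons coord(2,3) tauB intro: is_subring_mult[OF subB] polys_over_pCons is_subring_zero[OF subA] coord(1))

lemma coord_zero: "coord 0 = (%j. 0)"
 by (rule coord_eqI) (auto simp: comb_def intro: is_subring_zero[OF subB] polys_over_zero[OF subA])

lemma coord_sum: "finite I ==> (!!i. i : I ==> f i : B) ==> coord (sum f I) = (%j. \<Sum>i\<in>I. coord (f i) j)"
proof (induction I rule: finite_induct)
 case (insert i I)
 thus ?case using is_subring_sum[OF subB, of I f] by (simp add: coord_add)
qed (simp add: coord_zero)

text \<open>Coordinates over \<open>A\<close> itself: the index \<open>(j, k)\<close> belongs to the
  basis element \<open>tau^k * w j\<close>.\<close>

definition kap :: "nat \<times> nat => 'f => 'f" where "kap i f = coeff (coord f (fst i)) (snd i)"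

text \<open>An element with coordinates in \<open>P\<close> is a combination of basis elements with
  coefficients in \<open>P\<close>; after multiplication by \<open>b\<close> the products are
  expanded again with coefficients in \<open>A\<close>. So these elements form the extended ideal
  \<open>P B\<close>.\<close>

lemma coord_ideal_mult: assumes P: "is_ideal A P" and f: "f : B" "!!i. kap i f : P" and b: "b : B"
 shows "kap i (b*f) : P"
proof -
 define D where "D = (\<Sum>j<s. degree (coord f j))"
 have D: "degree (coord f j) <= D" if "j < s" for j
  unfolding D_def using member_le_sum[of j "{..<s}" "%j. degree (coord f j)"] that by auto
 have fs: "f = (\<Sum>j<s. (\<Sum>k\<le>D. coeff (coord f j) k*tau^k)*w j)"
 proof -
  have "poly (coord f j) tau = (\<Sum>k\<le>D. coeff (coord f j) k*tau^k)" if "j < s" for j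
   unfolding poly_altdef by (rule sum.mono_neutral_left) (use D[OF that] in \<open>auto simp: coeff_eq_0\<close>)
  thus ?thesis using coord(3)[OF f(1)] by (simp add: comb_def)
 qed
 have "b*f = b*(\<Sum>j<s. (\<Sum>k\<le>D. coeff (coord f j) k*tau^k)*w j)" by (rule arg_cong[OF fs])
 also have "\<dots> = (\<Sum>j<s. \<Sum>k\<le>D. coeff (coord f j) k*(b*tau^k*w j))"
  by (simp add: sum_distrib_left sum_distrib_right mult_ac)
 also have "\<dots> = (\<Sum>(j, k)\<in>{..<s} \<times> {..D}. coeff (coord f j) k*(b*tau^k*w j))"
  by (simp add: sum.cartesian_product)
 finally have bf: "b*f = (\<Sum>x\<in>{..<s} \<times> {..D}. kap x f*(b*tau^snd x*w (fst x)))"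
  by (simp add: case_prod_beta kap_def)
 have g: "b*tau^snd x*w (fst x) : B" if "x : {..<s} \<times> {..D}" for x
  using b tauB wB that by (auto intro!: is_subring_mult[OF subB] is_subring_power[OF subB])
 have kA: "kap x f : A" for x using f(2)[of x] is_idealD(1)[OF P] by blast
 have "coord (b*f) = (%j. \<Sum>x\<in>{..<s} \<times> {..D}. smult (kap x f) (coord (b*tau^snd x*w (fst x)) j))"
 proof -
  have "coord (b*f) = (%j. \<Sum>x\<in>{..<s} \<times> {..D}. coord (kap x f*(b*tau^snd x*w (fst x))) j)"
   unfolding bf using is_subring_mult[OF subB subsetD[OF AB kA] g] by (intro coord_sum) auto
  also have "\<dots> = (%j. \<Sum>x\<in>{..<s} \<times> {..D}. smult (kap x f) (coord (b*tau^snd x*w (fst x)) j))"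
   by (rule ext, rule sum.cong) (use coord_smult[OF g kA] in auto)
  finally show ?thesis .
 qed
 hence "kap i (b*f) = (\<Sum>x\<in>{..<s} \<times> {..D}. coeff (coord (b*tau^snd x*w (fst x)) (fst i)) (snd i)*kap x f)"
  by (simp add: kap_def[of i] coeff_sum mult.commute)
 moreover have "coeff (coord (b*tau^snd x*w (fst x)) (fst i)) (snd i)*kap x f : P" if "x : {..<s} \<times> {..D}" for x
  by (rule is_idealD(4)[OF P polys_overD[OF coord(1)[OF g[OF that]]] f(2)])
 ultimately show ?thesis by (simp only: is_ideal_sum[OF P])
qed

theorem normal_free: assumes A: "noetherian A" "normal_subring A"
  and red: "!!P f n i. is_prime_ideal A P ==> f : B ==> (!!i. kap i (f^n) : P) ==> kap i f : P"
  and gen: "!!f. f : fracs B ==> integral_over B f ==> EX a:A. a ~= 0 & a*f : B" shows "normal_subring B"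
proof (rule normal_extension[where kp = kap and A = A])
 show "kap i f : A" if "f : B" for i f unfolding kap_def by (rule polys_overD[OF coord(1)[OF that]])
 show "kap i (f+g) = kap i f+kap i g" if "f : B" "g : B" for i f g using that by (simp add: kap_def coord_add)
 show "kap i (a*f) = a*kap i f" if "f : B" "a : A" for i f a using that by (simp add: kap_def coord_smult)
 show "finite {i. kap i f ~= 0}" if "f : B" for f
 proof (rule finite_subset)
  show "{i. kap i f ~= 0} <= (\<Union>j<s. {j} \<times> {..degree (coord f j)})"
  proof
   fix i assume "i : {i. kap i f ~= 0}"
   hence "coeff (coord f (fst i)) (snd i) ~= 0" by (simp add: kap_def)
   hence "coord f (fst i) ~= 0" "snd i <= degree (coord f (fst i))" by (auto intro: le_degree)
   hence "fst i < s" "snd i <= degree (coord f (fst i))" using coord(2)[OF that, of "fst i"] not_less by blast+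
   thus "i : (\<Union>j<s. {j} \<times> {..degree (coord f j)})" by (cases i) auto
  qed
 qed auto
 show "EX g:B. f = a*g" if f: "f : B" and a: "a : A" "a ~= 0" and k: "!!i. EX y:A. kap i f = a*y" for f a
 proof -
  define p where "p j = smult (inverse a) (coord f j)" for j
  have "coeff (p j) k : A" for j k
  proof -
   obtain y where "y : A" "kap (j, k) f = a*y" using k by blast
   thus ?thesis using a by (simp add: p_def kap_def mult.assoc[symmetric])
  qed
  hence pA: "p j : polys_over A" for j by (simp add: polys_over_def)
  have "a * comb p = comb (%j. smult a (p j))" by (simp add: comb_smult)
  also have "\<dots> = comb (coord f)" using a by (simp add: p_def)
  finally have "f = a * comb p" using coord(3)[OF f] by simp
  moreover have "comb p : B" by (rule comb_B[OF pA])
  ultimately show ?thesis by (rule bexI)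
 qed
 show "kap i (b*f) : P" if "is_prime_ideal A P" "f : B" "!!i. kap i f : P" "b : B" for P f b i
  using coord_ideal_mult[OF _ that(2-4)] that(1) by (simp add: is_prime_ideal_def)
qed (use A red gen subA subB AB in blast)+

end

text \<open>The products of two bases are numbered by \<open>k = i * s + j\<close>.\<close>

lemma sum_div_mod:
 fixes g :: "nat => nat => 'a::comm_monoid_add"
 shows "(\<Sum>k<r*s. g (k div s) (k mod s)) = (\<Sum>i<r. \<Sum>j<s. g i j)"
proof (cases "s = 0")
 case False
 have "(\<Sum>(i, j)\<in>{..<r} \<times> {..<s}. g i j) = (\<Sum>k<r*s. g (k div s) (k mod s))"
 proof (rule sum.reindex_bij_witness[where i = "%k. (k div s, k mod s)" and j = "%(i, j). i*s+j"])
  fix x assume "x : {..<r} \<times> {..<s}"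
  then obtain i j where x: "x = (i, j)" "i < r" "j < s" by auto
  have "i*s+j < Suc i*s" using x by simp
  also have "\<dots> <= r*s" using x by (intro mult_right_mono) auto
  finally show "(case x of (i, j) => i*s+j) : {..<r*s}" using x by simp
 qed (use False in \<open>auto simp: less_mult_imp_div_less\<close>)
 thus ?thesis by (simp add: sum.cartesian_product)
qed simp

lemma map_poly_add_on: assumes "f 0 = 0" "!!i. f (coeff p i + coeff p' i) = f (coeff p i)+f (coeff p' i)"
 shows "map_poly f (p+p') = map_poly f p+map_poly f p'" by (rule poly_eqI) (simp add: coeff_map_poly assms)

text \<open>Transitivity: \<open>A\<close> is Frobenius over \<open>T\<close> by \<open>lam\<close>,
  and \<open>B\<close> over \<open>A[tau]\<close> by \<open>Lam\<close>. Together they make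
  \<open>B\<close> Frobenius over \<open>T[tau]\<close>, with the products of the dual bases as dual
  bases.\<close>

locale frobenius_step = X: frobenius_extension io A T m t q lam r b b'+free_basis A B tau s w
 for io :: "'k::field => 'f::field" and A T m t q lam r b b' B tau s w +
 fixes Lam :: "'f => 'f poly" and w' :: "nat => 'f"
 assumes w'B: "j < s ==> w' j : B" and LamA: "f : B ==> Lam f : polys_over A"
  and Lam_add: "f : B ==> g : B ==> Lam (f+g) = Lam f+Lam g"
  and Lam_smult: "f : B ==> a : A ==> Lam (a*f) = smult a (Lam f)"
  and Lam_tau: "f : B ==> Lam (tau*f) = pCons 0 (Lam f)"
  and Lam_dual: "f : B ==> f = (\<Sum>j<s. poly (Lam (f*w' j)) tau*w j)"
begin

text \<open>The old operators act on coefficients. The new one, \<open>l = m\<close>, drops the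
  terms without \<open>tau\<close> and lowers the other exponents; it commutes with the earlier
  variables because it is \<open>A\<close>-linear.\<close>

definition q' :: "nat => 'f => 'f" where
 "q' l f = (if l < m then comb (%j. map_poly (q l) (coord f j)) else comb (%j. poly_shift 1 (coord f j)))"

definition lam' :: "'f => 'f" where "lam' f = poly (map_poly lam (Lam f)) tau"

lemma lam0: "lam 0 = 0" by (rule double_eq_zero) (use X.lam_add[of 0 0] X.AC(3) in simp)

lemma mq: "l < m ==> p : polys_over A ==> map_poly (q l) p : polys_over A"
 using X.q_A by (auto simp: polys_over_def coeff_map_poly X.q_zero)

lemma ps: "p : polys_over A ==> poly_shift 1 p : polys_over A" by (auto simp: polys_over_def coeff_poly_shift)

lemma q'_B: "f : B ==> q' l f : B" unfolding q'_def using mq ps coord(1) by (auto intro!: comb_B)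

lemma coord_q': "f : B ==> l < m ==> coord (q' l f) = (%j. map_poly (q l) (coord f j))"
 by (rule coord_eqI[OF q'_B]) (auto simp: q'_def coord(2) intro: mq coord(1))

lemma coord_q'_tau: "f : B ==> coord (q' m f) = (%j. poly_shift 1 (coord f j))"
 by (rule coord_eqI[OF q'_B]) (auto simp: q'_def coord(2) poly_shift_0 simp del: One_nat_def intro: ps coord(1))

lemma q'_add: "f : B ==> g : B ==> q' l (f+g) = q' l f+q' l g"
proof (cases "l < m")
 case True
 assume fg: "f : B" "g : B"
 have "map_poly (q l) (coord f j + coord g j) = map_poly (q l) (coord f j)+map_poly (q l) (coord g j)" for j
  using X.q_add[OF True] fg coord(1)[THEN polys_overD] by (intro map_poly_add_on) (auto simp: X.q_zero True)
 thus ?thesis using True fg by (simp add: q'_def coord_add comb_add)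
next
 case False
 assume fg: "f : B" "g : B"
 have "poly_shift 1 (p+p') = poly_shift 1 p+poly_shift 1 p'" for p p' :: "'f poly"
  by (rule poly_eqI) (simp add: coeff_poly_shift)
 thus ?thesis using False fg by (simp add: q'_def coord_add comb_add)
qed

lemma q'_smult: assumes "f : B" "a : A" "l < m ==> (!!x. x : A ==> q l (a*x) = a*q l x)" shows "q' l (a*f) = a*q' l f"
proof (cases "l < m")
 case True
 have "map_poly (q l) (smult a (coord f j)) = smult a (map_poly (q l) (coord f j))" for j
  by (rule poly_eqI) (simp add: coeff_map_poly X.q_zero True assms(3) polys_overD[OF coord(1)[OF assms(1)]])
 thus ?thesis using True assms by (simp add: q'_def coord_smult comb_smult)
next
 case False
 have "poly_shift 1 (smult a p) = smult a (poly_shift 1 p)" for p :: "'f poly"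
  by (rule poly_eqI) (simp add: coeff_poly_shift)
 thus ?thesis using False assms by (simp add: q'_def coord_smult comb_smult)
qed

lemma q'_nil: "f : B ==> l < Suc m ==> EX n. (q' l ^^ n) f = 0"
proof (cases "l < m")
 case True
 assume f: "f : B"
 have pB: "(q' l ^^ n) f : B" for n by (induction n) (use f q'_B in auto)
 have co: "coeff (coord ((q' l ^^ n) f) j) k = (q l ^^ n) (coeff (coord f j) k)" for n j k
  by (induction n) (simp_all add: coord_q'[OF pB True] coeff_map_poly X.q_zero True)
 have q0: "(q l ^^ n) 0 = 0" for n by (induction n) (use X.q_zero True in auto)
 have "ALL i. EX n. (q l ^^ n) (kap i f) = 0"
  using X.q_nil[OF True] polys_overD[OF coord(1)[OF f]] by (auto simp: kap_def)
 then obtain n where n: "!!i. (q l ^^ n i) (kap i f) = 0" by metis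
 define D where "D = (\<Sum>j<s. degree (coord f j))"
 define N where "N = (\<Sum>i\<in>{..<s} \<times> {..D}. n i)"
 have "coord ((q' l ^^ N) f) = (%j. 0)"
 proof (intro ext poly_eqI)
  fix j k
  show "coeff (coord ((q' l ^^ N) f) j) k = coeff 0 k"
  proof (cases "j < s & k <= D")
   case True
   hence "n (j, k) <= N" unfolding N_def by (intro member_le_sum) auto
   hence "(q l ^^ N) (kap (j, k) f) = (q l ^^ (N - n (j, k))) ((q l ^^ n (j, k)) (kap (j, k) f))"
    by (simp add: funpow_add[symmetric, THEN fun_cong, unfolded comp_apply])
   thus ?thesis using n[of "(j, k)"] q0 by (simp add: co kap_def)
  next
   case False
   have "coeff (coord f j) k = 0"
   proof (cases "j < s")
    case True
    hence "degree (coord f j) <= D" unfolding D_def by (intro member_le_sum) auto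
    thus ?thesis using False True by (intro coeff_eq_0) auto
   next
    case False
    thus ?thesis using coord(2)[OF f, of j] by simp
   qed
   thus ?thesis by (simp add: co q0)
  qed
 qed
 hence "(q' l ^^ N) f = 0" using coord(3)[OF pB, of N] by (simp add: comb_def)
 thus ?thesis by blast
next
 case False
 assume f: "f : B" and "l < Suc m"
 hence l: "l = m" using False by simp
 have pB: "(q' l ^^ n) f : B" for n by (induction n) (use f q'_B in auto)
 have co: "coeff (coord ((q' l ^^ n) f) j) k = coeff (coord f j) (n+k)" for n j k
 proof (induction n arbitrary: k)
  case (Suc n)
  have "coord ((q' l ^^ Suc n) f) = (%j. poly_shift 1 (coord ((q' l ^^ n) f) j))" using coord_q'_tau[OF pB] l by simp
  thus ?case using Suc[of "Suc k"] by (simp add: coeff_poly_shift)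
 qed simp
 define D where "D = Suc (\<Sum>j<s. degree (coord f j))"
 have "coord ((q' l ^^ D) f) = (%j. 0)"
 proof (intro ext poly_eqI)
  fix j k
  show "coeff (coord ((q' l ^^ D) f) j) k = coeff 0 k"
  proof (cases "j < s")
   case True
   hence "degree (coord f j) < D" unfolding D_def less_Suc_eq_le by (intro member_le_sum) auto
   thus ?thesis by (simp add: co coeff_eq_0)
  next
   case False
   thus ?thesis using coord(2)[OF f, of j] by (simp add: co)
  qed
 qed
 hence "(q' l ^^ D) f = 0" using coord(3)[OF pB, of D] by (simp add: comb_def)
 thus ?thesis by blast
qed

lemma lam'_add: "f : B ==> g : B ==> lam' (f+g) = lam' f+lam' g"
 unfolding lam'_def using X.lam_add LamA[THEN polys_overD] by (simp add: Lam_add map_poly_add_on lam0)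

lemma lam'_smult: "f : B ==> a : T ==> lam' (a*f) = a*lam' f"
proof -
 assume f: "f : B" and a: "a : T"
 have "map_poly lam (smult a (Lam f)) = smult a (map_poly lam (Lam f))"
  by (rule poly_eqI) (simp add: coeff_map_poly lam0 X.lam_scale a polys_overD[OF LamA[OF f]])
 thus ?thesis using Lam_smult[OF f X.S_A[OF a]] by (simp add: lam'_def)
qed

lemma lam'_tau: "f : B ==> lam' (tau*f) = tau*lam' f" by (simp add: lam'_def Lam_tau map_poly_pCons lam0)

lemma T_B: "a : T ==> a : B" using X.S_A AB by auto

lemma lam'_scale: "f : B ==> p : polys_over T ==> lam' (poly p tau*f) = poly p tau*lam' f"
proof (induction p arbitrary: f)
 case 0
 have "lam' 0 = 0" using lam'_smult[of 0 0] X.SC(3) is_subring_zero[OF subB] by simp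
 thus ?case by simp
next
 case (pCons a p)
 hence h: "a : T" "p : polys_over T" using polys_over_pConsD by blast+
 have pf: "poly p tau*f : B"
  using poly_polys_over[OF subB _ tauB, of p] h(2) polys_over_mono[of T B] T_B pCons.prems is_subring_mult[OF subB] by blast
 have "lam' (a*f+tau*(poly p tau*f)) = a*lam' f+tau*(poly p tau*lam' f)"
  using pCons h pf T_B[OF h(1)] is_subring_mult[OF subB] tauB by (simp add: lam'_add lam'_smult lam'_tau)
 thus ?case by (simp add: algebra_simps)
qed

lemma dual': assumes f: "f : B" shows "f = (\<Sum>i<r. \<Sum>j<s. lam' (f*(b' i*w' j))*(b i*w j))"
proof -
 have fw: "f*w' j : B" if "j < s" for j using f w'B[OF that] is_subring_mult[OF subB] by blast
 have e: "poly (Lam (f*w' j)) tau = (\<Sum>i<r. lam' (f*(b' i*w' j))*b i)" if j: "j < s" for j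
 proof -
  let ?p = "Lam (f*w' j)"
  have pA: "?p : polys_over A" by (rule LamA[OF fw[OF j]])
  have "?p = (\<Sum>i<r. smult (b i) (map_poly lam (smult (b' i) ?p)))" using X.dual[OF polys_overD[OF pA]]
   by (intro poly_eqI) (simp add: coeff_sum coeff_map_poly lam0 mult.commute)
  hence "poly ?p tau = poly (\<Sum>i<r. smult (b i) (map_poly lam (smult (b' i) ?p))) tau" by (rule arg_cong)
  also have "\<dots> = (\<Sum>i<r. b i*poly (map_poly lam (smult (b' i) ?p)) tau)" by (simp add: poly_sum)
  also have "\<dots> = (\<Sum>i<r. lam' (f*(b' i*w' j))*b i)"
  proof (rule sum.cong)
   fix i assume "i : {..<r}"
   hence "smult (b' i) ?p = Lam (f*(b' i*w' j))" using Lam_smult[OF fw[OF j] X.b'_A, of i] by (simp add: mult_ac)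
   thus "b i*poly (map_poly lam (smult (b' i) ?p)) tau = lam' (f*(b' i*w' j))*b i" by (simp add: lam'_def mult.commute)
  qed simp
  finally show ?thesis .
 qed
 have "f = (\<Sum>j<s. poly (Lam (f*w' j)) tau*w j)" by (rule Lam_dual[OF f])
 also have "\<dots> = (\<Sum>j<s. \<Sum>i<r. lam' (f*(b' i*w' j))*(b i*w j))"
  using e by (simp add: sum_distrib_right mult.assoc)
 also have "\<dots> = (\<Sum>i<r. \<Sum>j<s. lam' (f*(b' i*w' j))*(b i*w j))" by (rule sum.swap)
 finally show ?thesis .
qed

theorem frobenius_extension_step:
 "frobenius_extension io B (adjoin T tau) (Suc m) (t(m := tau)) q' lam' (r*s)
  (%k. b (k div s)*w (k mod s)) (%k. b' (k div s)*w' (k mod s))"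
proof (unfold_locales, goal_cases)
 case 1 show ?case by (rule X.io_add)
 case 2 show ?case by (rule X.io_mult)
 case 3 show ?case by (rule X.io_one)
 case 4 show ?case by (rule subB)
 case 5 show ?case by (rule is_subring_adjoin[OF X.S])
 case 6 show ?case by (rule adjoin_least[OF subB _ tauB]) (use T_B in auto)
 case 7 show ?case by (rule adjoin_base[OF X.S X.io_S])
 case (8 l) thus ?case using adjoin_base[OF X.S X.t_S] adjoin_self[OF X.S] by auto
next
 case (9 Z)
 have tau: "tau*x : Z" if "x : Z" for x using 9(3)[of m x] that by simp
 have old: "t l*x : Z" if "l < m" "x : Z" for l x using 9(3)[of l x] that by simp
 have TZ: "T <= {x. tau^i*x : Z}" for i
 proof (rule X.S_gen)
  have "tau^i*x : Z" if "x : Z" for x using that tau by (induction i) (auto simp: mult.assoc)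
  thus "io c : {x. tau^i*x : Z}" for c using 9(1) by simp
  show "x+y : {x. tau^i*x : Z}" if "x : {x. tau^i*x : Z}" "y : {x. tau^i*x : Z}" for x y
   using 9(2) that by (simp add: distrib_left)
  show "t l*x : {x. tau^i*x : Z}" if "l < m" "x : {x. tau^i*x : Z}" for l x
   using old[OF that(1), of "tau^i*x"] that by (simp add: mult.left_commute)
 qed
 have "io 0 = 0" by (rule double_eq_zero) (use X.io_add[of 0 0] in simp)
 hence Z0: "0 : Z" using 9(1)[of 0] by simp
 show ?case
 proof
  fix x assume "x : adjoin T tau"
  then obtain p where p: "p : polys_over T" "x = poly p tau" by (auto simp: adjoin_def)
  have "coeff p i*tau^i : Z" for i using TZ[of i] polys_overD[OF p(1), of i] by (auto simp: mult.commute)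
  moreover have "sum f I : Z" if "finite I" "!!i. f i : Z" for f and I :: "nat set"
   using that(1) by (induction I rule: finite_induct) (use Z0 9(2) that in auto)
  ultimately show "x : Z" using p(2) unfolding poly_altdef by simp
 qed
next
 case (10 l x) thus ?case by (simp add: q'_B)
next
 case (11 l x y) thus ?case by (simp add: q'_add)
next
 case (12 l x c) thus ?case by (intro q'_smult) (auto simp: X.io_A X.q_scale)
next
 case (13 l x)
 show ?case
 proof (cases "l < m")
  case True
  hence B: "t l*x : B" using 13 X.t_A AB is_subring_mult[OF subB] by blast
  have "map_poly (q l) (smult (t l) (coord x j)) = coord x j" for j
   by (rule poly_eqI) (simp add: coeff_map_poly X.q_zero True X.q_self polys_overD[OF coord(1)[OF 13(2)]])
  hence "q' l (t l*x) = comb (coord x)" using True 13 X.t_A by (simp add: q'_def coord_smult)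
  thus ?thesis using True coord(3)[OF 13(2)] by simp
 next
  case False
  have "poly_shift 1 (pCons 0 p) = p" for p :: "'f poly" by (rule poly_eqI) (simp add: coeff_poly_shift)
  hence "q' m (tau*x) = comb (coord x)" using 13 by (simp add: q'_def coord_tau)
  thus ?thesis using False 13 coord(3)[OF 13(2)] by (simp add: less_Suc_eq)
 qed
next
 case (14 l i x)
 hence i: "i < m" by simp
 have "q' l (t i*x) = t i*q' l x" using 14 X.t_A[OF i] X.q_comm by (intro q'_smult) auto
 thus ?case using i by simp
next
 case (15 l x) thus ?case by (intro q'_nil) auto
next
 case (16 x)
 have "map_poly lam (Lam x) : polys_over T"
  using X.lam_S polys_overD[OF LamA[OF 16]] by (auto simp: polys_over_def coeff_map_poly lam0)
 thus ?case unfolding lam'_def by (rule adjoinI)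
next
 case (17 x y) thus ?case by (rule lam'_add)
next
 case (18 x a)
 then obtain p where "p : polys_over T" "a = poly p tau" by (auto simp: adjoin_def)
 thus ?case using lam'_scale 18 by simp
next
 case (19 k)
 hence "k div s < r" "k mod s < s" by (auto simp: less_mult_imp_div_less) (metis mod_less_divisor mult_0_right not_gr_zero not_less_zero)
 thus ?case using X.b_A wB AB is_subring_mult[OF subB] by blast
next
 case (20 k)
 hence "k div s < r" "k mod s < s" by (auto simp: less_mult_imp_div_less) (metis mod_less_divisor mult_0_right not_gr_zero not_less_zero)
 thus ?case using X.b'_A w'B AB is_subring_mult[OF subB] by blast
next
 case (21 x)
 thus ?case using dual'[OF 21] sum_div_mod[of "%i j. lam' (x*(b' i*w' j))*(b i*w j)" s r] by simp
qed

end

section \<open>Polynomial extensions\<close>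

text \<open>As in Gauss' lemma: if \<open>i\<close> and \<open>j\<close> are the lowest degrees of
  coefficients outside \<open>P\<close>, the coefficient of \<open>p * q\<close> in degree
  \<open>i + j\<close> is the product of these two up to elements of \<open>P\<close>.\<close>

lemma prime_ideal_poly_mult:
 assumes A: "is_subring A" and P: "is_prime_ideal A P" and p: "p : polys_over A" "q : polys_over A"
  and pq: "!!i. coeff (p*q) i : P" shows "(ALL i. coeff p i : P) \<or> (ALL i. coeff q i : P)"
proof (rule ccontr)
 assume "~ ?thesis"
 hence ex: "EX i. coeff p i ~: P" "EX i. coeff q i ~: P" by auto
 define i where "i = (LEAST i. coeff p i ~: P)"
 define j where "j = (LEAST i. coeff q i ~: P)"
 have i: "coeff p i ~: P" "!!l. l < i ==> coeff p l : P"
  unfolding i_def by (rule LeastI_ex[OF ex(1)]) (use not_less_Least in blast)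
 have j: "coeff q j ~: P" "!!l. l < j ==> coeff q l : P"
  unfolding j_def by (rule LeastI_ex[OF ex(2)]) (use not_less_Least in blast)
 have I: "is_ideal A P" using P by (simp add: is_prime_ideal_def)
 let ?S = "\<Sum>l\<in>{..i+j} - {i}. coeff p l * coeff q (i+j - l)"
 have "coeff (p*q) (i+j) = (\<Sum>l\<le>i+j. coeff p l * coeff q (i+j - l))" by (rule coeff_mult)
 also have "\<dots> = coeff p i * coeff q j + ?S" by (subst sum.remove[of _ i]) auto
 finally have eq: "coeff p i * coeff q j = coeff (p*q) (i+j) - ?S" by simp
 have "?S : P"
 proof (rule is_ideal_sum[OF I])
  fix l assume "l : {..i+j} - {i}"
  then consider "l < i" | "i+j - l < j" by force
  thus "coeff p l * coeff q (i+j - l) : P"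
  proof cases
   case 1
   thus ?thesis using is_idealD(4)[OF I polys_overD[OF p(2)] i(2)] by (simp add: mult.commute)
  next
   case 2
   thus ?thesis using is_idealD(4)[OF I polys_overD[OF p(1)] j(2)] by simp
  qed
 qed
 hence "coeff p i * coeff q j : P" unfolding eq by (rule is_ideal_diff[OF A I pq])
 thus False using P i(1) j(1) polys_overD[OF p(1)] polys_overD[OF p(2)] by (auto simp: is_prime_ideal_def)
qed

lemma prime_ideal_poly_power: assumes A: "is_subring A" and P: "is_prime_ideal A P" and p: "p : polys_over A"
  and pn: "!!i. coeff (p^n) i : P" shows "coeff p i : P" using pn
proof (induction n)
 case 0
 hence "1 : P" using 0[of 0] by simp
 thus ?case using P by (simp add: is_prime_ideal_def)
next
 case (Suc n)
 thus ?case using prime_ideal_poly_mult[OF A P p is_subring_power[OF is_subring_polys_over[OF A] p, of n]] by auto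
qed

text \<open>An almost integral fraction \<open>P / Q\<close> is a polynomial: peel off the roots of \<open>Q\<close> one at a time.\<close>

lemma almost_integral_dvd:
 fixes P Q H :: "'f::alg_closed_field poly" assumes H: "H ~= 0" and "Q ~= 0" "!!m. Q^m dvd H*P^m" shows "Q dvd P"
 using assms(2,3)
proof (induction "degree Q" arbitrary: P Q rule: less_induct)
 case less
 show ?case
 proof (cases "degree Q = 0")
  case True
  hence "is_unit Q" using less.prems(1) by (simp add: is_unit_iff_degree)
  thus ?thesis by (rule unit_imp_dvd)
 next
  case False
  then obtain rho where rho: "poly Q rho = 0" using alg_closed_imp_poly_has_root[of Q] by auto
  have "poly P rho = 0"
  proof (rule ccontr)
   assume nz: "poly P rho ~= 0"
   hence P0: "P ~= 0" by auto
   \<comment> \<open>\<open>m\<close> exceeds the order of \<open>rho\<close> as a root of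
     \<open>H\<close>, while no power of \<open>P\<close> vanishes at \<open>rho\<close>; so
     \<open>Q^m\<close> could not divide \<open>H * P^m\<close>.\<close>
   define m where "m = Suc (order rho H)"
   have "[:-rho, 1:]^m dvd Q^m" using rho by (intro dvd_power_same) (simp add: poly_eq_0_iff_dvd)
   also have "\<dots> dvd H*P^m" by (rule less.prems(2))
   finally have "m <= order rho (H*P^m)" using H P0 by (subst (asm) order_divides) auto
   also have "\<dots> = order rho H" using H P0 nz by (simp add: order_mult order_0I order_power_n_n)
   finally show False by (simp add: m_def)
  qed
  then obtain P' where P': "P = [:-rho, 1:]*P'" by (auto simp: poly_eq_0_iff_dvd)
  obtain Q' where Q': "Q = [:-rho, 1:]*Q'" using rho by (auto simp: poly_eq_0_iff_dvd)
  have Q0: "Q' ~= 0" using less.prems(1) Q' by auto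
  have "degree Q = Suc (degree Q')" unfolding Q' using Q0 by (subst degree_mult_eq) auto
  moreover have "Q'^m dvd H*P'^m" for m
  proof -
   have "[:-rho, 1:]^m*Q'^m dvd [:-rho, 1:]^m*(H*P'^m)"
    using less.prems(2)[of m] unfolding P' Q' power_mult_distrib by (simp only: mult_ac)
   thus ?thesis by (subst (asm) dvd_mult_cancel_left) auto
  qed
  ultimately have "Q' dvd P'" using less.hyps[of Q' P'] Q0 by simp
  thus ?thesis unfolding P' Q' by (rule mult_dvd_mono[OF dvd_refl])
 qed
qed

text \<open>The leading coefficient of \<open>R\<close> is a quotient of elements of
  \<open>K\<close>, and subtracting its monomial lowers the degree. In this way divisibilities found
  over the large field come back to \<open>K\<close>.\<close>

lemma polys_over_quotient:
 fixes K :: "'f::field set" assumes K: "is_subring K" "!!x. x : K ==> inverse x : K" and Q: "Q : polys_over K" "Q ~= 0"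
  and "Q*R : polys_over K" shows "R : polys_over K" using assms(5)
proof (induction "degree R" arbitrary: R rule: less_induct)
 case less
 show ?case
 proof (cases "R = 0")
  case False
  have "lead_coeff Q*lead_coeff R : K" using polys_overD[OF less.prems] by (simp add: lead_coeff_mult[symmetric])
  hence "inverse (lead_coeff Q)*(lead_coeff Q*lead_coeff R) : K" using K polys_overD[OF Q(1)] is_subring_mult by blast
  hence lc: "lead_coeff R : K" using Q(2) by (simp add: mult.assoc[symmetric])
  define R' where "R' = R - monom (lead_coeff R) (degree R)"
  note PK = is_subring_polys_over[OF K(1)]
  have mK: "monom (lead_coeff R) (degree R) : polys_over K" by (rule polys_over_monom[OF K(1) lc])
  have "Q*R' = Q*R - Q*monom (lead_coeff R) (degree R)" by (simp add: R'_def algebra_simps)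
  hence QR': "Q*R' : polys_over K" using is_subring_diff[OF PK less.prems is_subring_mult[OF PK Q(1) mK]] by simp
  have "R' : polys_over K"
  proof (cases "degree R = 0")
   case True
   hence "R' = 0" by (intro poly_eqI) (auto simp: R'_def coeff_eq_0)
   thus ?thesis using polys_over_zero[OF K(1)] by simp
  next
   case False
   have "degree R' <= degree R - 1" by (rule degree_le) (auto simp: R'_def coeff_eq_0)
   hence "degree R' < degree R" using False by simp
   thus ?thesis by (rule less.hyps[OF _ QR'])
  qed
  hence "R'+monom (lead_coeff R) (degree R) : polys_over K" by (rule is_subring_add[OF PK _ mK])
  thus ?thesis by (simp add: R'_def)
 qed (simp add: polys_over_zero[OF K(1)])
qed

lemma transcendental_poly_eq:
 assumes "is_subring K" "transcendental K x" "p : polys_over K" "q : polys_over K" "poly p x = poly q x" shows "p = q"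
 using assms is_subring_diff[OF is_subring_polys_over[OF assms(1)] assms(3,4)] by (auto simp: transcendental_def)

text \<open>Complete integral closedness of \<open>K[x]\<close>. Divisibility is proved over the
  algebraically closed field, where denominators split into linear factors, and then descends to
  \<open>K\<close>.\<close>

lemma almost_integral_adjoin:
 fixes K :: "'f::alg_closed_field set"
 assumes K: "is_subring K" "!!x. x : K ==> inverse x : K" and x: "transcendental K x"
  and f: "f : fracs (adjoin K x)" and h: "h : adjoin K x" "h ~= 0" and hf: "!!m. h*f^m : adjoin K x"
 shows "f : adjoin K x"
proof -
 note PK = is_subring_polys_over[OF K(1)]
 obtain u v where uv: "u : adjoin K x" "v : adjoin K x" "v ~= 0" "f = u / v"
  using f is_subring_adjoin[OF K(1)] by (metis fracsE)
 obtain P Q H where P: "P : polys_over K" "u = poly P x" and Q: "Q : polys_over K" "v = poly Q x"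
  and H: "H : polys_over K" "h = poly H x" using uv(1,2) h(1) by (auto simp: adjoin_def)
 have "Q^m dvd H*P^m" for m
 proof -
  obtain R where R: "R : polys_over K" "h*f^m = poly R x" using hf[of m] by (auto simp: adjoin_def)
  have "poly (H*P^m) x = poly (Q^m*R) x" using R(2) uv(3,4) P(2) Q(2) H(2) by (simp add: field_simps)
  hence "H*P^m = Q^m*R"
   by (intro transcendental_poly_eq[OF K(1) x] is_subring_mult[OF PK] is_subring_power[OF PK] P Q H R)
  thus ?thesis by simp
 qed
 moreover have "H ~= 0" "Q ~= 0" using h(2) H(2) uv(3) Q(2) by auto
 ultimately have "Q dvd P" using almost_integral_dvd[of H Q P] by blast
 then obtain R where R: "P = Q*R" by blast
 have "R : polys_over K" by (rule polys_over_quotient[OF K Q(1)]) (use R P(1) Q(2) uv(3) in auto)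
 moreover have "f = poly R x" using uv(3,4) P(2) Q(2) R by simp
 ultimately show ?thesis using adjoinI[of R K x] by simp
qed

lemma adjoin_mono: "A <= B ==> adjoin A x <= adjoin B x" using polys_over_mono[of A B] by (auto simp: adjoin_def)

definition has_frobenius :: "('k::field => 'f::field) => 'f set => bool" where
 "has_frobenius io A \<longleftrightarrow> (EX T m t q lam r b b'. frobenius_extension io A T m t q lam r b b')"

lemma free_basis_adjoin: assumes A: "is_subring A" and tau: "transcendental A tau"
 shows "free_basis A (adjoin A tau) tau 1 (%_. 1)"
proof
 show "EX p. (ALL j. p j : polys_over A) & f = (\<Sum>j<(1::nat). poly (p j) tau*1)" if f: "f : adjoin A tau" for f
 proof -
  obtain p where "p : polys_over A" "f = poly p tau" using f by (auto simp: adjoin_def)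
  thus ?thesis by (intro exI[of _ "%_. p"]) simp
 qed
 show "p j = 0" if "!!j. j < 1 ==> p j : polys_over A" "(\<Sum>j<1. poly (p j) tau*1) = 0" "j < 1" for p and j :: nat
  using that tau by (auto simp: transcendental_def)
qed (use A is_subring_adjoin[OF A] adjoin_base[OF A] adjoin_self[OF A] is_subring_one[OF is_subring_adjoin[OF A]] in auto)

lemma normal_adjoin:
 fixes A :: "'f::alg_closed_field set"
 assumes A: "is_subring A" "noetherian A" "normal_subring A" and tau: "transcendental A tau"
 shows "normal_subring (adjoin A tau)"
proof -
 interpret F: free_basis A "adjoin A tau" tau 1 "%_. 1" by (rule free_basis_adjoin[OF A(1) tau])
 let ?B = "adjoin A tau"
 have co: "F.coord (poly p tau) 0 = p" if "p : polys_over A" for p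
  using F.coord_comb[of "%_. p" 0] that by (simp add: F.comb_def del: One_nat_def)
 show ?thesis
 proof (rule F.normal_free[OF A(2,3)])
  fix P f n i assume P: "is_prime_ideal A P" and f: "f : ?B" and k: "!!i. F.kap i (f^n) : P"
  obtain p where p: "p : polys_over A" "f = poly p tau" using f by (auto simp: adjoin_def)
  have pn: "p^n : polys_over A" by (rule is_subring_power[OF is_subring_polys_over[OF A(1)] p(1)])
  have "coeff (p^n) l : P" for l using k[of "(0, l)"] co[OF pn] p(2) by (simp add: F.kap_def del: One_nat_def)
  hence c: "coeff p l : P" for l by (rule prime_ideal_poly_power[OF A(1) P p(1)])
  have "0 : P" using P is_idealD(2) by (auto simp: is_prime_ideal_def)
  thus "F.kap i f : P" using c co[OF p(1)] F.coord(2)[OF f, of "fst i"] p(2)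
   by (cases "fst i") (simp_all add: F.kap_def del: One_nat_def)
 next
  fix f assume f: "f : fracs ?B" "integral_over ?B f"
  let ?K = "fracs A"
  have AK: "A <= ?K" using fracs_incl[OF A(1)] by auto
  obtain u v where uv: "u : ?B" "v : ?B" "v ~= 0" "f = u / v" using f(1) F.subB by (metis fracsE)
  obtain N where N: "!!m. v^N*f^m : ?B" using integral_over_powers[OF F.subB f(2) uv(2)] uv by auto
  have "f : adjoin ?K tau"
  proof (rule almost_integral_adjoin)
   show "f : fracs (adjoin ?K tau)" using f(1) fracs_mono[OF adjoin_mono[OF AK]] by blast
   show "v^N : adjoin ?K tau" using N[of 0] adjoin_mono[OF AK, of tau] by auto
   show "v^N*f^m : adjoin ?K tau" for m using N adjoin_mono[OF AK, of tau] by auto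
  qed (use uv(3) A(1) tau in \<open>auto intro: is_subring_fracs fracs_inverse transcendental_fracs\<close>)
  then obtain p where p: "p : polys_over ?K" "f = poly p tau" by (auto simp: adjoin_def)
  obtain d where d: "d : A" "d ~= 0" "smult d p : polys_over A" using polys_over_fracs_clear[OF A(1) p(1)] by auto
  hence "d*f : ?B" using adjoinI[OF d(3), of tau] p(2) by simp
  thus "EX a:A. a ~= 0 & a*f : ?B" using d by blast
 qed
qed

lemma has_frobenius_adjoin:
 fixes io :: "'k::field => 'f::field" assumes fr: "has_frobenius io A" and tau: "transcendental A tau"
 shows "has_frobenius io (adjoin A tau)"
proof -
 obtain T m t q lam r b b' where "frobenius_extension io A T m t q lam r b b'"
  using fr unfolding has_frobenius_def by blast
 then interpret X: frobenius_extension io A T m t q lam r b b' .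
 interpret F: free_basis A "adjoin A tau" tau 1 "%_. 1" by (rule free_basis_adjoin[OF X.A tau])
 interpret S: frobenius_step io A T m t q lam r b b' "adjoin A tau" tau 1 "%_. 1" "%f. F.coord f 0" "%_. 1"
 proof
  show "f = (\<Sum>j<(1::nat). poly (F.coord (f*1) 0) tau*1)" if "f : adjoin A tau" for f
   using F.coord(3)[OF that] by (simp add: F.comb_def del: One_nat_def)
 qed (use F.coord_add F.coord_smult F.coord_tau F.coord(1) F.wB in auto)
 show ?thesis using S.frobenius_extension_step unfolding has_frobenius_def by blast
qed

section \<open>The base field\<close>

locale field_embedding =
 fixes io :: "'k::field => 'f::field"
 assumes add: "io (x+y) = io x+io y" and mult: "io (x*y) = io x*io y" and one: "io 1 = 1"
begin

lemma zero: "io 0 = 0" by (rule double_eq_zero) (use add[of 0 0] in simp)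
lemma minus: "io (- x) = - io x" using add[of x "- x"] zero by (simp add: eq_neg_iff_add_eq_0 add.commute)
lemma diff: "io (x - y) = io x - io y" using add[of x "- y"] minus by simp
lemma eq_zero: "io x = 0 \<longleftrightarrow> x = 0"
proof
 assume h: "io x = 0"
 show "x = 0"
 proof (rule ccontr)
  assume "x ~= 0"
  hence "io x*io (inverse x) = 1" using mult[of x "inverse x"] one by simp
  thus False using h by simp
 qed
qed (simp add: zero)
lemma eq_iff: "io x = io y \<longleftrightarrow> x = y" using eq_zero[of "x - y"] diff by simp
lemma inverse: "inverse (io x) = io (inverse x)"
 using mult[of x "inverse x"] one zero by (cases "x = 0") (auto intro: inverse_unique)
lemma of_nat: "io (of_nat k) = of_nat k" by (induction k) (simp_all add: zero add one)

lemma subring: "is_subring (range io)" unfolding is_subring_def using one diff mult by (metis rangeE rangeI)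

lemma fracs_range: "fracs (range io) = range io"
proof
 show "fracs (range io) <= range io" by (rule fracs_least[OF subring subring]) (auto simp: inverse)
 show "range io <= fracs (range io)" using fracs_incl[OF subring] by auto
qed

lemma normal: "normal_subring (range io)" by (simp add: normal_subring_def fracs_range)

lemma noetherian: "noetherian (range io)" unfolding noetherian_def
proof (intro allI impI)
 fix I assume I: "is_ideal (range io) I"
 show "EX F. finite F & F <= I & (ALL I'. is_ideal (range io) I' & F <= I' --> I <= I')"
 proof (cases "I <= {0}")
  case True
  have "I <= I'" if "is_ideal (range io) I'" for I' using True is_idealD(2)[OF that] by auto
  thus ?thesis by (intro exI[of _ "{}"]) auto
 next
  case False
  then obtain u where u: "u : I" "u ~= 0" by auto
  have "I <= I'" if I': "is_ideal (range io) I'" "{u} <= I'" for I'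
  proof
   fix v assume "v : I"
   then obtain k l where kl: "v = io k" "u = io l" using is_idealD(1)[OF I] u(1) by blast
   have "io (k*inverse l)*u : I'" by (rule is_idealD(4)[OF I'(1)]) (use I' in auto)
   thus "v : I'" using kl u(2) by (simp add: mult inverse[symmetric] mult.assoc)
  qed
  thus ?thesis using u by (intro exI[of _ "{u}"]) auto
 qed
qed

lemma has_frobenius: "has_frobenius io (range io)"
proof -
 have "frobenius_extension io (range io) (range io) 0 (%_. 0) (%_. id) id 1 (%_. 1) (%_. 1)"
  by unfold_locales (use add mult one subring is_subring_one[OF subring] in auto)
 thus ?thesis unfolding has_frobenius_def by blast
qed

end

section \<open>A large algebraically closed field\<close>

abbreviation "keys \<equiv> Poly_Mapping.keys"
abbreviation "lookup \<equiv> Poly_Mapping.lookup"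
abbreviation "single \<equiv> Poly_Mapping.single"

text \<open>
  The coordinate rings are realized inside an algebraically closed field with more elements than the
  base field; counting then provides transcendental elements over each ring of at most the
  cardinality of the base field. The variables are indexed by the subsets of the base field; they have
  to be linearly ordered for the polynomial ring to be recognized as a domain.
\<close>

typedef 'k idx = "UNIV :: 'k set set" by simp

instantiation idx :: (type) linorder
begin

definition less_eq_idx :: "'a idx => 'a idx => bool" where
 "less_eq_idx x y \<longleftrightarrow> (x, y) : (SOME r. well_order_on UNIV r)"

definition less_idx :: "'a idx => 'a idx => bool" where
 "less_idx x y \<longleftrightarrow> x <= y & ~ y <= x"

instance
proof
 define r where "r = (SOME r :: ('a idx \<times> 'a idx) set. well_order_on UNIV r)"
 have "well_order_on UNIV r" unfolding r_def using well_order_on by (rule someI_ex)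
 hence r: "refl_on UNIV r" "trans r" "antisym r" "total_on UNIV r"
  by (auto simp: well_order_on_def linear_order_on_def partial_order_on_def preorder_on_def)
 have le: "x <= y \<longleftrightarrow> (x, y) : r" for x y :: "'a idx" by (simp add: less_eq_idx_def r_def)
 fix x y z :: "'a idx"
 show "x < y \<longleftrightarrow> x <= y & ~ y <= x" by (rule less_idx_def)
 show "x <= x" using r(1) by (simp add: le refl_on_def)
 show "x <= z" if "x <= y" "y <= z" using that r(2) by (auto simp: le dest: transD)
 show "x = y" if "x <= y" "y <= x" using that r(3) by (auto simp: le dest: antisymD)
 show "x <= y \<or> y <= x" using r(1,4) by (cases "x = y") (auto simp: le refl_on_def total_on_def)
qed

end

type_synonym 'k big = "(('k idx \<Rightarrow>\<^sub>0 nat) \<Rightarrow>\<^sub>0 'k) fract alg_closure"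

definition big_const :: "'k::field => 'k big" where
 "big_const k = to_ac (Fract (single 0 k) 1)"

lemma field_embedding_big_const: "field_embedding (big_const :: 'k::field => 'k big)"
proof -
 have "big_const (x+y) = big_const x+big_const y" for x y :: 'k by (simp add: big_const_def single_add flip: to_ac_add)
 moreover have "big_const (x*y) = big_const x*big_const y" for x y :: 'k
  by (simp add: big_const_def mult_single flip: to_ac_mult)
 moreover have "big_const (1 :: 'k) = 1" by (simp add: big_const_def flip: One_fract_def)
 ultimately show ?thesis unfolding field_embedding_def by blast
qed

lemma big_large: "~ |UNIV :: 'k::field big set| \<le>o |UNIV :: 'k set|"
proof
 assume le: "|UNIV :: 'k big set| \<le>o |UNIV :: 'k set|"
 define v :: "'k set => 'k big" where
  "v s = to_ac (Fract (single (single (Abs_idx s) 1) 1) 1)" for s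
 have "inj v"
 proof (rule injI)
  fix s s' :: "'k set" assume "v s = v s'"
  hence "single (single (Abs_idx s) (1::nat)) (1::'k)
    = single (single (Abs_idx s') 1) 1" by (simp add: v_def eq_fract)
  hence "keys (single (single (Abs_idx s) (1::nat)) (1::'k))
    = keys (single (single (Abs_idx s') (1::nat)) (1::'k))" by (rule arg_cong)
  hence "single (Abs_idx s) (1::nat) = single (Abs_idx s') 1" by simp
  hence "keys (single (Abs_idx s) (1::nat)) = keys (single (Abs_idx s') (1::nat))" by (rule arg_cong)
  hence "Abs_idx s = Abs_idx s'" by simp
  thus "s = s'" by (simp add: Abs_idx_inject)
 qed
 hence "|UNIV :: 'k set set| \<le>o |UNIV :: 'k big set|" using card_of_ordLeq[of UNIV "UNIV :: 'k big set"] by auto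
 hence "|UNIV :: 'k set set| \<le>o |UNIV :: 'k set|" using le ordLeq_transitive by blast
 thus False using card_of_set_type not_ordLess_ordLeq by blast
qed

section \<open>Rings of small cardinality and elements transcendental over them\<close>

definition small :: "'k::field big set => bool" where
 "small A \<longleftrightarrow> |A| \<le>o |UNIV :: 'k set|"

lemma infinite_alg_closed: "infinite (UNIV :: 'k::alg_closed_field set)"
proof
 assume fin: "finite (UNIV :: 'k set)"
 define p :: "'k poly" where "p = (\<Prod>a\<in>UNIV. [:- a, 1:])+1"
 have "degree (\<Prod>a\<in>(UNIV :: 'k set). [:- a, 1:]) = card (UNIV :: 'k set)"
  by (subst degree_prod_eq_sum_degree) auto
 hence "degree p > 0" unfolding p_def using fin by (subst degree_add_eq_left) (auto simp: card_gt_0_iff)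
 then obtain x where "poly p x = 0" using alg_closed_imp_poly_has_root by blast
 moreover have "poly p x = (\<Prod>a\<in>UNIV. x - a)+1" by (simp add: p_def poly_prod)
 moreover have "(\<Prod>a\<in>UNIV. x - a) = 0" using fin by (intro prod_zero) auto
 ultimately show False by simp
qed

context
 fixes A :: "'k::alg_closed_field big set" assumes A: "is_subring A" "small A"
begin

lemma small_polys: "|polys_over A| \<le>o |UNIV :: 'k set|"
proof -
 let ?k = "|UNIV :: 'k set|"
 define Q :: "nat => 'k big poly set" where "Q n = rec_nat {0} (%_ S. (%(a, p). pCons a p) ` (A \<times> S)) n" for n
 have Q: "|Q n| \<le>o ?k" for n
 proof (induction n)
  case 0
  show ?case by (simp add: Q_def card_of_singl_ordLeq)
 next
  case (Suc n)
  have "|A \<times> Q n| \<le>o ?k"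
   using A(2) Suc infinite_alg_closed unfolding small_def by (intro card_of_Times_ordLeq_infinite) auto
  hence "|(%(a, p). pCons a p) ` (A \<times> Q n)| \<le>o ?k" by (rule ordLeq_transitive[OF card_of_image])
  moreover have "Q (Suc n) = (%(a, p). pCons a p) ` (A \<times> Q n)" by (simp add: Q_def)
  ultimately show ?case by simp
 qed
 have "p : (\<Union>n. Q n)" if "p : polys_over A" for p using that
 proof (induction p)
  case 0
  show ?case by (intro UN_I[of 0]) (auto simp: Q_def)
 next
  case (pCons b p)
  hence "b : A" "p : polys_over A" using polys_over_pConsD by blast+
  then obtain n where "p : Q n" using pCons by auto
  thus ?case using \<open>b : A\<close> by (intro UN_I[of "Suc n"]) (auto simp: Q_def)
 qed
 hence "polys_over A <= (\<Union>n. Q n)" by blast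
 moreover have "|\<Union>n. Q n| \<le>o ?k"
  using Q infinite_alg_closed infinite_iff_card_of_nat by (intro card_of_UNION_ordLeq_infinite) auto
 ultimately show ?thesis using card_of_mono1 ordLeq_transitive by blast
qed

lemma small_adjoin: "small (adjoin A x)"
 unfolding small_def adjoin_def using small_polys card_of_image ordLeq_transitive by blast

text \<open>The elements algebraic over \<open>A\<close> are roots of at most as many polynomials as
  the base field has elements, each with finitely many roots; this is too few to exhaust the large
  field.\<close>

lemma small_transcendental: "EX x. transcendental A x"
proof (rule ccontr)
 assume neg: "~ ?thesis"
 have "x : (\<Union>p\<in>polys_over A - {0}. {x. poly p x = 0})" for x using neg by (auto simp: transcendental_def)
 hence "UNIV <= (\<Union>p\<in>polys_over A - {0}. {x. poly p x = 0})" by blast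
 moreover have "|\<Union>p\<in>polys_over A - {0}. {x. poly p x = 0}| \<le>o |UNIV :: 'k set|"
 proof (rule card_of_UNION_ordLeq_infinite)
  show "|polys_over A - {0}| \<le>o |UNIV :: 'k set|"
   using small_polys card_of_mono1[of "polys_over A - {0}" "polys_over A"] ordLeq_transitive by blast
  show "ALL p:polys_over A - {0}. |{x. poly p x = 0}| \<le>o |UNIV :: 'k set|"
  proof
   fix p assume "p : polys_over A - {0}"
   hence "finite {x. poly p x = 0}" by (intro poly_roots_finite) auto
   thus "|{x. poly p x = 0}| \<le>o |UNIV :: 'k set|"
    by (intro ordLess_imp_ordLeq finite_ordLess_infinite2 infinite_alg_closed)
  qed
 qed (rule infinite_alg_closed)
 ultimately have "|UNIV :: 'k big set| \<le>o |UNIV :: 'k set|" using card_of_mono1 ordLeq_transitive by blast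
 thus False using big_large by blast
qed

end

text \<open>Serves to absorb finitely many exceptional values, so that a transcendental element
  chosen afterwards avoids them.\<close>

lemma small_finite_extension: assumes "is_subring A" "small A" "finite F"
 shows "EX A'. is_subring A' & small A' & A <= A' & F <= (A' :: 'k::alg_closed_field big set)" using assms(3)
proof (induction F rule: finite_induct)
 case empty thus ?case using assms by auto
next
 case (insert x F)
 then obtain A' where A': "is_subring A'" "small A'" "A <= A'" "F <= A'" by blast
 hence "A <= adjoin A' x" "insert x F <= adjoin A' x" using adjoin_base[OF A'(1)] adjoin_self[OF A'(1)] by blast+
 thus ?case using A' is_subring_adjoin small_adjoin by blast
qed

lemma small_range: "small (range (big_const :: 'k::field => 'k big))" unfolding small_def by (rule card_of_image)

section \<open>Evaluation of multivariate polynomials\<close>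

definition mpolys :: "'v set => ('v, 'k::comm_ring_1) mpoly set" where
 "mpolys V = {p. ALL m : keys p. keys m <= V}"

lemma mpoly_ring_simps:
 "carrier (mpoly_ring V) = mpolys V" "\<one>\<^bsub>mpoly_ring V\<^esub> = 1" "\<zero>\<^bsub>mpoly_ring V\<^esub> = 0"
 "x \<otimes>\<^bsub>mpoly_ring V\<^esub> y = x*y" "x \<oplus>\<^bsub>mpoly_ring V\<^esub> y = x+y"
 by (simp_all add: mpoly_ring_def mpolys_def ring_of_type_algebra_def)

abbreviation mconst :: "'k::comm_ring_1 => ('v, 'k) mpoly" where "mconst k \<equiv> single 0 k"

lemma mconst_mpolys: "mconst k : mpolys V" by (auto simp: mpolys_def)

lemma mvar_mpolys: "v : V ==> mvar v : mpolys V" by (auto simp: mpolys_def mvar_def)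

lemma is_subring_mpolys: "is_subring (mpolys V :: ('v, 'k::comm_ring_1) mpoly set)" unfolding is_subring_def
proof (intro conjI ballI)
 show "1 : mpolys V" using mconst_mpolys[of 1 V] by simp
 fix p q :: "('v, 'k) mpoly" assume p: "p : mpolys V" "q : mpolys V"
 have "keys (p - q) <= keys p Un keys q" by (auto simp: in_keys_iff lookup_minus)
 thus "p - q : mpolys V" using p unfolding mpolys_def by blast
 show "p*q : mpolys V" unfolding mpolys_def
 proof safe
  fix m v assume m: "m : keys (p*q)" "v : keys m"
  obtain m1 m2 where "m = m1+m2" "m1 : keys p" "m2 : keys q" using m(1) keys_mult[of p q] by blast
  thus "v : V" using m(2) Poly_Mapping.keys_add[of m1 m2] p unfolding mpolys_def by blast
 qed
qed

lemma mpolys_mono: "V <= W ==> mpolys V <= mpolys W" by (auto simp: mpolys_def)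

lemma mpolys_empty: "p : mpolys {} ==> EX k. p = mconst k"
proof -
 assume "p : mpolys {}"
 hence "m = 0" if "m : keys p" for m using that by (auto simp: mpolys_def)
 hence "p = mconst (lookup p 0)" by (intro poly_mapping_eqI) (auto simp: lookup_single when_def in_keys_iff)
 thus ?thesis by blast
qed

lemma sum_single: "p = (\<Sum>m\<in>keys p. single m (lookup p m))"
proof (rule poly_mapping_eqI)
 fix m
 have "lookup (\<Sum>m\<in>keys p. single m (lookup p m)) m
   = (\<Sum>l\<in>keys p. if l = m then lookup p m else 0)"
  by (simp add: lookup_sum lookup_single when_def if_distrib cong: if_cong)
 also have "\<dots> = lookup p m" by (simp add: in_keys_iff)
 finally show "lookup p m = lookup (\<Sum>m\<in>keys p. single m (lookup p m)) m" ..
qed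

lemma mpoly_induct [consumes 1, case_names const add var]:
 fixes p :: "('v, 'k::comm_ring_1) mpoly" assumes p: "p : mpolys V" and c: "!!k. P (mconst k)"
  and a: "!!p q. P p ==> P q ==> P (p+q)"
  and v: "!!v p. v : V ==> p : mpolys V ==> P p ==> P (mvar v*p)" shows "P p"
proof -
 have mono: "P (single m k)" if "keys m <= V" for m :: "'v \<Rightarrow>\<^sub>0 nat" and k using that
 proof (induction "\<Sum>w\<in>keys m. lookup m w" arbitrary: m rule: less_induct)
  case less
  show ?case
  proof (cases "m = 0")
   case True thus ?thesis using c by simp
  next
   case False
   then obtain w where w: "w : keys m" by fastforce
   define m' where "m' = m - single w 1"
   have wl: "lookup m w ~= 0" using w by (simp add: in_keys_iff)
   have lk: "lookup m' u = (if u = w then lookup m w - 1 else lookup m u)" for u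
    by (auto simp: m'_def lookup_minus lookup_single when_def)
   have m: "m = single w 1+m'" using wl by (intro poly_mapping_eqI) (simp add: lookup_add lookup_single when_def lk)
   have sub: "keys m' <= keys m" by (auto simp: in_keys_iff lk split: if_splits)
   have "(\<Sum>u\<in>keys m'. lookup m' u) = (\<Sum>u\<in>keys m. lookup m' u)"
    using sub by (intro sum.mono_neutral_left) (auto simp: in_keys_iff)
   also have "\<dots> < (\<Sum>u\<in>keys m. lookup m u)"
    by (rule sum_strict_mono_ex1) (use w wl in \<open>auto simp: lk\<close>)
   finally have "P (single m' k)" using less.hyps sub less.prems by blast
   moreover have "single m' k : mpolys V" using sub less.prems by (auto simp: mpolys_def)
   ultimately have "P (mvar w*single m' k)" using v w less.prems by blast
   thus ?thesis by (subst m) (simp add: mvar_def mult_single)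
  qed
 qed
 have "P (\<Sum>m\<in>S. single m (lookup p m))" if "S <= keys p" for S using finite_subset[OF that finite_keys] that
 proof (induction S rule: finite_induct)
  case empty thus ?case using c[of 0] by simp
 next
  case (insert m S)
  thus ?case using a mono[of m] p by (simp add: mpolys_def)
 qed
 thus ?thesis by (subst sum_single) simp
qed

context
 fixes io :: "'k::field => 'f::field" and gam :: "'v => 'f"
begin

definition mon :: "('v \<Rightarrow>\<^sub>0 nat) => 'f" where
 "mon m = (\<Prod>v\<in>keys m. gam v^lookup m v)"

definition mev :: "('v, 'k) mpoly => 'f" where
 "mev p = (\<Sum>m\<in>keys p. io (lookup p m)*mon m)"

end

lemma mon_superset:
 "finite S ==> keys m <= S ==> mon gam m = (\<Prod>v\<in>S. gam v^lookup m v)"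
 unfolding mon_def by (rule prod.mono_neutral_left) (auto simp: in_keys_iff)

lemma mon_add: "mon gam (m+m') = mon gam m*mon gam m'"
proof -
 let ?S = "keys m Un keys m'"
 have "mon gam (m+m') = (\<Prod>v\<in>?S. gam v^lookup (m+m') v)"
  by (rule mon_superset) (use Poly_Mapping.keys_add[of m m'] in auto)
 also have "\<dots> = mon gam m*mon gam m'"
  by (simp add: mon_superset[of ?S m] mon_superset[of ?S m'] lookup_add power_add prod.distrib)
 finally show ?thesis .
qed

context field_embedding
begin

lemma mev_superset:
 "finite S ==> keys p <= S ==> mev io gam p = (\<Sum>m\<in>S. io (lookup p m)*mon gam m)"
 unfolding mev_def by (rule sum.mono_neutral_left) (auto simp: in_keys_iff zero)

lemma mev_add: "mev io gam (p+q) = mev io gam p+mev io gam q"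
proof -
 let ?S = "keys p Un keys q"
 have "mev io gam (p+q) = (\<Sum>m\<in>?S. io (lookup (p+q) m)*mon gam m)"
  by (rule mev_superset) (use Poly_Mapping.keys_add[of p q] in auto)
 also have "\<dots> = mev io gam p+mev io gam q"
  by (simp add: mev_superset[of ?S p] mev_superset[of ?S q] lookup_add add distrib_right sum.distrib)
 finally show ?thesis .
qed

lemma mev_single: "mev io gam (single m k) = io k*mon gam m" by (cases "k = 0") (auto simp: mev_def zero)

lemma mev_zero: "mev io gam 0 = 0" by (simp add: mev_def)

lemma mev_sum: "mev io gam (sum f I) = (\<Sum>i\<in>I. mev io gam (f i))"
 by (induction I rule: infinite_finite_induct) (auto simp: mev_zero mev_add)

lemma mev_mult: "mev io gam (p*q) = mev io gam p*mev io gam q"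
proof -
 have "mev io gam (p*q) = mev io gam ((\<Sum>m\<in>keys p. single m (lookup p m)) *
   (\<Sum>m\<in>keys q. single m (lookup q m)))" by (simp flip: sum_single)
 also have "\<dots> = (\<Sum>m\<in>keys p. \<Sum>m'\<in>keys q.
   (io (lookup p m)*mon gam m)*(io (lookup q m')*mon gam m'))"
  by (simp add: sum_product mev_sum mult_single mev_single mult mon_add mult_ac)
 also have "\<dots> = mev io gam p*mev io gam q" by (simp add: mev_def sum_product)
 finally show ?thesis .
qed

lemma mev_const: "mev io gam (mconst k) = io k" by (simp add: mev_single mon_def)
lemma mev_one: "mev io gam 1 = 1" using mev_const[of gam 1] one by simp
lemma mev_var: "mev io gam (mvar v) = gam v" by (simp add: mvar_def mev_single one mon_def)
lemma mev_minus: "mev io gam (- p) = - mev io gam p"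
 using mev_add[of gam p "- p"] mev_zero[of gam] by (simp add: eq_neg_iff_add_eq_0 add.commute)
lemma mev_diff: "mev io gam (p - q) = mev io gam p - mev io gam q" using mev_add[of gam p "- q"] mev_minus by simp

lemmas mev_simps = mev_add mev_mult mev_const mev_one mev_var mev_minus mev_diff mev_zero

lemma mev_cong: "p : mpolys V ==> (!!v. v : V ==> gam v = gam' v) ==> mev io gam p = mev io gam' p"
 by (induction rule: mpoly_induct) (auto simp: mev_simps)

definition vals :: "('v => 'f) => 'v set => 'f set" where "vals gam V = mev io gam ` mpolys V"

lemma is_subring_vals: "is_subring (vals gam V)" unfolding is_subring_def vals_def
proof (intro conjI ballI)
 note M = is_subring_mpolys[of V]
 show "1 : mev io gam ` mpolys V" by (rule image_eqI[of _ _ 1]) (auto simp: mev_one intro: is_subring_one[OF M])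
 fix u v assume "u : mev io gam ` mpolys V" "v : mev io gam ` mpolys V"
 then obtain p q where p: "p : mpolys V" "u = mev io gam p" "q : mpolys V" "v = mev io gam q" by auto
 show "u - v : mev io gam ` mpolys V"
  by (rule image_eqI[of _ _ "p - q"]) (auto simp: p mev_diff intro: is_subring_diff[OF M])
 show "u*v : mev io gam ` mpolys V"
  by (rule image_eqI[of _ _ "p*q"]) (auto simp: p mev_mult intro: is_subring_mult[OF M])
qed

lemma vals_const: "io k : vals gam V" unfolding vals_def by (rule image_eqI[OF _ mconst_mpolys]) (simp add: mev_const)

lemma vals_var: "v : V ==> gam v : vals gam V"
 unfolding vals_def by (rule image_eqI[OF _ mvar_mpolys]) (simp add: mev_var)

lemma vals_least: assumes B: "is_subring B" "range io <= B" "gam ` V <= B" shows "vals gam V <= B"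
proof -
 have "mev io gam p : B" if "p : mpolys V" for p
  using that by (induction rule: mpoly_induct) (use B is_subring_add[OF B(1)] is_subring_mult[OF B(1)] in \<open>auto simp: mev_simps\<close>)
 thus ?thesis by (auto simp: vals_def)
qed

lemma vals_empty: "vals gam {} = range io" using vals_least[of "range io" gam "{}"] subring vals_const by blast

lemma vals_insert: "vals gam (insert v V) = adjoin (vals gam V) (gam v)"
proof
 have s: "is_subring (vals gam V)" "is_subring (adjoin (vals gam V) (gam v))"
  using is_subring_vals is_subring_adjoin by blast+
 show "vals gam (insert v V) <= adjoin (vals gam V) (gam v)"
 proof (rule vals_least[OF s(2)])
  show "range io <= adjoin (vals gam V) (gam v)" using adjoin_base[OF s(1) vals_const] by blast
  show "gam ` insert v V <= adjoin (vals gam V) (gam v)"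
   using adjoin_base[OF s(1) vals_var] adjoin_self[OF s(1)] by blast
 qed
 have "vals gam V <= vals gam (insert v V)" using mpolys_mono[of V "insert v V"] by (auto simp: vals_def)
 thus "adjoin (vals gam V) (gam v) <= vals gam (insert v V)"
  using is_subring_vals vals_var[of v "insert v V" gam] by (intro adjoin_least) auto
qed

lemma mev_inj_insert:
 assumes inj: "!!p. p : mpolys V ==> mev io gam p = 0 ==> p = 0" and tr: "transcendental (vals gam V) (gam v)"
  and p: "p : mpolys (insert v V)" "mev io gam p = 0" shows "p = 0"
proof -
 note M = is_subring_mpolys[of V]
 have "p : adjoin (mpolys V) (mvar v)" using p(1)
 proof (induction rule: mpoly_induct)
  case (const k) thus ?case by (rule adjoin_base[OF M mconst_mpolys])
 next
  case (add p q) thus ?case by (rule is_subring_add[OF is_subring_adjoin[OF M]])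
 next
  case (var w p)
  hence "mvar w : adjoin (mpolys V) (mvar v)" using adjoin_base[OF M mvar_mpolys] adjoin_self[OF M] by auto
  thus ?case using var is_subring_mult[OF is_subring_adjoin[OF M]] by blast
 qed
 then obtain P where P: "P : polys_over (mpolys V)" "p = poly P (mvar v)" by (auto simp: adjoin_def)
 have "mev io gam (poly Q (mvar v)) = poly (map_poly (mev io gam) Q) (gam v)" for Q
  by (induction Q) (simp_all add: mev_simps map_poly_pCons)
 hence "poly (map_poly (mev io gam) P) (gam v) = 0" using p(2) P(2) by simp
 moreover have "map_poly (mev io gam) P : polys_over (vals gam V)"
  using P(1) by (auto simp: polys_over_def coeff_map_poly mev_zero vals_def)
 ultimately have "map_poly (mev io gam) P = 0" using tr by (simp add: transcendental_def)
 hence "mev io gam (coeff P i) = 0" for i using coeff_map_poly[where f = "mev io gam" and p = P and n = i, OF mev_zero] by simp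
 hence "P = 0" using inj polys_overD[OF P(1)] by (intro poly_eqI) simp
 thus ?thesis using P(2) by simp
qed

text \<open>The second clause says that \<open>S\<close> generates the kernel of evaluation on the
  polynomials in \<open>V\<close>, by membership in every ideal containing \<open>S\<close>.\<close>

definition presents :: "('v => 'f) => 'v set => ('v, 'k) mpoly set => bool" where
 "presents gam V S \<longleftrightarrow> (ALL r:S. mev io gam r = 0) &
  (ALL p:mpolys V. mev io gam p = 0 --> (ALL I. is_ideal (mpolys V) I & S <= I --> p : I))"

text \<open>By \<open>presents\<close> the kernel of evaluation is exactly the ideal divided out, so
  evaluation induces an embedding of the quotient.\<close>

theorem quotient_embedded:
 fixes gam :: "'v => 'f" and S :: "('v, 'k) mpoly set" assumes pr: "presents gam V S" and S: "S <= mpolys V"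
 shows "EX j. embedded_cring (mpoly_ring V Quot genideal (mpoly_ring V) S) j &
  j ` carrier (mpoly_ring V Quot genideal (mpoly_ring V) S) = vals gam V"
proof -
 define R where "R = (mpoly_ring V :: ('v, 'k) mpoly ring)"
 define I where "I = genideal R S"
 note M = is_subring_mpolys[of V, where 'k = 'k]
 have Rs: "carrier R = mpolys V" "\<one>\<^bsub>R\<^esub> = 1" "\<zero>\<^bsub>R\<^esub> = 0" "x \<otimes>\<^bsub>R\<^esub> y = x*y" "x \<oplus>\<^bsub>R\<^esub> y = x+y" for x y
  by (simp_all add: R_def mpoly_ring_simps)
 note Mc = is_subring_add[OF M] is_subring_mult[OF M] is_subring_uminus[OF M] is_subring_zero[OF M] is_subring_one[OF M]
 have "abelian_group R"
  by (rule abelian_groupI) (use Mc in \<open>auto simp: Rs algebra_simps intro: bexI[of _ "- x" for x]\<close>)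
 moreover have "Group.comm_monoid R" by (rule comm_monoidI) (use Mc in \<open>auto simp: Rs algebra_simps\<close>)
 ultimately have "cring R" by (rule cringI) (auto simp: Rs algebra_simps)
 then interpret R: cring R .
 interpret I: ideal I R unfolding I_def by (rule R.genideal_ideal) (use S Rs in auto)
 have IM: "is_ideal (mpolys V) I" unfolding is_ideal_def
 proof (intro conjI ballI)
  show "I <= mpolys V" using I.a_subset Rs by auto
  show "0 : I" using I.zero_closed Rs by simp
  show "x+y : I" if "x : I" "y : I" for x y using I.a_closed[OF that] Rs by simp
  show "x*y : I" if "x : mpolys V" "y : I" for x y using I.I_l_closed[OF that(2)] that Rs by simp
 qed
 define k where "k = {p : mpolys V. mev io gam p = 0}"
 have kI: "k <= I" using pr IM R.genideal_self[of S] S Rs by (auto simp: presents_def k_def I_def)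
 have "ideal k R"
 proof (rule idealI)
  show "ring R" by (rule R.ring_axioms)
  show "subgroup k (add_monoid R)"
  proof (rule R.add.subgroupI)
   have "0 : k" using Mc(4) mev_zero[of gam] by (simp add: k_def)
   thus "k <= carrier R" "k ~= {}" by (auto simp: k_def Rs)
   show "\<ominus>\<^bsub>R\<^esub> a : k" if "a : k" for a
   proof -
    have "\<ominus>\<^bsub>R\<^esub> a = - a" using that Mc by (intro R.minus_equality) (auto simp: Rs k_def)
    thus ?thesis using that Mc by (simp add: k_def mev_minus)
   qed
   show "a \<oplus>\<^bsub>R\<^esub> b : k" if "a : k" "b : k" for a b using that Mc by (simp add: k_def mev_add Rs)
  qed
 qed (use Mc in \<open>auto simp: k_def mev_mult Rs\<close>)
 hence Ik: "I <= k" unfolding I_def using pr S Rs by (intro R.genideal_minimal) (auto simp: k_def presents_def)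
 have I0: "mev io gam i = 0" if "i : I" for i using Ik that by (auto simp: k_def)
 define Q where "Q = R Quot I"
 define j where "j Z = mev io gam (SOME p. p : Z)" for Z
 let ?c = "%p. I +>\<^bsub>R\<^esub> p"
 have cos: "Z : carrier Q \<longleftrightarrow> (EX p:mpolys V. Z = ?c p)" for Z
  by (auto simp: Q_def FactRing_def A_RCOSETS_def' Rs)
 have j: "j (?c p) = mev io gam p" if p: "p : mpolys V" for p
 proof -
  have "p : ?c p" using I.a_rcos_self[of p] p Rs by simp
  hence "(SOME q. q : ?c p) : ?c p" by (rule someI)
  then obtain i where "i : I" "(SOME q. q : ?c p) = i+p" by (auto simp: a_r_coset_def' Rs)
  thus ?thesis by (simp add: j_def mev_add I0)
 qed
 have hom: "(%p. ?c p) : ring_hom R Q" unfolding Q_def by (rule I.rcos_ring_hom)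
 note H = ring_hom_add[OF hom] ring_hom_mult[OF hom] ring_hom_one[OF hom] ring_hom_closed[OF hom]
 interpret Q: cring Q unfolding Q_def by (rule I.quotient_is_cring[OF R.is_cring])
 have "embedded_cring Q j"
 proof (rule embedded_cringI)
  show "inj_on j (carrier Q)"
  proof (rule inj_onI)
   fix Z W assume h: "Z : carrier Q" "W : carrier Q" "j Z = j W"
   obtain p q where p: "p : mpolys V" "Z = ?c p" "q : mpolys V" "W = ?c q" using h(1,2) unfolding cos by blast
   have "mev io gam (p - q) = 0" using h(3) j[OF p(1)] j[OF p(3)] unfolding p(2,4) mev_diff by simp
   hence "p - q : k" using is_subring_diff[OF M p(1,3)] unfolding k_def by simp
   hence pq: "p - q : I" using kI by blast
   have sub: "?c p <= ?c q" if "p - q : I" for p q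
   proof -
    have "h+p : ?c q" if "h : I" for h unfolding a_r_coset_def' Rs
     by (rule UN_I[OF is_idealD(3)[OF IM that \<open>p - q : I\<close>]]) simp
    thus ?thesis unfolding a_r_coset_def'[of R I p] Rs by blast
   qed
   have "q - p : I" using is_ideal_uminus[OF M IM pq] by simp
   thus "Z = W" unfolding p(2,4) using sub pq by blast
  qed
  show "\<one>\<^bsub>Q\<^esub> : carrier Q" "\<zero>\<^bsub>Q\<^esub> : carrier Q" by auto
  show "j \<one>\<^bsub>Q\<^esub> = 1" using H(3) j[OF Mc(5)] mev_one Rs by simp
  show "j \<zero>\<^bsub>Q\<^esub> = 0"
  proof -
   have "\<zero>\<^bsub>Q\<^esub> = ?c 0" by (simp add: Q_def FactRing_def a_r_coset_def' Rs)
   thus ?thesis using j[OF Mc(4)] mev_zero by simp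
  qed
  show "Z \<otimes>\<^bsub>Q\<^esub> W : carrier Q & j (Z \<otimes>\<^bsub>Q\<^esub> W) = j Z*j W" if h: "Z : carrier Q" "W : carrier Q" for Z W
  proof -
   obtain p q where p: "p : mpolys V" "Z = ?c p" "q : mpolys V" "W = ?c q" using h unfolding cos by blast
   have eq: "Z \<otimes>\<^bsub>Q\<^esub> W = ?c (p*q)" using H(2)[of p q] p(1,3) unfolding Rs p(2,4) by simp
   show ?thesis unfolding eq using Q.m_closed[OF h, unfolded eq] j[OF Mc(2)[OF p(1,3)]] j[OF p(1)] j[OF p(3)]
    by (simp add: mev_mult p(2,4))
  qed
  show "Z \<oplus>\<^bsub>Q\<^esub> W : carrier Q & j (Z \<oplus>\<^bsub>Q\<^esub> W) = j Z+j W" if h: "Z : carrier Q" "W : carrier Q" for Z W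
  proof -
   obtain p q where p: "p : mpolys V" "Z = ?c p" "q : mpolys V" "W = ?c q" using h unfolding cos by blast
   have eq: "Z \<oplus>\<^bsub>Q\<^esub> W = ?c (p+q)" using H(1)[of p q] p(1,3) unfolding Rs p(2,4) by simp
   show ?thesis unfolding eq using Q.a_closed[OF h, unfolded eq] j[OF Mc(1)[OF p(1,3)]] j[OF p(1)] j[OF p(3)]
    by (simp add: mev_add p(2,4))
  qed
  show "EX W:carrier Q. j W = - j Z" if h: "Z : carrier Q" for Z
  proof -
   obtain p where p: "p : mpolys V" "Z = ?c p" using h unfolding cos by blast
   show ?thesis
   proof (rule bexI[of _ "?c (- p)"])
    show "j (?c (- p)) = - j Z" unfolding p(2) using j[OF Mc(3)[OF p(1)]] j[OF p(1)] by (simp add: mev_minus)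
    show "?c (- p) : carrier Q" unfolding cos using Mc(3)[OF p(1)] by blast
   qed
  qed
 qed
 moreover have "j ` carrier Q = vals gam V"
 proof
  show "j ` carrier Q <= vals gam V"
  proof
   fix u assume "u : j ` carrier Q"
   then obtain Z where "Z : carrier Q" "u = j Z" by blast
   then obtain p where p: "p : mpolys V" "u = j (?c p)" unfolding cos by blast
   thus "u : vals gam V" using j[OF p(1)] unfolding vals_def by simp
  qed
  show "vals gam V <= j ` carrier Q"
  proof
   fix u assume "u : vals gam V"
   then obtain p where p: "p : mpolys V" "u = mev io gam p" by (auto simp: vals_def)
   show "u : j ` carrier Q"
   proof (rule image_eqI)
    show "u = j (?c p)" using j[OF p(1)] p(2) by simp
    show "?c p : carrier Q" unfolding cos using p(1) by blast
   qed
  qed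
 qed
 ultimately show ?thesis unfolding Q_def I_def R_def by blast
qed

end

section \<open>Adding a point to the curve\<close>

text \<open>
  With the new point \<open>(x, y) = (c\<^sub>n\<^sub>+\<^sub>1, cb\<^sub>n\<^sub>+\<^sub>1)\<close> and \<open>z i = c\<^sub>i\<^sub>,\<^sub>n\<^sub>+\<^sub>1\<close>, the ring for \<open>n + 1\<close> is the affine
  ring of a curve over the ring \<open>A\<close> for \<open>n\<close>, with \<open>n\<close> points at infinity. The functions \<open>x, y, z i\<close>
  have at most simple poles there; \<open>pt h j\<close> is the residue of the \<open>h\<close>-th function at the \<open>j\<close>-th point.
  \<open>Bs d\<close> consists of the elements with poles of order at most \<open>d\<close>, and \<open>LD d u v\<close> says that
  \<open>v j\<close> is a leading coefficient of \<open>u\<close> at the \<open>j\<close>-th point.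
  Everything is done modulo an ideal \<open>J\<close>, so that it applies to the polynomial ring and to its quotients.
\<close>

locale curve_algebra =
 fixes n :: nat and M A J :: "'r::comm_ring_1 set" and a c cb :: 'r and ci cbi :: "nat => 'r"
  and cij :: "nat => nat => 'r" and x y :: 'r and z :: "nat => 'r"
 assumes n: "4 <= n" and M: "is_subring M" and A: "is_subring A" and AM: "A <= M" and J: "is_ideal M J"
  and aA: "a : A" and cA: "c : A" and cbA: "cb : A"
  and ciA: "4 <= i ==> i <= n ==> ci i : A" and cbiA: "4 <= i ==> i <= n ==> cbi i : A"
  and cijA: "4 <= i ==> i < j ==> j <= n ==> cij i j : A"
  and xM: "x : M" and yM: "y : M" and zM: "4 <= i ==> i <= n ==> z i : M"
  and relx: "4 <= i ==> i <= n ==> (x - ci i)*z i - ((a + cbi i+x+y)*x - c) : J"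
  and rely: "4 <= i ==> i <= n ==> (cbi i - y)*z i - ((a + ci i + cbi i+x) * cbi i - cb) : J"
  and relz: "4 <= i ==> i < j ==> j <= n ==>
   cij i j*z j+(a + ci i + cbi i + ci j + cbi j - cij i j)*z i - z i*z j+(a+x+y)*x - c : J"
begin

definition g :: "nat => 'r" where "g h = (if h = 2 then x else if h = 3 then y else z h)"

text \<open>For \<open>j = 1, 2, 3\<close> the points are those at infinity of the plane cubic, in
  the directions \<open>x + y = 0\<close>, \<open>y = 0\<close> and \<open>x = 0\<close>; for
  \<open>j \<ge> 4\<close> the point is the \<open>j\<close>-th known point of the cubic, the only
  pole of \<open>z j\<close> at finite distance. Residues are normalized by the choice of a
  uniformizer at each point. Together with \<open>1\<close>, the \<open>g h\<close> with
  \<open>h\<close> from 2 to \<open>n\<close> are the \<open>n\<close> functions expected on a curve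
  of genus one with simple poles allowed at \<open>n\<close> points.\<close>

definition pt :: "nat => nat => 'r" where
 "pt h j = (if h = 2 then (if j = 1 \<or> j = 2 then 1 else 0)
  else if h = 3 then (if j = 1 then - 1 else if j = 3 then 1 else 0)
  else if j = 2 \<or> j = h then 1 else 0)"

text \<open>\<open>E j\<close> has a double pole with leading coefficient 1 at the
  \<open>j\<close>-th point and poles of order at most 1 at the others, and \<open>T j\<close> has
  residue 1 there. So \<open>E j * T j^d\<close> isolates one point in every order from 2 on. In
  order 1 this is impossible, because the residues satisfy a linear relation.\<close>

definition E :: "nat => 'r" where
 "E j = (if j = 1 then - (x*y) else if j = 2 then x*x+x*y else if j = 3 then y*y+x*y
  else z j*z j - x*x - x*y)"

definition T :: "nat => 'r" where "T j = (if j = 1 \<or> j = 2 then x else if j = 3 then y else z j)"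

inductive Bs :: "nat => 'r => bool" where
 base: "k : A ==> Bs d k"
| null: "u : J ==> Bs d u"
| gen: "h : {2..n} ==> Bs d u ==> Bs (Suc d) (g h*u)"
| plus: "Bs d u ==> Bs d v ==> Bs d (u+v)"

text \<open>A relation, because leading coefficients are read off from an expression for
  \<open>u\<close>. That they depend on \<open>u\<close> alone is shown only for the rings inside
  the field, by means of places, in \<open>LD_unique\<close>.\<close>

inductive LD :: "nat => 'r => (nat => 'r) => bool" where
 null: "u : J ==> LD 0 u (%_. 0)"
| low: "Bs d u ==> LD (Suc d) u (%_. 0)"
| const: "k : A ==> LD 0 k (%_. k)"
| gen: "h : {2..n} ==> LD d u v ==> LD (Suc d) (g h*u) (%j. pt h j*v j)"
| plus: "LD d u v ==> LD d u' v' ==> LD d (u+u') (%j. v j+v' j)"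

lemma gM: "h : {2..n} ==> g h : M" using xM yM zM[of h] by (auto simp: g_def)
lemma AM': "k : A ==> k : M" using AM by auto
lemmas AC = is_subring_one[OF A] is_subring_zero[OF A] is_subring_add[OF A] is_subring_diff[OF A] is_subring_mult[OF A] is_subring_uminus[OF A]
lemma ptA: "pt h j : A" unfolding pt_def using AC by auto

lemma Bs_M: "Bs d u ==> u : M"
 by (induction rule: Bs.induct) (use AM' is_idealD(1)[OF J] gM is_subring_mult[OF M] is_subring_add[OF M] in auto)

lemma Bs_Suc: "Bs d u ==> Bs (Suc d) u" by (induction rule: Bs.induct) (auto intro: Bs.intros)

lemma Bs_mono: "Bs d u ==> d <= e ==> Bs e u"
 by (rule lift_Suc_mono_le[of "%d. Collect (%u. Bs d u)" d e, THEN subsetD, simplified]) (auto intro: Bs_Suc)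

lemma Bs_scale: "Bs d u ==> k : A ==> Bs d (k*u)"
proof (induction rule: Bs.induct)
 case (gen h d u) thus ?case using Bs.gen[of h d "k*u"] by (simp add: mult.left_commute)
next
 case (null u d) thus ?case using is_idealD(4)[OF J AM'] Bs.null by blast
qed (auto intro: Bs.intros AC simp: distrib_left)

lemma Bs_uminus: "Bs d u ==> Bs d (- u)" using Bs_scale[of d u "- 1"] AC by simp

lemma Bs_diff: "Bs d u ==> Bs d v ==> Bs d (u - v)" using Bs.plus[of d u "- v"] Bs_uminus by simp

lemma Bs_sum: "(!!i. i : I ==> Bs d (f i)) ==> Bs d (sum f I)"
 by (induction I rule: infinite_finite_induct) (auto intro: Bs.intros AC)

lemma Bs_mult: "Bs d u ==> Bs e v ==> Bs (d+e) (u*v)"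
proof (induction rule: Bs.induct)
 case (base k d) thus ?case using Bs_mono[OF Bs_scale, of e v k "d+e"] by simp
next
 case (null u d) thus ?case using is_idealD(4)[OF J Bs_M[OF null(2)] null(1)] by (simp add: mult.commute Bs.null)
next
 case (gen h d u) thus ?case using Bs.gen[of h "d+e" "u*v"] by (simp add: mult.assoc)
qed (auto intro: Bs.intros simp: distrib_right)

lemma Bs_g: "h : {2..n} ==> Bs 1 (g h)" using Bs.gen[of h 0 1] Bs.base AC by simp
lemma Bs_x: "Bs 1 x" using Bs_g[of 2] n by (simp add: g_def)
lemma Bs_y: "Bs 1 y" using Bs_g[of 3] n by (simp add: g_def)
lemma Bs_z: "4 <= i ==> i <= n ==> Bs 1 (z i)" using Bs_g[of i] by (simp add: g_def)
lemma Bs_T: "j : {1..n} ==> Bs 1 (T j)" using Bs_x Bs_y Bs_z[of j] by (auto simp: T_def)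
lemma Bs_mult2: "Bs 1 u ==> Bs 1 v ==> Bs 2 (u*v)" using Bs_mult[of 1 u 1 v] by (simp add: numeral_2_eq_2)

lemma Bs_power: "Bs 1 u ==> Bs d (u^d)" by (induction d) (use Bs.base AC Bs_mult[of 1 u] in auto)

lemma Bs_E: "j : {1..n} ==> Bs 2 (E j)"
 using Bs_z[of j] by (auto simp: E_def intro!: Bs_uminus Bs.plus Bs_diff Bs_mult2 Bs_x Bs_y)

section \<open>Reduction of products of generators modulo lower pole order\<close>

context
 fixes i assumes i: "4 <= i" "i <= n"
begin

lemma Bs_xz: "Bs 1 (x*z i - x*x - x*y)"
proof -
 have eq: "x*z i - x*x - x*y = ci i*z i+(a + cbi i)*x - c+((x - ci i)*z i - ((a + cbi i+x+y)*x - c))"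
  by (simp add: algebra_simps)
 show ?thesis unfolding eq
  by (rule Bs.plus[OF Bs_diff[OF Bs.plus[OF Bs_scale[OF Bs_z ciA] Bs_scale[OF Bs_x]] Bs.base[OF cA]] Bs.null[OF relx]])
   (use i aA cbiA[OF i] AC in auto)
qed

lemma Bs_yz: "Bs 1 (y*z i)"
proof -
 have "y*z i = cbi i*z i - cbi i*x - ((a + ci i + cbi i) * cbi i - cb) - ((cbi i - y)*z i - ((a + ci i + cbi i+x) * cbi i - cb))"
  by (simp add: algebra_simps)
 moreover have "(a + ci i + cbi i) * cbi i - cb : A" using AC aA ciA cbiA cbA i by simp
 ultimately show ?thesis
  using Bs_diff[OF Bs_diff[OF Bs_diff[OF Bs_scale[OF Bs_z[OF i] cbiA[OF i]] Bs_scale[OF Bs_x cbiA[OF i]]] Bs.base] Bs.null[OF rely[OF i]]] by metis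
qed

end

lemma Bs_zz: "4 <= i ==> i <= n ==> 4 <= j ==> j <= n ==> i ~= j ==> Bs 1 (z i*z j - x*x - x*y)"
proof (induction i j rule: linorder_wlog)
 case (le i j)
 let ?r = "cij i j*z j+(a + ci i + cbi i + ci j + cbi j - cij i j)*z i - z i*z j+(a+x+y)*x - c"
 have r: "?r : J" and k: "cij i j : A" "a + ci i + cbi i + ci j + cbi j - cij i j : A"
  using le relz[of i j] cijA[of i j] AC aA ciA cbiA by auto
 have "z i*z j - x*x - x*y = cij i j*z j+(a + ci i + cbi i + ci j + cbi j - cij i j)*z i+a*x - c - ?r"
  by (simp add: algebra_simps)
 thus ?case
  using Bs_diff[OF Bs_diff[OF Bs.plus[OF Bs.plus[OF Bs_scale[OF Bs_z k(1)] Bs_scale[OF Bs_z k(2)]] Bs_scale[OF Bs_x aA]] Bs.base[OF cA]] Bs.null[OF r]] le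
  by metis
next
 case (sym i j) thus ?case by (metis mult.commute)
qed

text \<open>The cubic equation is not among the relations. Up to order 2 it follows by eliminating
  between the two relations for the index 4: multiplied by \<open>y\<close> and \<open>x\<close> and
  added, their terms in \<open>x * y * z 4\<close> cancel.\<close>

lemma Bs_F: "Bs 2 (x*x*y+x*y*y)"
proof -
 have i: "4 <= (4::nat)" "4 <= n" using n by auto
 let ?r1 = "(x - ci 4)*z 4 - ((a + cbi 4+x+y)*x - c)"
 let ?r2 = "(cbi 4 - y)*z 4 - ((a + ci 4 + cbi 4+x) * cbi 4 - cb)"
 let ?k = "cb - (a + ci 4 + cbi 4) * cbi 4"
 have k: "?k : A" using AC aA ciA[OF i] cbiA[OF i] cbA by simp
 have "x*x*y+x*y*y = cbi 4*(x*z 4) - cbi 4*(x*x) + ?k*x - x * ?r2 - ci 4*(y*z 4) - (a + cbi 4)*(x*y) + c*y - y * ?r1"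
  by (simp add: algebra_simps)
 moreover have "Bs 2 (cbi 4*(x*z 4))" "Bs 2 (cbi 4*(x*x))" "Bs 2 (ci 4*(y*z 4))" "Bs 2 ((a + cbi 4)*(x*y))"
  by (intro Bs_scale Bs_mult2 Bs_x Bs_y Bs_z i ciA cbiA aA AC)+
 moreover have "Bs 2 (?k*x)" "Bs 2 (c*y)" using Bs_Suc[OF Bs_scale[OF Bs_x k]] Bs_Suc[OF Bs_scale[OF Bs_y cA]] by (simp_all add: numeral_2_eq_2)
 moreover have "Bs 2 (x * ?r2)" "Bs 2 (y * ?r1)"
  using is_idealD(4)[OF J xM rely[OF i]] is_idealD(4)[OF J yM relx[OF i]] Bs.null by blast+
 ultimately show ?thesis using Bs.plus Bs_diff by (metis (no_types, lifting))
qed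

lemma sum_split: "(\<Sum>j = 1..n. f j) = f 1+f 2+f 3+(\<Sum>j = 4..n. f j :: 'r)"
proof -
 have "{1..n} = insert 1 (insert 2 (insert 3 {4..n}))" using n by auto
 thus ?thesis by (simp add: add.assoc)
qed

lemma sum_H_split: "(\<Sum>j = 2..n. f j) = f 2+f 3+(\<Sum>j = 4..n. f j :: 'r)"
proof -
 have "{2..n} = insert 2 (insert 3 {4..n})" using n by auto
 thus ?thesis by (simp add: add.assoc)
qed

lemma sum_pt_pt: assumes "h : {2..n}" "l : {2..n}"
 shows "(\<Sum>j = 4..n. pt h j*pt l j*E j) = (if 4 <= h & h = l then E h else 0)"
proof -
 have "(\<Sum>j = 4..n. pt h j*pt l j*E j) = (\<Sum>j = 4..n. if j = h then (if h = l then E h else 0) else 0)"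
  by (rule sum.cong) (auto simp: pt_def)
 thus ?thesis using assms by auto
qed

text \<open>A product of two functions with simple poles has the products of residues as leading
  coefficients, and the \<open>E j\<close> realize any such system. The mixed products involving
  \<open>z\<close> are what the relations provide; the others are built into
  \<open>E\<close>.\<close>

lemma Bs_gg: assumes "h : {2..n}" "l : {2..n}" shows "Bs 1 (g h*g l - (\<Sum>j = 1..n. pt h j*pt l j*E j))" using assms
proof (induction h l rule: linorder_wlog)
 case (le h l)
 have B0: "Bs 1 0" by (rule Bs.base) (rule AC)
 consider "h = 2" "l = 2" | "h = 2" "l = 3" | "h = 3" "l = 3" | "h = 2" "4 <= l" | "h = 3" "4 <= l"
  | "4 <= h" "h = l" | "4 <= h" "4 <= l" "h ~= l" using le by force
 thus ?case unfolding sum_split sum_pt_pt[OF le(2,3)]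
  by cases (use B0 Bs_xz[of l] Bs_yz[of l] Bs_zz[of h l] le in \<open>simp_all add: g_def pt_def E_def diff_diff_eq\<close>)
next
 case (sym h l)
 thus ?case by (simp add: mult.commute mult.left_commute)
qed

text \<open>At the \<open>j\<close>-th point the difference has no pole, and \<open>E j\<close> has
  order 2; at the other points both factors have order at most 1. So the expected order 3 drops to
  2.\<close>

lemma Bs_gE: assumes h: "h : {2..n}" and j: "j : {1..n}" shows "Bs 2 ((g h - pt h j*T j)*E j)"
proof -
 have B0: "Bs 2 0" by (rule Bs.base) (rule AC)
 have F': "Bs 2 (- (x*x*y+x*y*y))" by (rule Bs_uminus[OF Bs_F])
 consider "h = 2" | "h = 3" | "4 <= h" using h by force
 thus ?thesis
 proof cases
  case 1
  consider "j = 1 \<or> j = 2" | "j = 3" | "4 <= j" using j by force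
  thus ?thesis
  proof cases
   case 3
   have "(g h - pt h j*T j)*E j = z j*(x*z j - x*x - x*y)+x*(x*z j - x*x - x*y)+x*(y*z j)"
    using 1 3 by (simp add: g_def pt_def E_def algebra_simps)
   thus ?thesis using 3 j by (auto intro!: Bs.plus Bs_mult2 Bs_xz Bs_yz Bs_x Bs_z)
  qed (use 1 B0 Bs_F in \<open>auto simp: g_def pt_def T_def E_def algebra_simps\<close>)
 next
  case 2
  consider "j = 1" | "j = 2" | "j = 3" | "4 <= j" using j by force
  thus ?thesis
  proof cases
   case 4
   have "(g h - pt h j*T j)*E j = z j*(y*z j) - (x*x*y+x*y*y)" using 2 4 by (simp add: g_def pt_def E_def algebra_simps)
   thus ?thesis using 4 j by (auto intro!: Bs_diff Bs_mult2 Bs_yz Bs_F Bs_z)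
  qed (use 2 B0 Bs_F F' in \<open>auto simp: g_def pt_def T_def E_def algebra_simps\<close>)
 next
  case 3
  consider "j = 1" | "j = 2" | "j = 3" | "4 <= j" "j = h" | "4 <= j" "j ~= h" using j by force
  thus ?thesis
  proof cases
   case 1
   have "(g h - pt h j*T j)*E j = - (x*(y*z h))" using 1 3 by (simp add: g_def pt_def E_def algebra_simps)
   thus ?thesis using 3 h by (auto intro!: Bs_uminus Bs_mult2 Bs_x Bs_yz)
  next
   case 2
   have "(g h - pt h j*T j)*E j = x*(x*z h - x*x - x*y)+x*(y*z h)"
    using 2 3 by (simp add: g_def pt_def T_def E_def algebra_simps)
   thus ?thesis using 3 h by (auto intro!: Bs.plus Bs_mult2 Bs_x Bs_yz Bs_xz)
  next
   case j3: 3
   have "(g h - pt h j*T j)*E j = y*(y*z h)+x*(y*z h)" using 3 j3 by (simp add: g_def pt_def T_def E_def algebra_simps)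
   thus ?thesis using 3 h by (auto intro!: Bs.plus Bs_mult2 Bs_x Bs_y Bs_yz)
  next
   case 4
   thus ?thesis using 3 B0 by (simp add: g_def pt_def T_def)
  next
   case 5
   have eq: "(g h - pt h j*T j)*E j = z j*(z h*z j - x*x - x*y)+x*(x*z j - x*x - x*y)
     - x*(x*z h - x*x - x*y)+x*(y*z j) - x*(y*z h)" using 3 5 by (simp add: g_def pt_def E_def algebra_simps)
   show ?thesis unfolding eq
    by (rule Bs_diff[OF Bs.plus[OF Bs_diff[OF Bs.plus[OF Bs_mult2[OF Bs_z Bs_zz] Bs_mult2[OF Bs_x Bs_xz]]
      Bs_mult2[OF Bs_x Bs_xz]] Bs_mult2[OF Bs_x Bs_yz]] Bs_mult2[OF Bs_x Bs_yz]]) (use 3 5 h j in auto)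
  qed
 qed
qed

section \<open>Leading coefficients\<close>

lemma LD_A: "LD d u v ==> v j : A" by (induction rule: LD.induct) (auto intro: AC ptA)

lemma LD_Bs: "LD d u v ==> Bs d u" by (induction rule: LD.induct) (auto intro: Bs.intros Bs_Suc)

lemma LD_zero: "u : J ==> LD d u (%_. 0)" by (cases d) (auto intro: LD.null LD.low Bs.null)

lemma Bs_LD: "Bs d u ==> EX v. LD d u v"
proof (induction rule: Bs.induct)
 case (base k d) thus ?case by (cases d) (auto intro: LD.const LD.low Bs.base)
qed (use LD_zero LD.gen LD.plus in blast)+

lemma LD_scale: "LD d u v ==> k : A ==> LD d (k*u) (%j. k*v j)"
proof (induction rule: LD.induct)
 case (null u) thus ?case using LD.null[OF is_idealD(4)[OF J AM' null(1)]] by simp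
next
 case (low d u) thus ?case using LD.low[OF Bs_scale] by simp
next
 case (const l) thus ?case using LD.const[OF AC(5)] by blast
next
 case (gen h d u v) thus ?case using LD.gen[of h d "k*u" "%j. k*v j"] by (simp add: mult.left_commute)
next
 case (plus d u v u' v')
 thus ?case using LD.plus[of d "k*u" "%j. k*v j"] by (simp add: distrib_left)
qed

lemma LD_mult: "LD d u v ==> LD e u' v' ==> LD (d+e) (u*u') (%j. v j*v' j)"
proof (induction rule: LD.induct)
 case (null u)
 thus ?case using LD_zero[OF is_idealD(4)[OF J Bs_M[OF LD_Bs[OF null(2)]] null(1)]] by (simp add: mult.commute)
next
 case (low d u) thus ?case using LD.low[OF Bs_mult[OF low(1) LD_Bs[OF low(2)]]] by simp
next
 case (const l) thus ?case using LD_scale[OF const(2,1)] by simp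
next
 case (gen h d u v) thus ?case using LD.gen[of h "d+e" "u*u'"] by (simp add: mult.assoc)
next
 case (plus d u1 v1 u2 v2)
 thus ?case using LD.plus[of "d+e" "u1*u'"] by (simp add: distrib_right)
qed

lemma LD_power: "LD d u v ==> LD (m*d) (u^m) (%j. v j^m)"
proof (induction m)
 case 0 thus ?case using LD.const[OF AC(1)] by simp
next
 case (Suc m) thus ?case using LD_mult[of d u v "m*d"] by simp
qed

lemma LD_sum: "finite I ==> (!!i. i : I ==> LD d (f i) (v i)) ==> LD d (sum f I) (%j. \<Sum>i\<in>I. v i j)"
proof (induction I rule: finite_induct)
 case empty thus ?case using LD_zero[OF is_idealD(2)[OF J]] by simp
next
 case (insert i I) thus ?case using LD.plus[of d "f i" "v i"] by simp
qed

lemma LD_uminus: "LD d u v ==> LD d (- u) (%j. - v j)" using LD_scale[of d u v "- 1"] AC by simp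

lemma LD_diff: "LD d u v ==> LD d u' v' ==> LD d (u - u') (%j. v j - v' j)"
 using LD.plus[of d u v "- u'" "%j. - v' j"] LD_uminus[of d u' v'] by simp

text \<open>Up to lower order \<open>u\<close> is determined by its leading coefficients. Order 1
  needs a form of its own, since only \<open>n - 1\<close> generators face \<open>n\<close> points
  there; the coefficients \<open>w\<close> replace the \<open>v j\<close>.\<close>

lemma LD_expand: assumes "LD d u v" shows "(d = 0 --> (EX k:A. u - k : J & (ALL j. v j = k))) &
  (d = 1 --> (EX w. (ALL l. w l : A) & Bs 0 (u - (\<Sum>l = 2..n. w l*g l)) & (ALL j. v j = (\<Sum>l = 2..n. w l*pt l j)))) &
  (d >= 2 --> Bs (d - 1) (u - (\<Sum>j = 1..n. v j*E j*T j^(d - 2))))" using assms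
proof (induction rule: LD.induct)
 case (null u)
 thus ?case using AC by (auto intro!: bexI[of _ 0])
next
 case (low d u)
 thus ?case using AC by (auto intro!: exI[of _ "%_. 0"])
next
 case (const k)
 thus ?case using is_idealD(2)[OF J] by (auto intro!: bexI[of _ k])
next
 case (gen h d u v)
 consider "d = 0" | "d = 1" | "d >= 2" by linarith
 thus ?case
 proof cases
  case 1
  then obtain k where k: "k : A" "u - k : J" "ALL j. v j = k" using gen by auto
  have "(\<Sum>l = 2..n. (if l = h then k else 0)*f l) = k*f h" for f :: "nat => 'r"
  proof -
   have "(\<Sum>l = 2..n. (if l = h then k else 0)*f l) = (\<Sum>l = 2..n. if l = h then k*f h else 0)"
    by (rule sum.cong) auto
   thus ?thesis using gen(1) by simp
  qed
  moreover have "g h*u - k*g h : J" using is_idealD(4)[OF J gM[OF gen(1)] k(2)] by (simp add: algebra_simps)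
  ultimately show ?thesis using 1 k AC Bs.null[of "g h*u - k*g h" 0]
   by (auto intro!: exI[of _ "%l. if l = h then k else 0"] simp: mult.commute)
 next
  case 2
  then obtain w where w: "!!l. w l : A" "Bs 0 (u - (\<Sum>l = 2..n. w l*g l))" "!!j. v j = (\<Sum>l = 2..n. w l*pt l j)"
   using gen by auto
  have "(\<Sum>j = 1..n. pt h j*v j*E j) = (\<Sum>j = 1..n. \<Sum>l = 2..n. w l*(pt h j*pt l j*E j))"
   by (simp add: w(3) sum_distrib_left sum_distrib_right mult_ac)
  also have "\<dots> = (\<Sum>l = 2..n. w l*(\<Sum>j = 1..n. pt h j*pt l j*E j))"
   by (subst sum.swap) (simp add: sum_distrib_left)
  finally have e: "(\<Sum>j = 1..n. pt h j*v j*E j) = (\<Sum>l = 2..n. w l*(\<Sum>j = 1..n. pt h j*pt l j*E j))" .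
  have "g h*u - (\<Sum>j = 1..n. pt h j*v j*E j) = g h*(u - (\<Sum>l = 2..n. w l*g l))
    + (\<Sum>l = 2..n. w l*(g h*g l - (\<Sum>j = 1..n. pt h j*pt l j*E j)))"
   unfolding e by (simp add: right_diff_distrib sum_subtractf sum_distrib_left mult.left_commute)
  moreover have "Bs 1 (g h*(u - (\<Sum>l = 2..n. w l*g l)))" using Bs.gen[OF gen(1) w(2)] by simp
  moreover have "Bs 1 (\<Sum>l = 2..n. w l*(g h*g l - (\<Sum>j = 1..n. pt h j*pt l j*E j)))"
   by (intro Bs_sum Bs_scale Bs_gg gen(1) w(1))
  ultimately have "Bs 1 (g h*u - (\<Sum>j = 1..n. pt h j*v j*E j))" by (simp only: Bs.plus)
  thus ?thesis using 2 by (simp add: numeral_2_eq_2)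
 next
  case 3
  then obtain d' where d: "d = d'+2" by (metis add.commute le_Suc_ex)
  have IH: "Bs (Suc d') (u - (\<Sum>j = 1..n. v j*E j*T j^d'))" using gen d by simp
  have "g h*u - (\<Sum>j = 1..n. pt h j*v j*E j*T j^Suc d') = g h*(u - (\<Sum>j = 1..n. v j*E j*T j^d'))
    + (\<Sum>j = 1..n. v j*((g h - pt h j*T j)*E j*T j^d'))" by (simp add: algebra_simps sum_subtractf sum_distrib_left)
  moreover have "Bs (2+d') ((g h - pt h j*T j)*E j*T j^d')" if "j : {1..n}" for j
   by (rule Bs_mult[OF Bs_gE[OF gen(1) that] Bs_power[OF Bs_T[OF that]]])
  hence "Bs (2+d') (\<Sum>j = 1..n. v j*((g h - pt h j*T j)*E j*T j^d'))"
   by (intro Bs_sum) (rule Bs_scale[OF _ LD_A[OF gen(2)]])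
  moreover have "Bs (2+d') (g h*(u - (\<Sum>j = 1..n. v j*E j*T j^d')))" using Bs.gen[OF gen(1) IH] by simp
  ultimately have "Bs (2+d') (g h*u - (\<Sum>j = 1..n. pt h j*v j*E j*T j^Suc d'))" by (simp only: Bs.plus)
  thus ?thesis using d by simp
 qed
next
 case (plus d u v u' v')
 consider "d = 0" | "d = 1" | "d >= 2" by linarith
 thus ?case
 proof cases
  case 1
  then obtain k k' where k: "k : A" "u - k : J" "ALL j. v j = k" "k' : A" "u' - k' : J" "ALL j. v' j = k'" using plus by auto
  hence "u+u' - (k+k') : J" using is_idealD(3)[OF J k(2,5)] by (simp add: algebra_simps)
  thus ?thesis using 1 k AC by auto
 next
  case 2
  then obtain w w' where w: "!!l. w l : A" "Bs 0 (u - (\<Sum>l = 2..n. w l*g l))" "!!j. v j = (\<Sum>l = 2..n. w l*pt l j)"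
   "!!l. w' l : A" "Bs 0 (u' - (\<Sum>l = 2..n. w' l*g l))" "!!j. v' j = (\<Sum>l = 2..n. w' l*pt l j)"
   using plus by auto
  have "Bs 0 (u+u' - (\<Sum>l = 2..n. (w l+w' l)*g l))"
   using Bs.plus[OF w(2,5)] by (simp add: distrib_right sum.distrib algebra_simps)
  thus ?thesis using 2 w AC by (auto intro!: exI[of _ "%l. w l+w' l"] simp: distrib_right sum.distrib)
 next
  case 3
  thus ?thesis using plus Bs.plus[of "d - 1" "u - (\<Sum>j = 1..n. v j*E j*T j^(d - 2))"]
   by (simp add: distrib_right sum.distrib add_diff_add)
 qed
qed

text \<open>If the leading coefficients lie in \<open>J\<close>, so does the main term of
  \<open>LD_expand\<close>, and the pole order drops. This is the engine of all descents on the
  order below.\<close>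

lemma LD_descend: assumes L: "LD d u v" and v: "!!j. j : {1..n} ==> v j : J"
 shows "if d = 0 then u : J else Bs (d - 1) u"
proof -
 have JM: "k*m : J" if "k : J" "m : M" for k m using is_idealD(4)[OF J that(2,1)] by (simp add: mult.commute)
 have Jd: "k - l : J" if "k : J" "l : J" for k l by (rule is_ideal_diff[OF M J that])
 have bk: "Bs e u" if "Bs e (u - m)" "m : J" for e m using Bs.plus[OF that(1) Bs.null[OF that(2)]] by simp
 consider "d = 0" | "d = 1" | "d >= 2" by linarith
 thus ?thesis
 proof cases
  case 1
  then obtain k where "u - k : J" "ALL j. v j = k" using LD_expand[OF L] by auto
  thus ?thesis using v[of 1] n is_idealD(3)[OF J, of "u - k" k] 1 by simp
 next
  case 2
  then obtain w where w: "!!l. w l : A" "Bs 0 (u - (\<Sum>l = 2..n. w l*g l))" "!!j. v j = (\<Sum>l = 2..n. w l*pt l j)"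
   using LD_expand[OF L] by auto
  \<comment> \<open>The residues at the points 1, 3 and 4 to \<open>n\<close> recover all
    coefficients \<open>w\<close>.\<close>
  have w4: "w i : J" if "i : {4..n}" for i
  proof -
   have "(\<Sum>l = 4..n. w l*pt l i) = (\<Sum>l = 4..n. if l = i then w i else 0)"
    by (rule sum.cong) (use that in \<open>auto simp: pt_def\<close>)
   moreover have "w 2*pt 2 i = 0" "w 3*pt 3 i = 0" using that by (auto simp: pt_def)
   ultimately have "v i = (\<Sum>l = 4..n. if l = i then w i else 0)" unfolding w(3) sum_H_split by simp
   thus ?thesis using v[of i] that by simp
  qed
  have s0: "(\<Sum>l = 4..n. w l*pt l j) = 0" if "j = 1 \<or> j = 3" for j by (rule sum.neutral) (use that in \<open>auto simp: pt_def\<close>)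
  have "v 3 = w 3" unfolding w(3) sum_H_split by (subst s0) (simp_all add: pt_def)
  moreover have "v 1 = w 2 - w 3" unfolding w(3) sum_H_split by (subst s0) (simp_all add: pt_def)
  ultimately have w23: "w 3 : J" "w 2 : J" using v[of 1] v[of 3] n is_idealD(3)[OF J, of "w 2 - w 3" "w 3"] by auto
  have "w l : J" if "l : {2..n}" for l using that w4 w23 by (cases "l = 2"; cases "l = 3") auto
  hence "(\<Sum>l = 2..n. w l*g l) : J" by (intro is_ideal_sum[OF J] JM gM) auto
  thus ?thesis using bk[OF w(2)] 2 by simp
 next
  case 3
  have "(\<Sum>j = 1..n. v j*E j*T j^(d - 2)) : J"
   by (intro is_ideal_sum[OF J] JM v Bs_M[OF Bs_E] Bs_M[OF Bs_power[OF Bs_T]])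
  thus ?thesis using bk LD_expand[OF L] 3 by auto
 qed
qed

end

text \<open>Applied to evaluation from the polynomial ring into the field, and to the passage from
  \<open>J = {0}\<close> to the ideal of a fibre.\<close>

lemma curve_algebra_hom:
 assumes X: "curve_algebra n M A J a c cb ci cbi cij x y z" and Y: "curve_algebra n M' A' J' a' c' cb' ci' cbi' cij' x' y' z'"
  and hom: "!!u v. phi (u+v) = phi u+phi v" "!!u v. phi (u*v) = phi u*phi v" "phi 1 = 1"
  and AA: "!!u. u : A ==> phi u : A'" and JJ: "!!u. u : J ==> phi u : J'"
  and g: "phi x = x'" "phi y = y'" "!!i. i : {4..n} ==> phi (z i) = z' i"
 shows "curve_algebra.Bs n A J x y z d u ==> curve_algebra.Bs n A' J' x' y' z' d (phi u)"
  and "curve_algebra.LD n A J x y z d u v ==> curve_algebra.LD n A' J' x' y' z' d (phi u) (%j. phi (v j))"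
proof -
 interpret X: curve_algebra n M A J a c cb ci cbi cij x y z by (rule X)
 interpret Y: curve_algebra n M' A' J' a' c' cb' ci' cbi' cij' x' y' z' by (rule Y)
 have h0: "phi 0 = 0" by (rule double_eq_zero) (use hom(1)[of 0 0] in simp)
 have hm: "phi (- 1) = - 1" using hom(1)[of 1 "- 1"] hom(3) h0 by (simp add: eq_neg_iff_add_eq_0 add.commute)
 have gg: "phi (X.g h) = Y.g h" if "h : {2..n}" for h using g that by (auto simp: X.g_def Y.g_def)
 have pp: "phi (X.pt h j) = Y.pt h j" for h j using h0 hm hom(3) by (simp add: X.pt_def Y.pt_def)
 show B: "Y.Bs d (phi u)" if "X.Bs d u" for d u
  using that by (induction rule: X.Bs.induct) (simp_all add: hom gg AA JJ Y.Bs.intros)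
 show "Y.LD d (phi u) (%j. phi (v j))" if "X.LD d u v" using that
 proof (induction rule: X.LD.induct)
  case (gen h d u v) thus ?case using Y.LD.gen[of h d "phi u"] by (simp add: hom gg pp)
 qed (simp_all add: hom h0 AA JJ B Y.LD.null Y.LD.low Y.LD.const Y.LD.plus)
qed

section \<open>Quadratic extensions of a polynomial ring over a field\<close>

text \<open>The fraction \<open>(u + v * eta) / w\<close> has trace
  \<open>(2 * u - v * q) / w\<close> and norm \<open>(u^2 - u * v * q + v^2 * r) / w^2\<close>; on a
  smooth curve it is regular once both are polynomials. The numerator of the norm vanishes doubly at
  a root \<open>rho\<close> of \<open>w\<close>. Unless \<open>v\<close> vanishes there too, this
  and the trace condition produce a singular point above \<open>rho\<close>, in any
  characteristic.\<close>

lemma nonsingular_dvd: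
 fixes u v w q r :: "'f::alg_closed_field poly"
 assumes ns: "!!x0 y0. y0^2+poly q x0*y0+poly r x0 = 0 ==> 2*y0+poly q x0 = 0 ==>
   poly (pderiv q) x0*y0+poly (pderiv r) x0 ~= 0"
  and "w ~= 0" "w dvd 2*u - v*q" "w^2 dvd u^2 - u*v*q+v^2*r" shows "w dvd u & w dvd v" using assms(2-4)
proof (induction "degree w" arbitrary: u v w rule: less_induct)
 case less
 show ?case
 proof (cases "degree w = 0")
  case True
  hence "is_unit w" using less.prems(1) by (simp add: is_unit_iff_degree)
  thus ?thesis using unit_imp_dvd by blast
 next
  case False
  then obtain rho where rho: "poly w rho = 0" using alg_closed_imp_poly_has_root[of w] by auto
  then obtain w1 where w1: "w = [:-rho, 1:]*w1" by (auto simp: poly_eq_0_iff_dvd)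
  define D where "D = u^2 - u*v*q+v^2*r"
  obtain s where s: "D = w^2*s" using less.prems(3) by (auto simp: D_def)
  let ?U = "poly u rho" and ?V = "poly v rho" and ?Q = "poly q rho" and ?R = "poly r rho"
  let ?U' = "poly (pderiv u) rho" and ?V' = "poly (pderiv v) rho" and ?Q' = "poly (pderiv q) rho" and ?R' = "poly (pderiv r) rho"
  have "poly D rho = 0" using s rho by simp
  hence D0: "?U^2 - ?U * ?V * ?Q + ?V^2 * ?R = 0" by (simp add: D_def)
  have "poly (pderiv D) rho = 0" using s rho by (simp add: pderiv_mult power2_eq_square)
  hence D1: "?U'*(2 * ?U - ?V * ?Q) + ?V'*(2 * ?V * ?R - ?U * ?Q) - ?U * ?V * ?Q' + ?V^2 * ?R' = 0"
   by (simp add: D_def pderiv_mult pderiv_add pderiv_diff power2_eq_square algebra_simps)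
  obtain t where "2*u - v*q = w*t" using less.prems(2) by auto
  hence "poly (2*u - v*q) rho = 0" using rho by simp
  hence T: "2 * ?U = ?V * ?Q" by simp
  have V0: "?V = 0"
  proof (rule ccontr)
   assume V: "?V ~= 0"
   \<comment> \<open>The point above \<open>rho\<close> at which \<open>u + v * y\<close>
     vanishes.\<close>
   define y0 where "y0 = - ?U / ?V"
   have U: "?U = - (y0 * ?V)" using V by (simp add: y0_def)
   have "?V^2*(y0^2 + ?Q*y0 + ?R) = 0" using D0 unfolding U by (simp add: power2_eq_square algebra_simps)
   hence e1: "y0^2 + ?Q*y0 + ?R = 0" using V by simp
   have "?V*(2*y0 + ?Q) = ?V * ?Q - 2 * ?U" unfolding U by (simp add: algebra_simps)
   hence "?V*(2*y0 + ?Q) = 0" using T by simp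
   hence e2: "2*y0 + ?Q = 0" using V by simp
   have "2 * ?V * ?R - ?U * ?Q = ?V*(2*(y0^2 + ?Q*y0 + ?R) - y0*(2*y0 + ?Q))"
    unfolding U by (simp add: power2_eq_square algebra_simps)
   hence "2 * ?V * ?R - ?U * ?Q = 0" using e1 e2 by simp
   hence "?V^2 * ?R' - ?U * ?V * ?Q' = 0" using D1 T by simp
   hence "?V^2*(?Q'*y0 + ?R') = 0" unfolding U by (simp add: power2_eq_square algebra_simps)
   thus False using ns[OF e1 e2] V by simp
  qed
  hence "?U = 0" using D0 by simp
  then obtain u1 where u1: "u = [:-rho, 1:]*u1" by (auto simp: poly_eq_0_iff_dvd)
  obtain v1 where v1: "v = [:-rho, 1:]*v1" using V0 by (auto simp: poly_eq_0_iff_dvd)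
  have w10: "w1 ~= 0" using less.prems(1) w1 by auto
  have "degree w = Suc (degree w1)" unfolding w1 using w10 by (subst degree_mult_eq) auto
  moreover have "[:-rho, 1:]*w1 dvd [:-rho, 1:]*(2*u1 - v1*q)"
   using less.prems(2) unfolding u1 v1 w1 by (simp only: algebra_simps)
  hence "w1 dvd 2*u1 - v1*q" by (subst (asm) dvd_mult_cancel_left) auto
  moreover have "[:-rho, 1:]^2*w1^2 dvd [:-rho, 1:]^2*(u1^2 - u1*v1*q+v1^2*r)"
   using less.prems(3) unfolding u1 v1 w1 by (simp only: algebra_simps power2_eq_square)
  hence "w1^2 dvd u1^2 - u1*v1*q+v1^2*r" by (subst (asm) dvd_mult_cancel_left) auto
  ultimately have "w1 dvd u1 & w1 dvd v1" using less.hyps[of w1 u1 v1] w10 by simp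
  thus ?thesis unfolding u1 v1 w1 using mult_dvd_mono[OF dvd_refl] by blast
 qed
qed

text \<open>An affine plane curve over the field \<open>K\<close>, as a double cover of the line
  with coordinate \<open>xi\<close>; \<open>irr\<close> makes \<open>1\<close> and
  \<open>eta\<close> independent over \<open>K(xi)\<close>. The cubic is covered near its relevant
  points by two such charts.\<close>

locale quadratic_extension =
 fixes K :: "'f::alg_closed_field set" and xi eta :: 'f and q r :: "'f poly"
 assumes K: "is_subring K" and Ki: "!!x. x : K ==> inverse x : K" and tr: "transcendental K xi"
  and qK: "q : polys_over K" and rK: "r : polys_over K"
  and eq: "eta^2+poly q xi*eta+poly r xi = 0" and irr: "eta ~: fracs (adjoin K xi)"
begin

definition el :: "'f poly => 'f poly => 'f" where "el p p' = poly p xi+poly p' xi*eta"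
definition C :: "'f set" where "C = {el p p' | p p'. p : polys_over K & p' : polys_over K}"

lemmas PK = polys_over_closed(1-5)[OF K] polys_over_const[OF K] polys_over_X[OF K] polys_over_zero[OF K]
 is_subring_one[OF is_subring_polys_over[OF K]]
lemma KP: "is_subring (polys_over K)" by (rule is_subring_polys_over[OF K])
lemma aK: "is_subring (adjoin K xi)" by (rule is_subring_adjoin[OF K])

lemma el_in_fracs: assumes "p : polys_over K" "p' : polys_over K" "el p p' : fracs (adjoin K xi)" shows "p' = 0"
proof (rule ccontr)
 assume "p' ~= 0"
 hence nz: "poly p' xi ~= 0" using tr assms(2) by (auto simp: transcendental_def)
 note F = is_subring_fracs[OF aK]
 have "eta = (el p p' - poly p xi) / poly p' xi" using nz by (simp add: el_def)
 moreover have "(el p p' - poly p xi) / poly p' xi : fracs (adjoin K xi)"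
  by (intro fracs_divide[OF aK] is_subring_diff[OF F] assms(3) fracs_incl[OF aK] adjoinI assms)
 ultimately show False using irr by simp
qed

lemma el_eq: assumes "p : polys_over K" "p' : polys_over K" "s : polys_over K" "s' : polys_over K" "el p p' = el s s'"
 shows "p = s & p' = s'"
proof -
 have "el (p - s) (p' - s') = 0" using assms(5) by (simp add: el_def algebra_simps)
 moreover have "0 : fracs (adjoin K xi)" by (rule is_subring_zero[OF is_subring_fracs[OF aK]])
 ultimately have "p' - s' = 0" using el_in_fracs[of "p - s" "p' - s'"] assms PK by simp
 hence "p' = s'" "poly p xi = poly s xi" using assms(5) by (auto simp: el_def)
 thus ?thesis using transcendental_poly_eq[OF K tr assms(1,3)] by simp
qed

lemma el_add: "el p p'+el s s' = el (p+s) (p'+s')" by (simp add: el_def algebra_simps)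
lemma el_diff: "el p p' - el s s' = el (p - s) (p' - s')" by (simp add: el_def algebra_simps)
lemma eta2: "eta*eta = - (poly q xi*eta) - poly r xi"
proof -
 have "eta*eta = (eta^2+poly q xi*eta+poly r xi) - poly q xi*eta - poly r xi" by (simp add: power2_eq_square)
 thus ?thesis unfolding eq by simp
qed
lemma el_mult: "el p p'*el s s' = el (p*s - p'*s'*r) (p*s'+p'*s - p'*s'*q)"
proof -
 have "el p p'*el s s' = poly p xi*poly s xi+(poly p xi*poly s' xi+poly p' xi*poly s xi)*eta+poly p' xi*poly s' xi*(eta*eta)"
  by (simp add: el_def algebra_simps)
 thus ?thesis unfolding eta2 by (simp add: el_def algebra_simps)
qed

lemma elC: "p : polys_over K ==> p' : polys_over K ==> el p p' : C" by (auto simp: C_def)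

lemma C_subring: "is_subring C" unfolding is_subring_def
proof (intro conjI ballI)
 have "el 1 0 : C" by (intro elC PK)
 thus "1 : C" by (simp add: el_def)
 fix f f' assume "f : C" "f' : C"
 then obtain p p' s s' where f: "f = el p p'" "f' = el s s'" "p : polys_over K" "p' : polys_over K" "s : polys_over K" "s' : polys_over K"
  by (auto simp: C_def)
 show "f - f' : C" "f*f' : C" unfolding f(1,2) el_diff el_mult
  by (intro elC KP[THEN is_subring_diff] KP[THEN is_subring_add] KP[THEN is_subring_mult] f qK rK)+
qed

lemma C_K: "k : K ==> k : C" using elC[of "[:k:]" 0] PK by (simp add: el_def)
lemma C_xi: "xi : C" using elC[of "[:0, 1:]" 0] PK by (simp add: el_def)
lemma C_eta: "eta : C" using elC[of 0 1] PK by (simp add: el_def)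

text \<open>Evaluation at \<open>(x0, y0)\<close>, whose coordinates may lie outside
  \<open>K\<close>. Points over \<open>K\<close> give places, and a point over the function field
  gives the conjugation used below.\<close>

definition ev :: "'f => 'f => 'f => 'f" where
 "ev x0 y0 f = (THE e. EX p p'. p : polys_over K & p' : polys_over K & f = el p p' & e = poly p x0+poly p' x0*y0)"

lemma ev_el: "p : polys_over K ==> p' : polys_over K ==> ev x0 y0 (el p p') = poly p x0+poly p' x0*y0"
 unfolding ev_def by (rule the_equality) (use el_eq in blast)+

lemma ev_K: "k : K ==> ev x0 y0 k = k" using ev_el[of "[:k:]" 0] PK by (simp add: el_def)
lemma ev_xi: "ev x0 y0 xi = x0" using ev_el[of "[:0, 1:]" 0] PK by (simp add: el_def)
lemma ev_eta: "ev x0 y0 eta = y0" using ev_el[of 0 1] PK by (simp add: el_def)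

lemma ev_add: "f : C ==> f' : C ==> ev x0 y0 (f+f') = ev x0 y0 f+ev x0 y0 f'"
proof -
 assume "f : C" "f' : C"
 then obtain p p' s s' where f: "f = el p p'" "f' = el s s'" "p : polys_over K" "p' : polys_over K" "s : polys_over K" "s' : polys_over K"
  by (auto simp: C_def)
 thus ?thesis unfolding f(1,2) el_add by (simp add: ev_el PK algebra_simps)
qed

lemma ev_mult: assumes e: "y0^2+poly q x0*y0+poly r x0 = 0" and "f : C" "f' : C"
 shows "ev x0 y0 (f*f') = ev x0 y0 f*ev x0 y0 f'"
proof -
 obtain p p' s s' where f: "f = el p p'" "f' = el s s'" "p : polys_over K" "p' : polys_over K" "s : polys_over K" "s' : polys_over K"
  using assms by (auto simp: C_def)
 have y: "y0*y0 = - (poly q x0*y0) - poly r x0"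
 proof -
  have "y0*y0 = (y0^2+poly q x0*y0+poly r x0) - poly q x0*y0 - poly r x0" by (simp add: power2_eq_square)
  thus ?thesis unfolding e by simp
 qed
 have "ev x0 y0 f*ev x0 y0 f' = poly p x0*poly s x0+(poly p x0*poly s' x0+poly p' x0*poly s x0)*y0
   + poly p' x0*poly s' x0*(y0*y0)" using f by (simp add: ev_el algebra_simps)
 also have "\<dots> = poly (p*s - p'*s'*r) x0+poly (p*s'+p'*s - p'*s'*q) x0*y0" unfolding y by (simp add: algebra_simps)
 moreover have "ev x0 y0 (f*f') = poly (p*s - p'*s'*r) x0+poly (p*s'+p'*s - p'*s'*q) x0*y0" unfolding f(1,2) el_mult
  by (intro ev_el KP[THEN is_subring_diff] KP[THEN is_subring_add] KP[THEN is_subring_mult] f qK rK)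
 ultimately show ?thesis by simp
qed

text \<open>Trace and norm of \<open>f\<close> over \<open>K(xi)\<close> inherit almost integrality,
  with the norm of \<open>h\<close> as denominator, so both are polynomials in \<open>xi\<close>.
  Smoothness then removes the denominator \<open>w\<close> of \<open>f\<close> by
  \<open>nonsingular_dvd\<close>.\<close>

theorem C_integrally_closed: assumes ns: "!!x0 y0. y0^2+poly q x0*y0+poly r x0 = 0 ==> 2*y0+poly q x0 = 0 ==>
   poly (pderiv q) x0*y0+poly (pderiv r) x0 ~= 0"
  and f: "f : fracs C" and h: "h : C" "h ~= 0" and hf: "!!m. h*f^m : C" shows "f : C"
proof -
 \<comment> \<open>The other root of the quadratic equation: conjugation is evaluation at the point
   \<open>(xi, eta')\<close> of the curve.\<close>
 define eta' where "eta' = - poly q xi - eta"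
 define sg where "sg = ev xi eta'"
 have "eta'^2+poly q xi*eta'+poly r xi = eta^2+poly q xi*eta+poly r xi"
  by (simp add: eta'_def power2_eq_square algebra_simps)
 hence e': "eta'^2+poly q xi*eta'+poly r xi = 0" using eq by simp
 have smult: "sg (g*g') = sg g*sg g'" if "g : C" "g' : C" for g g' unfolding sg_def by (rule ev_mult[OF e' that])
 have s_el: "sg (el p p') = el (p - p'*q) (- p')" if "p : polys_over K" "p' : polys_over K" for p p'
  unfolding sg_def using that by (subst ev_el) (simp_all add: el_def eta'_def algebra_simps)
 have sC: "sg g : C" if g: "g : C" for g
 proof -
  obtain p p' where p: "g = el p p'" "p : polys_over K" "p' : polys_over K" using g by (auto simp: C_def)
  have "el (p - p'*q) (- p') : C" by (intro elC PK p qK)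
  thus ?thesis using s_el p by simp
 qed
 have norm: "g*sg g : adjoin K xi" if g: "g : C" for g
 proof -
  obtain p p' where p: "g = el p p'" "p : polys_over K" "p' : polys_over K" using g by (auto simp: C_def)
  have "g*sg g = poly (p*(p - p'*q)+p'*p'*r) xi"
   unfolding p(1) s_el[OF p(2,3)] el_mult by (simp add: el_def algebra_simps)
  moreover have "p*(p - p'*q)+p'*p'*r : polys_over K" by (intro PK p qK rK)
  ultimately show ?thesis by (simp only: adjoinI)
 qed
 have s_nz: "sg g ~= 0" if g: "g : C" "g ~= 0" for g
 proof
  assume z: "sg g = 0"
  obtain p p' where p: "g = el p p'" "p : polys_over K" "p' : polys_over K" using g by (auto simp: C_def)
  have "el (p - p'*q) (- p') = el 0 0" using z s_el p by (simp add: el_def)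
  hence "p - p'*q = 0 & - p' = 0" by (intro el_eq PK p qK)
  thus False using p(1) g(2) by (simp add: el_def)
 qed
 note CC = is_subring_mult[OF C_subring] is_subring_add[OF C_subring] is_subring_power[OF C_subring]
 have s_pow: "sg (g^m) = sg g^m" if "g : C" for g m
 proof (induction m)
  case 0 show ?case using ev_K[OF is_subring_one[OF K]] by (simp add: sg_def)
 next
  case (Suc m) thus ?case using smult[OF that CC(3)[OF that], of m] by simp
 qed
 obtain F G where FG: "F : C" "G : C" "G ~= 0" "f = F / G" using f C_subring by (metis fracsE)
 obtain w where w: "w : polys_over K" "G*sg G = poly w xi" using norm[OF FG(2)] by (auto simp: adjoin_def)
 have w0: "poly w xi ~= 0" using w(2) FG(3) s_nz[OF FG(2,3)] by auto
 have "F*sg G : C" using FG sC CC by blast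
 then obtain u v where uv: "F*sg G = el u v" "u : polys_over K" "v : polys_over K" by (auto simp: C_def)
 have fuv: "f = el u v / poly w xi" using FG(3,4) s_nz[OF FG(2,3)] uv(1)[symmetric] w(2)[symmetric] by simp
 \<comment> \<open>The conjugate of \<open>f\<close>, written as a fraction because
   \<open>sg\<close> is only meaningful on \<open>C\<close>.\<close>
 define f' where "f' = sg (el u v) / poly w xi"
 have wC: "el w 0 : C" "el u v : C" by (intro elC w uv PK)+
 have sw: "sg (el w 0) = el w 0" using s_el[OF w(1) PK(8)] by (simp add: el_def)
 have hf': "sg h*f'^m : C" for m
 proof -
  have "h*el u v^m = el w 0^m*(h*f^m)" using w0 by (simp add: fuv el_def power_divide)
  hence "sg (h*el u v^m) = sg (el w 0^m*(h*f^m))" by (rule arg_cong)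
  hence "sg h*sg (el u v)^m = el w 0^m*sg (h*f^m)" using h(1) hf wC CC by (simp add: smult s_pow sw)
  hence "sg h*f'^m = sg (h*f^m)" using w0 by (simp add: f'_def power_divide el_def field_simps)
  thus ?thesis using sC[OF hf] by simp
 qed
 define H where "H = h*sg h"
 have H: "H : adjoin K xi" "H ~= 0" using norm[OF h(1)] s_nz[OF h] h(2) by (auto simp: H_def)
 note Fr = is_subring_fracs[OF aK]
 have CK: "g : adjoin K xi" if g: "g : C" "g : fracs (adjoin K xi)" for g
 proof -
  obtain p p' where p: "g = el p p'" "p : polys_over K" "p' : polys_over K" using g(1) unfolding C_def by blast
  hence "p' = 0" using el_in_fracs g(2) by blast
  thus ?thesis using p adjoinI[of p K xi] by (simp add: el_def)
 qed
 have pfr: "poly p xi / poly p' xi : fracs (adjoin K xi)" if "p : polys_over K" "p' : polys_over K" for p p'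
  by (intro fracsI adjoinI that)
 have t: "f+f' = poly (2*u - v*q) xi / poly w xi"
  unfolding f'_def fuv s_el[OF uv(2,3)] using w0 by (simp add: el_def field_simps)
 have "el u v*sg (el u v) = poly (u^2 - u*v*q+v^2*r) xi"
  unfolding s_el[OF uv(2,3)] el_mult by (simp add: el_def algebra_simps power2_eq_square)
 hence nn: "f*f' = poly (u^2 - u*v*q+v^2*r) xi / poly (w^2) xi" unfolding f'_def fuv by (simp add: power2_eq_square)
 have p2: "2 : polys_over K" using is_subring_numeral[OF KP] by blast
 have tK: "2*u - v*q : polys_over K" "u^2 - u*v*q+v^2*r : polys_over K" "w^2 : polys_over K"
  by (intro PK uv qK rK w p2)+
 have "f+f' : adjoin K xi"
 proof (rule almost_integral_adjoin[OF K Ki tr _ H])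
  show fr: "f+f' : fracs (adjoin K xi)" unfolding t by (rule pfr) (use tK w in auto)
  fix m
  have "H*(f+f')^m = (\<Sum>i\<le>m. of_nat (m choose i)*((h*f^i)*(sg h*f'^(m - i))))"
   unfolding binomial_ring H_def sum_distrib_left by (intro sum.cong) (auto simp: mult_ac)
  also have "\<dots> : C" by (intro is_subring_sum[OF C_subring] CC is_subring_of_nat[OF C_subring] hf hf')
  finally show "H*(f+f')^m : adjoin K xi"
   by (rule CK) (intro is_subring_mult[OF Fr] is_subring_power[OF Fr] fr fracs_incl[OF aK] H(1))
 qed
 then obtain t' where t': "t' : polys_over K" "f+f' = poly t' xi" by (auto simp: adjoin_def)
 have "f*f' : adjoin K xi"
 proof (rule almost_integral_adjoin[OF K Ki tr _ H])
  show fr: "f*f' : fracs (adjoin K xi)" unfolding nn by (rule pfr) (use tK w in auto)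
  fix m
  have "H*(f*f')^m = (h*f^m)*(sg h*f'^m)" by (simp add: H_def power_mult_distrib mult_ac)
  also have "\<dots> : C" by (rule CC(1)[OF hf hf'])
  finally show "H*(f*f')^m : adjoin K xi"
   by (rule CK) (intro is_subring_mult[OF Fr] is_subring_power[OF Fr] fr fracs_incl[OF aK] H(1))
 qed
 then obtain n' where n': "n' : polys_over K" "f*f' = poly n' xi" by (auto simp: adjoin_def)
 have "poly (2*u - v*q) xi = poly (w*t') xi" using t t'(2) w0 by (simp add: field_simps)
 hence d1: "2*u - v*q = w*t'" by (intro transcendental_poly_eq[OF K tr] tK PK w t')
 have "poly (u^2 - u*v*q+v^2*r) xi = poly (w^2*n') xi" using nn n'(2) w0 by (simp add: field_simps)
 hence d2: "u^2 - u*v*q+v^2*r = w^2*n'" by (intro transcendental_poly_eq[OF K tr] tK PK w n')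
 have wnz: "w ~= 0" using w0 by auto
 have "w dvd u & w dvd v" by (rule nonsingular_dvd[OF ns wnz]) (simp_all add: d1 d2)
 then obtain u' v' where d: "u = w*u'" "v = w*v'" by (auto elim!: dvdE)
 have "u' : polys_over K" "v' : polys_over K" using polys_over_quotient[OF K Ki w(1) wnz] uv d by auto
 moreover have "f = el u' v'" using w0 unfolding fuv d by (simp add: el_def field_simps)
 ultimately show ?thesis using elC by simp
qed

end

section \<open>Places\<close>

text \<open>
  \<open>pole d f e\<close>: the fraction \<open>f\<close> has a pole of order at most \<open>d\<close> at the point \<open>ep\<close> with
  uniformizer \<open>pp\<close>, and \<open>e\<close> is the value of \<open>pp ^ d * f\<close> there.
\<close>

locale place =
 fixes C :: "'f::field set" and ep :: "'f => 'f" and pp :: 'f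
 assumes C: "is_subring C" and e_add: "f : C ==> f' : C ==> ep (f+f') = ep f+ep f'"
  and e_mult: "f : C ==> f' : C ==> ep (f*f') = ep f*ep f'" and e_one: "ep 1 = 1"
  and pi: "pp : C" "ep pp = 0"
begin

text \<open>Since \<open>f\<close> need not lie in \<open>C\<close>, a denominator \<open>D\<close>
  is allowed that does not vanish at the place.\<close>

definition pole :: "nat => 'f => 'f => bool" where
 "pole d f e \<longleftrightarrow> (EX D:C. ep D ~= 0 & pp^d*D*f : C & ep (pp^d*D*f) = e*ep D)"

lemma e_zero: "ep 0 = 0" by (rule double_eq_zero) (use e_add[of 0 0] is_subring_zero[OF C] in simp)

lemma pole_const: "k : C ==> pole 0 k (ep k)"
 unfolding pole_def using is_subring_one[OF C] e_one by (intro bexI[of _ 1]) auto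

lemma pole_mult: assumes "pole d f e" "pole d' f' e'" shows "pole (d+d') (f*f') (e*e')"
proof -
 obtain D D' where D: "D : C" "ep D ~= 0" "pp^d*D*f : C" "ep (pp^d*D*f) = e*ep D"
  "D' : C" "ep D' ~= 0" "pp^d'*D'*f' : C" "ep (pp^d'*D'*f') = e'*ep D'" using assms unfolding pole_def by blast
 define F F' where F: "F = pp^d*D*f" "F' = pp^d'*D'*f'"
 have eq: "pp^(d+d')*(D*D')*(f*f') = F*F'" unfolding F by (simp add: power_add mult_ac)
 note D = D[folded F]
 show ?thesis unfolding pole_def
 proof (intro bexI[of _ "D*D'"] conjI)
  show "ep (D*D') ~= 0" using D by (simp add: e_mult)
  show "ep (pp^(d+d')*(D*D')*(f*f')) = e*e'*ep (D*D')" unfolding eq using D by (simp add: e_mult)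
 qed (use D is_subring_mult[OF C] eq in auto)
qed

lemma pole_add: assumes "pole d f e" "pole d f' e'" shows "pole d (f+f') (e+e')"
proof -
 obtain D D' where D: "D : C" "ep D ~= 0" "pp^d*D*f : C" "ep (pp^d*D*f) = e*ep D"
  "D' : C" "ep D' ~= 0" "pp^d*D'*f' : C" "ep (pp^d*D'*f') = e'*ep D'" using assms unfolding pole_def by blast
 define F F' where F: "F = pp^d*D*f" "F' = pp^d*D'*f'"
 have eq: "pp^d*(D*D')*(f+f') = D'*F+D*F'" unfolding F by (simp add: algebra_simps)
 note D = D[folded F]
 show ?thesis unfolding pole_def
 proof (intro bexI[of _ "D*D'"] conjI)
  show "ep (D*D') ~= 0" using D by (simp add: e_mult)
  show "ep (pp^d*(D*D')*(f+f')) = (e+e')*ep (D*D')"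
   unfolding eq using D by (simp add: e_mult e_add is_subring_mult[OF C] algebra_simps)
 qed (use D is_subring_mult[OF C] is_subring_add[OF C] eq in auto)
qed

lemma pole_Suc: "pole d f e ==> pole (Suc d) f 0"
proof -
 have "pole 1 1 0" unfolding pole_def using pi is_subring_one[OF C] e_one by (intro bexI[of _ 1]) auto
 thus "pole d f e ==> pole (Suc d) f 0" using pole_mult[of 1 1 0 d f e] by simp
qed

lemma pole_zero: "pole d 0 e ==> e = 0" unfolding pole_def using e_zero by auto

end

section \<open>The new point over the coordinate ring\<close>

lemma (in place) pole1I: "D : C ==> ep D ~= 0 ==> pp*D*f = u ==> u : C ==> ep u = e*ep D ==> pole 1 f e"
 unfolding pole_def by auto

text \<open>The uniformizer of the place may differ by the factor \<open>kp\<close> from the one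
  implicit in \<open>pt\<close>; hence the power \<open>kp^d\<close>.\<close>

lemma (in place) LD_pole: assumes X: "curve_algebra n M A {0} a c cb ci cbi cij x y z"
  and AC: "!!k. k : A ==> k : C & ep k = k"
  and g: "!!h. h : {2..n} ==> pole 1 (curve_algebra.g x y z h) (kp * curve_algebra.pt h j)"
  and L: "curve_algebra.LD n A {0} x y z d u v" shows "pole d u (kp^d*v j)"
proof -
 interpret X: curve_algebra n M A "{0}" a c cb ci cbi cij x y z by (rule X)
 have up: "pole d f 0" if "pole 0 f 0" for d f by (induction d) (use that pole_Suc in auto)
 have A0: "pole 0 k k" if "k : A" for k using pole_const[of k] AC that by simp
 have Ad: "EX e. pole d k e" if "k : A" for d k by (induction d) (use A0[OF that] pole_Suc in blast)+
 have B: "EX e. pole d u e" if "X.Bs d u" for d u using that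
 proof (induction rule: X.Bs.induct)
  case (null u d)
  hence "u = 0" by simp
  thus ?case using up[OF A0[OF X.AC(2)], of d] by blast
 next
  case (gen h d u)
  thus ?case using pole_mult[OF g[OF gen(1)]] by fastforce
 next
  case (plus d u v) thus ?case using pole_add by blast
 qed (use Ad in blast)
 show ?thesis using L
 proof (induction rule: X.LD.induct)
  case (null u) thus ?case using A0[of 0] X.AC by simp
 next
  case (low d u) thus ?case using B pole_Suc by fastforce
 next
  case (const k) thus ?case using A0 by simp
 next
  case (gen h d u v)
  thus ?case using pole_mult[OF g[OF gen(1)] gen(3)] by (simp add: mult_ac)
 next
  case (plus d u v u' v') thus ?case using pole_add[OF plus(3,4)] by (simp add: distrib_left)
 qed
qed

lemma transcendental_inverse: assumes K: "is_subring K" and x: "transcendental K (x :: 'f::field)"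
 shows "transcendental K (1 / x)" unfolding transcendental_def
proof safe
 fix p assume p: "p : polys_over K" "poly p (1 / x) = 0"
 have "[:0, 1:] : polys_over K" by (rule polys_over_X[OF K])
 hence x0: "x ~= 0" using x by (auto simp: transcendental_def)
 have "reflect_poly p : polys_over K" using p(1) is_subring_zero[OF K] by (auto simp: polys_over_def coeff_reflect_poly)
 moreover have "poly (reflect_poly p) x = 0" using p(2) x0 by (simp add: poly_reflect_poly_nz inverse_eq_divide)
 ultimately show "p = 0" using x by (auto simp: transcendental_def)
qed

text \<open>\<open>Ni\<close> is the derivative of the cubic by \<open>y\<close> at the
  \<open>i\<close>-th point, so \<open>x - ci i\<close> is a uniformizer there. \<open>ns\<close> is
  smoothness in the coordinates \<open>x\<close> and \<open>x * y\<close>. \<open>cb0\<close> and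
  \<open>ccb\<close> yield irreducibility over \<open>K(x)\<close>, and \<open>c0\<close> a nonzero
  leading coefficient at the third point at infinity.\<close>

locale curve_point = field_embedding io for io :: "'k::alg_closed_field => 'f::alg_closed_field" +
 fixes n :: nat and A :: "'f set" and a c cb e :: 'f and ci cbi :: "nat => 'f" and cij :: "nat => nat => 'f" and x y :: 'f
 assumes n: "4 <= n" and A: "is_subring A" and kA: "range io <= A"
  and aA: "a : A" and cA: "c : A" and cbA: "cb : A" and eA: "e : A"
  and ciA: "4 <= i ==> i <= n ==> ci i : A" and cbiA: "4 <= i ==> i <= n ==> cbi i : A"
  and cijA: "4 <= i ==> i < j ==> j <= n ==> cij i j : A"
  and tr: "transcendental A x"
  and eqn: "x*x*y+x*y*y+a*x*y = cb*x + c*y+e"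
  and eqi: "4 <= i ==> i <= n ==> ci i * ci i * cbi i + ci i * cbi i * cbi i+a * ci i * cbi i = cb * ci i + c * cbi i+e"
  and ci0: "4 <= i ==> i <= n ==> ci i ~= 0"
  and cineq: "4 <= i ==> i < j ==> j <= n ==> ci i ~= ci j"
  and c0: "c ~= 0" and cb0: "cb ~= 0" and ccb: "c ~= cb"
  and Ni: "4 <= i ==> i <= n ==> (a+2 * cbi i + ci i) * ci i - c ~= 0"
  and ns: "y0^2+(x0^2+a*x0 - c)*y0 - x0*(cb*x0+e) = 0 ==> 2*y0+(x0^2+a*x0 - c) = 0 ==>
   (2*x0+a)*y0 - 2 * cb*x0 - e ~= 0"
  and r1: "4 <= i ==> i < j ==> j <= n ==> (ci j - ci i) * cij i j = (a + cbi i + ci j + cbi j) * ci j - c"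
  and r2: "4 <= i ==> i < j ==> j <= n ==> (cbi i - cbi j) * cij i j = (a + ci i + cbi i + ci j) * cbi i - cb"
begin

definition z :: "nat => 'f" where "z i = ((a + cbi i+x+y)*x - c) / (x - ci i)"
definition K :: "'f set" where "K = fracs A"

lemma K: "is_subring K" unfolding K_def by (rule is_subring_fracs[OF A])
lemma Ki: "u : K ==> inverse u : K" unfolding K_def by (rule fracs_inverse)
lemma AK: "u : A ==> u : K" unfolding K_def by (rule fracs_incl[OF A])
lemma trK: "transcendental K x" unfolding K_def by (rule transcendental_fracs[OF A tr])

lemmas KC = is_subring_add[OF K] is_subring_mult[OF K] is_subring_diff[OF K] is_subring_uminus[OF K]
 is_subring_zero[OF K] is_subring_one[OF K]
lemmas inK = AK[OF aA] AK[OF cA] AK[OF cbA] AK[OF eA] AK[OF ciA] AK[OF cbiA]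

lemma x_notin: "x ~: K"
proof
 assume "x : K"
 hence "[:- x, 1:] : polys_over K" using KC by (auto simp: polys_over_def coeff_pCons split: nat.splits)
 moreover have "poly [:- x, 1:] x = 0" by simp
 ultimately have "[:- x, 1:] = 0" using trK unfolding transcendental_def by blast
 thus False by simp
qed

lemma x0: "x ~= 0" using x_notin KC by auto
lemma xci: "4 <= i ==> i <= n ==> x - ci i ~= 0" using x_notin inK by auto

lemma xz: "4 <= i ==> i <= n ==> (x - ci i)*z i = (a + cbi i+x+y)*x - c" using xci by (simp add: z_def)

lemma relation_y: assumes i: "4 <= i" "i <= n" shows "(cbi i - y)*z i - ((a + ci i + cbi i+x) * cbi i - cb) = 0"
proof -
 have "(x - ci i)*((cbi i - y)*z i - ((a + ci i + cbi i+x) * cbi i - cb))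
   = (cbi i - y)*((x - ci i)*z i) - (x - ci i)*((a + ci i + cbi i+x) * cbi i - cb)" by (simp add: algebra_simps)
 also have "\<dots> = (ci i * ci i * cbi i + ci i * cbi i * cbi i+a * ci i * cbi i - (cb * ci i + c * cbi i+e))
   - (x*x*y+x*y*y+a*x*y - (cb*x + c*y+e))" unfolding xz[OF i] by (simp add: algebra_simps)
 also have "\<dots> = 0" using eqn eqi[OF i] by simp
 finally show ?thesis using xci[OF i] by simp
qed

text \<open>Multiplied by both denominators, the left side is a combination of \<open>r1\<close>,
  \<open>r2\<close>, the cubic equation of the \<open>i\<close>-th point and that of
  \<open>(x, y)\<close>.\<close>

lemma relation_z: assumes i: "4 <= i" "i < j" "j <= n"
 shows "cij i j*z j+(a + ci i + cbi i + ci j + cbi j - cij i j)*z i - z i*z j+(a+x+y)*x - c = 0" (is "?L = 0")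
proof -
 let ?W = "(a+x+y)*x - c"
 have ii: "i <= n" "4 <= j" using i by auto
 have "(x - ci i)*(x - ci j) * ?L = cij i j*(x - ci i)*((x - ci j)*z j)
   + (a + ci i + cbi i + ci j + cbi j - cij i j)*(x - ci j)*((x - ci i)*z i)
   - ((x - ci i)*z i)*((x - ci j)*z j)+(x - ci i)*(x - ci j) * ?W" by (simp add: algebra_simps)
 also have "\<dots> = ?W*((ci j - ci i) * cij i j - ((a + cbi i + ci j + cbi j) * ci j - c))
   + x*(cbi i*((ci j - ci i) * cij i j - ((a + cbi i + ci j + cbi j) * ci j - c))
    + ci i*((cbi i - cbi j) * cij i j - ((a + ci i + cbi i + ci j) * cbi i - cb))
    - x*((cbi i - cbi j) * cij i j - ((a + ci i + cbi i + ci j) * cbi i - cb))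
    + (ci i * ci i * cbi i + ci i * cbi i * cbi i+a * ci i * cbi i - (cb * ci i + c * cbi i+e)))
   - x*(x*x*y+x*y*y+a*x*y - (cb*x + c*y+e))" unfolding xz[OF i(1) ii(1)] xz[OF ii(2) i(3)] by (simp add: algebra_simps)
 also have "\<dots> = 0" using eqn eqi[OF i(1) ii(1)] r1[OF i] r2[OF i] by simp
 finally show ?thesis using xci i ii by simp
qed

lemma curve_algebra_field: assumes "is_subring A'" "A <= A'" shows "curve_algebra n UNIV A' {0} a c cb ci cbi cij x y z"
 by unfold_locales
  (use assms n aA cA cbA ciA cbiA cijA xz relation_y relation_z in
   \<open>auto simp: is_subring_def is_ideal_def\<close>)

sublocale Y: curve_algebra n UNIV A "{0}" a c cb ci cbi cij x y z by (rule curve_algebra_field[OF A subset_refl])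

text \<open>A rational \<open>x * y\<close> would be a polynomial \<open>R\<close> in
  \<open>x\<close>, as it is integral over \<open>K[x]\<close>, with
  \<open>R * (R + q) = - r\<close>. Since \<open>q\<close> and \<open>r\<close> have degree 2, one
  factor is a constant; comparing the constant and the quadratic coefficients makes it equal, up to
  sign, to both \<open>c\<close> and \<open>cb\<close>.\<close>

lemma xy_irr: "x*y ~: fracs (adjoin K x)"
proof
 assume f: "x*y : fracs (adjoin K x)"
 define q where "q = [:- c, a, 1:]"
 define r where "r = [:0, - e, - cb:]"
 have qr: "q : polys_over K" "r : polys_over K"
  using inK KC by (auto simp: q_def r_def intro!: polys_over_pCons polys_over_zero[OF K])
 have eq: "(x*y)^2+poly q x*(x*y)+poly r x = 0"
 proof -
  have "(x*y)^2+poly q x*(x*y)+poly r x = x*(x*x*y+x*y*y+a*x*y - (cb*x + c*y+e))"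
   by (simp add: q_def r_def power2_eq_square algebra_simps)
  thus ?thesis using eqn by simp
 qed
 have aK: "is_subring (adjoin K x)" by (rule is_subring_adjoin[OF K])
 have int: "integral_over (adjoin K x) (x*y)" unfolding integral_over_def
 proof (intro exI conjI allI impI)
  show "(if i = 0 then poly r x else poly q x) : adjoin K x" for i :: nat using qr adjoinI by auto
  show "(x*y)^2+(\<Sum>i<2. (if i = 0 then poly r x else poly q x)*(x*y)^i) = 0"
   using eq by (simp add: numeral_2_eq_2 algebra_simps)
 qed
 obtain u v where uv: "u : adjoin K x" "v : adjoin K x" "v ~= 0" "x*y = u / v" using f aK by (metis fracsE)
 obtain N where N: "!!m. v^N*(x*y)^m : adjoin K x" using integral_over_powers[OF aK int uv(2)] uv by auto
 have "x*y : adjoin K x" by (rule almost_integral_adjoin[OF K Ki trK f _ _ N]) (use N[of 0] uv in auto)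
 then obtain R where R: "R : polys_over K" "x*y = poly R x" by (auto simp: adjoin_def)
 have "poly (R^2+q*R+r) x = 0" using eq R(2) by simp
 moreover have "R^2+q*R+r : polys_over K" by (intro polys_over_closed(1-5)[OF K] R qr)
 ultimately have Req: "R^2+q*R+r = 0" using trK by (simp add: transcendental_def)
 have prod: "R*(R+q) = - r" using Req by (simp add: power2_eq_square algebra_simps add_eq_0_iff)
 have r0: "r ~= 0" "degree r = 2" using cb0 by (simp_all add: r_def)
 have dq: "degree q = 2" by (simp add: q_def)
 have nz: "R ~= 0" "R+q ~= 0" using prod r0 by auto
 hence "degree (R*(R+q)) = degree R+degree (R+q)" by (rule degree_mult_eq)
 hence deg: "degree R+degree (R+q) = 2" using prod r0 by simp
 have q_coeff: "coeff q 0 = - c" "coeff q 2 = 1" "coeff r 0 = 0" "coeff r 2 = - cb"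
  by (simp_all add: q_def r_def numeral_2_eq_2)
 have key: False if "R = [:s:] \<or> R+q = [:s:]" for s
 proof (cases "R = [:s:]")
  case True
  have "smult s ([:s:]+q) = - r" using prod True by simp
  hence h: "coeff (smult s ([:s:]+q)) k = coeff (- r) k" for k by simp
  show ?thesis using h[of 0] h[of 2] q_coeff cb0 ccb by (simp add: numeral_2_eq_2)
 next
  case False
  hence "R = [:s:] - q" using that by (simp add: algebra_simps)
  hence "smult s ([:s:] - q) = - r" using prod by (simp add: mult.commute)
  hence h: "coeff (smult s ([:s:] - q)) k = coeff (- r) k" for k by simp
  show ?thesis using h[of 0] h[of 2] q_coeff cb0 ccb by (auto simp: numeral_2_eq_2)
 qed
 have "degree R = 0 \<or> degree (R+q) = 0"
 proof (rule ccontr)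
  assume "~ ?thesis"
  hence "degree R = 1" "degree (R+q) = 1" using deg by auto
  moreover have "degree (R+q) = 2" using \<open>degree R = 1\<close> dq by (subst degree_add_eq_right) auto
  ultimately show False by simp
 qed
 thus False using key degree_eq_zeroE by metis
qed

text \<open>The chart with finite \<open>x\<close>. The coordinate \<open>x * y\<close> makes the
  equation monic and brings in the third point at infinity, at \<open>x = 0\<close> and
  \<open>x * y = c\<close>.\<close>

sublocale Q: quadratic_extension K x "x*y" "[:- c, a, 1:]" "[:0, - e, - cb:]"
proof
 show "(x*y)\<^sup>2+poly [:- c, a, 1:] x*(x*y)+poly [:0, - e, - cb:] x = 0"
 proof -
  have "(x*y)\<^sup>2+poly [:- c, a, 1:] x*(x*y)+poly [:0, - e, - cb:] x = x*(x*x*y+x*y*y+a*x*y - (cb*x + c*y+e))"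
   by (simp add: power2_eq_square algebra_simps)
  thus ?thesis using eqn by simp
 qed
qed (use K Ki trK xy_irr inK KC in \<open>auto intro!: polys_over_pCons polys_over_zero[OF K]\<close>)

lemma adjoin_inverse: "fracs (adjoin K (1 / x)) <= fracs (adjoin K x)"
proof (rule fracs_least)
 have aK: "is_subring (adjoin K x)" by (rule is_subring_adjoin[OF K])
 show s: "is_subring (fracs (adjoin K x))" by (rule is_subring_fracs[OF aK])
 show "is_subring (adjoin K (1 / x))" by (rule is_subring_adjoin[OF K])
 show "adjoin K (1 / x) <= fracs (adjoin K x)" using adjoin_base[OF K] adjoin_self[OF K] is_subring_one[OF aK]
  by (intro adjoin_least s fracsI) (auto intro: fracs_incl[OF aK])
qed (rule fracs_inverse)

text \<open>The chart containing the other two points at infinity, where \<open>1 / x\<close>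
  vanishes.\<close>

sublocale Q': quadratic_extension K "1 / x" "y / x" "[:1, a, - c:]" "[:0, 0, - cb, - e:]"
proof
 show "(y / x)\<^sup>2+poly [:1, a, - c:] (1 / x)*(y / x)+poly [:0, 0, - cb, - e:] (1 / x) = 0"
 proof -
  have "x^3*((y / x)\<^sup>2+poly [:1, a, - c:] (1 / x)*(y / x)+poly [:0, 0, - cb, - e:] (1 / x))
    = x*x*y+x*y*y+a*x*y - (cb*x + c*y+e)" using x0 by (simp add: power2_eq_square power3_eq_cube field_simps)
  thus ?thesis using eqn x0 by simp
 qed
 show "y / x ~: fracs (adjoin K (1 / x))"
 proof
  assume "y / x : fracs (adjoin K (1 / x))"
  hence "y / x : fracs (adjoin K x)" using adjoin_inverse by blast
  moreover have "is_subring (fracs (adjoin K x))" "x : fracs (adjoin K x)"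
   using is_subring_fracs[OF is_subring_adjoin[OF K]] fracs_incl[OF is_subring_adjoin[OF K] adjoin_self[OF K]] by auto
  ultimately have "x*(x*(y / x)) : fracs (adjoin K x)" using is_subring_mult by blast
  thus False using xy_irr x0 by simp
 qed
qed (use K Ki transcendental_inverse[OF K trK] inK KC in \<open>auto intro!: polys_over_pCons polys_over_zero[OF K]\<close>)

lemma ext_place: assumes "quadratic_extension K xi eta q r" "y0^2+poly q x0*y0+poly r x0 = 0" "x0 : K"
 shows "place (quadratic_extension.C K xi eta) (quadratic_extension.ev K xi eta x0 y0) (xi - x0)"
proof -
 interpret S: quadratic_extension K xi eta q r by fact
 have p: "xi - x0 = S.el [:- x0, 1:] 0" "[:- x0, 1:] : polys_over K"
  using assms(3) KC by (auto simp: S.el_def intro!: polys_over_pCons polys_over_zero[OF K])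
 show ?thesis
 proof
  show "S.ev x0 y0 1 = 1" by (rule S.ev_K) (rule KC)
  show "xi - x0 : S.C" "S.ev x0 y0 (xi - x0) = 0"
   unfolding p(1) using p(2) polys_over_zero[OF K] by (simp_all add: S.elC S.ev_el)
 qed (use S.C_subring S.ev_add S.ev_mult[OF assms(2)] in auto)
qed

text \<open>The leading coefficients are seen by the \<open>n\<close> places at infinity.\<close>

theorem LD_unique: assumes L: "Y.LD d 0 v" and j: "j : {1..n}" shows "v j = 0"
proof -
 note P = polys_over_pCons polys_over_zero[OF K]
 note KK = inK KC
 have fin: "v j = 0" if "place C ep pp" "!!k. k : A ==> k : C & ep k = k"
  "!!h. h : {2..n} ==> place.pole C ep pp 1 (Y.g h) (kp*Y.pt h j)" "kp ~= 0" for C ep pp kp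
  using place.pole_zero[OF that(1) place.LD_pole[OF that(1) Y.curve_algebra_axioms that(2,3) L]] that(4) by simp
 have QA: "k : Q.C & Q.ev x0 y0 k = k" "k : Q'.C & Q'.ev x0 y0 k = k" if "k : A" for k x0 y0
  using Q.C_K Q.ev_K Q'.C_K Q'.ev_K AK[OF that] by auto
 have h_cases: "h = 2 \<or> h = 3 \<or> (4 <= h & h <= n)" if "h : {2..n}" for h using that by auto
 consider "j = 1 \<or> j = 2" | "j = 3" | "4 <= j" "j <= n" using j by force
 thus ?thesis
 proof cases
  case 1
  \<comment> \<open>At \<open>1 / x = 0\<close> the equation for \<open>y / x\<close> has the roots
    \<open>-1\<close> and \<open>0\<close>, the slopes of the first and second point.\<close>
  define y0 :: 'f where "y0 = (if j = 1 then - 1 else 0)"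
  have "place Q'.C (Q'.ev 0 y0) (1 / x - 0)"
   by (rule ext_place[OF Q'.quadratic_extension_axioms _ KC(5)]) (simp add: y0_def)
  then interpret p: place Q'.C "Q'.ev 0 y0" "1 / x" by simp
  have one: "1 : Q'.C" by (rule is_subring_one[OF Q'.C_subring])
  show ?thesis
  proof (rule fin[OF p.place_axioms QA(2), of 1])
   fix h assume h: "h : {2..n}"
   show "p.pole 1 (Y.g h) (1*Y.pt h j)" using h_cases[OF h]
   proof (elim disjE)
    assume "h = 2"
    thus ?thesis using 1 x0 one p.e_one by (intro p.pole1I[of 1 _ 1]) (auto simp: Y.g_def Y.pt_def)
   next
    assume "h = 3"
    thus ?thesis using 1 x0 one p.e_one Q'.C_eta Q'.ev_eta[of 0 y0]
     by (intro p.pole1I[of 1 _ "y / x"]) (auto simp: Y.g_def Y.pt_def y0_def)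
   next
    assume h4: "4 <= h & h <= n"
    \<comment> \<open>In this chart \<open>z h\<close> is a fraction with denominator
      \<open>1 - ci h / x\<close>, which has the value 1 at \<open>1 / x = 0\<close>.\<close>
    have D: "[:1, - ci h:] : polys_over K" using h4 KK by (auto intro!: P)
    have U: "[:1, a + cbi h, - c:] : polys_over K" "1 : polys_over K" using h4 KK by (auto simp: one_pCons intro!: P)
    have "x*x*(1 / x*Q'.el [:1, - ci h:] 0*z h) = (x - ci h)*z h" using x0 by (simp add: Q'.el_def field_simps)
    also have "\<dots> = x*x*Q'.el [:1, a + cbi h, - c:] 1"
     unfolding xz[OF h4[THEN conjunct1] h4[THEN conjunct2]] using x0 by (simp add: Q'.el_def field_simps)
    finally have eq: "1 / x*Q'.el [:1, - ci h:] 0*z h = Q'.el [:1, a + cbi h, - c:] 1" using x0 by simp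
    show ?thesis
    proof (rule p.pole1I)
     show "1 / x*Q'.el [:1, - ci h:] 0*Y.g h = Q'.el [:1, a + cbi h, - c:] 1" using eq h4 by (simp add: Y.g_def)
    qed (use 1 h4 D U polys_over_zero[OF K] in \<open>auto simp: Q'.elC Q'.ev_el Y.pt_def y0_def\<close>)
   qed
  qed auto
 next
  case 2
  \<comment> \<open>The uniformizer is \<open>x\<close>, and \<open>x * y\<close> has the value
    \<open>c\<close> at this point; so the leading coefficients carry the factor
    \<open>c\<close>.\<close>
  have "place Q.C (Q.ev 0 c) (x - 0)"
   by (rule ext_place[OF Q.quadratic_extension_axioms _ KC(5)]) (simp add: power2_eq_square)
  then interpret p: place Q.C "Q.ev 0 c" x by simp
  have one: "1 : Q.C" by (rule is_subring_one[OF Q.C_subring])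
  show ?thesis
  proof (rule fin[OF p.place_axioms QA(1) _ c0])
   fix h assume h: "h : {2..n}"
   show "p.pole 1 (Y.g h) (c*Y.pt h j)" using h_cases[OF h]
   proof (elim disjE)
    assume h2: "h = 2"
    have U: "[:0, 0, 1:] : polys_over K" using KK by (auto intro!: P)
    show ?thesis
    proof (rule p.pole1I)
     show "x*1*Y.g h = Q.el [:0, 0, 1:] 0" using h2 by (simp add: Y.g_def Q.el_def)
    qed (use 2 h2 U one p.e_one polys_over_zero[OF K] in \<open>auto simp: Q.elC Q.ev_el Y.pt_def\<close>)
   next
    assume "h = 3"
    thus ?thesis using 2 one p.e_one Q.C_eta Q.ev_eta[of 0 c]
     by (intro p.pole1I[of 1 _ "x*y"]) (auto simp: Y.g_def Y.pt_def)
   next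
    assume h4: "4 <= h & h <= n"
    have D: "[:- ci h, 1:] : polys_over K" using h4 KK by (auto intro!: P)
    have U: "[:0, - c, a + cbi h, 1:] : polys_over K" "[:0, 1:] : polys_over K" using h4 KK by (auto intro!: P)
    have "x*Q.el [:- ci h, 1:] 0*z h = x*((x - ci h)*z h)" by (simp add: Q.el_def algebra_simps)
    also have "\<dots> = Q.el [:0, - c, a + cbi h, 1:] [:0, 1:]"
     unfolding xz[OF h4[THEN conjunct1] h4[THEN conjunct2]] by (simp add: Q.el_def algebra_simps)
    finally have eq: "x*Q.el [:- ci h, 1:] 0*z h = Q.el [:0, - c, a + cbi h, 1:] [:0, 1:]" .
    show ?thesis
    proof (rule p.pole1I)
     show "x*Q.el [:- ci h, 1:] 0*Y.g h = Q.el [:0, - c, a + cbi h, 1:] [:0, 1:]" using eq h4 by (simp add: Y.g_def)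
    qed (use 2 h4 D U ci0[of h] polys_over_zero[OF K] in \<open>auto simp: Q.elC Q.ev_el Y.pt_def\<close>)
   qed
  qed
 next
  case 3
  \<comment> \<open>The known point itself, with uniformizer \<open>x - ci j\<close>; the value of
    \<open>(x - ci j) * z j\<close> there is the quantity in \<open>Ni\<close>.\<close>
  let ?y0 = "ci j * cbi j"
  have "ci j*(ci j * ci j * cbi j + ci j * cbi j * cbi j+a * ci j * cbi j - (cb * ci j + c * cbi j+e)) = 0"
   using eqi[OF 3] by simp
  hence e0: "?y0^2+poly [:- c, a, 1:] (ci j) * ?y0+poly [:0, - e, - cb:] (ci j) = 0"
   by (simp add: power2_eq_square algebra_simps)
  interpret p: place Q.C "Q.ev (ci j) ?y0" "x - ci j"
   by (rule ext_place[OF Q.quadratic_extension_axioms e0]) (use 3 KK in auto)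
  have one: "1 : Q.C" by (rule is_subring_one[OF Q.C_subring])
  show ?thesis
  proof (rule fin[OF p.place_axioms QA(1) _ Ni[OF 3]])
   fix h assume h: "h : {2..n}"
   show "p.pole 1 (Y.g h) (((a+2 * cbi j + ci j) * ci j - c)*Y.pt h j)" using h_cases[OF h]
   proof (elim disjE)
    assume h2: "h = 2"
    have U: "[:0, - ci j, 1:] : polys_over K" using 3 KK by (auto intro!: P)
    show ?thesis
    proof (rule p.pole1I)
     show "(x - ci j)*1*Y.g h = Q.el [:0, - ci j, 1:] 0" using h2 by (simp add: Y.g_def Q.el_def algebra_simps)
    qed (use 3 h2 U one p.e_one polys_over_zero[OF K] in \<open>auto simp: Q.elC Q.ev_el Y.pt_def\<close>)
   next
    assume h3: "h = 3"
    have U: "[:- ci j, 1:] : polys_over K" using 3 KK by (auto intro!: P)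
    show ?thesis
    proof (rule p.pole1I)
     show "(x - ci j)*x*Y.g h = Q.el 0 [:- ci j, 1:]" using h3 by (simp add: Y.g_def Q.el_def algebra_simps)
    qed (use 3 h3 U ci0[of j] Q.C_xi Q.ev_xi[of "ci j" ?y0] polys_over_zero[OF K] in \<open>auto simp: Q.elC Q.ev_el Y.pt_def\<close>)
   next
    assume h4: "4 <= h & h <= n"
    show ?thesis
    proof (cases "h = j")
     case True
     have U: "[:- c, a + cbi j, 1:] : polys_over K" "1 : polys_over K" using 3 KK by (auto simp: one_pCons intro!: P)
     show ?thesis
     proof (rule p.pole1I)
      show "(x - ci j)*1*Y.g h = Q.el [:- c, a + cbi j, 1:] 1"
       using True 3 xz[OF 3] by (simp add: Y.g_def Q.el_def algebra_simps)
     qed (use 3 True U one p.e_one in \<open>auto simp: Q.elC Q.ev_el Y.pt_def algebra_simps\<close>)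
    next
     case False
     have ne: "ci j ~= ci h" using cineq[of j h] cineq[of h j] 3 h4 False by (cases "j < h") auto
     have D: "[:- ci h, 1:] : polys_over K" using h4 KK by (auto intro!: P)
     have U: "[:- ci j, 1:] * [:- c, a + cbi h, 1:] : polys_over K" "[:- ci j, 1:] : polys_over K"
      using h4 3 KK by (auto intro!: polys_over_closed(3)[OF K] P)
     have "(x - ci j)*Q.el [:- ci h, 1:] 0*z h = (x - ci j)*((x - ci h)*z h)" by (simp add: Q.el_def algebra_simps)
     also have "\<dots> = Q.el ([:- ci j, 1:] * [:- c, a + cbi h, 1:]) [:- ci j, 1:]"
      unfolding xz[OF h4[THEN conjunct1] h4[THEN conjunct2]] by (simp add: Q.el_def algebra_simps)
     finally have eq: "(x - ci j)*Q.el [:- ci h, 1:] 0*z h = Q.el ([:- ci j, 1:] * [:- c, a + cbi h, 1:]) [:- ci j, 1:]" .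
     show ?thesis
     proof (rule p.pole1I)
      show "(x - ci j)*Q.el [:- ci h, 1:] 0*Y.g h = Q.el ([:- ci j, 1:] * [:- c, a + cbi h, 1:]) [:- ci j, 1:]"
       using eq h4 by (simp add: Y.g_def)
      show "Q.el ([:- ci j, 1:] * [:- c, a + cbi h, 1:]) [:- ci j, 1:] : Q.C" by (rule Q.elC[OF U])
      show "Q.ev (ci j) ?y0 (Q.el ([:- ci j, 1:] * [:- c, a + cbi h, 1:]) [:- ci j, 1:])
        = ((a+2 * cbi j + ci j) * ci j - c)*Y.pt h j*Q.ev (ci j) ?y0 (Q.el [:- ci h, 1:] 0)"
       unfolding Q.ev_el[OF U] using 3 h4 False by (simp add: Y.pt_def)
     qed (use 3 h4 D ne polys_over_zero[OF K] in \<open>auto simp: Q.elC Q.ev_el\<close>)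
    qed
   qed
  qed
 qed
qed

end

lemma (in free_basis) coord_poly: assumes f: "f : B" and p: "p : polys_over A"
 shows "coord (poly p tau*f) = (%j. p * coord f j)"
proof (rule coord_eqI)
 show "poly p tau*f : B"
  using poly_polys_over[OF subB subsetD[OF polys_over_mono[OF AB] p] tauB] f is_subring_mult[OF subB] by blast
 show "p * coord f j : polys_over A" for j by (rule is_subring_mult[OF is_subring_polys_over[OF subA] p coord(1)[OF f]])
 have "comb (%j. p * coord f j) = poly p tau * comb (coord f)" by (simp add: comb_def sum_distrib_left mult.assoc)
 thus "poly p tau*f = comb (%j. p * coord f j)" using coord(3)[OF f] by simp
qed (simp add: coord(2)[OF f])

lemma (in curve_algebra) Bs_subring: "is_subring {u. EX d. Bs d u}" unfolding is_subring_def
proof (intro conjI ballI)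
 show "1 : {u. EX d. Bs d u}" using Bs.base[OF AC(1)] by blast
 fix u v assume "u : {u. EX d. Bs d u}" "v : {u. EX d. Bs d u}"
 then obtain d d' where d: "Bs d u" "Bs d' v" by auto
 show "u*v : {u. EX d. Bs d u}" using Bs_mult[OF d] by blast
 show "u - v : {u. EX d. Bs d u}"
  using Bs_diff[OF Bs_mono[OF d(1), of "max d d'"] Bs_mono[OF d(2), of "max d d'"]] by auto
qed

lemma (in curve_algebra) Bs_least:
 assumes S: "is_subring S" "A <= S" "J <= S" "x : S" "y : S" "!!i. i : {4..n} ==> z i : S" shows "Bs d u ==> u : S"
proof (induction rule: Bs.induct)
 case (gen h d u)
 have "g h : S" using S(4-6) gen(1) by (auto simp: g_def)
 thus ?case using is_subring_mult[OF S(1)] gen by blast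
qed (use S is_subring_add[OF S(1)] in auto)

section \<open>A basis over a polynomial subring\<close>

text \<open>
  A general linear combination \<open>tau\<close> of the functions with simple poles has a pole at each point at
  infinity, so the new ring is free over \<open>A[tau]\<close>; \<open>tv\<close> lists the residues of \<open>tau\<close>.
\<close>

locale curve_basis = curve_point io n A a c cb e ci cbi cij x y
 for io :: "'k::alg_closed_field => 'f::alg_closed_field" and n A a c cb e ci cbi cij x y +
 fixes al :: 'f assumes al: "al : range io" "al ~= 0" "al ~= 1" "al + of_nat (n - 3) ~= 0"
begin

definition B :: "'f set" where "B = {u. EX d. Y.Bs d u}"
definition tau :: 'f where "tau = al*Y.g 2+Y.g 3+(\<Sum>i = 4..n. Y.g i)"
definition tv :: "nat => 'f" where "tv j = al*Y.pt 2 j+Y.pt 3 j+(\<Sum>i = 4..n. Y.pt i j)"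
text \<open>The function \<open>x\<close> is left out, as \<open>tau\<close> expresses it by the
  others when \<open>al\<close> is invertible. Functions of order one satisfy the residue relation
  \<open>lead_degree_1\<close>, so one direction is missing in order two; \<open>w 1\<close>
  supplies it. The factor \<open>1 - al\<close> gives \<open>w 1\<close> the same leading
  coefficient at the first point as \<open>tau\<close>.\<close>

definition w :: "nat => 'f" where "w j = (if j = 0 then 1 else if j = 1 then (1 - al)*(Y.g 2*Y.g 3) else Y.g (Suc j))"
definition wt :: "nat => nat" where "wt j = (if j = 0 then 0 else if j = 1 then 2 else 1)"
definition wl :: "nat => nat => 'f" where
 "wl j i = (if j = 0 then 1 else if j = 1 then (1 - al)*(Y.pt 2 i*Y.pt 3 i) else Y.pt (Suc j) i)"
definition Ld :: "(nat => 'f) => nat => nat => 'f" where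
 "Ld b N i = (\<Sum>j<n. if wt j <= N then b j*tv i^(N - wt j)*wl j i else 0)"
abbreviation t2 :: 'f where "t2 \<equiv> al + of_nat (n - 3)"

lemma BI: "Y.Bs d u ==> u : B" by (auto simp: B_def)

lemma B_subring: "is_subring B" unfolding B_def by (rule Y.Bs_subring)

lemma A_B: "A <= B" using Y.Bs.base BI by blast

lemma range_inverse: "u : range io ==> u : A & inverse u : A"
proof
 assume u: "u : range io"
 thus "u : A" using kA by blast
 obtain k where "u = io k" using u by auto
 hence "inverse u = io (inverse k)" using inverse by simp
 thus "inverse u : A" using kA by auto
qed

lemma al_A: "al : A" "inverse al : A" "al - 1 : A" "inverse (al - 1) : A" "1 - al : A"
  "t2 : A" "inverse t2 : A"
proof -
 have "al - 1 : range io" "t2 : range io" using is_subring_diff[OF subring al(1) is_subring_one[OF subring]]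
   is_subring_add[OF subring al(1) is_subring_of_nat[OF subring]] by auto
 thus "al : A" "inverse al : A" "al - 1 : A" "inverse (al - 1) : A" "t2 : A" "inverse t2 : A"
  using range_inverse al(1) by blast+
 thus "1 - al : A" using is_subring_uminus[OF A, of "al - 1"] by simp
qed

lemma sum_pt: "4 <= j ==> j <= n ==> (\<Sum>i = 4..n. f i*Y.pt i j) = f j"
proof -
 assume j: "4 <= j" "j <= n"
 have "(\<Sum>i = 4..n. f i*Y.pt i j) = (\<Sum>i = 4..n. if i = j then f j else 0)"
  by (rule sum.cong) (use j in \<open>auto simp: Y.pt_def\<close>)
 thus ?thesis using j by simp
qed

lemma sum_pt': "(\<Sum>i = 4..n. f i*Y.pt i 1) = 0" "(\<Sum>i = 4..n. f i*Y.pt i 2) = (\<Sum>i = 4..n. f i)"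
  "(\<Sum>i = 4..n. f i*Y.pt i 3) = 0"
 by (rule sum.neutral, force simp: Y.pt_def) (rule sum.cong, auto simp: Y.pt_def intro: sum.neutral)

lemma tv_simps: "tv 1 = al - 1" "tv 2 = t2" "tv 3 = 1" "4 <= i ==> i <= n ==> tv i = 1"
proof -
 have "card {4..n} = n - 3" using n by simp
 thus "tv 1 = al - 1" "tv 2 = t2" "tv 3 = 1"
  using sum_pt'[of "%_. 1"] by (simp_all add: tv_def Y.pt_def[of 2] Y.pt_def[of 3] del: One_nat_def)
 show "tv i = 1" if "4 <= i" "i <= n" using sum_pt[OF that, of "%_. 1"] that by (simp add: tv_def Y.pt_def[of 2] Y.pt_def[of 3])
qed

lemma tvA: "tv i : A" unfolding tv_def by (intro Y.AC is_subring_sum[OF A] al_A Y.ptA)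
lemma wlA: "wl j i : A" unfolding wl_def using Y.AC Y.ptA al_A by auto

lemma LD_g: "h : {2..n} ==> Y.LD 1 (Y.g h) (Y.pt h)" using Y.LD.gen[of h 0 1 "%_. 1"] Y.LD.const[OF Y.AC(1)] by simp

lemma LD_tau: "Y.LD 1 tau tv"
proof -
 have "Y.LD 1 (al*Y.g 2) (%j. al*Y.pt 2 j)" using Y.LD_scale[OF LD_g al_A(1), of 2] n by simp
 moreover have "Y.LD 1 (Y.g 3) (Y.pt 3)" using LD_g[of 3] n by simp
 moreover have "Y.LD 1 (\<Sum>i = 4..n. Y.g i) (%j. \<Sum>i = 4..n. Y.pt i j)" by (rule Y.LD_sum) (simp_all add: LD_g del: One_nat_def)
 ultimately have "Y.LD 1 (al*Y.g 2+Y.g 3+(\<Sum>i = 4..n. Y.g i)) (%j. al*Y.pt 2 j+Y.pt 3 j+(\<Sum>i = 4..n. Y.pt i j))"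
  by (intro Y.LD.plus)
 thus ?thesis unfolding tau_def tv_def .
qed

lemma LD_w: "j < n ==> Y.LD (wt j) (w j) (wl j)"
proof -
 assume j: "j < n"
 have "Y.LD 2 (Y.g 2*Y.g 3) (%i. Y.pt 2 i*Y.pt 3 i)"
  using Y.LD_mult[OF LD_g LD_g, of 2 3] n by (simp add: numeral_2_eq_2)
 hence "Y.LD 2 ((1 - al)*(Y.g 2*Y.g 3)) (%i. (1 - al)*(Y.pt 2 i*Y.pt 3 i))" by (rule Y.LD_scale) (rule al_A)
 moreover have "Y.LD 1 (Y.g (Suc j)) (Y.pt (Suc j))" if "j ~= 0" using that j by (intro LD_g) auto
 ultimately show ?thesis using Y.LD.const[OF Y.AC(1)] by (simp add: wt_def w_def wl_def[abs_def])
qed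

lemma tau_Bs: "Y.Bs d (tau^d)" by (rule Y.Bs_power[OF Y.LD_Bs[OF LD_tau]])
lemma tau_B: "tau : B" by (rule BI[OF Y.LD_Bs[OF LD_tau]])
lemma w_B: "j < n ==> w j : B" by (rule BI[OF Y.LD_Bs[OF LD_w]])

lemma LD_poly: assumes p: "p : polys_over A" "!!k. k > d ==> coeff p k = 0"
 shows "Y.LD d (poly p tau) (%i. coeff p d*tv i^d)"
proof -
 have "degree p <= d" using p(2) by (intro degree_le) auto
 hence "poly p tau = (\<Sum>k\<le>d. coeff p k*tau^k)"
  unfolding poly_altdef by (intro sum.mono_neutral_left) (auto simp: coeff_eq_0)
 moreover have "Y.LD d (\<Sum>k\<le>d. coeff p k*tau^k) (%i. \<Sum>k\<le>d. if k = d then coeff p d*tv i^d else 0)"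
 proof (rule Y.LD_sum)
  fix k assume k: "k : {..d}"
  have ck: "coeff p k : A" by (rule polys_overD[OF p(1)])
  show "Y.LD d (coeff p k*tau^k) (%i. if k = d then coeff p d*tv i^d else 0)"
  proof (cases "k = d")
   case True
   thus ?thesis using Y.LD_scale[OF Y.LD_power[OF LD_tau, of d] ck] by simp
  next
   case False
   then obtain d' where d': "d = Suc d'" "k <= d'" using k by (cases d) auto
   thus ?thesis using False Y.LD.low[OF Y.Bs_mono[OF Y.Bs_scale[OF tau_Bs ck] d'(2)]] by simp
  qed
 qed simp
 ultimately show ?thesis by simp
qed

lemma comb_LD: assumes p: "!!j. j < n ==> p j : polys_over A" "!!j k. j < n ==> k+wt j > N ==> coeff (p j) k = 0"
 shows "Y.LD N (\<Sum>j<n. poly (p j) tau*w j) (Ld (%j. coeff (p j) (N - wt j)) N)"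
proof -
 have "Y.LD N (\<Sum>j<n. poly (p j) tau*w j) (%i. \<Sum>j<n. if wt j <= N then coeff (p j) (N - wt j)*tv i^(N - wt j)*wl j i else 0)"
 proof (rule Y.LD_sum)
  fix j assume j: "j : {..<n}"
  show "Y.LD N (poly (p j) tau*w j) (%i. if wt j <= N then coeff (p j) (N - wt j)*tv i^(N - wt j)*wl j i else 0)"
  proof (cases "wt j <= N")
   case True
   have "Y.LD (N - wt j) (poly (p j) tau) (%i. coeff (p j) (N - wt j)*tv i^(N - wt j))"
    using p j by (intro LD_poly) auto
   thus ?thesis using Y.LD_mult[OF _ LD_w] j True by force
  next
   case False
   hence "coeff (p j) k = 0" for k using p(2)[of j k] j by simp
   hence "p j = 0" by (intro poly_eqI) simp
   thus ?thesis using False Y.LD_zero[of 0 N] by simp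
  qed
 qed simp
 thus ?thesis by (simp add: Ld_def[abs_def])
qed

lemma sum_n_split: "(\<Sum>j<n. F j) = F 0+F 1+F 2+(\<Sum>i = 4..n. F (i - 1) :: 'z::comm_monoid_add)"
proof -
 have "{..<n} = insert 0 (insert 1 (insert 2 {3..<n}))" using n by auto
 moreover have "(\<Sum>j = 3..<n. F j) = (\<Sum>i = 4..n. F (i - 1))"
  by (rule sum.reindex_bij_witness[where i = "%i. i - 1" and j = Suc]) auto
 ultimately show ?thesis by (simp add: add.assoc)
qed

lemma Ld_split: assumes "N >= 1"
 shows "Ld b N i = b 0*tv i^N+(if N >= 2 then b 1*tv i^(N - 2)*((1 - al)*(Y.pt 2 i*Y.pt 3 i)) else 0)
  + b 2*tv i^(N - 1)*Y.pt 3 i+tv i^(N - 1)*(\<Sum>k = 4..n. b (k - 1)*Y.pt k i)"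
proof -
 have "(\<Sum>k = 4..n. if wt (k - 1) <= N then b (k - 1)*tv i^(N - wt (k - 1))*wl (k - 1) i else 0)
   = tv i^(N - 1)*(\<Sum>k = 4..n. b (k - 1)*Y.pt k i)"
  unfolding sum_distrib_left by (rule sum.cong) (use assms in \<open>auto simp: wt_def wl_def\<close>)
 thus ?thesis unfolding Ld_def sum_n_split using assms by (simp add: wt_def wl_def numeral_3_eq_3)
qed

lemma Ld_simps: assumes "N >= 1" shows "Ld b N 1 = (al - 1)^(N - 1)*(b 0*(al - 1)+(if N >= 2 then b 1 else 0) - b 2)"
  and "Ld b N 2 = t2^(N - 1)*(b 0*t2+(\<Sum>k = 4..n. b (k - 1)))"
  and "Ld b N 3 = b 0+b 2"
  and "4 <= i ==> i <= n ==> Ld b N i = b 0+b (i - 1)"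
proof -
 obtain M where M: "N = Suc M" using assms by (cases N) auto
 have p1: "Y.pt 2 1 = 1" "Y.pt 3 1 = - 1" "Y.pt 2 2 = 1" "Y.pt 3 2 = 0" "Y.pt 2 3 = 0" "Y.pt 3 3 = 1" by (simp_all add: Y.pt_def)
 show "Ld b N 1 = (al - 1)^(N - 1)*(b 0*(al - 1)+(if N >= 2 then b 1 else 0) - b 2)"
  unfolding Ld_split[OF assms] tv_simps sum_pt' p1 unfolding M by (cases M) (simp_all add: algebra_simps)
 show "Ld b N 2 = t2^(N - 1)*(b 0*t2+(\<Sum>k = 4..n. b (k - 1)))"
  unfolding Ld_split[OF assms] tv_simps sum_pt' p1 unfolding M by (simp add: algebra_simps)
 show "Ld b N 3 = b 0+b 2" unfolding Ld_split[OF assms] tv_simps sum_pt' p1 by simp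
 show "Ld b N i = b 0+b (i - 1)" if i: "4 <= i" "i <= n"
  unfolding Ld_split[OF assms] tv_simps(4)[OF i] sum_pt[OF i] using i by (simp add: Y.pt_def)
qed

text \<open>Eliminating the other unknowns from the equations at all points but the first leaves
  \<open>b 0 * al = 0\<close>; the first point then determines \<open>b 1\<close>.\<close>

lemma Ld_inj: assumes N: "N >= 1" and z: "!!i. i : {1..n} ==> Ld b N i = 0" and j: "j < n" "wt j <= N" shows "b j = 0"
proof -
 have b2: "b 2 = - b 0" using z[of 3] n Ld_simps(3)[OF N, of b] by (simp add: eq_neg_iff_add_eq_0 add.commute)
 have bi: "b (i - 1) = - b 0" if "i : {4..n}" for i
  using z[of i] that Ld_simps(4)[OF N, of i b] by (simp add: eq_neg_iff_add_eq_0 add.commute)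
 have "t2^(N - 1)*(b 0*t2+(\<Sum>k = 4..n. b (k - 1))) = 0" using z[of 2] n Ld_simps(2)[OF N, of b] by simp
 hence "b 0*t2+(\<Sum>k = 4..n. b (k - 1)) = 0" using al(4) by simp
 moreover have "(\<Sum>k = 4..n. b (k - 1)) = of_nat (n - 3)*(- b 0)" using bi n by simp
 ultimately have "b 0*al = 0" by (simp add: algebra_simps)
 hence b0: "b 0 = 0" using al(2) by simp
 have "(al - 1)^(N - 1)*(b 0*(al - 1)+(if N >= 2 then b 1 else 0) - b 2) = 0"
  using z[of 1] n Ld_simps(1)[OF N, of b] by simp
 hence b1: "(if N >= 2 then b 1 else 0) = 0" using al(3) b0 b2 by simp
 show ?thesis
 proof (cases "j <= 2")
  case True
  then consider "j = 0" | "j = 1" | "j = 2" by linarith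
  thus ?thesis using b0 b1 b2 j by cases (auto simp: wt_def)
 next
  case False
  thus ?thesis using bi[of "Suc j"] b0 j by simp
 qed
qed

text \<open>The residue theorem for simple poles, in the normalization of \<open>pt\<close>; here it
  is checked on the generators \<open>g h\<close>.\<close>

lemma lead_degree_1: assumes "Y.LD 1 f v" shows "v 1+v 3 - v 2+(\<Sum>i = 4..n. v i) = 0"
proof -
 obtain l where v: "v j = (\<Sum>h = 2..n. l h*Y.pt h j)" for j using Y.LD_expand[OF assms] by auto
 have "v i = l i" if "i : {4..n}" for i
  unfolding v Y.sum_H_split using that sum_pt[of i l] by (simp add: Y.pt_def[of 2] Y.pt_def[of 3])
 hence "(\<Sum>i = 4..n. v i) = (\<Sum>i = 4..n. l i)" by simp
 moreover have "v 1 = l 2 - l 3" "v 2 = l 2+(\<Sum>i = 4..n. l i)" "v 3 = l 3"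
  unfolding v Y.sum_H_split sum_pt' by (simp_all add: Y.pt_def)
 ultimately show ?thesis by simp
qed

lemma expand: assumes "Y.Bs N f"
 shows "EX p. (ALL j. p j : polys_over A) & (ALL j k. k+wt j > N --> coeff (p j) k = 0) & f = (\<Sum>j<n. poly (p j) tau*w j)"
 using assms
proof (induction N arbitrary: f)
 case 0
 then obtain v where "Y.LD 0 f v" using Y.Bs_LD by blast
 then obtain k where k: "k : A" "f = k" using Y.LD_expand by fastforce
 show ?case
 proof (intro exI[of _ "%j. if j = 0 then [:k:] else 0"] conjI allI impI)
  fix j l :: nat assume "0 < l+wt j"
  thus "coeff (if j = 0 then [:k:] else 0) l = 0" by (cases l) (auto simp: wt_def)
 qed (use k polys_over_const[OF A k(1)] polys_over_zero[OF A] in \<open>auto simp: sum_n_split w_def intro: sum.neutral\<close>)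
next
 case (Suc M)
 then obtain v where L: "Y.LD (Suc M) f v" using Y.Bs_LD by blast
 define nu where "nu i = v i*inverse (tv i)^M" for i
 have tvi: "inverse (tv i) : A & tv i ~= 0" if "i : {1..n}" for i
 proof -
  consider "i = 1" | "i = 2" | "i = 3" | "4 <= i" "i <= n" using \<open>i : {1..n}\<close> by force
  thus ?thesis by cases (use al_A al tv_simps Y.AC in auto)
 qed
 have vnu: "v i = tv i^M*nu i" if "i : {1..n}" for i using tvi[OF that] by (simp add: nu_def field_simps)
 have nuA: "nu i : A" if "i : {1..n}" for i
  unfolding nu_def using tvi[OF that] Y.LD_A[OF L] is_subring_mult[OF A] is_subring_power[OF A] by blast
 define s where "s = (\<Sum>i = 4..n. nu i)"
 have sA: "s : A" unfolding s_def using nuA by (intro is_subring_sum[OF A]) auto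
 \<comment> \<open>The \<open>nu\<close> are the leading coefficients divided by those of
   \<open>tau^M\<close>, and \<open>b\<close> solves \<open>Ld b (Suc M) = v\<close>: the points
   from 3 on express \<open>b 2\<close> and the \<open>b (i - 1)\<close> through \<open>b 0\<close>,
   the second point gives \<open>b 0 * al\<close>, and the first gives \<open>b 1\<close>.\<close>
 define b0 where "b0 = (nu 2 - s)*inverse al"
 have n123: "nu 1 : A" "nu 2 : A" "nu 3 : A" using nuA n by auto
 have b0A: "b0 : A" unfolding b0_def using Y.AC n123 sA al_A by simp
 have alb0: "b0*al = nu 2 - s" using al(2) by (simp add: b0_def)
 define b where "b j = (if j = 0 then b0 else if j = 1 then nu 1+nu 3 - nu 2+s else if j = 2 then nu 3 - b0 else nu (Suc j) - b0)" for j
 have bA: "b j : A" if "j < n" for j unfolding b_def using Y.AC n123 sA b0A nuA[of "Suc j"] that by simp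
 define p where "p j = (if j < n & wt j <= Suc M then monom (b j) (Suc M - wt j) else 0)" for j
 have pA: "p j : polys_over A" for j unfolding p_def using polys_over_monom[OF A bA] polys_over_zero[OF A] by simp
 have pc: "coeff (p j) k = 0" if "k+wt j > Suc M" for j k using that by (auto simp: p_def)
 define f0 where "f0 = (\<Sum>j<n. poly (p j) tau*w j)"
 have "Y.LD (Suc M) f0 (Ld (%j. coeff (p j) (Suc M - wt j)) (Suc M))"
  unfolding f0_def using pA pc by (intro comb_LD) auto
 moreover have "Ld (%j. coeff (p j) (Suc M - wt j)) (Suc M) = Ld b (Suc M)"
  unfolding Ld_def by (intro ext sum.cong) (auto simp: p_def)
 ultimately have L0: "Y.LD (Suc M) (f - f0) (%i. v i - Ld b (Suc M) i)" using Y.LD_diff[OF L] by simp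
 have N1: "Suc M >= 1" by simp
 have bs: "b 0 = b0" "b 1 = nu 1+nu 3 - nu 2+s" "b 2 = nu 3 - b0" by (simp_all add: b_def)
 have bi: "b (i - 1) = nu i - b0" if "i : {4..n}" for i using that by (auto simp: b_def)
 have "v i - Ld b (Suc M) i = 0" if "i : {1..n}" for i
 proof -
  consider "i = 1" | "i = 2" | "i = 3" | "4 <= i" "i <= n" using \<open>i : {1..n}\<close> by force
  thus ?thesis
  proof cases
   case 1
   have "b 1 = 0" if "M = 0" unfolding bs(2) s_def nu_def using lead_degree_1[of f v] L that by simp
   hence "(if Suc M >= 2 then b 1 else 0) = b 1" by (cases M) auto
   moreover have "b 0*(al - 1)+b 1 - b 2 = nu 1" unfolding bs using alb0 by (simp add: algebra_simps)
   ultimately have "Ld b (Suc M) 1 = (al - 1)^M*nu 1" unfolding Ld_simps(1)[OF N1] by simp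
   thus ?thesis using vnu[OF that] 1 tv_simps by simp
  next
   case 2
   have "(\<Sum>k = 4..n. b (k - 1)) = s - of_nat (n - 3)*b0" using bi n by (simp add: s_def sum_subtractf)
   hence "b 0*t2+(\<Sum>k = 4..n. b (k - 1)) = nu 2" using alb0 by (simp add: bs algebra_simps)
   hence "Ld b (Suc M) 2 = t2^M*nu 2" unfolding Ld_simps(2)[OF N1] by simp
   thus ?thesis using vnu[OF that] 2 tv_simps by simp
  next
   case 3
   thus ?thesis using vnu[OF that] tv_simps Ld_simps(3)[OF N1, of b] by (simp add: bs)
  next
   case 4
   thus ?thesis using vnu[OF that] tv_simps Ld_simps(4)[OF N1 4, of b] bi bs(1) by simp
  qed
 qed
 hence "Y.Bs M (f - f0)" using Y.LD_descend[OF L0] by simp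
 then obtain p' where p': "ALL j. p' j : polys_over A" "ALL j k. k+wt j > M --> coeff (p' j) k = 0"
  "f - f0 = (\<Sum>j<n. poly (p' j) tau*w j)" using Suc.IH by blast
 have "f = (\<Sum>j<n. poly (p j+p' j) tau*w j)"
  using p'(3) by (simp add: f0_def distrib_right sum.distrib algebra_simps)
 moreover have "p j+p' j : polys_over A" for j using pA p'(1) is_subring_add[OF is_subring_polys_over[OF A]] by blast
 moreover have "coeff (p j+p' j) k = 0" if "k+wt j > Suc M" for j k using pc[OF that] p'(2) that by simp
 ultimately show ?case by (intro exI[of _ "%j. p j+p' j"]) blast
qed

sublocale F: free_basis A B tau n w
proof
 show "EX p. (ALL j. p j : polys_over A) & f = (\<Sum>j<n. poly (p j) tau*w j)" if "f : B" for f
  using that expand unfolding B_def by blast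
 fix p and j assume p: "!!j. j < n ==> p j : polys_over A" "(\<Sum>j<n. poly (p j) tau*w j) = 0" and j: "j < n"
 \<comment> \<open>Induction on a bound for the weighted degree: the leading coefficients of a
   vanishing combination are zero by \<open>LD_unique\<close>, and \<open>Ld_inj\<close> then lowers
   the bound.\<close>
 have all: "ALL j<n. p j = 0" if "!!j k. j < n ==> k+wt j > N ==> coeff (p j) k = 0" for N using that
 proof (induction N)
  case (Suc N)
  have "Y.LD (Suc N) (\<Sum>j<n. poly (p j) tau*w j) (Ld (%j. coeff (p j) (Suc N - wt j)) (Suc N))"
   by (rule comb_LD[OF p(1) Suc.prems])
  hence "Y.LD (Suc N) 0 (Ld (%j. coeff (p j) (Suc N - wt j)) (Suc N))" unfolding p(2) .
  hence "Ld (%j. coeff (p j) (Suc N - wt j)) (Suc N) i = 0" if "i : {1..n}" for i by (rule LD_unique[OF _ that])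
  hence b: "coeff (p j) (Suc N - wt j) = 0" if "j < n" "wt j <= Suc N" for j
   using Ld_inj[of "Suc N" "%j. coeff (p j) (Suc N - wt j)" j] that by simp
  show ?case
  proof (rule Suc.IH)
   fix j k assume jk: "j < n" "k+wt j > N"
   hence "k+wt j > Suc N \<or> (wt j <= Suc N & k = Suc N - wt j)" by linarith
   thus "coeff (p j) k = 0" using Suc.prems b jk by blast
  qed
 next
  case 0
  have "Y.LD 0 (\<Sum>j<n. poly (p j) tau*w j) (Ld (%j. coeff (p j) (0 - wt j)) 0)" by (rule comb_LD[OF p(1) 0])
  hence "Y.LD 0 0 (Ld (%j. coeff (p j) (0 - wt j)) 0)" unfolding p(2) .
  hence "Ld (%j. coeff (p j) (0 - wt j)) 0 1 = 0" by (rule LD_unique) (use n in auto)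
  moreover have "Ld (%j. coeff (p j) (0 - wt j)) 0 1 = coeff (p 0) 0"
   unfolding Ld_def sum_n_split by (simp add: wt_def[of 0] wt_def[of "Suc 0"] wt_def[of 2] wl_def[of 0]) (rule sum.neutral, auto simp: wt_def)
  ultimately have c0: "coeff (p 0) 0 = 0" by simp
  show ?case
  proof (intro allI impI poly_eqI)
   fix j k assume "j < n"
   thus "coeff (p j) k = coeff 0 k" using 0[of j k] c0 by (cases "j = 0 & k = 0") (auto simp: wt_def split: if_splits)
  qed
 qed
 define D where "D = 2+(\<Sum>j<n. degree (p j))"
 have "coeff (p j) k = 0" if "j < n" "k+wt j > D" for j k
 proof (rule coeff_eq_0)
  have "degree (p j) <= (\<Sum>j<n. degree (p j))" using that by (intro member_le_sum) auto
  thus "degree (p j) < k" using that(2) by (auto simp: D_def wt_def split: if_splits)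
 qed
 thus "p j = 0" using all j by blast
qed (use A B_subring A_B tau_B w_B in auto)

lemma coord_bound: assumes "Y.Bs N f" "j < n" "k+wt j > N" shows "coeff (F.coord f j) k = 0"
proof -
 obtain p where p: "ALL j. p j : polys_over A" "ALL j k. k+wt j > N --> coeff (p j) k = 0" "f = F.comb p"
  using expand[OF assms(1)] by (auto simp: F.comb_def)
 thus ?thesis using F.coord_comb[of p j] assms by simp
qed

lemma coord_LD: assumes "Y.LD N f v" "i : {1..n}" shows "v i = Ld (%j. coeff (F.coord f j) (N - wt j)) N i"
proof -
 have B: "Y.Bs N f" by (rule Y.LD_Bs[OF assms(1)])
 have "Y.LD N (\<Sum>j<n. poly (F.coord f j) tau*w j) (Ld (%j. coeff (F.coord f j) (N - wt j)) N)"
  by (rule comb_LD) (use F.coord(1)[OF BI[OF B]] coord_bound[OF B] in auto)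
 hence "Y.LD N f (Ld (%j. coeff (F.coord f j) (N - wt j)) N)" using F.coord(3)[OF BI[OF B]] by (simp add: F.comb_def)
 hence "Y.LD N 0 (%i. v i - Ld (%j. coeff (F.coord f j) (N - wt j)) N i)" using Y.LD_diff[OF assms(1)] by fastforce
 thus ?thesis using LD_unique[OF _ assms(2)] by fastforce
qed

text \<open>The residue sum of \<open>lead_degree_1\<close> for \<open>f / tau\<close>: each leading
  coefficient is divided by the residue of \<open>tau\<close> at its point. For a function with
  double poles this is the coefficient of \<open>w 1\<close>.\<close>

definition sg :: "(nat => 'f) => 'f" where
 "sg v = v 1*inverse (al - 1)+v 3 - v 2*inverse t2+(\<Sum>i = 4..n. v i)"

abbreviation Lam :: "'f => 'f poly" where "Lam f \<equiv> F.coord f 1"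

lemma Lambda_Bs1: "Y.Bs 1 f ==> Lam f = 0" using coord_bound[of 1 f 1] n by (intro poly_eqI) (auto simp: wt_def)

lemma Lambda_LD2: assumes "Y.LD 2 f v" shows "Lam f = [:sg v:]"
proof -
 let ?b = "%j. coeff (F.coord f j) (2 - wt j)"
 have v: "v i = Ld ?b 2 i" if "i : {1..n}" for i by (rule coord_LD[OF assms that])
 have N: "(2::nat) >= 1" by simp
 define b where "b = ?b"
 have V: "v 1 = (al - 1)*(b 0*(al - 1)+b 1 - b 2)" "v 2 = t2*(b 0*t2+(\<Sum>k = 4..n. b (k - 1)))" "v 3 = b 0+b 2"
  using v[of 1] v[of 2] v[of 3] n Ld_simps(1-3)[OF N, of b] by (simp_all add: b_def)
 have VS: "(\<Sum>i = 4..n. v i) = of_nat (n - 3)*b 0+(\<Sum>k = 4..n. b (k - 1))"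
 proof -
  have "(\<Sum>i = 4..n. v i) = (\<Sum>i = 4..n. b 0+b (i - 1))"
   using v Ld_simps(4)[OF N, of _ b] by (intro sum.cong) (auto simp: b_def)
  thus ?thesis using n by (simp add: sum.distrib)
 qed
 have c: "(al - 1)*u*inverse (al - 1) = u" "t2*u*inverse t2 = u" for u
  using al by (simp_all add: mult.commute[of _ u] mult.assoc)
 have "sg v = (b 0*(al - 1)+b 1 - b 2)+(b 0+b 2) - (b 0*t2+(\<Sum>k = 4..n. b (k - 1)))
   + (of_nat (n - 3)*b 0+(\<Sum>k = 4..n. b (k - 1)))" unfolding sg_def V VS c by simp
 also have "\<dots> = b 1" by (simp add: algebra_simps)
 finally have s: "sg v = coeff (Lam f) 0" by (simp add: b_def wt_def)
 show ?thesis
 proof (rule poly_eqI)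
  fix k
  show "coeff (Lam f) k = coeff [:sg v:] k"
   using s coord_bound[OF Y.LD_Bs[OF assms], of 1 k] n by (cases k) (auto simp: wt_def)
 qed
qed

text \<open>Functions dual to the \<open>g l\<close> with \<open>l\<close> from 3 to
  \<open>n\<close>. For \<open>h \<ge> 4\<close> the term in \<open>x\<close> cancels the
  contribution of the second point, and the term in \<open>y\<close> makes the pairing with
  \<open>y\<close> vanish.\<close>

definition lh :: "nat => 'f" where
 "lh h = (if h = 3 then (al - 1)*inverse al*Y.g 3 else Y.g h - Y.g 2 - inverse al*Y.g 3)"
definition Ph :: "nat => nat => 'f" where
 "Ph h j = (if h = 3 then (al - 1)*inverse al*Y.pt 3 j else Y.pt h j - Y.pt 2 j - inverse al*Y.pt 3 j)"

lemma LD_lh: "h : {3..n} ==> Y.LD 1 (lh h) (Ph h)"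
proof -
 assume h: "h : {3..n}"
 have g: "Y.LD 1 (Y.g 2) (Y.pt 2)" "Y.LD 1 (Y.g 3) (Y.pt 3)" "Y.LD 1 (Y.g h) (Y.pt h)" using LD_g n h by auto
 have m: "(al - 1)*inverse al : A" by (rule Y.AC(5)[OF al_A(3,2)])
 show ?thesis using Y.LD_scale[OF g(2) m] Y.LD_diff[OF Y.LD_diff[OF g(3,1)] Y.LD_scale[OF g(2) al_A(2)]]
  by (simp add: lh_def Ph_def[abs_def])
qed

lemma sigma_pairing: assumes h: "h : {3..n}" "l : {3..n}" shows "sg (%j. Y.pt l j*Ph h j) = (if l = h then 1 else 0)"
proof -
 have nz: "al ~= 0" "al - 1 ~= 0" using al by auto
 have s: "(\<Sum>i = 4..n. Y.pt l i*Ph h i) = (if l = 3 then 0 else if h = l then 1 else 0)"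
 proof -
  have "(\<Sum>i = 4..n. Y.pt l i*Ph h i) = (\<Sum>i = 4..n. if i = l then Ph h l else 0)"
   by (rule sum.cong) (use h in \<open>auto simp: Y.pt_def\<close>)
  also have "\<dots> = (if l = 3 then 0 else Ph h l)" using h by auto
  finally show ?thesis using h by (auto simp: Ph_def Y.pt_def)
 qed
 show ?thesis unfolding sg_def s using nz h by (auto simp: Ph_def Y.pt_def field_simps)
qed

lemma gB: "h : {2..n} ==> Y.g h : B" using Y.Bs_g BI by blast
lemma lhB: "h : {3..n} ==> lh h : B" using Y.LD_Bs[OF LD_lh] BI by blast

lemmas BC = is_subring_mult[OF B_subring] is_subring_diff[OF B_subring] is_subring_add[OF B_subring]
 is_subring_sum[OF B_subring] is_subring_one[OF B_subring]
lemma poly_B: "p : polys_over A ==> poly p tau : B"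
 by (rule poly_polys_over[OF B_subring _ tau_B]) (use polys_over_mono[OF A_B] in auto)
lemma LamA: "f : B ==> Lam f : polys_over A" by (rule F.coord(1))
lemma Lam_diff: "f : B ==> f' : B ==> Lam (f - f') = Lam f - Lam f'"
 using F.coord_add[of "f - f'" f'] BC(2)[of f f'] by (simp add: fun_eq_iff)
lemma Lam_poly: "f : B ==> p : polys_over A ==> Lam (poly p tau*f) = p*Lam f" by (simp add: F.coord_poly)

lemma Lam_w: "Lam 1 = 0" "h : {2..n} ==> Lam (Y.g h) = 0" "h : {3..n} ==> Lam (lh h) = 0" "Lam (w 1) = 1"
proof -
 show "Lam 1 = 0" by (rule Lambda_Bs1) (rule Y.Bs.base, rule Y.AC)
 show "Lam (Y.g h) = 0" if "h : {2..n}" by (rule Lambda_Bs1[OF Y.Bs_g[OF that]])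
 show "Lam (lh h) = 0" if "h : {3..n}" by (rule Lambda_Bs1[OF Y.LD_Bs[OF LD_lh[OF that]]])
 have "w 1 = F.comb (%j. if j = 1 then 1 else 0)" unfolding F.comb_def sum_n_split by simp (rule sum.neutral, auto)
 moreover have "F.coord (F.comb (%j. if j = 1 then 1 else 0)) 1 = 1"
  by (subst F.coord_comb) (use n polys_over_zero[OF A] is_subring_one[OF is_subring_polys_over[OF A]] in auto)
 ultimately show "Lam (w 1) = 1" by simp
qed

lemma Lam_pairing: "h : {3..n} ==> l : {3..n} ==> Lam (Y.g l*lh h) = (if l = h then 1 else 0)"
proof -
 assume h: "h : {3..n}" "l : {3..n}"
 have "Y.LD 2 (Y.g l*lh h) (%j. Y.pt l j*Ph h j)" using Y.LD_mult[OF LD_g LD_lh, of l h] h by (simp add: numeral_2_eq_2)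
 thus ?thesis using Lambda_LD2 sigma_pairing[OF h] by (simp add: one_pCons)
qed

text \<open>As \<open>1\<close> is dual to \<open>w 1\<close> and the \<open>lh\<close> are dual to
  the functions of order one, only pairings with \<open>w 1\<close> are left to correct. Subtracting
  a multiple of \<open>1\<close> makes \<open>lh'\<close> orthogonal to \<open>w 1\<close>;
  \<open>w0\<close> is \<open>w 1\<close> made orthogonal to every basis element except
  \<open>1\<close>.\<close>

definition lh' :: "nat => 'f" where "lh' h = lh h - poly (Lam (w 1*lh h)) tau"
definition w0 :: 'f where
 "w0 = w 1 - (\<Sum>h = 3..n. poly (Lam (Y.g h*w 1)) tau*lh' h) - poly (Lam (w 1*w 1)) tau"
definition w' :: "nat => 'f" where "w' j = (if j = 0 then w0 else if j = 1 then 1 else lh' (Suc j))"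

lemma w1B: "w 1 : B" using w_B[of 1] n by simp
lemma lh'B: "h : {3..n} ==> lh' h : B" unfolding lh'_def by (intro BC poly_B LamA w1B lhB)
lemma gB3: "h : {3..n} ==> Y.g h : B" using gB by auto
lemma w0B: "w0 : B" unfolding w0_def by (intro BC poly_B LamA w1B lh'B gB3)

lemma Lam_lh': assumes f: "f : B" and h: "h : {3..n}" shows "Lam (f*lh' h) = Lam (f*lh h) - Lam (w 1*lh h)*Lam f"
proof -
 have p: "Lam (w 1*lh h) : polys_over A" by (intro LamA BC w1B lhB h)
 have "f*lh' h = f*lh h - poly (Lam (w 1*lh h)) tau*f" by (simp add: lh'_def algebra_simps)
 thus ?thesis using Lam_diff[OF BC(1)[OF f lhB[OF h]] BC(1)[OF poly_B[OF p] f]] Lam_poly[OF f p] by simp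
qed

lemma Lam_lh'_w: "h : {3..n} ==> Lam (1*lh' h) = 0" "h : {3..n} ==> Lam (w 1*lh' h) = 0"
  "h : {3..n} ==> l : {3..n} ==> Lam (Y.g l*lh' h) = (if l = h then 1 else 0)"
 using Lam_lh'[OF BC(5)] Lam_lh'[OF w1B] Lam_lh'[OF gB3] Lam_w Lam_pairing by simp_all

lemma Lam_w0: assumes f: "f : B"
 shows "Lam (f*w0) = Lam (f*w 1) - (\<Sum>h = 3..n. Lam (Y.g h*w 1)*Lam (f*lh' h)) - Lam (w 1*w 1)*Lam f"
proof -
 have p: "Lam (w 1*w 1) : polys_over A" "h : {3..n} ==> Lam (Y.g h*w 1) : polys_over A" for h
  by (intro LamA BC w1B gB3, assumption?)+
 have fl: "f*lh' h : B" if "h : {3..n}" for h by (rule BC(1)[OF f lh'B[OF that]])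
 have pf: "poly (Lam (Y.g h*w 1)) tau*(f*lh' h) : B" if "h : {3..n}" for h
  by (rule BC(1)[OF poly_B[OF p(2)[OF that]] fl[OF that]])
 let ?s = "\<Sum>h = 3..n. poly (Lam (Y.g h*w 1)) tau*(f*lh' h)"
 have eq: "f*w0 = f*w 1 - ?s - poly (Lam (w 1*w 1)) tau*f" by (simp add: w0_def algebra_simps sum_distrib_left)
 have B: "f*w 1 : B" "?s : B" "poly (Lam (w 1*w 1)) tau*f : B"
  by (rule BC(1)[OF f w1B], rule BC(4)[OF pf], assumption, rule BC(1)[OF poly_B[OF p(1)] f])
 have "F.coord ?s = (%j. \<Sum>h = 3..n. F.coord (poly (Lam (Y.g h*w 1)) tau*(f*lh' h)) j)"
  using pf by (intro F.coord_sum) auto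
 hence "Lam ?s = (\<Sum>h = 3..n. Lam (Y.g h*w 1)*Lam (f*lh' h))" using Lam_poly[OF fl p(2)] by simp
 thus ?thesis unfolding eq using Lam_diff[OF BC(2)[OF B(1,2)] B(3)] Lam_diff[OF B(1,2)] Lam_poly[OF f p(1)] by simp
qed

lemma dual_basis: assumes "i < n" "j < n" shows "Lam (w i*w' j) = (if i = j then 1 else 0)"
proof -
 have wi: "i = 0 & w i = 1 \<or> i = 1 \<or> (2 <= i & Suc i : {3..n} & w i = Y.g (Suc i))"
  using assms by (auto simp: w_def)
 consider "j = 0" | "j = 1" | "2 <= j" "Suc j : {3..n}" using assms by force
 thus ?thesis
 proof cases
  case 1
  have d: "(\<Sum>h = 3..n. F h*(if l = h then 1 else 0)) = F l" if "l : {3..n}" for l and F :: "nat => 'f poly"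
  proof -
   have "(\<Sum>h = 3..n. F h*(if l = h then 1 else 0)) = (\<Sum>h = 3..n. if h = l then F l else 0)" by (rule sum.cong) auto
   thus ?thesis using that by simp
  qed
  show ?thesis using wi
  proof (elim disjE)
   assume i: "i = 0 & w i = 1"
   hence "w 0 = 1" by auto
   thus ?thesis using 1 i Lam_w0[OF BC(5)] Lam_lh'_w(1) Lam_w by (simp add: w'_def)
  next
   assume "i = 1"
   thus ?thesis using 1 Lam_w0[OF w1B] Lam_lh'_w(2) Lam_w by (simp add: w'_def)
  next
   assume h: "2 <= i & Suc i : {3..n} & w i = Y.g (Suc i)"
   have "(\<Sum>h = 3..n. Lam (Y.g h*w 1)*Lam (Y.g (Suc i)*lh' h)) = Lam (Y.g (Suc i)*w 1)"
    using d[of "Suc i" "%h. Lam (Y.g h*w 1)"] Lam_lh'_w(3) h by simp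
   thus ?thesis using 1 h Lam_w0[OF gB3, of "Suc i"] Lam_w(2)[of "Suc i"] by (simp add: w'_def)
  qed
 next
  case 2
  thus ?thesis using wi Lam_w by (auto simp: w'_def)
 next
  case 3
  thus ?thesis using wi Lam_lh'_w(1)[OF 3(2)] Lam_lh'_w(2)[OF 3(2)] Lam_lh'_w(3)[OF 3(2), of "Suc i"] by (auto simp: w'_def)
 qed
qed

lemma w'B: "j < n ==> w' j : B" unfolding w'_def using w0B BC(5) lh'B by simp

theorem has_frobenius_curve: assumes "has_frobenius io A" shows "has_frobenius io B"
proof -
 obtain T m t q lam r b b' where "frobenius_extension io A T m t q lam r b b'"
  using assms unfolding has_frobenius_def by blast
 then interpret X: frobenius_extension io A T m t q lam r b b' .
 interpret S: frobenius_step io A T m t q lam r b b' B tau n w Lam w'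
 proof
  show "f = (\<Sum>j<n. poly (Lam (f*w' j)) tau*w j)" if f: "f : B" for f
  proof -
   have "Lam (f*w' j) = F.coord f j" if j: "j < n" for j
   proof -
    have ww: "w i*w' j : B" if "i < n" for i by (rule BC(1)[OF w_B[OF that] w'B[OF j]])
    have pw: "poly (F.coord f i) tau*(w i*w' j) : B" if "i < n" for i
     by (rule BC(1)[OF poly_B[OF F.coord(1)[OF f]] ww[OF that]])
    have "f*w' j = F.comb (F.coord f)*w' j" using F.coord(3)[OF f] by simp
    also have "\<dots> = (\<Sum>i<n. poly (F.coord f i) tau*(w i*w' j))" by (simp add: F.comb_def sum_distrib_right mult.assoc)
    finally have "F.coord (f*w' j) = (%k. \<Sum>i<n. F.coord (poly (F.coord f i) tau*(w i*w' j)) k)"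
     using pw by (simp only:) (intro F.coord_sum, auto)
    hence "Lam (f*w' j) = (\<Sum>i<n. F.coord f i*Lam (w i*w' j))" using Lam_poly[OF ww F.coord(1)[OF f]] by simp
    also have "\<dots> = (\<Sum>i<n. if i = j then F.coord f j else 0)"
     by (rule sum.cong) (use dual_basis[OF _ j] in auto)
    finally show ?thesis using j by simp
   qed
   thus ?thesis using F.coord(3)[OF f] by (simp add: F.comb_def)
  qed
 qed (use w'B F.coord_add F.coord_smult F.coord_tau F.coord(1) in auto)
 show ?thesis using S.frobenius_extension_step unfolding has_frobenius_def by blast
qed

end

section \<open>Normality of the new ring\<close>

context curve_point
begin

sublocale YK: curve_algebra n UNIV K "{0}" a c cb ci cbi cij x y z by (rule curve_algebra_field[OF K]) (use AK in auto)

definition BK :: "'f set" where "BK = {u. EX d. YK.Bs d u}"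

lemma BK_subring: "is_subring BK" unfolding BK_def by (rule YK.Bs_subring)
lemma K_BK: "K <= BK" unfolding BK_def using YK.Bs.base by blast
lemma gens_BK: "x : BK" "y : BK" "4 <= i ==> i <= n ==> z i : BK"
 unfolding BK_def using YK.Bs_x YK.Bs_y YK.Bs_z by blast+
lemma BK_least:
 "is_subring S ==> K <= S ==> x : S ==> y : S ==> (!!i. i : {4..n} ==> z i : S) ==> BK <= S"
proof
 fix u assume S: "is_subring S" "K <= S" "x : S" "y : S" "!!i. i : {4..n} ==> z i : S" and "u : BK"
 then obtain d where d: "YK.Bs d u" unfolding BK_def by blast
 have "{0} <= S" using is_subring_zero[OF S(1)] by simp
 from S(1,2) this S(3-5) d show "u : S" by (rule YK.Bs_least)
qed

lemmas BKC = is_subring_mult[OF BK_subring] is_subring_add[OF BK_subring] is_subring_diff[OF BK_subring]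
 is_subring_uminus[OF BK_subring] is_subring_one[OF BK_subring] is_subring_zero[OF BK_subring]
 is_subring_power[OF BK_subring] is_subring_sum[OF BK_subring] subsetD[OF K_BK]

text \<open>Where \<open>h\<close> does not vanish, normality is read off from the chart
  \<open>Q.C\<close>; a good \<open>h\<close> lets it be extended across the zeros of
  \<open>h\<close>.\<close>

definition good :: "'f => bool" where
 "good h \<longleftrightarrow> h : BK & (ALL f. integral_over BK f --> h*f : BK --> f : BK)"

lemma good_mult: "good h ==> good h' ==> good (h*h')" unfolding good_def
proof (intro conjI allI impI)
 assume g: "h : BK & (ALL f. integral_over BK f --> h*f : BK --> f : BK)"
  "h' : BK & (ALL f. integral_over BK f --> h'*f : BK --> f : BK)"
 show "h*h' : BK" using g BKC by blast
 fix f assume f: "integral_over BK f" "h*h'*f : BK"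
 have "integral_over BK (h'*f)" using integral_over_mult[OF BK_subring f(1)] g by blast
 hence "h'*f : BK" using g f(2) by (simp add: mult.assoc)
 thus "f : BK" using g f(1) by blast
qed

lemma good_one: "good 1" using BKC by (simp add: good_def)
lemma good_power: "good h ==> good (h^m)" by (induction m) (auto simp: good_one good_mult)
lemma good_prod: "finite I ==> (!!i. i : I ==> good (f i)) ==> good (prod f I)"
 by (induction I rule: finite_induct) (auto simp: good_one good_mult)

text \<open>The hypothesis \<open>dec\<close> says that \<open>h = 0\<close> is empty or a single reduced point.\<close>

lemma good_if: assumes h: "h : BK" "h ~= 0" and dec: "BK <= {kp+h*b | kp b. kp : K & b : BK}" shows "good h"
 unfolding good_def
proof (intro conjI allI impI)
 show "h : BK" by fact
 fix f assume f: "integral_over BK f" "h*f : BK"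
 define r where "r = h*f"
 have rB: "r : BK" using f(2) by (simp add: r_def)
 obtain kp b where k: "r = kp+h*b" "kp : K" "b : BK" using dec rB by blast
 show "f : BK"
 proof (cases "kp = 0")
  case True
  hence "f = b" using k(1) h(2) by (simp add: r_def)
  thus ?thesis using k(3) by simp
 next
  case False
  \<comment> \<open>The integral equation puts \<open>r^m\<close> into \<open>h * BK\<close>, and
    \<open>kp\<close> is congruent to \<open>r\<close> modulo \<open>h\<close>. So
    \<open>kp^m\<close> is a multiple of \<open>h\<close>, and \<open>kp \<noteq> 0\<close> makes
    \<open>h\<close> invertible in \<open>BK\<close>.\<close>
  obtain m co where co: "!!i. i < m ==> co i : BK" "f^m+(\<Sum>i<m. co i*f^i) = 0"
   using f(1) by (auto simp: integral_over_def)
  have m: "m ~= 0" using co(2) by (cases m) auto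
  define t where "t = - (\<Sum>i<m. co i*h^(m - i - 1)*r^i)"
  have tB: "t : BK" unfolding t_def using co(1) h rB BKC by (intro BKC(4,8) BKC(1) BKC(7)) auto
  have fm: "f^m = - (\<Sum>i<m. co i*f^i)" using co(2) by (simp add: eq_neg_iff_add_eq_0)
  have "h^m*f^m = - (\<Sum>i<m. h^m*(co i*f^i))" unfolding fm by (simp add: sum_distrib_left)
  also have "(\<Sum>i<m. h^m*(co i*f^i)) = (\<Sum>i<m. h*(co i*h^(m - i - 1)*r^i))"
  proof (rule sum.cong)
   fix i assume "i : {..<m}"
   hence "m = Suc (m - i - 1)+i" by simp
   hence "h^m = h*h^(m - i - 1)*h^i" by (metis power_Suc power_add)
   thus "h^m*(co i*f^i) = h*(co i*h^(m - i - 1)*r^i)" by (simp add: r_def power_mult_distrib mult_ac)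
  qed simp
  finally have rm: "r^m = h*t" by (simp add: r_def t_def power_mult_distrib sum_distrib_left)
  have "EX s:BK. kp^l = r^l+h*s" for l
  proof (induction l)
   case 0 thus ?case using BKC by (intro bexI[of _ 0]) auto
  next
   case (Suc l)
   then obtain s where s: "s : BK" "kp^l = r^l+h*s" by blast
   have "kp^Suc l = kp*r^l+kp*(h*s)" using s(2) by (simp add: distrib_left)
   also have "kp*r^l = r^Suc l - h*b*r^l" using k(1) by (simp add: algebra_simps)
   finally have "kp^Suc l = r^Suc l+h*(kp*s - b*r^l)" by (simp add: algebra_simps)
   moreover have "kp*s - b*r^l : BK" using BKC s k rB by simp
   ultimately show ?case by blast
  qed
  then obtain s where s: "s : BK" "kp^m = r^m+h*s" by blast
  have "kp^m = h*(t+s)" using s(2) rm by (simp add: distrib_left)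
  hence "f*kp^m = r*(t+s)" by (simp add: r_def mult_ac)
  hence "f = r*(t+s)*inverse kp^m" using False by (simp add: field_simps)
  thus ?thesis using BKC rB tB s(1) Ki[OF k(2)] by simp
 qed
qed

lemma reduction_I: "kp : K ==> b : BK ==> kp+h*b : {kp+h*b | kp b. kp : K & b : BK}" by blast

lemma reduction_subring: assumes "h : BK" shows "is_subring {kp+h*b | kp b. kp : K & b : BK}" (is "is_subring ?S")
 unfolding is_subring_def
proof (intro conjI ballI)
 show "1 : ?S" using reduction_I[OF KC(6) BKC(6), of h] by simp
 fix u v assume "u : ?S" "v : ?S"
 then obtain kp b kp' b' where u: "u = kp+h*b" "kp : K" "b : BK" and v: "v = kp'+h*b'" "kp' : K" "b' : BK" by blast
 have eq: "u - v = (kp - kp')+h*(b - b')" unfolding u v by (simp add: algebra_simps)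
 show "u - v : ?S" unfolding eq by (intro reduction_I KC BKC u v)
 have eq': "u*v = kp*kp'+h*(b*kp'+kp*b'+h*b*b')" unfolding u v by (simp add: algebra_simps)
 have "b*kp'+kp*b'+h*b*b' : BK" using BKC u(2,3) v(2,3) assms by simp
 thus "u*v : ?S" unfolding eq' by (intro reduction_I KC u v)
qed

text \<open>On \<open>x = 0\<close> the first relation makes each \<open>z i\<close> equal to
  \<open>c / ci i\<close>, and the second one then makes \<open>y\<close> constant. So a single
  reduced point remains.\<close>

lemma good_x: "good x"
proof (rule good_if)
 let ?S = "{kp+x*b | kp b. kp : K & b : BK}"
 have S: "is_subring ?S" by (rule reduction_subring[OF gens_BK(1)])
 have KS: "kp : ?S" if "kp : K" for kp using reduction_I[OF that BKC(6), of "x"] by simp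
 have xS: "x*b : ?S" if "b : BK" for b using reduction_I[OF KC(5) that, of "x"] by simp
 have zeq: "z i = inverse (ci i)*(c+x*(z i - (a + cbi i+x+y)))" if i: "4 <= i" "i <= n" for i
 proof -
  have "ci i*z i = c+x*(z i - (a + cbi i+x+y))" using xz[OF i] by (simp add: algebra_simps)
  thus ?thesis using ci0[OF i] by (simp add: field_simps)
 qed
 have zB: "z i - (a + cbi i+x+y) : BK" if i: "4 <= i" "i <= n" for i using BKC gens_BK inK i by simp
 note SC = is_subring_mult[OF S] is_subring_add[OF S] is_subring_diff[OF S]
 have zS: "z i : ?S" if i: "4 <= i" "i <= n" for i
 proof -
  have "inverse (ci i)*(c+x*(z i - (a + cbi i+x+y))) : ?S" by (intro SC KS xS zB i Ki inK)
  thus ?thesis using zeq[OF i] by simp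
 qed
 have x1S: "x : ?S" using xS[OF BKC(5)] by simp
 have i4: "4 <= (4::nat)" "4 <= n" using n by auto
 \<comment> \<open>The product \<open>y * z 4\<close> is computed twice, by the second relation and
   by the value of \<open>z 4\<close> modulo \<open>x\<close>; comparison gives \<open>y\<close>
   modulo \<open>x\<close>.\<close>
 have "y*z 4 = cbi 4*z 4 - ((a + ci 4 + cbi 4+x) * cbi 4 - cb)" using relation_y[OF i4] by (simp add: algebra_simps)
 moreover have "cbi 4*z 4 - ((a + ci 4 + cbi 4+x) * cbi 4 - cb) : ?S" by (intro SC KS x1S zS i4 inK)
 ultimately have yz: "y*z 4 : ?S" by simp
 define W where "W = z 4 - (a + cbi 4+x+y)"
 have "y*z 4 = y*(inverse (ci 4)*(c+x*W))" unfolding W_def using zeq[OF i4] by (rule arg_cong)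
 hence "inverse (ci 4) * c*y = y*z 4 - x*(inverse (ci 4)*W*y)" by (simp add: algebra_simps)
 moreover have "inverse (ci 4)*W*y : BK" unfolding W_def by (intro BKC(1) BKC(9) zB i4 Ki inK gens_BK)
 ultimately have cy: "inverse (ci 4) * c*y : ?S" using SC(3)[OF yz xS] by simp
 have "(ci 4*inverse c)*(inverse (ci 4) * c*y) : ?S" by (intro SC(1) cy KS KC Ki inK i4)
 hence yS: "y : ?S" using ci0[OF i4] c0 by (simp add: field_simps)
 show "BK <= ?S" by (rule BK_least[OF S]) (use KS x1S yS zS in auto)
qed (rule gens_BK, rule x0)

text \<open>The point \<open>(ci i, cbi i)\<close> itself is at infinity. What remains of the line
  \<open>x = ci i\<close> is the second intersection with the cubic, where the first relation
  determines \<open>y\<close>.\<close>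

lemma good_xci: assumes i: "4 <= i" "i <= n" shows "good (x - ci i)"
proof (rule good_if)
 let ?h = "x - ci i"
 let ?S = "{kp + ?h*b | kp b. kp : K & b : BK}"
 show hB: "?h : BK" using BKC gens_BK inK i by simp
 have S: "is_subring ?S" by (rule reduction_subring[OF hB])
 have KS: "kp : ?S" if "kp : K" for kp using reduction_I[OF that BKC(6), of "x - ci i"] by simp
 have hS: "?h*b : ?S" if "b : BK" for b using reduction_I[OF KC(5) that, of "x - ci i"] by simp
 note SC = is_subring_mult[OF S] is_subring_add[OF S] is_subring_diff[OF S]
 have kS: "u : ?S" if "k*u : ?S" "k : K" "k ~= 0" for k u
  using SC(1)[OF KS[OF Ki[OF that(2)]] that(1)] that(3) by (simp add: mult.assoc[symmetric])
 have xS: "x : ?S" using SC(2)[OF hS[OF BKC(5)] KS[OF inK(5)[OF i]]] by simp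
 define b where "b = z i - y - (a + cbi i+x + ci i)"
 have bB: "b : BK" unfolding b_def using BKC gens_BK inK i by simp
 have y_eq: "ci i*y = (c - (a + cbi i + ci i) * ci i) + ?h*b" using xz[OF i] by (simp add: b_def algebra_simps)
 have "ci i*y : ?S" unfolding y_eq by (intro SC KS hS bB KC inK i)
 hence yS: "y : ?S" using kS ci0[OF i] inK(5)[OF i] by blast
 have zS: "z l : ?S" if l: "l : {4..n}" for l
 proof (cases "l = i")
  case False
  have l': "4 <= l" "l <= n" using l by auto
  have ne: "ci i - ci l ~= 0" using cineq[of i l] cineq[of l i] i l' False by (cases "i < l") auto
  have "(ci i - ci l)*z l = (a + cbi l+x+y)*x - c - ?h*z l" using xz[OF l'] by (simp add: algebra_simps)
  also have "\<dots> : ?S" by (intro SC KS hS xS yS inK l' gens_BK)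
  finally show ?thesis using kS[of "ci i - ci l" "z l"] ne is_subring_diff[OF K inK(5)[OF i] inK(5)[OF l']] by blast
 next
  case True
  \<comment> \<open>For \<open>x = ci i\<close> the first relation leaves \<open>z i\<close> open.
    The second has the coefficient \<open>cbi i - y\<close>, and \<open>ci i\<close> times its value
    at the remaining point is the nonzero quantity in \<open>Ni\<close>.\<close>
  have "(c - (a+2 * cbi i + ci i) * ci i)*z i = ci i*(y*z i) - ci i * cbi i*z i - ?h*(b*z i)"
  proof -
   have "ci i*y*z i = ((c - (a + cbi i + ci i) * ci i) + ?h*b)*z i" using y_eq by simp
   thus ?thesis by (simp add: algebra_simps)
  qed
  also have "\<dots> = ci i*(cb - (a + ci i + cbi i+x) * cbi i) - ?h*(b*z i)"
  proof -
   have ry: "y*z i = cbi i*z i+(cb - (a + ci i + cbi i+x) * cbi i)" using relation_y[OF i] by (simp add: algebra_simps)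
   show ?thesis unfolding ry by (simp add: algebra_simps)
  qed
  also have "\<dots> : ?S" by (intro SC KS hS xS BKC(1) bB inK i gens_BK)
  finally have "(c - (a+2 * cbi i + ci i) * ci i)*z i : ?S" .
  moreover have "c - (a+2 * cbi i + ci i) * ci i : K" by (intro KC inK i is_subring_numeral[OF K])
  ultimately show ?thesis using kS[of "c - (a+2 * cbi i + ci i) * ci i" "z i"] Ni[OF i] True by simp
 qed
 show "BK <= ?S" by (rule BK_least[OF S]) (use KS xS yS zS in auto)
qed (rule xci[OF i])

text \<open>Away from its zeros \<open>BK\<close> and the chart \<open>Q.C\<close> agree:
  \<open>x\<close> and the \<open>x - ci i\<close> are the denominators of \<open>y\<close> and of
  the \<open>z i\<close> in terms of \<open>x\<close> and \<open>x * y\<close>.\<close>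

definition H :: 'f where "H = x*(\<Prod>i = 4..n. (x - ci i))"

lemma good_H: "good H" unfolding H_def by (intro good_mult good_x good_prod) (auto intro: good_xci)

lemmas QC = is_subring_mult[OF Q.C_subring] is_subring_add[OF Q.C_subring] is_subring_diff[OF Q.C_subring]
 is_subring_power[OF Q.C_subring] is_subring_prod[OF Q.C_subring] is_subring_sum[OF Q.C_subring]

lemma xci_C: "4 <= i ==> i <= n ==> x - ci i : Q.C" by (intro QC Q.C_xi Q.C_K inK)

lemma prod_C: "I <= {4..n} ==> (\<Prod>i\<in>I. (x - ci i)) : Q.C" by (rule QC(5)) (use xci_C in auto)

lemma H_C: "H : Q.C" unfolding H_def by (rule QC(1)[OF Q.C_xi prod_C[OF subset_refl]])

lemma H_nz: "H ~= 0" unfolding H_def using x0 xci by auto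

lemma H_clear: "u : BK ==> EX M. H^M*u : Q.C"
proof -
 have Hg: "H*YK.g h : Q.C" if h: "h : {2..n}" for h
 proof -
  consider "h = 2" | "h = 3" | "4 <= h" "h <= n" using \<open>h : {2..n}\<close> by force
  thus ?thesis
  proof cases
   case 1 thus ?thesis using QC H_C Q.C_xi by (simp add: YK.g_def)
  next
   case 2
   have "H*y = (x*y)*(\<Prod>i = 4..n. (x - ci i))" by (simp add: H_def mult_ac)
   also have "\<dots> : Q.C" by (rule QC(1)[OF Q.C_eta prod_C[OF subset_refl]])
   finally show ?thesis using 2 by (simp add: YK.g_def)
  next
   case 3
   have "(\<Prod>i = 4..n. (x - ci i)) = (x - ci h)*(\<Prod>i\<in>{4..n} - {h}. (x - ci i))"
    using 3 by (intro prod.remove) auto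
   hence "H*z h = x*(\<Prod>i\<in>{4..n} - {h}. (x - ci i))*((x - ci h)*z h)" by (simp add: H_def mult_ac)
   also have "\<dots> = x*(\<Prod>i\<in>{4..n} - {h}. (x - ci i))*((a + cbi h)*x+x*x+x*y - c)"
    unfolding xz[OF 3] by (simp add: algebra_simps)
   also have "\<dots> : Q.C" by (rule QC(1)[OF QC(1)[OF Q.C_xi prod_C] QC(3)[OF QC(2)[OF QC(2)[OF QC(1)[OF Q.C_K Q.C_xi]
      QC(1)[OF Q.C_xi Q.C_xi]] Q.C_eta] Q.C_K]]) (use 3 KC inK in auto)
   finally show ?thesis using 3 by (simp add: YK.g_def)
  qed
 qed
 assume "u : BK"
 then obtain d where "YK.Bs d u" by (auto simp: BK_def)
 thus ?thesis
 proof (induction rule: YK.Bs.induct)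
  case (base k d) thus ?case using Q.C_K by (intro exI[of _ 0]) simp
 next
  case (null u d) thus ?case using is_subring_zero[OF Q.C_subring] by simp
 next
  case (gen h d u)
  then obtain M where M: "H^M*u : Q.C" by blast
  have "H^Suc M*(YK.g h*u) = (H*YK.g h)*(H^M*u)" by (simp add: mult_ac)
  thus ?case using QC(1)[OF Hg[OF gen(1)] M] by metis
 next
  case (plus d u v)
  then obtain M M' where M: "H^M*u : Q.C" "H^M'*v : Q.C" by blast
  have "H^(M+M')*(u+v) = H^M'*(H^M*u)+H^M*(H^M'*v)" by (simp add: power_add algebra_simps)
  moreover have "H^M'*(H^M*u)+H^M*(H^M'*v) : Q.C"
   by (rule QC(2)[OF QC(1)[OF QC(4)[OF H_C] M(1)] QC(1)[OF QC(4)[OF H_C] M(2)]])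
  ultimately show ?case by metis
 qed
qed

lemma C_BK: "Q.C <= BK"
proof
 fix u assume "u : Q.C"
 then obtain p p' where p: "u = Q.el p p'" "p : polys_over K" "p' : polys_over K" by (auto simp: Q.C_def)
 have "poly q x : BK" if "q : polys_over K" for q
  using poly_polys_over[OF BK_subring _ gens_BK(1)] polys_over_mono[OF K_BK] that by blast
 thus "u : BK" using p BKC gens_BK by (simp add: Q.el_def)
qed

text \<open>A power of \<open>H\<close> clears the coefficients of the integral equation, so
  \<open>H^M * f\<close> is integral over the smooth chart \<open>Q.C\<close> and lies in it. As
  \<open>H\<close> is good, its power can be divided out again inside \<open>BK\<close>.\<close>

theorem BK_normal: assumes f: "f : fracs BK" "integral_over BK f" shows "f : BK"
proof -
 obtain m co where co: "!!i. i < m ==> co i : BK" "f^m+(\<Sum>i<m. co i*f^i) = 0"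
  using f(2) by (auto simp: integral_over_def)
 have "EX M. ALL i<l. H^M * co i : Q.C" if "l <= m" for l using that
 proof (induction l)
  case (Suc l)
  then obtain M where M: "ALL i<l. H^M * co i : Q.C" by auto
  obtain M' where M': "H^M' * co l : Q.C" using H_clear[OF co(1)[of l]] Suc.prems by auto
  have "H^(M+M') * co i : Q.C" if "i < Suc l" for i
  proof (cases "i = l")
   case True
   hence "H^(M+M') * co i = H^M*(H^M' * co l)" by (simp add: power_add mult_ac)
   thus ?thesis using QC(1)[OF QC(4)[OF H_C] M'] by metis
  next
   case False
   hence "H^(M+M') * co i = H^M'*(H^M * co i)" by (simp add: power_add mult_ac)
   thus ?thesis using QC(1)[OF QC(4)[OF H_C], of "H^M * co i"] M that False less_antisym by metis
  qed
  thus ?case by blast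
 qed simp
 then obtain M where M: "!!i. i < m ==> H^M * co i : Q.C" by blast
 define F where "F = H^M*f"
 have int: "integral_over Q.C F" unfolding integral_over_def
 proof (intro exI conjI allI impI)
  show "H^(M*(m - i - 1))*(H^M * co i) : Q.C" if "i < m" for i by (rule QC(1)[OF QC(4)[OF H_C] M[OF that]])
  have "F^m+(\<Sum>i<m. H^(M*(m - i - 1))*(H^M * co i)*F^i) = H^(M*m)*(f^m+(\<Sum>i<m. co i*f^i))"
   unfolding distrib_left sum_distrib_left
  proof (intro arg_cong2[where f = "(+)"] sum.cong)
   show "F^m = H^(M*m)*f^m" by (simp add: F_def power_mult_distrib power_mult)
   fix i assume "i : {..<m}"
   then obtain l where "m = Suc i+l" using less_imp_Suc_add by fastforce
   hence "M*m = M*(m - i - 1)+M+M*i" by (simp add: algebra_simps)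
   hence "H^(M*m) = H^(M*(m - i - 1))*H^M*H^(M*i)" by (simp add: power_add)
   thus "H^(M*(m - i - 1))*(H^M * co i)*F^i = H^(M*m)*(co i*f^i)"
    by (simp add: F_def power_mult_distrib power_mult mult_ac)
  qed simp
  thus "F^m+(\<Sum>i<m. H^(M*(m - i - 1))*(H^M * co i)*F^i) = 0" using co(2) by simp
 qed
 obtain u v where uv: "u : BK" "v : BK" "v ~= 0" "f = u / v" using f(1) BK_subring by (metis fracsE)
 obtain L L' where L: "H^L*u : Q.C" "H^L'*v : Q.C" using H_clear uv by blast
 define V where "V = H^(L+L')*v"
 have "H^L*(H^L'*v) : Q.C" "H^M*(H^L'*(H^L*u)) : Q.C"
  by (rule QC(1)[OF QC(4)[OF H_C] L(2)], rule QC(1)[OF QC(4)[OF H_C] QC(1)[OF QC(4)[OF H_C] L(1)]])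
 hence V: "V : Q.C" "V*F : Q.C" "V ~= 0" using uv H_nz by (simp_all add: V_def F_def power_add mult_ac)
 obtain N where N: "!!l. V^N*F^l : Q.C" using integral_over_powers[OF Q.C_subring int V(1,2)] by blast
 have "F : Q.C"
 proof (rule Q.C_integrally_closed)
  show "F : fracs Q.C" using fracsI[OF V(2,1)] V(3) by simp
  show "V^N : Q.C" by (rule QC(4)[OF V(1)])
  show "V^N ~= 0" using V by simp
  show "V^N*F^l : Q.C" for l by (rule N)
  fix x0 y0 :: 'f
  assume "y0^2+poly [:- c, a, 1:] x0*y0+poly [:0, - e, - cb:] x0 = 0" "2*y0+poly [:- c, a, 1:] x0 = 0"
  hence "y0^2+(x0^2+a*x0 - c)*y0 - x0*(cb*x0+e) = 0" "2*y0+(x0^2+a*x0 - c) = 0"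
   by (simp_all add: power2_eq_square algebra_simps)
  hence "(2*x0+a)*y0 - 2 * cb*x0 - e ~= 0" by (rule ns)
  thus "poly (pderiv [:- c, a, 1:]) x0*y0+poly (pderiv [:0, - e, - cb:]) x0 ~= 0"
   by (simp add: pderiv_pCons algebra_simps)
 qed
 hence "H^M*f : BK" using C_BK by (auto simp: F_def)
 thus ?thesis using good_power[OF good_H, of M] f(2) by (simp add: good_def)
qed

end

section \<open>Reducedness of all fibres and descent of normality from the generic fibre\<close>

context curve_basis
begin

lemma B_BK: "B <= BK"
proof
 fix u assume "u : B"
 then obtain d where "Y.Bs d u" by (auto simp: B_def)
 thus "u : BK" by (rule Y.Bs_least[OF BK_subring, rotated -1]) (use AK K_BK BKC gens_BK in auto)
qed

lemma BK_clear: "u : BK ==> EX k:A. k ~= 0 & k*u : B"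
proof -
 assume "u : BK"
 then obtain d where "YK.Bs d u" by (auto simp: BK_def)
 thus ?thesis
 proof (induction rule: YK.Bs.induct)
  case (base k d)
  then obtain p q where pq: "p : A" "q : A" "q ~= 0" "k = p / q" using A unfolding K_def by (metis fracsE)
  thus ?case using A_B by (intro bexI[of _ q]) auto
 next
  case (null u d) thus ?case using Y.AC(1) is_subring_zero[OF B_subring] by (intro bexI[of _ 1]) auto
 next
  case (gen h d u)
  then obtain k where k: "k : A" "k ~= 0" "k*u : B" by blast
  have "k*(YK.g h*u) = Y.g h*(k*u)" by simp
  thus ?case using k BC(1)[OF gB[OF gen(1)] k(3)] by metis
 next
  case (plus d u v)
  then obtain k k' where k: "k : A" "k ~= 0" "k*u : B" "k' : A" "k' ~= 0" "k'*v : B" by blast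
  have "k*k'*(u+v) = k'*(k*u)+k*(k'*v)" by (simp add: algebra_simps)
  moreover have "k'*(k*u)+k*(k'*v) : B" by (intro BC(3) BC(1) subsetD[OF A_B] k)
  ultimately show ?case using k Y.AC(5)[OF k(1,4)] by (intro bexI[of _ "k*k'"]) auto
 qed
qed

text \<open>Modulo the extension \<open>PB\<close> of \<open>P\<close>, an element outside
  \<open>PB\<close> of minimal pole order has a leading coefficient \<open>v j\<close> outside
  \<open>P\<close>. If its \<open>m\<close>-th power were in \<open>PB\<close>, then
  \<open>v j^m\<close> would be a leading coefficient of an element of \<open>PB\<close>, hence in
  the prime \<open>P\<close>.\<close>

lemma fiber_reduced: assumes P: "is_prime_ideal A P" and f: "f : B" and fm: "!!i. F.kap i (f^m) : P"
 shows "F.kap i f : P"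
proof -
 have IP: "is_ideal A P" using P by (simp add: is_prime_ideal_def)
 define PB where "PB = {f : B. ALL i. F.kap i f : P}"
 have PB_I: "is_ideal B PB" unfolding is_ideal_def
 proof (intro conjI ballI)
  show "0 : PB" using is_subring_zero[OF B_subring] is_idealD(2)[OF IP] F.coord_zero by (simp add: PB_def F.kap_def)
  show "u+v : PB" if "u : PB" "v : PB" for u v
   using that BC is_idealD(3)[OF IP] by (simp add: PB_def F.kap_def F.coord_add)
  show "u*v : PB" if "u : B" "v : PB" for u v
  proof -
   have v: "v : B" "!!i. F.kap i v : P" using that(2) by (auto simp: PB_def)
   show ?thesis using F.coord_ideal_mult[OF IP v that(1)] BC(1)[OF that(1) v(1)] by (simp add: PB_def)
  qed
 qed (auto simp: PB_def)
 have PPB: "k : PB" if "k : P" for k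
 proof -
  have kA: "k : A" using that is_idealD(1)[OF IP] by blast
  have "F.kap i k = F.kap i 1*k" for i using F.coord_smult[OF BC(5) kA] by (simp add: F.kap_def mult.commute)
  moreover have "F.kap i 1 : A" for i using polys_overD[OF F.coord(1)[OF BC(5)]] by (simp add: F.kap_def)
  ultimately have "F.kap i k : P" for i using is_idealD(4)[OF IP _ that, of "F.kap i 1"] by simp
  thus ?thesis using subsetD[OF A_B kA] by (simp add: PB_def)
 qed
 have P0: "0 : PB" by (rule is_idealD(2)[OF PB_I])
 have xyz: "x : B" "y : B" "4 <= i ==> i <= n ==> z i : B" for i using BI Y.Bs_x Y.Bs_y Y.Bs_z by blast+
 \<comment> \<open>The fibre over \<open>P\<close>, as the same algebra taken modulo
   \<open>PB\<close>.\<close>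
 interpret Z: curve_algebra n B A PB a c cb ci cbi cij x y z by unfold_locales
   (use n A B_subring A_B PB_I xyz aA cA cbA ciA cbiA cijA P0 xz relation_y relation_z in \<open>simp_all\<close>)
 have YZ: "Z.Bs d u" if "Y.Bs d u" for d u
  using curve_algebra_hom(1)[OF Y.curve_algebra_axioms Z.curve_algebra_axioms, of "%u. u", OF _ _ _ _ _ _ _ _ that] P0 by simp
 have ZB: "EX u0. Y.Bs d u0 & u - u0 : PB" if "Z.Bs d u" for d u using that
 proof (induction rule: Z.Bs.induct)
  case (base k d) thus ?case using Y.Bs.base P0 by (intro exI[of _ k]) auto
 next
  case (null u d) thus ?case using Y.Bs.base[OF Y.AC(2)] by (intro exI[of _ 0]) auto
 next
  case (gen h d u)
  then obtain u0 where u0: "Y.Bs d u0" "u - u0 : PB" by blast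
  have "Z.g h*(u - u0) : PB" by (rule is_idealD(4)[OF PB_I gB[OF gen(1)] u0(2)])
  thus ?case using Y.Bs.gen[OF gen(1) u0(1)] by (intro exI[of _ "Z.g h*u0"]) (simp add: right_diff_distrib)
 next
  case (plus d u v)
  then obtain u0 v0 where u0: "Y.Bs d u0" "u - u0 : PB" "Y.Bs d v0" "v - v0 : PB" by blast
  have "(u - u0)+(v - v0) : PB" by (rule is_idealD(3)[OF PB_I u0(2,4)])
  thus ?case using Y.Bs.plus[OF u0(1,3)] by (intro exI[of _ "u0+v0"]) (simp add: add_diff_add)
 qed
 have ZL: "EX u0. Y.LD d u0 v & u - u0 : PB" if "Z.LD d u v" for d u v using that
 proof (induction rule: Z.LD.induct)
  case (null u) thus ?case using Y.LD.null[of 0] by (intro exI[of _ 0]) auto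
 next
  case (low d u) thus ?case using ZB Y.LD.low by blast
 next
  case (const k) thus ?case using Y.LD.const P0 by (intro exI[of _ k]) auto
 next
  case (gen h d u v)
  then obtain u0 where u0: "Y.LD d u0 v" "u - u0 : PB" by blast
  have "Z.g h*(u - u0) : PB" by (rule is_idealD(4)[OF PB_I gB[OF gen(1)] u0(2)])
  thus ?case using Y.LD.gen[OF gen(1) u0(1)] by (intro exI[of _ "Z.g h*u0"]) (simp add: right_diff_distrib)
 next
  case (plus d u v u' v')
  then obtain u0 v0 where u0: "Y.LD d u0 v" "u - u0 : PB" "Y.LD d v0 v'" "u' - v0 : PB" by blast
  have "(u - u0)+(u' - v0) : PB" by (rule is_idealD(3)[OF PB_I u0(2,4)])
  thus ?case using Y.LD.plus[OF u0(1,3)] by (intro exI[of _ "u0+v0"]) (simp add: add_diff_add)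
 qed
 \<comment> \<open>Elements of \<open>PB\<close> have their coordinates in \<open>P\<close>, and
   \<open>coord_LD\<close> writes leading coefficients as combinations of coordinates.\<close>
 have claim: "v j : P" if L: "Z.LD d g v" and g: "g : PB" and j: "j : {1..n}" for d g v j
 proof -
  obtain g0 where g0: "Y.LD d g0 v" "g - g0 : PB" using ZL[OF L] by blast
  have "g - (g - g0) : PB" by (rule is_ideal_diff[OF B_subring PB_I g g0(2)])
  hence co: "coeff (F.coord g0 l) k : P" for l k by (auto simp: PB_def F.kap_def)
  have PA: "p*u : P" if "p : P" "u : A" for p u using is_idealD(4)[OF IP that(2,1)] by (simp add: mult.commute)
  have "Ld (%j. coeff (F.coord g0 j) (d - wt j)) d j : P" unfolding Ld_def
   by (rule is_ideal_sum[OF IP]) (use PA[OF PA[OF co is_subring_power[OF A tvA]] wlA] is_idealD(2)[OF IP] in auto)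
  thus ?thesis using coord_LD[OF g0(1) j] by simp
 qed
 have "f : PB"
 proof (rule ccontr)
  assume neg: "f ~: PB"
  have ex: "EX d. Z.Bs d f" using f YZ unfolding B_def by blast
  define d where "d = (LEAST d. Z.Bs d f)"
  have d: "Z.Bs d f" "!!d'. d' < d ==> ~ Z.Bs d' f" unfolding d_def using LeastI_ex[OF ex] not_less_Least by blast+
  obtain v where L: "Z.LD d f v" using Z.Bs_LD[OF d(1)] by blast
  show False
  proof (cases "ALL j:{1..n}. v j : P")
   case True
   hence "if d = 0 then f : PB else Z.Bs (d - 1) f" using Z.LD_descend[OF L] PPB by blast
   thus False using neg d(2)[of "d - 1"] by (cases "d = 0") auto
  next
   case False
   then obtain j where j: "j : {1..n}" "v j ~: P" by blast
   have "f^m : PB" using fm f is_subring_power[OF B_subring] by (simp add: PB_def)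
   hence "v j^m : P" using claim[OF Z.LD_power[OF L, of m] _ j(1)] by simp
   thus False using is_prime_ideal_power[OF A P Z.LD_A[OF L]] j(2) by blast
  qed
 qed
 thus ?thesis unfolding PB_def by blast
qed

theorem normal_curve: assumes "noetherian A" "normal_subring A" shows "normal_subring B"
proof (rule F.normal_free[OF assms])
 show "F.kap i f : P" if "is_prime_ideal A P" "f : B" "!!i. F.kap i (f^m) : P" for P f m i
  by (rule fiber_reduced[OF that])
 show "EX k:A. k ~= 0 & k*f : B" if "f : fracs B" "integral_over B f" for f
  using BK_clear[OF BK_normal] fracs_mono[OF B_BK] integral_over_mono[OF B_BK] that by blast
qed

end

section \<open>The coordinate rings inside the large field\<close>

interpretation bc: field_embedding "big_const :: 'k::alg_closed_field => 'k big" by (rule field_embedding_big_const)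

lemma vals_finite:
 fixes gam :: "'v => 'k::alg_closed_field big" assumes "finite V"
 shows "noetherian (bc.vals gam V) & small (bc.vals gam V)" using assms
proof (induction V rule: finite_induct)
 case empty
 thus ?case using bc.noetherian small_range by (simp add: bc.vals_empty)
next
 case (insert v V)
 thus ?case using noetherian_adjoin[OF bc.is_subring_vals[of gam V]] small_adjoin[OF bc.is_subring_vals[of gam V]]
  by (simp add: bc.vals_insert)
qed

lemma finite_U_vars: "finite (U_vars n)"
proof -
 have "{Vcij i j | i j. 4 <= i & i < j & j <= n} <= (%(i, j). Vcij i j) ` ({..n} \<times> {..n})" by auto
 hence "finite {Vcij i j | i j. 4 <= i & i < j & j <= n}" by (rule finite_subset) auto
 thus ?thesis by (simp add: U_vars_def)
qed

lemma U_relsI: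
 "4 <= i ==> i < j ==> j <= n ==> rel1 i j : U_rels n"
 "4 <= i ==> i < j ==> j <= n ==> rel2 i j : U_rels n"
 "4 <= i ==> i < j ==> j < k ==> k <= n ==> rel3 i j k : U_rels n" unfolding U_rels_def by blast+

lemma U_rels_mpolys: "U_rels n <= mpolys (U_vars n)"
proof (cases "n >= 4")
 case True
 note M = is_subring_mpolys[of "U_vars n"]
 note MC = is_subring_add[OF M] is_subring_diff[OF M] is_subring_mult[OF M]
 have v: "mvar Va : mpolys (U_vars n)" "mvar Vc : mpolys (U_vars n)" "mvar Vcbar : mpolys (U_vars n)"
  "4 <= i ==> i <= n ==> mvar (Vci i) : mpolys (U_vars n)"
  "4 <= i ==> i <= n ==> mvar (Vcbari i) : mpolys (U_vars n)"
  "4 <= i ==> i < j ==> j <= n ==> mvar (Vcij i j) : mpolys (U_vars n)" for i j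
  using True by (auto intro!: mvar_mpolys simp: U_vars_def)
 have c: "cc i j : mpolys (U_vars n)" if "4 <= i" "i <= n" "4 <= j" "j <= n" "i ~= j" for i j
  unfolding cc_def using that by (auto intro!: MC v)
 show ?thesis
 proof
  fix r :: "(uvar, 'a) mpoly" assume "r : U_rels n"
  then consider i j where "4 <= i" "i < j" "j <= n" "r = rel1 i j"
   | i j where "4 <= i" "i < j" "j <= n" "r = rel2 i j"
   | i j k where "4 <= i" "i < j" "j < k" "k <= n" "r = rel3 i j k" unfolding U_rels_def by blast
  thus "r : mpolys (U_vars n)" by cases (simp_all add: rel1_def rel2_def rel3_def MC v c)
 qed
qed (auto simp: U_rels_def)

text \<open>
  The conditions for a singular point of \<open>Y\<^sup>2 + (X\<^sup>2 + aX - c)Y = X(cb X + e)\<close>, which is the equation of the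
  cubic in \<open>X = x\<close>, \<open>Y = xy\<close>.
\<close>

definition sing :: "'f::field => 'f => 'f => 'f => 'f => 'f => bool" where
 "sing a c cb e x0 y0 \<longleftrightarrow> y0^2+(x0^2+a*x0 - c)*y0 - x0*(cb*x0+e) = 0 &
  2*y0+(x0^2+a*x0 - c) = 0 & (2*x0+a)*y0 - 2 * cb*x0 - e = 0"

definition cubic :: "'f::field => 'f => 'f => 'f => 'f => 'f" where
 "cubic a c cb x y = x*x*y+x*y*y+a*x*y - cb*x - c*y"

text \<open>
  A faithful model of \<open>U n\<close>: the points \<open>(c\<^sub>i, cb\<^sub>i)\<close> lie on one smooth plane cubic
  \<open>cubic a c cb x y = e\<close>.
\<close>

definition model :: "nat => (uvar => 'k::alg_closed_field big) => bool" where
 "model n gam \<longleftrightarrow> bc.presents gam (U_vars n) (U_rels n) & normal_subring (bc.vals gam (U_vars n)) &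
  has_frobenius big_const (bc.vals gam (U_vars n))"

text \<open>Besides smoothness and distinct abscissas this records the genericity that allows a
  further point: the third condition at each point is a nonzero derivative by \<open>y\<close>, and
  those on \<open>c\<close> and \<open>cb\<close> enter the irreducibility of the cubic over
  \<open>K(x)\<close>.\<close>

definition on_cubic :: "nat => (uvar => 'k::alg_closed_field big) => 'k big => bool" where
 "on_cubic n gam e \<longleftrightarrow>
  (ALL i:{4..n}. cubic (gam Va) (gam Vc) (gam Vcbar) (gam (Vci i)) (gam (Vcbari i)) = e & gam (Vci i) ~= 0 &
    (gam Va+2*gam (Vcbari i)+gam (Vci i))*gam (Vci i) - gam Vc ~= 0) &
  (ALL i j. 4 <= i & i < j & j <= n --> gam (Vci i) ~= gam (Vci j)) &
  gam Vc ~= 0 & gam Vcbar ~= 0 & gam Vc ~= gam Vcbar & (ALL x0 y0. ~ sing (gam Va) (gam Vc) (gam Vcbar) e x0 y0)"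

section \<open>Models for \<open>n = 3\<close> and \<open>n = 4\<close>\<close>

lemma transcendental_notin: assumes A: "is_subring A" and x: "transcendental A x" and u: "u : A" shows "x ~= u"
proof
 assume "x = u"
 hence "poly [:- u, 1:] x = 0" by simp
 moreover have "[:- u, 1:] : polys_over A"
  by (intro polys_over_pCons is_subring_uminus[OF A u] is_subring_one[OF A] polys_over_zero[OF A])
 ultimately have "[:- u, 1:] = 0" using x unfolding transcendental_def by blast
 thus False by simp
qed

text \<open>These are the abscissas of the critical points \<open>(x0, t)\<close> of
  \<open>cubic a c cb\<close>, which do not depend on \<open>e\<close>. As \<open>p\<close> has the
  value \<open>2 * x0 * t\<close> there, \<open>P\<close> is \<open>4 * x0^2\<close> times the
  second equation; its constant term \<open>c^2\<close> keeps it nonzero in every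
  characteristic.\<close>

lemma finite_sing:
 fixes a c cb :: "'f::field" assumes "c ~= 0" shows "finite {x0. EX t. c = x0^2+a*x0+2*x0*t & cb = t^2+a*t+2*x0*t}"
proof (rule finite_subset)
 define p where "p = [:c, - a, - 1:]"
 define P where "P = p^2 + [:0, 0, 4:]*p + [:0, 2*a:]*p - [:0, 0, 4 * cb:]"
 have "poly P 0 = c^2" by (simp add: P_def p_def)
 hence "P ~= 0" using assms by auto
 thus "finite {x. poly P x = 0}" by (rule poly_roots_finite)
 show "{x0. EX t. c = x0^2+a*x0+2*x0*t & cb = t^2+a*t+2*x0*t} <= {x. poly P x = 0}"
 proof safe
  fix x0 t assume c: "c = x0^2+a*x0+2*x0*t" and cb: "cb = t^2+a*t+2*x0*t"
  have "poly p x0 = 2*x0*t" by (simp add: p_def c power2_eq_square algebra_simps)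
  thus "poly P x0 = 0" by (simp add: P_def cb power2_eq_square algebra_simps)
 qed
qed

text \<open>With \<open>y0 = x0 * t\<close>, a singular point becomes a critical point
  \<open>(x0, t)\<close> of \<open>cubic a c cb\<close>, and \<open>e\<close> is the critical value.
  Here \<open>x0 = 0\<close> would force \<open>c = 0\<close>.\<close>

lemma singE: assumes "sing a c cb e x0 y0" "c ~= (0 :: 'f::field)"
 obtains t where "c = x0^2+a*x0+2*x0*t" "cb = t^2+a*t+2*x0*t"
  "e = - (2*x0^2*t+2*x0*t^2+a*x0*t)"
proof -
 have h: "y0^2+(x0^2+a*x0 - c)*y0 - x0*(cb*x0+e) = 0"
  "2*y0+(x0^2+a*x0 - c) = 0" "(2*x0+a)*y0 - 2 * cb*x0 - e = 0" using assms(1) by (auto simp: sing_def)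
 have c: "c = x0^2+a*x0+2*y0" using h(2) by (simp add: algebra_simps)
 have e: "e = (2*x0+a)*y0 - 2 * cb*x0" using h(3) by (simp add: algebra_simps)
 have x0: "x0 ~= 0"
 proof
  assume x: "x0 = 0"
  hence "y0^2 - 2*y0*y0 = 0" using h(1) c by (simp add: algebra_simps)
  hence "y0 = 0" by (simp add: power2_eq_square algebra_simps)
  thus False using c x assms(2) by simp
 qed
 define t where "t = y0 / x0"
 have y0: "y0 = x0*t" using x0 by (simp add: t_def)
 have "x0^2*(cb - (t^2+a*t+2*x0*t)) = y0^2+(x0^2+a*x0 - c)*y0 - x0*(cb*x0+e)"
  unfolding e c y0 by (simp add: power2_eq_square algebra_simps)
 hence cb: "cb = t^2+a*t+2*x0*t" using h(1) x0 by simp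
 have "e = - (2*x0^2*t+2*x0*t^2+a*x0*t)" unfolding e cb y0 by (simp add: power2_eq_square algebra_simps)
 moreover have "c = x0^2+a*x0+2*x0*t" unfolding c y0 by simp
 ultimately show ?thesis using that cb by blast
qed

definition free_on :: "uvar set => (uvar => 'k::alg_closed_field big) => bool" where
 "free_on V gam \<longleftrightarrow> (ALL p:mpolys V. mev big_const gam p = 0 --> p = 0) & normal_subring (bc.vals gam V) &
  has_frobenius big_const (bc.vals gam V)"

lemma free_on_empty: "free_on {} gam" unfolding free_on_def
proof (intro conjI ballI impI)
 fix p :: "(uvar, 'a) mpoly" assume p: "p : mpolys {}" "mev big_const gam p = 0"
 obtain k where "p = mconst k" using mpolys_empty[OF p(1)] by blast
 thus "p = 0" using p(2) by (simp add: bc.mev_const bc.eq_zero)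
qed (simp_all add: bc.vals_empty bc.normal bc.has_frobenius)

lemma free_on_insert: assumes "finite V" "free_on V gam" "transcendental (bc.vals gam V) (gam v)"
 shows "free_on (insert v V) gam" using assms vals_finite[OF assms(1), of gam] bc.mev_inj_insert[OF _ assms(3)]
  normal_adjoin[OF bc.is_subring_vals _ _ assms(3)] has_frobenius_adjoin[of big_const, OF _ assms(3)]
 unfolding free_on_def by (simp add: bc.vals_insert)

lemma free_on_model: assumes "free_on (U_vars n) gam" "U_rels n = ({} :: (uvar, 'k::alg_closed_field) mpoly set)"
 shows "model n (gam :: uvar => 'k big)"
proof -
 have "p : I" if "p : mpolys (U_vars n)" "mev big_const gam p = 0" "is_ideal (mpolys (U_vars n)) I" for p I
  using assms(1) that is_idealD(2)[OF that(3)] unfolding free_on_def by auto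
 thus ?thesis using assms unfolding model_def bc.presents_def free_on_def by auto
qed

lemma model_3: "EX gam :: uvar => 'k::alg_closed_field big. model 3 gam"
proof -
 have "EX gam :: uvar => 'k big. free_on (Aff ` {..<m}) gam" for m :: nat
 proof (induction m)
  case (Suc m)
  let ?V = "Aff ` {..<m}"
  obtain gam :: "uvar => 'k big" where gam: "free_on ?V gam" using Suc by blast
  obtain x where x: "transcendental (bc.vals gam ?V) x"
   using small_transcendental[OF bc.is_subring_vals] vals_finite[of ?V] by blast
  define gam' where "gam' = gam(Aff m := x)"
  have ev: "mev big_const gam' p = mev big_const gam p" if "p : mpolys ?V" for p
   by (rule bc.mev_cong[OF that]) (auto simp: gam'_def)
  hence V: "bc.vals gam' ?V = bc.vals gam ?V" unfolding bc.vals_def by (rule image_cong[OF refl])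
  have "free_on ?V gam'" using gam ev by (simp add: free_on_def V)
  hence "free_on (insert (Aff m) ?V) gam'" by (rule free_on_insert[rotated]) (simp_all add: V, simp add: gam'_def x)
  thus ?case by (auto simp: lessThan_Suc)
 qed (use free_on_empty in auto)
 then obtain gam :: "uvar => 'k big" where "free_on (Aff ` {..<4}) gam" by blast
 moreover have "U_vars 3 = Aff ` {..<4}" by (simp add: U_vars_def)
 ultimately have "model 3 gam" by (intro free_on_model) (auto simp: U_rels_def)
 thus ?thesis by blast
qed

text \<open>The five variables are chosen algebraically independent, and \<open>e\<close> is the
  value of the cubic form at the resulting point. It is not critical: \<open>L\<close> contains the
  critical values, whereas \<open>y\<close> is transcendental over \<open>L[x]\<close> and so
  satisfies no equation \<open>cubic a c cb x y = e\<close> with \<open>e\<close> in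
  \<open>L\<close>.\<close>

lemma model_4: "EX (gam :: uvar => 'k::alg_closed_field big) e. model 4 gam & on_cubic 4 gam e"
proof -
 note ad = is_subring_adjoin adjoin_base adjoin_self small_adjoin
 define A0 where "A0 = range (big_const :: 'k => 'k big)"
 have A0: "is_subring A0" "small A0" unfolding A0_def using bc.subring small_range by auto
 obtain a where a: "transcendental A0 a" using small_transcendental[OF A0] by blast
 define A1 where "A1 = adjoin A0 a"
 have A1: "is_subring A1" "small A1" "a : A1" unfolding A1_def using ad A0 by blast+
 obtain c where c: "transcendental A1 c" using small_transcendental[OF A1(1,2)] by blast
 define A2 where "A2 = adjoin A1 c"
 have A2: "is_subring A2" "small A2" "c : A2" "a : A2" unfolding A2_def using ad A1 by blast+
 obtain cb where cb: "transcendental A2 cb" using small_transcendental[OF A2(1,2)] by blast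
 define A3 where "A3 = adjoin A2 cb"
 have A3: "is_subring A3" "small A3" "cb : A3" "c : A3" "a : A3" unfolding A3_def using ad A2 by blast+
 have nz: "c ~= 0" "cb ~= 0" "cb ~= c"
  using transcendental_notin[OF A1(1) c is_subring_zero[OF A1(1)]] transcendental_notin[OF A2(1) cb]
   is_subring_zero[OF A2(1)] A2(3) by auto
 \<comment> \<open>Both coordinates of the critical points: exchanging \<open>c\<close> and
   \<open>cb\<close> exchanges the roles of \<open>x0\<close> and \<open>t\<close>.\<close>
 define F where "F = {x0. EX t. c = x0^2+a*x0+2*x0*t & cb = t^2+a*t+2*x0*t} Un
  {x0. EX t. cb = x0^2+a*x0+2*x0*t & c = t^2+a*t+2*x0*t}"
 have "finite F" unfolding F_def using finite_sing nz by blast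
 then obtain L where L: "is_subring L" "small L" "A3 <= L" "F <= L" using small_finite_extension[OF A3(1,2)] by blast
 obtain x where x: "transcendental L x" using small_transcendental[OF L(1,2)] by blast
 define L1 where "L1 = adjoin L x"
 have L1: "is_subring L1" "small L1" "x : L1" "L <= L1" unfolding L1_def using ad L by blast+
 obtain y where y: "transcendental L1 y" using small_transcendental[OF L1(1,2)] by blast
 have acL: "a : L" "c : L" "cb : L" using A3 L by auto
 have acL1: "a : L1" "c : L1" "cb : L1" using acL L1 by auto
 note LC = is_subring_add[OF L(1)] is_subring_mult[OF L(1)] is_subring_uminus[OF L(1)] is_subring_one[OF L(1)]
  is_subring_numeral[OF L(1)] is_subring_power[OF L(1)]
 note L1C = is_subring_add[OF L1(1)] is_subring_mult[OF L1(1)] is_subring_uminus[OF L1(1)] is_subring_one[OF L1(1)]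
  is_subring_numeral[OF L1(1)] is_subring_power[OF L1(1)] is_subring_diff[OF L1(1)]
 have x0: "x ~= 0" by (rule transcendental_notin[OF L(1) x is_subring_zero[OF L(1)]])
 define e where "e = cubic a c cb x y"
 have N: "(a+2*y+x)*x - c ~= 0"
 proof
  assume h: "(a+2*y+x)*x - c = 0"
  have "[:(a+x)*x - c, 2*x:] : polys_over L1" by (intro polys_over_pCons polys_over_zero[OF L1(1)] L1C acL1 L1)
  moreover have "poly [:(a+x)*x - c, 2*x:] y = 0" using h by (simp add: algebra_simps)
  ultimately have "[:(a+x)*x - c, 2*x:] = 0" using y unfolding transcendental_def by blast
  hence "(a+x)*x - c = 0" by simp
  hence "poly [:- c, a, 1:] x = 0" by (simp add: algebra_simps)
  moreover have "[:- c, a, 1:] : polys_over L" by (intro polys_over_pCons polys_over_zero[OF L(1)] LC acL)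
  ultimately have "[:- c, a, 1:] = 0" using x unfolding transcendental_def by blast
  thus False by simp
 qed
 have ns: "~ sing a c cb e x0 y0" for x0 y0
 proof
  assume "sing a c cb e x0 y0"
  then obtain t where t: "c = x0^2+a*x0+2*x0*t" "cb = t^2+a*t+2*x0*t"
   "e = - (2*x0^2*t+2*x0*t^2+a*x0*t)" using nz(1) by (rule singE)
  have "x0 : F" unfolding F_def using t(1,2) by blast
  moreover have "t : F" unfolding F_def using t(1,2) by (auto simp: mult_ac)
  ultimately have "x0 : L" "t : L" using L(4) by auto
  hence "e : L" unfolding t(3) by (intro LC acL)
  hence eL: "e : L1" using L1 by blast
  have "[:- (cb*x) - e, x*x+a*x - c, x:] : polys_over L1"
   by (intro polys_over_pCons polys_over_zero[OF L1(1)] L1C acL1 L1(3) eL)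
  moreover have "poly [:- (cb*x) - e, x*x+a*x - c, x:] y = 0" by (simp add: e_def cubic_def algebra_simps)
  ultimately have "[:- (cb*x) - e, x*x+a*x - c, x:] = 0" using y unfolding transcendental_def by blast
  thus False using x0 by simp
 qed
 define gam :: "uvar => 'k big" where "gam = ((%_. 0)(Va := a, Vc := c, Vcbar := cb, Vci 4 := x, Vcbari 4 := y))"
 have g: "gam Va = a" "gam Vc = c" "gam Vcbar = cb" "gam (Vci 4) = x" "gam (Vcbari 4) = y" by (simp_all add: gam_def)
 define A4 where "A4 = adjoin A3 x"
 have v: "bc.vals gam {} = A0" "bc.vals gam {Va} = A1" "bc.vals gam {Vc, Va} = A2" "bc.vals gam {Vcbar, Vc, Va} = A3"
  "bc.vals gam {Vci 4, Vcbar, Vc, Va} = A4"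
  unfolding bc.vals_insert bc.vals_empty g A4_def A3_def A2_def A1_def A0_def by (rule refl)+
 have x': "transcendental A3 x" using transcendental_mono x L(3) by blast
 have A4L: "A4 <= L1" unfolding A4_def L1_def by (rule adjoin_mono[OF L(3)])
 hence y': "transcendental A4 y" using transcendental_mono y by blast
 have V: "U_vars 4 = insert (Vcbari 4) (insert (Vci 4) (insert Vcbar (insert Vc (insert Va {}))))"
  by (auto simp: U_vars_def)
 have "free_on (U_vars 4) gam"
  unfolding V by (intro free_on_insert free_on_empty) (simp_all only: v g a c cb x' y' finite.intros)
 hence "model 4 gam" by (rule free_on_model) (auto simp: U_rels_def)
 moreover have "on_cubic 4 gam e" unfolding on_cubic_def g using N ns nz x0 g by (auto simp: e_def)
 ultimately show ?thesis by blast
qed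

section \<open>From \<open>n\<close> to \<open>n + 1\<close> points\<close>

lemma is_ideal_restrict: assumes J: "is_ideal M J" and A: "is_subring A" "A <= M" shows "is_ideal A (J Int A)"
 unfolding is_ideal_def
proof (intro conjI ballI)
 show "0 : J Int A" using is_idealD(2)[OF J] is_subring_zero[OF A(1)] by simp
 show "u+v : J Int A" if "u : J Int A" "v : J Int A" for u v
  using that is_idealD(3)[OF J, of u v] is_subring_add[OF A(1), of u v] by simp
 show "u*v : J Int A" if "u : A" "v : J Int A" for u v
  using that is_idealD(4)[OF J subsetD[OF A(2)], of u v] is_subring_mult[OF A(1), of u v] by simp
qed simp

lemma U_rels_Suc: "U_rels n <= U_rels (Suc n)"
proof
 fix r :: "(uvar, 'a) mpoly" assume "r : U_rels n"
 then consider i j where "4 <= i" "i < j" "j <= n" "r = rel1 i j"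
  | i j where "4 <= i" "i < j" "j <= n" "r = rel2 i j"
  | i j k where "4 <= i" "i < j" "j < k" "k <= n" "r = rel3 i j k" unfolding U_rels_def by blast
 thus "r : U_rels (Suc n)" by cases (simp_all add: U_relsI)
qed

text \<open>The new point is generic on the same cubic, so \<open>e\<close> is kept. Normality and
  the Frobenius structure concern only the values in the field. For the presentation, the polynomial
  ring modulo the new relations is viewed as a curve algebra too and compared with the field by
  evaluation.\<close>

lemma model_Suc:
 fixes gam :: "uvar => 'k::alg_closed_field big" assumes n: "4 <= n" and m: "model n gam" and oc: "on_cubic n gam e"
 shows "EX gam'. model (Suc n) gam' & on_cubic (Suc n) gam' e"
proof -
 let ?V = "U_vars n" and ?V' = "U_vars (Suc n)"
 define A where "A = bc.vals gam ?V"
 define a where "a = gam Va"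
 define c where "c = gam Vc"
 define cb where "cb = gam Vcbar"
 define ci where "ci i = gam (Vci i)" for i
 define cbi where "cbi i = gam (Vcbari i)" for i
 define cij where "cij i j = gam (Vcij i j)" for i j
 note gd = a_def c_def cb_def ci_def cbi_def cij_def
 have A: "is_subring A" "noetherian A" "small A" unfolding A_def
  using bc.is_subring_vals vals_finite[OF finite_U_vars] by auto
 have rel0: "mev big_const gam r = 0" if "r : U_rels n" for r using m that by (simp add: model_def bc.presents_def)
 have inA: "a : A" "c : A" "cb : A" "4 <= i ==> i <= n ==> ci i : A" "4 <= i ==> i <= n ==> cbi i : A"
  "4 <= i ==> i < j ==> j <= n ==> cij i j : A" for i j
  unfolding A_def gd using n by (auto intro!: bc.vals_var simp: U_vars_def)
 have oc': "4 <= i ==> i <= n ==> cubic a c cb (ci i) (cbi i) = e" "4 <= i ==> i <= n ==> ci i ~= 0"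
  "4 <= i ==> i <= n ==> (a+2 * cbi i + ci i) * ci i - c ~= 0" "4 <= i ==> i < j ==> j <= n ==> ci i ~= ci j"
  "c ~= 0" "cb ~= 0" "c ~= cb" "~ sing a c cb e x0 y0" for i j x0 y0 using oc unfolding on_cubic_def gd by auto
 have eA: "e : A"
 proof -
  have "cubic a c cb (ci 4) (cbi 4) : A" unfolding cubic_def using n
   by (intro is_subring_diff[OF A(1)] is_subring_add[OF A(1)] is_subring_mult[OF A(1)] inA) auto
  thus ?thesis using oc'(1)[of 4] n by simp
 qed
 have r1: "(ci j - ci i) * cij i j = (a + cbi i + ci j + cbi j) * ci j - c"
  and r2: "(cbi i - cbi j) * cij i j = (a + ci i + cbi i + ci j) * cbi i - cb" if "4 <= i" "i < j" "j <= n" for i j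
 proof -
  have "rel1 i j : U_rels n" "rel2 i j : U_rels n" unfolding U_rels_def using that by blast+
  thus "(ci j - ci i) * cij i j = (a + cbi i + ci j + cbi j) * ci j - c"
   "(cbi i - cbi j) * cij i j = (a + ci i + cbi i + ci j) * cbi i - cb"
   using rel0[of "rel1 i j"] rel0[of "rel2 i j"] that(2) by (simp_all add: rel1_def rel2_def cc_def bc.mev_simps gd)
 qed
 obtain x where x: "transcendental A x" using small_transcendental[OF A(1,3)] by blast
 have x0: "x ~= 0" by (rule transcendental_notin[OF A(1) x is_subring_zero[OF A(1)]])
 have "degree [:- (cb*x+e), x*x+a*x - c, x:] > 0" using x0 by simp
 then obtain y where "poly [:- (cb*x+e), x*x+a*x - c, x:] y = 0" using alg_closed_imp_poly_has_root by blast
 hence y: "cubic a c cb x y = e" by (simp add: cubic_def algebra_simps)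
 \<comment> \<open>The values 1 and \<open>- of_nat (n - 3)\<close> would make a residue of
   \<open>tau\<close> vanish, and 0 would make the proposed basis dependent; an infinite field has
   other constants in every characteristic.\<close>
 have "finite {0, 1, - of_nat (n - 3) :: 'k}" by simp
 then obtain k :: 'k where k: "k ~: {0, 1, - of_nat (n - 3)}" using infinite_alg_closed ex_new_if_finite by blast
 have "k + of_nat (n - 3) ~= 0" using k by (auto simp: eq_neg_iff_add_eq_0)
 hence kn: "big_const k + of_nat (n - 3) ~= (0 :: 'k big)"
  using bc.eq_zero[of "k + of_nat (n - 3)"] by (simp add: bc.add bc.of_nat)
 interpret cp: curve_basis big_const n A a c cb e ci cbi cij x y "big_const k"
 proof
  show "range big_const <= A" unfolding A_def using bc.vals_const by blast
  show "x*x*y+x*y*y+a*x*y = cb*x + c*y+e" using y by (simp add: cubic_def algebra_simps)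
  show "ci i * ci i * cbi i + ci i * cbi i * cbi i+a * ci i * cbi i = cb * ci i + c * cbi i+e" if "4 <= i" "i <= n" for i
   using oc'(1)[OF that] by (simp add: cubic_def algebra_simps)
  show "(2*x0+a)*y0 - 2 * cb*x0 - e ~= 0"
   if "y0\<^sup>2+(x0\<^sup>2+a*x0 - c)*y0 - x0*(cb*x0+e) = 0" "2*y0+(x0\<^sup>2+a*x0 - c) = 0" for x0 y0
   using oc'(8)[of x0 y0] that by (simp add: sing_def)
  show "big_const k ~= (0 :: 'k big)" "big_const k ~= (1 :: 'k big)"
   using k bc.eq_zero[of k] bc.eq_iff[of k 1] bc.one by auto
 qed (use n A inA eA x oc' r1 r2 kn in auto)
 define gam' where "gam' v = (case v of Vci i => if i = Suc n then x else gam v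
  | Vcbari i => if i = Suc n then y else gam v
  | Vcij i j => if j = Suc n then cp.z i else gam v | _ => gam v)" for v
 have g': "gam' Va = a" "gam' Vc = c" "gam' Vcbar = cb" "gam' (Vci (Suc n)) = x" "gam' (Vcbari (Suc n)) = y"
  "gam' (Vcij i (Suc n)) = cp.z i" "j <= n ==> gam' (Vci j) = ci j" "j <= n ==> gam' (Vcbari j) = cbi j"
  "j <= n ==> gam' (Vcij i j) = cij i j" for i j by (simp_all add: gam'_def gd)
 have agree: "gam' v = gam v" if "v : ?V" for v using that n by (auto simp: gam'_def U_vars_def split: uvar.split)
 have VV: "?V <= ?V'" using n by (auto simp: U_vars_def)
 have new: "Vci (Suc n) : ?V'" "Vcbari (Suc n) : ?V'" "4 <= i ==> i <= n ==> Vcij i (Suc n) : ?V'" for i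
  using n by (auto simp: U_vars_def)
 have V'_cases: "v : ?V \<or> v = Vci (Suc n) \<or> v = Vcbari (Suc n) \<or> (EX i. 4 <= i & i <= n & v = Vcij i (Suc n))"
  if "v : ?V'" for v using that n by (auto simp: U_vars_def le_Suc_eq)
 have ev: "mev big_const gam' p = mev big_const gam p" if "p : mpolys ?V" for p
  by (rule bc.mev_cong[OF that]) (rule agree)
 have vA: "bc.vals gam' ?V = A" unfolding A_def bc.vals_def by (rule image_cong[OF refl ev])
 have vB: "bc.vals gam' ?V' = cp.B"
 proof
  show "bc.vals gam' ?V' <= cp.B"
  proof (rule bc.vals_least[OF cp.B_subring])
   show "range big_const <= cp.B" using cp.kA cp.A_B by blast
   show "gam' ` ?V' <= cp.B"
   proof
    fix u assume "u : gam' ` ?V'"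
    then obtain v where v: "v : ?V'" "u = gam' v" by blast
    have "x : cp.B" "y : cp.B" "4 <= i ==> i <= n ==> cp.z i : cp.B" for i
     using cp.BI cp.Y.Bs_x cp.Y.Bs_y cp.Y.Bs_z by blast+
    moreover have "gam' v : cp.B" if "v : ?V" using bc.vals_var[OF that, of gam'] vA cp.A_B by blast
    ultimately show "u : cp.B" using V'_cases[OF v(1)] g' v(2) by auto
   qed
  qed
  have AV: "A <= bc.vals gam' ?V'" unfolding vA[symmetric] bc.vals_def using mpolys_mono[OF VV] by blast
  show "cp.B <= bc.vals gam' ?V'"
  proof
   fix u assume "u : cp.B"
   then obtain d where d: "cp.Y.Bs d u" unfolding cp.B_def by blast
   have z: "{0} <= bc.vals gam' ?V'" using is_subring_zero[OF bc.is_subring_vals] by blast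
   have gens: "x : bc.vals gam' ?V'" "y : bc.vals gam' ?V'" "i : {4..n} ==> cp.z i : bc.vals gam' ?V'" for i
    using bc.vals_var[OF new(1), of gam'] bc.vals_var[OF new(2), of gam'] bc.vals_var[OF new(3), of i gam'] g' by auto
   show "u : bc.vals gam' ?V'" by (rule cp.Y.Bs_least[OF bc.is_subring_vals AV z gens d])
  qed
 qed
 have rel_new: "4 <= i ==> i <= n ==> mev big_const gam' (rel1 i (Suc n)) = 0"
  "4 <= i ==> i <= n ==> mev big_const gam' (rel2 i (Suc n)) = 0"
  "4 <= i ==> i < j ==> j <= n ==> mev big_const gam' (rel3 i j (Suc n)) = 0" for i j
 proof -
  show "mev big_const gam' (rel1 i (Suc n)) = 0" if "4 <= i" "i <= n"
   using that cp.xz[OF that] by (simp add: rel1_def cc_def bc.mev_simps g')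
  show "mev big_const gam' (rel2 i (Suc n)) = 0" if "4 <= i" "i <= n"
   using that cp.relation_y[OF that] by (simp add: rel2_def cc_def bc.mev_simps g')
  show "mev big_const gam' (rel3 i j (Suc n)) = 0" if "4 <= i" "i < j" "j <= n"
   using that cp.relation_z[OF that] by (simp add: rel3_def cc_def bc.mev_simps g')
 qed
 have rels: "mev big_const gam' r = 0" if "r : U_rels (Suc n)" for r
 proof -
  consider i j where "4 <= i" "i < j" "j <= Suc n" "r = rel1 i j \<or> r = rel2 i j"
   | i j k where "4 <= i" "i < j" "j < k" "k <= Suc n" "r = rel3 i j k"
   using \<open>r : U_rels (Suc n)\<close> unfolding U_rels_def by blast
  hence "r : U_rels n \<or> (EX i. 4 <= i & i <= n & (r = rel1 i (Suc n) \<or> r = rel2 i (Suc n))) \<or>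
    (EX i j. 4 <= i & i < j & j <= n & r = rel3 i j (Suc n))"
  proof cases
   case (1 i j)
   show ?thesis
   proof (cases "j = Suc n")
    case True
    thus ?thesis using 1 by auto
   next
    case False
    hence "j <= n" using 1 by simp
    hence "r : U_rels n" using 1 unfolding U_rels_def by blast
    thus ?thesis ..
   qed
  next
   case (2 i j k)
   show ?thesis
   proof (cases "k = Suc n")
    case True
    hence "j <= n" using 2 by simp
    thus ?thesis using 2 True by blast
   next
    case False
    hence "k <= n" using 2 by simp
    hence "r : U_rels n" using 2 unfolding U_rels_def by blast
    thus ?thesis ..
   qed
  qed
  thus ?thesis using rel_new rel0 ev U_rels_mpolys[of n] by auto
 qed
 define M where "M = (mpolys ?V' :: (uvar, 'k) mpoly set)"
 have Ms: "is_subring M" unfolding M_def by (rule is_subring_mpolys)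
 define J where "J = {p : M. ALL I. is_ideal M I & U_rels (Suc n) <= I --> p : I}"
 have JI: "p : J" if "p : M" "!!I. is_ideal M I ==> U_rels (Suc n) <= I ==> p : I" for p
  unfolding J_def using that by simp
 have JD: "p : M" "is_ideal M I ==> U_rels (Suc n) <= I ==> p : I" if "p : J" for p I
  using that unfolding J_def by simp_all
 have J: "is_ideal M J" unfolding is_ideal_def
 proof (intro conjI ballI)
  show "J <= M" using JD(1) by (rule subsetI)
  show "0 : J" by (rule JI[OF is_subring_zero[OF Ms] is_idealD(2)])
  show "p+q : J" if "p : J" "q : J" for p q by (rule JI[OF is_subring_add[OF Ms JD(1)[OF that(1)] JD(1)[OF that(2)]]])
    (rule is_idealD(3)[OF _ JD(2)[OF that(1)] JD(2)[OF that(2)]])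
  show "q*p : J" if "q : M" "p : J" for p q by (rule JI[OF is_subring_mult[OF Ms that(1) JD(1)[OF that(2)]]])
    (rule is_idealD(4)[OF _ that(1) JD(2)[OF that(2)]])
 qed
 have relJ: "U_rels (Suc n) <= J"
 proof
  fix r :: "(uvar, 'k) mpoly" assume r: "r : U_rels (Suc n)"
  hence "r : M" using U_rels_mpolys[of "Suc n"] unfolding M_def by blast
  thus "r : J" using r by (intro JI) blast+
 qed
 have "is_ideal M {p : M. mev big_const gam' p = 0}" unfolding is_ideal_def
 proof (intro conjI ballI)
  show "0 : {p : M. mev big_const gam' p = 0}" using is_subring_zero[OF Ms] by (simp add: bc.mev_zero)
  show "p+q : {p : M. mev big_const gam' p = 0}"
   if "p : {p : M. mev big_const gam' p = 0}" "q : {p : M. mev big_const gam' p = 0}" for p q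
   using that is_subring_add[OF Ms, of p q] by (simp add: bc.mev_add)
  show "q*p : {p : M. mev big_const gam' p = 0}" if "q : M" "p : {p : M. mev big_const gam' p = 0}" for p q
   using that is_subring_mult[OF Ms, of q p] by (simp add: bc.mev_mult)
 qed blast
 moreover have "U_rels (Suc n) <= {p : M. mev big_const gam' p = 0}"
 proof
  fix r :: "(uvar, 'k) mpoly" assume r: "r : U_rels (Suc n)"
  hence "r : M" using U_rels_mpolys[of "Suc n"] unfolding M_def by blast
  thus "r : {p : M. mev big_const gam' p = 0}" using rels[OF r] by simp
 qed
 ultimately have J0: "mev big_const gam' p = 0" if "p : J" for p using JD(2)[OF that] by blast
 have vM: "mvar v : M" if "v : ?V'" for v unfolding M_def by (rule mvar_mpolys[OF that])
 interpret P: curve_algebra n M "mpolys ?V" J "mvar Va" "mvar Vc" "mvar Vcbar" "%i. mvar (Vci i)" "%i. mvar (Vcbari i)"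
  "%i j. mvar (Vcij i j)" "mvar (Vci (Suc n))" "mvar (Vcbari (Suc n))" "%i. mvar (Vcij i (Suc n))"
 proof
  show "mpolys ?V <= M" unfolding M_def by (rule mpolys_mono[OF VV])
  show "(mvar (Vci (Suc n)) - mvar (Vci i))*mvar (Vcij i (Suc n)) -
    ((mvar Va+mvar (Vcbari i)+mvar (Vci (Suc n))+mvar (Vcbari (Suc n)))*mvar (Vci (Suc n)) - mvar Vc) : J"
   if "4 <= i" "i <= n" for i
  proof -
   have "rel1 i (Suc n) : J" by (rule subsetD[OF relJ]) (rule U_relsI, use that in auto)
   thus ?thesis using that by (simp add: rel1_def cc_def)
  qed
  show "(mvar (Vcbari i) - mvar (Vcbari (Suc n)))*mvar (Vcij i (Suc n)) -
    ((mvar Va+mvar (Vci i)+mvar (Vcbari i)+mvar (Vci (Suc n)))*mvar (Vcbari i) - mvar Vcbar) : J"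
   if "4 <= i" "i <= n" for i
  proof -
   have "rel2 i (Suc n) : J" by (rule subsetD[OF relJ]) (rule U_relsI, use that in auto)
   thus ?thesis using that by (simp add: rel2_def cc_def)
  qed
  show "mvar (Vcij i j)*mvar (Vcij j (Suc n)) +
    (mvar Va+mvar (Vci i)+mvar (Vcbari i)+mvar (Vci j)+mvar (Vcbari j) - mvar (Vcij i j))*mvar (Vcij i (Suc n)) -
    mvar (Vcij i (Suc n))*mvar (Vcij j (Suc n)) +
    (mvar Va+mvar (Vci (Suc n))+mvar (Vcbari (Suc n)))*mvar (Vci (Suc n)) - mvar Vc : J"
   if "4 <= i" "i < j" "j <= n" for i j
  proof -
   have "rel3 i j (Suc n) : J" by (rule subsetD[OF relJ]) (rule U_relsI, use that in auto)
   thus ?thesis using that by (simp add: rel3_def cc_def)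
  qed
 qed (use n Ms is_subring_mpolys J vM new in \<open>auto intro!: mvar_mpolys simp: U_vars_def\<close>)
 have Bs: "EX d. P.Bs d p" if "p : M" for p using that unfolding M_def
 proof (induction rule: mpoly_induct)
  case (const k) thus ?case using P.Bs.base[OF mconst_mpolys] by blast
 next
  case (add p q)
  then obtain d d' where "P.Bs d p" "P.Bs d' q" by blast
  hence "P.Bs (max d d') (p+q)" by (intro P.Bs.plus) (auto intro: P.Bs_mono)
  thus ?case by blast
 next
  case (var v p)
  then obtain d where d: "P.Bs d p" by blast
  have gen: "EX d. P.Bs d (mvar v*p)" if "h : {2..n}" "P.g h = mvar v" for h
   using P.Bs.gen[OF that(1) d] that(2) by auto
  show ?case using V'_cases[OF var(1)]
  proof (elim disjE exE conjE)
   assume "v : ?V"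
   thus ?thesis using P.Bs_scale[OF d mvar_mpolys] by blast
  next
   assume "v = Vci (Suc n)" thus ?thesis using gen[of 2] n by (simp add: P.g_def)
  next
   assume "v = Vcbari (Suc n)" thus ?thesis using gen[of 3] n by (simp add: P.g_def)
  next
   fix i assume "4 <= i" "i <= n" "v = Vcij i (Suc n)"
   thus ?thesis using gen[of i] by (simp add: P.g_def)
  qed
 qed
 \<comment> \<open>If \<open>p\<close> evaluates to zero, so do its leading coefficients, by
   uniqueness in the field. These are polynomials in the old variables, so the presentation for
   \<open>n\<close> puts them into \<open>J\<close>, and \<open>LD_descend\<close> lowers the order
   of \<open>p\<close>.\<close>
 have ker: "p : J" if "P.Bs d p" "mev big_const gam' p = 0" for d p using that
 proof (induction d arbitrary: p rule: less_induct)
  case (less d)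
  obtain v where L: "P.LD d p v" using P.Bs_LD[OF less.prems(1)] by blast
  have "cp.Y.LD d (mev big_const gam' p) (%j. mev big_const gam' (v j))"
   by (rule curve_algebra_hom(2)[OF P.curve_algebra_axioms cp.Y.curve_algebra_axioms _ _ _ _ _ _ _ _ L])
    (use J0 g' vA in \<open>auto simp: bc.mev_simps bc.vals_def\<close>)
  hence v0: "mev big_const gam' (v j) = 0" if "j : {1..n}" for j using cp.LD_unique[OF _ that] less.prems(2) by simp
  have vJ: "v j : J" if "j : {1..n}" for j
  proof -
   have vM: "v j : mpolys ?V" by (rule P.LD_A[OF L])
   have ideal: "is_ideal (mpolys ?V) (J Int mpolys ?V)" by (rule is_ideal_restrict[OF J P.A P.AM])
   have "U_rels n <= J Int mpolys ?V" by (rule Int_greatest[OF subset_trans[OF U_rels_Suc relJ] U_rels_mpolys])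
   moreover have "mev big_const gam (v j) = 0" using v0[OF that] ev[OF vM] by simp
   ultimately show ?thesis using m vM ideal unfolding model_def bc.presents_def by blast
  qed
  have "if d = 0 then p : J else P.Bs (d - 1) p" by (rule P.LD_descend[OF L vJ])
  thus ?case using less.IH[of "d - 1" p] less.prems(2) by (cases "d = 0") auto
 qed
 have "bc.presents gam' ?V' (U_rels (Suc n))" unfolding bc.presents_def using rels ker Bs unfolding J_def M_def by blast
 moreover have "normal_subring (bc.vals gam' ?V')"
  unfolding vB using cp.normal_curve[OF A(2)] m by (simp add: model_def A_def)
 moreover have "has_frobenius big_const (bc.vals gam' ?V')"
  unfolding vB using cp.has_frobenius_curve m by (simp add: model_def A_def)
 ultimately have "model (Suc n) gam'" by (simp add: model_def)
 moreover have "on_cubic (Suc n) gam' e"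
 proof -
  \<comment> \<open>Otherwise \<open>2 * (x * y)\<close> is a polynomial in \<open>x\<close>. If
    \<open>2 \<noteq> 0\<close> this contradicts \<open>xy_irr\<close>; if \<open>2 = 0\<close>, a
    nonzero polynomial over \<open>K\<close> vanishes at the transcendental
    \<open>x\<close>.\<close>
  have N: "(a+2*y+x)*x - c ~= 0"
  proof
   assume h: "(a+2*y+x)*x - c = 0"
   have pK: "[:- c, a, 1:] : polys_over cp.K"
    using cp.inK cp.KC by (auto intro!: polys_over_pCons polys_over_zero[OF cp.K])
   have eq: "2*(x*y) = - poly [:- c, a, 1:] x" using h by (simp add: algebra_simps)
   show False
   proof (cases "(2 :: 'k big) = 0")
    case True
    hence "poly [:- c, a, 1:] x = 0" using eq by simp
    hence "[:- c, a, 1:] = 0" using cp.trK pK unfolding transcendental_def by blast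
    thus False by simp
   next
    case False
    have E: "x*y = - poly [:- c, a, 1:] x / 2" using arg_cong[OF eq, of "%u. u / 2"] False by simp
    have "- poly [:- c, a, 1:] x / 2 : fracs (adjoin cp.K x)"
     using is_subring_adjoin[OF cp.K, of x] adjoinI[OF pK, of x]
     by (intro fracsI is_subring_uminus is_subring_numeral) auto
    hence "x*y : fracs (adjoin cp.K x)" unfolding E .
    thus False using cp.xy_irr by blast
   qed
  qed
  have xi: "x ~= ci i" if "4 <= i" "i <= n" for i using cp.xci[OF that] by simp
  have "cubic (gam' Va) (gam' Vc) (gam' Vcbar) (gam' (Vci i)) (gam' (Vcbari i)) = e & gam' (Vci i) ~= 0 &
    (gam' Va+2*gam' (Vcbari i)+gam' (Vci i))*gam' (Vci i) - gam' Vc ~= 0" if "i : {4..Suc n}" for i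
   using that y x0 N oc' g' by (cases "i = Suc n") auto
  moreover have "gam' (Vci i) ~= gam' (Vci j)" if "4 <= i" "i < j" "j <= Suc n" for i j
   using that xi[of i] oc'(4) g' by (cases "j = Suc n") auto
  ultimately show ?thesis unfolding on_cubic_def g' using oc' by blast
 qed
 ultimately show ?thesis by blast
qed

lemma model_exists: "n >= 3 ==> EX gam :: uvar => 'k::alg_closed_field big. model n gam"
proof (cases "n = 3")
 case False
 assume "n >= 3"
 hence "4 <= n" using False by simp
 hence "EX (gam :: uvar => 'k big) e. model n gam & on_cubic n gam e"
 proof (induction n rule: dec_induct)
  case base show ?case by (rule model_4)
 next
  case (step n) thus ?case using model_Suc by blast
 qed
 thus ?thesis by blast
qed (use model_3 in simp)

theorem proposition1p5p13:
  fixes n :: nat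
  assumes "n \<ge> 3"
  shows "Spec_gorenstein (U_ring n :: (uvar, 'k::alg_closed_field) mpoly set ring)
       \<and> Spec_regular_in_codim_1 (U_ring n :: (uvar, 'k) mpoly set ring)
       \<and> Spec_normal (U_ring n :: (uvar, 'k) mpoly set ring)"
proof -
 let ?R = "U_ring n :: (uvar, 'k) mpoly set ring"
 obtain gam :: "uvar => 'k big" where "model n gam" using model_exists[OF assms] by blast
 hence m: "bc.presents gam (U_vars n) (U_rels n)" "normal_subring (bc.vals gam (U_vars n))"
  "has_frobenius big_const (bc.vals gam (U_vars n))" by (simp_all add: model_def)
 obtain j where j: "embedded_cring ?R j" "j ` carrier ?R = bc.vals gam (U_vars n)"
  using bc.quotient_embedded[OF m(1) U_rels_mpolys] unfolding U_ring_def by blast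
 interpret E: embedded_cring ?R j by (rule j(1))
 have noeth: "noetherian (j ` carrier ?R)" unfolding j(2) using vals_finite[OF finite_U_vars] by blast
 \<comment> \<open>Infinitely many elements are required for coding triples by elements of the ring
   in \<open>spec_gorenstein\<close>.\<close>
 have inf: "infinite (carrier ?R)"
 proof
  assume "finite (carrier ?R)"
  hence "finite (bc.vals gam (U_vars n))" unfolding j(2)[symmetric] by (rule finite_imageI)
  moreover have "range big_const <= bc.vals gam (U_vars n)" using bc.vals_const by blast
  ultimately have "finite (range (big_const :: 'k => 'k big))" by (rule finite_subset[rotated])
  moreover have "inj (big_const :: 'k => 'k big)" by (rule injI) (simp add: bc.eq_iff)
  ultimately show False using infinite_alg_closed finite_imageD by blast
 qed
 obtain T d t q lam r b b' where "frobenius_extension (big_const :: 'k => 'k big) (j ` carrier ?R) T d t q lam r b b'"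
  using m(3) unfolding has_frobenius_def j(2) by blast
 hence "Spec_gorenstein ?R" by (rule spec_gorenstein[OF j(1) inf _ noeth])
 thus ?thesis using E.normal_spec[OF noeth] m(2) j(2) by simp
qed

end
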